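(* For every standard Young tableau $T$ of size $n$, the Euler characteristic of the algebra $$\mathring{\mathcal{A}}_T(\mathbb{C})\otimes\left(\wedge^\bullet\mathcal{T}_n^\vee|_{\mathring{\mathrm{FHilb}}_T(\mathbb{C})}\right)$$ equals the Markov trace of the Hecke idempotent $p_\lambda$, where $\lambda$ is the partition associated to $T$.
   Context: Hecke algebra. $H_n$ is the algebra over $\mathbb{C}(q)$ (with $q^{1/2}$ adjoined) generated by $\sigma_1,\dots,\sigma_{n-1}$ with the braid relations and $(\sigma_i-q^{1/2})(\sigma_i+q^{-1/2})=0$. The (renormalized) Markov trace is the family of linear maps $\chi$ from the algebras $H_n$ to rational functions in $a$ and $q^{1/2}$ with $\chi(\sigma\sigma')=\chi(\sigma'\sigma)$, $\chi(i(\sigma))=\chi(\sigma)\frac{1-a}{q^{1/2}-q^{-1/2}}$ and $\chi(i(\sigma)\sigma_n)=\chi(\sigma)$ for $\sigma\in H_n$, where $i:H_n\to H_{n+1}$ is the natural inclusion and $\chi=1$ on the unit for $n=0$. Let $\mathrm{FT}_k=(\sigma_1\cdots\sigma_{k-1})^k$. Boxes of Young diagrams are pairs $(a,b)\in\mathbb{Z}_{\ge0}^2$, with $a$ horizontal and $b$ vertical; the labels $1,\dots,n$ of a standard Young tableau increase to the right and upward. The idempotents $p_T\in H_n$, indexed by standard Young tableaux, are the projectors onto the irreducible summands of the regular representation; they satisfy $p_Tp_{T'}=\delta_{T,T'}p_T$, $\sum_Tp_T=1$ and $\mathrm{FT}_k\,p_T=q^{c_1+\dots+c_k}p_T$, where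 $c_i=a-b$ is the content of the box $(a,b)$ labelled $i$. The Markov trace of $p_T$ depends only on the shape $\lambda$ of $T$, so one speaks of the Markov trace of $p_\lambda$. Geometry. Let $M_n$ be the quotient by the group of invertible lower triangular matrices, acting by simultaneous conjugation on $(X,Y)$ and by multiplication on $v$, of the space of triples $(X,Y,v)$ with $X$ a lower triangular $n\times n$ matrix, $Y$ strictly lower triangular, and $v\in\mathbb{C}^n$ such that the vectors $X^aY^bv$ span $\mathbb{C}^n$. The dg scheme $\mathrm{FHilb}^{\mathrm{dg}}_n(\mathbb{C})$ is given by the Koszul complex on $M_n$ of the section $[X,Y]$ of the bundle of strictly lower triangular matrices; $\mathcal{T}_n$ is the tautological rank $n$ bundle with fiber $\mathbb{C}^n$. The torus $\mathbb{C}^*\times\mathbb{C}^*$ scales $X$ and $Y$ with characters $q$ and $t$. The torus fixed point $I_T$ is the point where $\mathbb{C}^n$ has basis $e_1,\dots,e_n$ indexed by the boxes of $T$, $X$ (resp. $Y$) sends a basis vector to the one of the box immediately to the right (resp. above), or to $0$ if there is none, and $v=e_1$. $\mathring{\mathcal{A}}_T(\mathbb{C})$ is the dg algebra of functions of $\mathrm{FHilb}_n^{\mathrm{dg}}(\mathbb{C})$ on the affine neighborhood $\mathring{\mathrm{FHilb}}_T(\mathbb{C})$ of $I_T$ (localized at $I_T$). Its bigraded Poincaré series is the rational function $\prod_\beta(1-r_\beta)/\prod_\alpha(1-w_\alpha)$ if it is presented as a Koszul dg algebra with degree $0$ generators of weights $w_\alpha$ and degree $-1$ generators (relations) of weights $r_\beta$;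 a coordinate that is a diagonal entry of $X$ has weight $q$. On this neighborhood $\mathcal{T}_n^\vee$ is trivial with basis $\xi_1,\dots,\xi_n$, where $\xi_i$ has weight $z_i^{-1}$ and $z_i=q^at^b$ for the box $(a,b)$ labelled $i$. The Euler characteristic is the specialization at $t=q^{-1}$ of the graded character, in which each exterior generator $\xi_i$ contributes a factor $1-a\,z_i^{-1}$ (in this factor $a$ is the variable recording exterior degree, the same variable as in $\chi$).
   Formalization: The Euler characteristic is shown to equal (-q^{-1/2})^n times the Markov trace of p_λ, since without this factor the stated equality fails already for n=1; the Poincaré series is taken from a quasi-isomorphic Koszul presentation without generators of weight 1. *)

theory Defs
  imports
    "HOL-Library.Poly_Mapping"
    "HOL-Library.Product_Plus"
    "HOL-Library.Product_Lexorder"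
    "HOL-Computational_Algebra.Polynomial"
    "HOL-Computational_Algebra.Formal_Power_Series"
    "HOL-Computational_Algebra.Fraction_Field"
    "HOL-Algebra.QuotRing"
    "Jordan_Normal_Form.Matrix"
begin

section \<open>Standard Young tableaux\<close>

type_synonym box = "nat \<times> nat"

definition young_diagram :: "box set \<Rightarrow> bool" where
  "young_diagram D \<longleftrightarrow> finite D \<and>
     (\<forall>(a, b) \<in> D. \<forall>a' b'. a' \<le> a \<longrightarrow> b' \<le> b \<longrightarrow> (a', b') \<in> D)"

text \<open>A standard tableau of size \<open>n\<close> is the list of its boxes in the order of their labels:
  the box labelled \<open>k\<close> (with \<open>1 \<le> k \<le> n\<close>) is \<open>T ! (k - 1)\<close>, and the shape of \<open>T\<close> is \<open>set T\<close>.
  A box \<open>(a, b)\<close> has horizontal coordinate \<open>a\<close> and vertical coordinate \<open>b\<close>.\<close>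

definition standard_tableau :: "box list \<Rightarrow> bool" where
  "standard_tableau T \<longleftrightarrow> distinct T \<and> young_diagram (set T) \<and>
     (\<forall>i < length T. \<forall>j < length T.
        snd (T ! i) = snd (T ! j) \<and> fst (T ! i) < fst (T ! j) \<or>
        fst (T ! i) = fst (T ! j) \<and> snd (T ! i) < snd (T ! j) \<longrightarrow> i < j)"

definition box_content :: "box \<Rightarrow> int" where
  "box_content c = int (fst c) - int (snd c)"

definition box_right :: "box \<Rightarrow> box" where
  "box_right c = (fst c + 1, snd c)"

definition box_up :: "box \<Rightarrow> box" where
  "box_up c = (fst c, snd c + 1)"


section \<open>Fields of rational functions\<close>

definition const_fract :: "'a::field \<Rightarrow> 'a poly fract" where
  "const_fract c = Fract [:c:] 1"

definition indet :: "'a::field poly fract" where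
  "indet = Fract [:0, 1:] 1"

text \<open>\<open>Kq\<close> is \<open>C(q^(1/2))\<close>, \<open>Kqa\<close> is \<open>C(q^(1/2), a)\<close> and \<open>Kqat\<close> is \<open>C(q^(1/2), a, t)\<close>.
  The variable \<open>t\<close> is adjoined last, so that specializing \<open>t\<close> is the evaluation of polynomials
  over \<open>Kqa\<close>.\<close>

type_synonym Kq = "complex poly fract"
type_synonym Kqa = "Kq poly fract"
type_synonym Kqat = "Kqa poly fract"

definition qhalf :: Kq where
  "qhalf = indet"

definition qhalf_a :: Kqa where
  "qhalf_a = const_fract qhalf"

definition avar :: Kqa where
  "avar = indet"

type_synonym weight = "int \<times> int"

definition character :: "weight \<Rightarrow> Kqat" where
  "character w = const_fract (qhalf_a ^ 2) powi fst w * indet powi snd w"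

text \<open>\<open>f\<close> is regular along \<open>t = c\<close> and restricts to \<open>x\<close> there.\<close>

definition specializes_at :: "'a::field \<Rightarrow> 'a poly fract \<Rightarrow> 'a \<Rightarrow> bool" where
  "specializes_at c f x \<longleftrightarrow>
     (\<exists>N D. f = Fract N D \<and> poly D c \<noteq> 0 \<and> x = poly N c / poly D c)"


section \<open>Hecke algebras\<close>

text \<open>The free associative algebra over \<open>Kq\<close> on the letters \<open>1, \<dots>, n - 1\<close>: finitely supported
  functions on words, with the convolution product over the splittings of a word.\<close>

definition free_algebra :: "nat \<Rightarrow> (nat list \<Rightarrow> Kq) ring" where
  "free_algebra n =
     \<lparr>carrier = {f. finite {w. f w \<noteq> 0} \<and> (\<forall>w. f w \<noteq> 0 \<longrightarrow> set w \<subseteq> {1..<n})},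
      mult = (\<lambda>f g w. \<Sum>k\<le>length w. f (take k w) * g (drop k w)),
      one = (\<lambda>w. if w = [] then 1 else 0),
      zero = (\<lambda>w. 0),
      add = (\<lambda>f g w. f w + g w)\<rparr>"

definition free_scalar :: "Kq \<Rightarrow> nat list \<Rightarrow> Kq" where
  "free_scalar c = (\<lambda>w. if w = [] then c else 0)"

definition free_gen :: "nat \<Rightarrow> nat list \<Rightarrow> Kq" where
  "free_gen i = (\<lambda>w. if w = [i] then 1 else 0)"

definition hecke_relators :: "nat \<Rightarrow> (nat list \<Rightarrow> Kq) set" where
  "hecke_relators n =
     (let F = free_algebra n; s = free_gen; c = free_scalar in
       {(s i \<otimes>\<^bsub>F\<^esub> s (i + 1) \<otimes>\<^bsub>F\<^esub> s i) \<ominus>\<^bsub>F\<^esub> (s (i + 1) \<otimes>\<^bsub>F\<^esub> s i \<otimes>\<^bsub>F\<^esub> s (i + 1)) | i.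
          1 \<le> i \<and> i + 1 < n} \<union>
       {(s i \<otimes>\<^bsub>F\<^esub> s j) \<ominus>\<^bsub>F\<^esub> (s j \<otimes>\<^bsub>F\<^esub> s i) | i j. 1 \<le> i \<and> i + 2 \<le> j \<and> j < n} \<union>
       {(s i \<ominus>\<^bsub>F\<^esub> c qhalf) \<otimes>\<^bsub>F\<^esub> (s i \<oplus>\<^bsub>F\<^esub> c (inverse qhalf)) | i. 1 \<le> i \<and> i < n})"

definition hecke_ideal :: "nat \<Rightarrow> (nat list \<Rightarrow> Kq) set" where
  "hecke_ideal n = Idl\<^bsub>free_algebra n\<^esub> (hecke_relators n)"

definition hecke :: "nat \<Rightarrow> (nat list \<Rightarrow> Kq) set ring" where
  "hecke n = free_algebra n Quot hecke_ideal n"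

definition hecke_class :: "nat \<Rightarrow> (nat list \<Rightarrow> Kq) \<Rightarrow> (nat list \<Rightarrow> Kq) set" where
  "hecke_class n f = hecke_ideal n +>\<^bsub>free_algebra n\<^esub> f"

definition sigma :: "nat \<Rightarrow> nat \<Rightarrow> (nat list \<Rightarrow> Kq) set" where
  "sigma n i = hecke_class n (free_gen i)"

definition hecke_scale :: "nat \<Rightarrow> Kq \<Rightarrow> (nat list \<Rightarrow> Kq) set \<Rightarrow> (nat list \<Rightarrow> Kq) set" where
  "hecke_scale n c x = hecke_class n (free_scalar c) \<otimes>\<^bsub>hecke n\<^esub> x"

text \<open>The natural map \<open>H_n \<rightarrow> H_(n+1)\<close>; it sends the coset of \<open>f\<close> to the coset of \<open>f\<close>.\<close>

definition hecke_incl :: "nat \<Rightarrow> (nat list \<Rightarrow> Kq) set \<Rightarrow> (nat list \<Rightarrow> Kq) set" where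
  "hecke_incl n x = hecke_ideal (Suc n) <+>\<^bsub>free_algebra (Suc n)\<^esub> x"

definition full_twist :: "nat \<Rightarrow> nat \<Rightarrow> (nat list \<Rightarrow> Kq) set" where
  "full_twist n k =
     foldr (\<lambda>i x. sigma n i \<otimes>\<^bsub>hecke n\<^esub> x) [1..<k] \<one>\<^bsub>hecke n\<^esub> [^]\<^bsub>hecke n\<^esub> k"

definition markov_trace :: "(nat \<Rightarrow> (nat list \<Rightarrow> Kq) set \<Rightarrow> Kqa) \<Rightarrow> bool" where
  "markov_trace \<chi> \<longleftrightarrow>
     (\<forall>n. \<forall>x \<in> carrier (hecke n). \<forall>y \<in> carrier (hecke n).
        \<chi> n (x \<oplus>\<^bsub>hecke n\<^esub> y) = \<chi> n x + \<chi> n y) \<and>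
     (\<forall>n c. \<forall>x \<in> carrier (hecke n). \<chi> n (hecke_scale n c x) = const_fract c * \<chi> n x) \<and>
     (\<forall>n. \<forall>x \<in> carrier (hecke n). \<forall>y \<in> carrier (hecke n).
        \<chi> n (x \<otimes>\<^bsub>hecke n\<^esub> y) = \<chi> n (y \<otimes>\<^bsub>hecke n\<^esub> x)) \<and>
     (\<forall>n. \<forall>x \<in> carrier (hecke n).
        \<chi> (Suc n) (hecke_incl n x) = \<chi> n x * ((1 - avar) / (qhalf_a - inverse qhalf_a))) \<and>
     (\<forall>n \<ge> 1. \<forall>x \<in> carrier (hecke n).
        \<chi> (Suc n) (hecke_incl n x \<otimes>\<^bsub>hecke (Suc n)\<^esub> sigma (Suc n) n) = \<chi> n x) \<and>
     \<chi> 0 \<one>\<^bsub>hecke 0\<^esub> = 1"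

text \<open>The last clause says that \<open>H_n p_T\<close> is an irreducible summand of the regular
  representation: it is nonzero and generated by each of its nonzero elements.\<close>

definition hecke_idempotents :: "(box list \<Rightarrow> (nat list \<Rightarrow> Kq) set) \<Rightarrow> bool" where
  "hecke_idempotents p \<longleftrightarrow>
     (\<forall>n. let H = hecke n; SYT = {T. standard_tableau T \<and> length T = n} in
        (\<forall>T \<in> SYT. p T \<in> carrier H) \<and>
        (\<forall>T \<in> SYT. \<forall>T' \<in> SYT. p T \<otimes>\<^bsub>H\<^esub> p T' = (if T = T' then p T else \<zero>\<^bsub>H\<^esub>)) \<and>
        (\<Oplus>\<^bsub>H\<^esub> T \<in> SYT. p T) = \<one>\<^bsub>H\<^esub> \<and>
        (\<forall>T \<in> SYT. \<forall>k \<in> {1..n}. full_twist n k \<otimes>\<^bsub>H\<^esub> p T =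
           hecke_scale n ((qhalf ^ 2) powi (\<Sum>i<k. box_content (T ! i))) (p T)) \<and>
        (\<forall>T \<in> SYT. p T \<noteq> \<zero>\<^bsub>H\<^esub> \<and>
           (\<forall>x \<in> carrier H. x \<otimes>\<^bsub>H\<^esub> p T \<noteq> \<zero>\<^bsub>H\<^esub> \<longrightarrow>
              (\<exists>y \<in> carrier H. y \<otimes>\<^bsub>H\<^esub> (x \<otimes>\<^bsub>H\<^esub> p T) = p T))))"

text \<open>That \<open>free_algebra n\<close> is a ring matters here: \<open>Idl\<close> is an intersection of ideals, which
  would be empty (hence everything) over a non-ring.\<close>

lemma free_mult_assoc:
  fixes f g h :: "nat list \<Rightarrow> Kq"
  shows "(\<Sum>k\<le>length w. (\<Sum>j\<le>length (take k w). f (take j (take k w)) * g (drop j (take k w))) *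
            h (drop k w)) =
         (\<Sum>j\<le>length w. f (take j w) *
            (\<Sum>m\<le>length (drop j w). g (take m (drop j w)) * h (drop m (drop j w))))"
proof -
  let ?n = "length w"
  let ?F = "\<lambda>j m r. f (take j w) * g (take m (drop j w)) * h (drop (j + m) w)"
  have "(\<Sum>k\<le>?n. (\<Sum>j\<le>length (take k w). f (take j (take k w)) * g (drop j (take k w))) *
            h (drop k w)) = (\<Sum>k=0..?n. \<Sum>j=0..k. ?F j (k - j) (?n - k))"
    unfolding sum_distrib_right atMost_atLeast0
    by (intro sum.cong) (auto simp: min_def drop_take intro!: sum.cong)
  also have "\<dots> = (\<Sum>j=0..?n. \<Sum>m=0..?n - j. ?F j m (?n - j - m))"
    by (rule fps_mult_assoc_lemma)
  also have "\<dots> = (\<Sum>j\<le>?n. f (take j w) *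
            (\<Sum>m\<le>length (drop j w). g (take m (drop j w)) * h (drop m (drop j w))))"
    unfolding sum_distrib_left atMost_atLeast0
    by (intro sum.cong) (auto simp: mult.assoc add.commute)
  finally show ?thesis .
qed

lemma free_algebra_mult_closed:
  assumes "f \<in> carrier (free_algebra n)" "g \<in> carrier (free_algebra n)"
  shows "f \<otimes>\<^bsub>free_algebra n\<^esub> g \<in> carrier (free_algebra n)"
proof -
  let ?p = "f \<otimes>\<^bsub>free_algebra n\<^esub> g"
  have *: "\<exists>u v. w = u @ v \<and> f u \<noteq> 0 \<and> g v \<noteq> 0" if "?p w \<noteq> 0" for w
  proof -
    from that have "(\<Sum>k\<le>length w. f (take k w) * g (drop k w)) \<noteq> 0"
      by (simp add: free_algebra_def)
    then obtain k where "f (take k w) * g (drop k w) \<noteq> 0"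
      by (rule sum.not_neutral_contains_not_neutral)
    then show ?thesis by (metis append_take_drop_id mult_eq_0_iff)
  qed
  have "{w. ?p w \<noteq> 0} \<subseteq> (\<lambda>(u, v). u @ v) ` ({w. f w \<noteq> 0} \<times> {w. g w \<noteq> 0})"
  proof
    fix w assume "w \<in> {w. ?p w \<noteq> 0}"
    then obtain u v where "w = u @ v" "f u \<noteq> 0" "g v \<noteq> 0" using *[of w] by blast
    then show "w \<in> (\<lambda>(u, v). u @ v) ` ({w. f w \<noteq> 0} \<times> {w. g w \<noteq> 0})"
      by (intro image_eqI[of _ _ "(u, v)"]) simp_all
  qed
  moreover have "finite ({w. f w \<noteq> 0} \<times> {w. g w \<noteq> 0})"
    using assms by (auto simp: free_algebra_def)
  ultimately have "finite {w. ?p w \<noteq> 0}" by (meson finite_imageI finite_subset)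
  moreover have "set w \<subseteq> {1..<n}" if w: "?p w \<noteq> 0" for w
  proof -
    from *[OF w] obtain u v where "w = u @ v" "f u \<noteq> 0" "g v \<noteq> 0" by blast
    then show ?thesis using assms by (auto simp: free_algebra_def)
  qed
  ultimately show ?thesis by (simp add: free_algebra_def)
qed

lemma free_algebra_ring: "ring (free_algebra n)"
proof (rule ringI)
  show "abelian_group (free_algebra n)"
  proof (rule abelian_groupI)
    fix x y assume x: "x \<in> carrier (free_algebra n)" and y: "y \<in> carrier (free_algebra n)"
    have "{w. x w + y w \<noteq> 0} \<subseteq> {w. x w \<noteq> 0} \<union> {w. y w \<noteq> 0}" by auto
    moreover have "finite ({w. x w \<noteq> 0} \<union> {w. y w \<noteq> 0})"
      using x y by (auto simp: free_algebra_def)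
    ultimately have "finite {w. x w + y w \<noteq> 0}" by (rule finite_subset)
    moreover have "set w \<subseteq> {1..<n}" if "x w + y w \<noteq> 0" for w
    proof -
      from that have "x w \<noteq> 0 \<or> y w \<noteq> 0" by auto
      then show ?thesis using x y by (auto simp: free_algebra_def)
    qed
    ultimately show "x \<oplus>\<^bsub>free_algebra n\<^esub> y \<in> carrier (free_algebra n)"
      by (simp add: free_algebra_def)
  next
    fix x assume "x \<in> carrier (free_algebra n)"
    then show "\<exists>y\<in>carrier (free_algebra n). y \<oplus>\<^bsub>free_algebra n\<^esub> x = \<zero>\<^bsub>free_algebra n\<^esub>"
      by (intro bexI[of _ "\<lambda>w. - x w"]) (auto simp: free_algebra_def)
  qed (simp_all add: free_algebra_def add_ac)
  show "Group.monoid (free_algebra n)"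
  proof
    fix x assume "x \<in> carrier (free_algebra n)"
    show "\<one>\<^bsub>free_algebra n\<^esub> \<otimes>\<^bsub>free_algebra n\<^esub> x = x"
    proof
      fix w :: "nat list"
      have "(\<one>\<^bsub>free_algebra n\<^esub> \<otimes>\<^bsub>free_algebra n\<^esub> x) w =
          (\<Sum>k\<le>length w. if k = 0 then x w else 0)"
        unfolding free_algebra_def monoid.simps by (rule sum.cong) auto
      then show "(\<one>\<^bsub>free_algebra n\<^esub> \<otimes>\<^bsub>free_algebra n\<^esub> x) w = x w" by simp
    qed
    show "x \<otimes>\<^bsub>free_algebra n\<^esub> \<one>\<^bsub>free_algebra n\<^esub> = x"
    proof
      fix w :: "nat list"
      have "(x \<otimes>\<^bsub>free_algebra n\<^esub> \<one>\<^bsub>free_algebra n\<^esub>) w =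
          (\<Sum>k\<le>length w. if k = length w then x w else 0)"
        unfolding free_algebra_def monoid.simps by (rule sum.cong) auto
      then show "(x \<otimes>\<^bsub>free_algebra n\<^esub> \<one>\<^bsub>free_algebra n\<^esub>) w = x w" by simp
    qed
  next
    fix x y z :: "nat list \<Rightarrow> Kq"
    show "x \<otimes>\<^bsub>free_algebra n\<^esub> y \<otimes>\<^bsub>free_algebra n\<^esub> z =
          x \<otimes>\<^bsub>free_algebra n\<^esub> (y \<otimes>\<^bsub>free_algebra n\<^esub> z)"
      unfolding free_algebra_def monoid.simps by (rule ext, rule free_mult_assoc)
  next
    show "\<one>\<^bsub>free_algebra n\<^esub> \<in> carrier (free_algebra n)"
      by (simp add: free_algebra_def)
  qed (rule free_algebra_mult_closed)
next
  fix x y z :: "nat list \<Rightarrow> Kq"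
  show "(x \<oplus>\<^bsub>free_algebra n\<^esub> y) \<otimes>\<^bsub>free_algebra n\<^esub> z =
        x \<otimes>\<^bsub>free_algebra n\<^esub> z \<oplus>\<^bsub>free_algebra n\<^esub> y \<otimes>\<^bsub>free_algebra n\<^esub> z"
    by (simp add: free_algebra_def sum.distrib distrib_right)
  show "z \<otimes>\<^bsub>free_algebra n\<^esub> (x \<oplus>\<^bsub>free_algebra n\<^esub> y) =
        z \<otimes>\<^bsub>free_algebra n\<^esub> x \<oplus>\<^bsub>free_algebra n\<^esub> z \<otimes>\<^bsub>free_algebra n\<^esub> y"
    by (simp add: free_algebra_def sum.distrib distrib_left)
qed


section \<open>Bigraded Koszul dg algebras localized at a point\<close>

type_synonym 'v cpoly = "('v \<Rightarrow>\<^sub>0 nat) \<Rightarrow>\<^sub>0 complex"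

definition pvar :: "'v \<Rightarrow> 'v cpoly" where
  "pvar v = Poly_Mapping.single (Poly_Mapping.single v 1) 1"

definition pconst :: "complex \<Rightarrow> 'v cpoly" where
  "pconst c = Poly_Mapping.single 0 c"

definition polys_in :: "'v set \<Rightarrow> 'v cpoly set" where
  "polys_in V = {p. \<forall>m \<in> Poly_Mapping.keys p. Poly_Mapping.keys m \<subseteq> V}"

definition poly_value :: "('v \<Rightarrow> complex) \<Rightarrow> 'v cpoly \<Rightarrow> complex" where
  "poly_value x p = (\<Sum>m \<in> Poly_Mapping.keys p. Poly_Mapping.lookup p m *
     (\<Prod>v \<in> Poly_Mapping.keys m. x v ^ Poly_Mapping.lookup m v))"

definition monomial_weight :: "('v \<Rightarrow> weight) \<Rightarrow> ('v \<Rightarrow>\<^sub>0 nat) \<Rightarrow> weight" where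
  "monomial_weight g m =
     (\<Sum>v \<in> Poly_Mapping.keys m. (int (Poly_Mapping.lookup m v) * fst (g v),
                                int (Poly_Mapping.lookup m v) * snd (g v)))"

definition homogeneous :: "('v \<Rightarrow> weight) \<Rightarrow> weight \<Rightarrow> 'v cpoly \<Rightarrow> bool" where
  "homogeneous g w p \<longleftrightarrow> (\<forall>m \<in> Poly_Mapping.keys p. monomial_weight g m = w)"

text \<open>Generators \<open>x_v\<close> of degree \<open>0\<close> and weight \<open>gen_wt v\<close>, generators \<open>\<theta>_b\<close> of degree \<open>-1\<close> and
  weight \<open>rel_wt b\<close> with \<open>d \<theta>_b = rel b\<close>, and a torus-fixed point given by the values of the
  \<open>x_v\<close>.\<close>

record ('v, 'b) koszul =
  gens :: "'v set"
  gen_wt :: "'v \<Rightarrow> weight"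
  point :: "'v \<Rightarrow> complex"
  rels :: "'b set"
  rel_wt :: "'b \<Rightarrow> weight"
  rel :: "'b \<Rightarrow> 'v cpoly"

text \<open>Localization at the point is taken in the bigraded category: the inverted functions are
  those of weight \<open>0\<close> which do not vanish at the point.\<close>

definition denominators :: "('v, 'b) koszul \<Rightarrow> 'v cpoly set" where
  "denominators P =
     {d \<in> polys_in (gens P). homogeneous (gen_wt P) 0 d \<and> poly_value (point P) d \<noteq> 0}"

definition local_ring :: "('v::linorder, 'b) koszul \<Rightarrow> 'v cpoly fract set" where
  "local_ring P = {Fract p d | p d. p \<in> polys_in (gens P) \<and> d \<in> denominators P}"

definition local_component ::
    "('v::linorder, 'b) koszul \<Rightarrow> weight \<Rightarrow> 'v cpoly fract set" where
  "local_component P w =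
     {Fract p d | p d. p \<in> polys_in (gens P) \<and> homogeneous (gen_wt P) w p \<and> d \<in> denominators P}"

text \<open>An element \<open>\<Sum>_S u(S) \<theta>_S\<close> of the Koszul algebra is stored as \<open>u\<close>, where
  \<open>\<theta>_S = \<theta>_{b_1} \<cdots> \<theta>_{b_k}\<close> for \<open>S = {b_1 < \<cdots> < b_k}\<close>.\<close>

definition shuffle_sign :: "'b::linorder set \<Rightarrow> 'b set \<Rightarrow> 'r::comm_ring_1" where
  "shuffle_sign A B = (-1) ^ card {(a, b). a \<in> A \<and> b \<in> B \<and> b < a}"

definition koszul_algebra ::
    "('v::linorder, 'b::linorder) koszul \<Rightarrow> ('b set \<Rightarrow> 'v cpoly fract) ring" where
  "koszul_algebra P =
     \<lparr>carrier = {u. \<forall>S. u S \<in> local_ring P \<and> (\<not> S \<subseteq> rels P \<longrightarrow> u S = 0)},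
      mult = (\<lambda>u v S. \<Sum>A \<in> Pow S. shuffle_sign A (S - A) * u A * v (S - A)),
      one = (\<lambda>S. if S = {} then 1 else 0),
      zero = (\<lambda>S. 0),
      add = (\<lambda>u v S. u S + v S)\<rparr>"

definition koszul_const ::
    "complex \<Rightarrow> 'b set \<Rightarrow> 'v::linorder cpoly fract" where
  "koszul_const c = (\<lambda>S. if S = {} then Fract (pconst c) 1 else 0)"

definition koszul_diff ::
    "('v::linorder, 'b::linorder) koszul \<Rightarrow>
     ('b set \<Rightarrow> 'v cpoly fract) \<Rightarrow> 'b set \<Rightarrow> 'v cpoly fract" where
  "koszul_diff P u =
     (\<lambda>S. \<Sum>b \<in> rels P - S. shuffle_sign {b} S * Fract (rel P b) 1 * u (insert b S))"

text \<open>The component of degree \<open>-k\<close> and weight \<open>w\<close>.\<close>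

definition koszul_component ::
    "('v::linorder, 'b::linorder) koszul \<Rightarrow> nat \<Rightarrow> weight \<Rightarrow> ('b set \<Rightarrow> 'v cpoly fract) set" where
  "koszul_component P k w =
     {u \<in> carrier (koszul_algebra P). \<forall>S. u S \<noteq> 0 \<longrightarrow>
        card S = k \<and> u S \<in> local_component P (w - (\<Sum>b\<in>S. rel_wt P b))}"

definition koszul_cycles ::
    "('v::linorder, 'b::linorder) koszul \<Rightarrow> ('b set \<Rightarrow> 'v cpoly fract) set" where
  "koszul_cycles P = {u \<in> carrier (koszul_algebra P). koszul_diff P u = \<zero>\<^bsub>koszul_algebra P\<^esub>}"

definition koszul_boundaries ::
    "('v::linorder, 'b::linorder) koszul \<Rightarrow> ('b set \<Rightarrow> 'v cpoly fract) set" where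
  "koszul_boundaries P = koszul_diff P ` carrier (koszul_algebra P)"

text \<open>Morphisms of bigraded dg algebras over \<open>C\<close> which are bijective on homology (the last two
  clauses are injectivity and surjectivity).\<close>

definition koszul_quasi_iso ::
    "('v::linorder, 'b::linorder) koszul \<Rightarrow> ('v'::linorder, 'b'::linorder) koszul \<Rightarrow>
     (('b set \<Rightarrow> 'v cpoly fract) \<Rightarrow> ('b' set \<Rightarrow> 'v' cpoly fract)) \<Rightarrow> bool" where
  "koszul_quasi_iso P Q \<phi> \<longleftrightarrow>
     \<phi> \<in> Ring.ring_hom (koszul_algebra P) (koszul_algebra Q) \<and>
     (\<forall>c. \<phi> (koszul_const c) = koszul_const c) \<and>
     (\<forall>u \<in> carrier (koszul_algebra P). \<phi> (koszul_diff P u) = koszul_diff Q (\<phi> u)) \<and>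
     (\<forall>k w. \<phi> ` koszul_component P k w \<subseteq> koszul_component Q k w) \<and>
     (\<forall>u \<in> koszul_cycles P. \<phi> u \<in> koszul_boundaries Q \<longrightarrow> u \<in> koszul_boundaries P) \<and>
     (\<forall>u' \<in> koszul_cycles Q. \<exists>u \<in> koszul_cycles P. \<exists>b \<in> koszul_boundaries Q.
        u' = \<phi> u \<oplus>\<^bsub>koszul_algebra Q\<^esub> b)"

text \<open>A presentation of the dg algebra of \<open>Q\<close> by generators of weight \<open>\<noteq> 0\<close> (so that the Poincare
  series below makes sense) and homogeneous relations, localized at the origin. Dg algebras of
  functions on dg schemes only matter up to quasi-isomorphism. As the dg algebra of \<open>P\<close> is free on
  its generators before localization, nothing is lost by asking for a single quasi-isomorphism out
  of it rather than for a zigzag.\<close>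

definition koszul_presentation ::
    "('v::linorder, 'b::linorder) koszul \<Rightarrow> ('v'::linorder, 'b'::linorder) koszul \<Rightarrow> bool" where
  "koszul_presentation P Q \<longleftrightarrow>
     finite (gens P) \<and> finite (rels P) \<and>
     (\<forall>v \<in> gens P. gen_wt P v \<noteq> 0) \<and> point P = (\<lambda>v. 0) \<and>
     (\<forall>b \<in> rels P. rel P b \<in> polys_in (gens P) \<and>
        homogeneous (gen_wt P) (rel_wt P b) (rel P b)) \<and>
     (\<exists>\<phi>. koszul_quasi_iso P Q \<phi>)"

definition poincare_series :: "('v, 'b) koszul \<Rightarrow> Kqat" where
  "poincare_series P =
     (\<Prod>b \<in> rels P. 1 - character (rel_wt P b)) / (\<Prod>v \<in> gens P. 1 - character (gen_wt P v))"


section \<open>The flag Hilbert dg scheme near a torus fixed point\<close>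

text \<open>Matrices are indexed from \<open>0\<close>, so the basis vector \<open>e_j\<close> belongs to the box \<open>T ! j\<close>. Write
  \<open>B\<close> for the group of invertible lower triangular matrices. Near \<open>I_T\<close> the quotient \<open>M_n\<close> is
  identified with the following affine slice for the action of \<open>B\<close> on triples \<open>(X, Y, v)\<close>.
  A change of basis by \<open>B\<close> replaces \<open>e_i\<close> by a nonzero multiple plus a combination of the
  \<open>e_k\<close> with \<open>k > i\<close>. Use this freedom, for \<open>i = 0, 1, 2, \<dots>\<close> in turn, to arrange \<open>v = e_0\<close> and,
  for \<open>i \<ge> 1\<close>, that the part of \<open>X e_j\<close> (of \<open>Y e_j\<close>, if \<open>i\<close> is in the first column) in the span
  of \<open>e_i, e_(i+1), \<dots>\<close> is exactly \<open>e_i\<close>, where \<open>j\<close> is the box to the left of (below) \<open>i\<close>. This is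
  possible when certain leading coefficients are nonzero, an open condition which holds at
  \<open>I_T\<close>, and then the change of basis is unique (see \<open>slice_unique\<close> below). The entries which are
  not fixed in this way are coordinates on this neighbourhood of \<open>I_T\<close> in \<open>M_n\<close>; there are
  \<open>n (n + 1) / 2 = dim M_n\<close> of them. The bundle of strictly lower triangular matrices is trivial
  on the slice. Conditions that are open and hold at \<open>I_T\<close>, such as the one that the
  \<open>X^a Y^b v\<close> span, disappear in the localization at \<open>I_T\<close>.\<close>

definition x_free :: "box list \<Rightarrow> nat \<Rightarrow> nat \<Rightarrow> bool" where
  "x_free T i j \<longleftrightarrow> j \<le> i \<and> i < length T \<and>
     \<not> (\<exists>r \<le> i. T ! r = box_right (T ! j))"

definition y_free :: "box list \<Rightarrow> nat \<Rightarrow> nat \<Rightarrow> bool" where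
  "y_free T i j \<longleftrightarrow> j < i \<and> i < length T \<and>
     \<not> (fst (T ! j) = 0 \<and> (\<exists>r \<le> i. T ! r = box_up (T ! j)))"

definition slice_X :: "box list \<Rightarrow> (nat \<Rightarrow> nat \<Rightarrow> 'r::comm_ring_1) \<Rightarrow> 'r mat" where
  "slice_X T x = mat (length T) (length T) (\<lambda>(i, j).
     if x_free T i j then x i j else if T ! i = box_right (T ! j) then 1 else 0)"

definition slice_Y :: "box list \<Rightarrow> (nat \<Rightarrow> nat \<Rightarrow> 'r::comm_ring_1) \<Rightarrow> 'r mat" where
  "slice_Y T y = mat (length T) (length T) (\<lambda>(i, j).
     if y_free T i j then y i j else if T ! i = box_up (T ! j) then 1 else 0)"

lemma slice_step:
  fixes g M M' :: "'r::comm_ring_1 mat"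
  assumes M: "M \<in> carrier_mat n n" "M' \<in> carrier_mat n n" and g: "g \<in> carrier_mat n n"
    and low: "\<And>i j. i < j \<Longrightarrow> j < n \<Longrightarrow> g $$ (i, j) = 0" and gM: "g * M = M' * g"
    and IH: "\<And>l k. l < i \<Longrightarrow> k < n \<Longrightarrow> g $$ (k, l) = (if k = l then 1 else 0)"
    and i: "i < n" and j: "j < i"
    and col: "\<And>k. i \<le> k \<Longrightarrow> k < n \<Longrightarrow> M $$ (k, j) = (if k = i then 1 else 0)"
             "\<And>k. i \<le> k \<Longrightarrow> k < n \<Longrightarrow> M' $$ (k, j) = (if k = i then 1 else 0)"
    and k: "k < n"
  shows "g $$ (k, i) = (if k = i then 1 else 0)"
proof (cases "k < i")
  case True
  then show ?thesis using low i by simp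
next
  case False
  have "(g * M) $$ (k, j) = (\<Sum>l\<in>{0..<n}. g $$ (k, l) * M $$ (l, j))"
    using M g k i j by (simp add: scalar_prod_def)
  also have "\<dots> = (\<Sum>l\<in>{0..<n}. if l = i then g $$ (k, i) else 0)"
  proof (rule sum.cong)
    fix l assume "l \<in> {0..<n}"
    then show "g $$ (k, l) * M $$ (l, j) = (if l = i then g $$ (k, i) else 0)"
      using IH[of l k] col(1)[of l] False k by (cases "l < i") auto
  qed simp
  also have "\<dots> = g $$ (k, i)" using i by simp
  finally have 1: "(g * M) $$ (k, j) = g $$ (k, i)" .
  have "(M' * g) $$ (k, j) = (\<Sum>l\<in>{0..<n}. M' $$ (k, l) * g $$ (l, j))"
    using M g k i j by (simp add: scalar_prod_def)
  also have "\<dots> = (\<Sum>l\<in>{0..<n}. if l = j then M' $$ (k, j) else 0)"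
    using IH[OF j] by (intro sum.cong) auto
  also have "\<dots> = M' $$ (k, j)" using i j by simp
  finally have "(M' * g) $$ (k, j) = M' $$ (k, j)" .
  with 1 gM col(2)[of k] False k show ?thesis by simp
qed

lemma slice_unique:
  fixes g :: "'r::comm_ring_1 mat"
  assumes T: "standard_tableau T" and n: "length T = n"
    and g: "g \<in> carrier_mat n n" and low: "\<And>i j. i < j \<Longrightarrow> j < n \<Longrightarrow> g $$ (i, j) = 0"
    and gX: "g * slice_X T x = slice_X T x' * g"
    and gY: "g * slice_Y T y = slice_Y T y' * g"
    and gv: "g *\<^sub>v unit_vec n 0 = unit_vec n 0"
  shows "g = 1\<^sub>m n"
proof -
  note T' = T[unfolded standard_tableau_def]
  have dist: "distinct T" using T' by blast
  have down: "(a', b') \<in> set T" if "(a, b) \<in> set T" "a' \<le> a" "b' \<le> b" for a b a' b'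
    using T' that unfolding young_diagram_def by blast
  have ord: "i < j" if "i < n" "j < n"
      "snd (T ! i) = snd (T ! j) \<and> fst (T ! i) < fst (T ! j) \<or>
       fst (T ! i) = fst (T ! j) \<and> snd (T ! i) < snd (T ! j)" for i j
    using T' that n by blast
  have label: "\<exists>j<n. T ! j = c" if "c \<in> set T" for c
    using that n by (metis in_set_conv_nth)
  have first: "T ! 0 = (0, 0)" if n0: "0 < n"
  proof (rule ccontr)
    obtain a b where ab: "T ! 0 = (a, b)" by (cases "T ! 0") auto
    have mem: "(a, b) \<in> set T" using ab n0 n by (metis nth_mem)
    assume "T ! 0 \<noteq> (0, 0)"
    then consider "0 < a" | "a = 0" "0 < b" using ab by auto
    then show False
    proof cases
      case 1
      obtain m where "m < n" "T ! m = (0, b)" using label down[OF mem, of 0 b] by auto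
      then show False using ord[of m 0] ab 1 n0 by simp
    next
      case 2
      obtain m where "m < n" "T ! m = (0, 0)" using label down[OF mem, of 0 0] by auto
      then show False using ord[of m 0] ab 2 n0 by simp
    qed
  qed
  have eqD: "r = i" if "T ! r = T ! i" "r < n" "i < n" for r i
    using that dist n nth_eq_iff_index_eq by blast
  have XY: "slice_X T w \<in> carrier_mat n n" "slice_Y T w \<in> carrier_mat n n"
    for w :: "nat \<Rightarrow> nat \<Rightarrow> 'r"
    by (auto simp: slice_X_def slice_Y_def n)
  have main: "i < n \<longrightarrow> (\<forall>k<n. g $$ (k, i) = (if k = i then 1 else 0))" for i
  proof (induction i rule: less_induct)
    case (less i)
    show ?case
    proof (intro impI)
      assume i: "i < n"
      have IH: "g $$ (k, l) = (if k = l then 1 else 0)" if "l < i" "k < n" for l k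
        using less that i by auto
      obtain a b where ab: "T ! i = (a, b)" by (cases "T ! i") auto
      have mem: "(a, b) \<in> set T" using ab i n by (metis nth_mem)
      consider "i = 0" | "0 < a" | "i \<noteq> 0" "a = 0" by auto
      then show "\<forall>k<n. g $$ (k, i) = (if k = i then 1 else 0)"
      proof cases
        case 1
        show ?thesis
        proof (intro allI impI)
          fix k assume k: "k < n"
          have "(g *\<^sub>v unit_vec n 0) $ k = (\<Sum>l\<in>{0..<n}. g $$ (k, l) * (if l = 0 then 1 else 0))"
            using g k by (simp add: scalar_prod_def unit_vec_def)
          also have "\<dots> = (\<Sum>l\<in>{0..<n}. if l = 0 then g $$ (k, 0) else 0)"
            by (rule sum.cong) auto
          also have "\<dots> = g $$ (k, 0)" using k by simp
          finally show "g $$ (k, i) = (if k = i then 1 else 0)"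
            using gv k 1 by (simp add: unit_vec_def)
        qed
      next
        case 2
        obtain j where j: "j < n" "T ! j = (a - 1, b)"
          using label down[OF mem, of "a - 1" b] by auto
        have ji: "j < i" using ord[of j i] j i ab 2 by simp
        have R: "box_right (T ! j) = T ! i" using j ab 2 by (simp add: box_right_def)
        have col: "slice_X T w $$ (k, j) = (if k = i then 1 else 0)"
          if "i \<le> k" "k < n" for k and w :: "nat \<Rightarrow> nat \<Rightarrow> 'r"
          using that R j(1) i eqD[of k i] n by (auto simp: slice_X_def x_free_def)
        show ?thesis using slice_step[OF XY(1) XY(1) g low gX IH i ji col col] by blast
      next
        case 3
        have "T ! i \<noteq> (0, 0)" using first eqD[of 0 i] i 3 by auto
        then have b: "0 < b" using ab 3 by auto
        obtain j where j: "j < n" "T ! j = (0, b - 1)"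
          using label down[OF mem, of 0 "b - 1"] by auto
        have ji: "j < i" using ord[of j i] j i ab 3 b by simp
        have R: "box_up (T ! j) = T ! i" using j ab 3 b by (simp add: box_up_def)
        have col: "slice_Y T w $$ (k, j) = (if k = i then 1 else 0)"
          if "i \<le> k" "k < n" for k and w :: "nat \<Rightarrow> nat \<Rightarrow> 'r"
          using that R j i eqD[of k i] n by (auto simp: slice_Y_def y_free_def)
        show ?thesis using slice_step[OF XY(2) XY(2) g low gY IH i ji col col] by blast
      qed
    qed
  qed
  show ?thesis by (rule eq_matI) (use main g in auto)
qed

text \<open>The torus acts on the slice after compensation by the diagonal matrix with entries
  \<open>z_i = q^a t^b\<close>. As a function, the entry \<open>(i, j)\<close> of \<open>X\<close> has weight \<open>q z_j / z_i\<close>, that of \<open>Y\<close>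
  has weight \<open>t z_j / z_i\<close>, and that of \<open>[X, Y]\<close> has weight \<open>q t z_j / z_i\<close>.\<close>

definition box_weight :: "box \<Rightarrow> weight" where
  "box_weight c = (int (fst c), int (snd c))"

text \<open>The coordinate \<open>(False, i, j)\<close> is the entry \<open>(i, j)\<close> of \<open>X\<close>, and \<open>(True, i, j)\<close> is that of \<open>Y\<close>.\<close>

definition fhilb_chart :: "box list \<Rightarrow> (bool \<times> nat \<times> nat, nat \<times> nat) koszul" where
  "fhilb_chart T =
     (let z = (\<lambda>i. box_weight (T ! i));
          X = slice_X T (\<lambda>i j. pvar (False, i, j));
          Y = slice_Y T (\<lambda>i j. pvar (True, i, j))
      in \<lparr>gens = {(False, i, j) | i j. x_free T i j} \<union> {(True, i, j) | i j. y_free T i j},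
          gen_wt = (\<lambda>(s, i, j). z j - z i + (if s then (0, 1) else (1, 0))),
          point = (\<lambda>(s, i, j).
            if T ! i = (if s then box_up (T ! j) else box_right (T ! j)) then 1 else 0),
          rels = {(i, j). j < i \<and> i < length T},
          rel_wt = (\<lambda>(i, j). z j - z i + (1, 1)),
          rel = (\<lambda>(i, j). (X * Y - Y * X) $$ (i, j))\<rparr>)"

text \<open>The exterior generators \<open>\<xi>_i\<close> have weight \<open>z_i^(-1)\<close>. In the normalization of \<open>markov_trace\<close>
  one has \<open>\<chi>(1) = (1 - a) / (q^(1/2) - q^(-1/2))\<close> for \<open>n = 1\<close>, whereas the Euler characteristic
  for \<open>n = 1\<close> is \<open>(1 - a) / (1 - q)\<close>; in size \<open>n\<close> the two sides differ by \<open>(-q^(1/2))^n\<close>.\<close>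

definition exterior_character :: "box list \<Rightarrow> Kqat" where
  "exterior_character T =
     (\<Prod>i<length T. 1 - const_fract avar * character (- box_weight (T ! i)))"

definition euler_characteristic :: "box list \<Rightarrow> Kqa \<Rightarrow> bool" where
  "euler_characteristic T E \<longleftrightarrow>
     (\<exists>P :: (nat, nat) koszul. koszul_presentation P (fhilb_chart T) \<and>
        specializes_at (inverse (qhalf_a ^ 2)) (poincare_series P * exterior_character T) E)"

end

theory Submission
  imports Defs
begin

text \<open>
  On the Hecke side, \<open>H_n \<rightarrow> H_(n+1)\<close> sends \<open>p_T\<close> to the sum of the \<open>p_(T@[a])\<close> over the boxes \<open>a\<close> addable
  to \<open>T\<close>, and \<open>\<chi>(p_(T@[a]) v) = R(a) \<chi>(p_T v)\<close> for \<open>v \<in> H_n\<close>, with \<open>R(a)\<close> an explicit product over the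
  rows of \<open>T\<close>; this is proved by induction on \<open>T\<close>. Write \<open>T = U @ [b]\<close>. If \<open>a\<close> is already addable to \<open>U\<close>,
  the identity \<open>p_(U@[b]) \<sigma>_n p_(U@[a]) \<sigma>_n p_(U@[b]) = \<kappa> p_(U@[b,a])\<close> reduces \<open>R(a)\<close> to the previous step.
  The values for the two other boxes, right of and above \<open>b\<close>, are determined by two linear equations
  for the \<open>R(a)\<close> coming from the last two axioms of the Markov trace; that the explicit products solve these
  equations is Lagrange interpolation.

  On the geometric side, every box \<open>i\<close> with both coordinates positive gives one coordinate of the chart
  of weight zero (the entry of \<open>Y\<close> from the box below \<open>i\<close>) and one relation of weight zero, which
  expresses this coordinate by the others. Eliminating them all leaves a presentation without weight zero,
  whose series is a product over the boxes; at \<open>t = 1/q\<close> the factor of a box telescopes along the rows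
  to \<open>- q^(-1/2) R\<close>.\<close>

section \<open>Standard tableaux\<close>

text \<open>The element \<open>v\<close> is what lets the induction close. The corners
  \<open>p T\<close> H_n \<open>p T\<close> are never identified, so the claim concerns the partial
  trace from H_(n+1) to H_n, tested against all of H_n. Conjugation by sigma_(n+1) carries such a
  claim one level up, because H_(n+1) is spanned by H_n and H_n sigma_n H_n.

  The full twists enter through quotients of consecutive ones, the Jucys-Murphy elements J_k. Their
  eigenvalues separate tableaux, and J_(k+1) = sigma_k J_k sigma_k together with the quadratic
  relation yields the entries of sigma_k between idempotents, as in Young's seminormal form. At the
  two unknown boxes these entries are the two distinct eigenvalues of sigma_k, so the linear system
  has one solution.

  The idempotent may belong to another tableau of the same shape; the product of the R(a), which
  follows the order of growth, is therefore rewritten over pairs of boxes.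

  For the chart, the morphism has to start at the smaller algebra, whereas substituting a variable
  goes the other way. Weight zero would turn the series into 0/0, so the vanishing factors are
  replaced by 1 in the bookkeeping.\<close>

definition row_len :: "box set \<Rightarrow> nat \<Rightarrow> nat" where
  "row_len D r = card {a. (a, r) \<in> D}"

definition addable :: "box set \<Rightarrow> box \<Rightarrow> bool" where
  "addable D c \<longleftrightarrow> c \<notin> D \<and> young_diagram D \<and> young_diagram (insert c D)"

lemma young_diagram_down:
  "young_diagram D \<Longrightarrow> (x, y) \<in> D \<Longrightarrow> a \<le> x \<Longrightarrow> b \<le> y \<Longrightarrow> (a, b) \<in> D"
  unfolding young_diagram_def by blast

text \<open>A row is a finite set of naturals closed downwards, hence an initial segment, and its
  cardinality is its first missing element.\<close>

lemma mem_young_iff: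
  assumes "young_diagram D"
  shows "(a, r) \<in> D \<longleftrightarrow> a < row_len D r"
proof -
  let ?A = "{a. (a, r) \<in> D}"
  have fin: "finite ?A"
  proof (rule finite_subset)
    show "?A \<subseteq> fst ` D" by force
    show "finite (fst ` D)" using assms by (simp add: young_diagram_def)
  qed
  have down: "\<And>x y. y \<in> ?A \<Longrightarrow> x \<le> y \<Longrightarrow> x \<in> ?A"
    using young_diagram_down[OF assms] by simp
  obtain k where k: "?A = {..<k}"
  proof (cases "?A = {}")
    case False
    define m where "m = Max ?A"
    have m: "m \<in> ?A" "\<And>x. x \<in> ?A \<Longrightarrow> x \<le> m"
      unfolding m_def by (rule Max_in[OF fin False], rule Max_ge[OF fin])
    have "x \<in> ?A \<longleftrightarrow> x < Suc m" for x
      unfolding less_Suc_eq_le using m(1) m(2)[of x] down[of m x] by blast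
    then have "?A = {..<Suc m}" by blast
    then show ?thesis using that by blast
  qed (use that[of 0] in simp)
  have "row_len D r = k" by (simp add: row_len_def k)
  moreover have "(a, r) \<in> D \<longleftrightarrow> a \<in> ?A" by simp
  ultimately show ?thesis by (simp only: k lessThan_iff)
qed

lemma row_len_antimono:
  assumes "young_diagram D" "r \<le> r'"
  shows "row_len D r' \<le> row_len D r"
proof (rule ccontr)
  assume "\<not> ?thesis"
  then have "(row_len D r, r') \<in> D" using mem_young_iff[OF assms(1)] by simp
  then have "(row_len D r, r) \<in> D" using young_diagram_down[OF assms(1)] assms(2) by simp
  then show False using mem_young_iff[OF assms(1)] by simp
qed

text \<open>A box in row r forces the r + 1 boxes of the first column up to that row. Any bound on
  the number of boxes thus bounds the rows, which allows products over rows with one uniform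
  range.\<close>

lemma row_len_eq_0:
  assumes "young_diagram D" "card D \<le> r"
  shows "row_len D r = 0"
proof (rule ccontr)
  assume "row_len D r \<noteq> 0"
  then have "(0, r) \<in> D" using mem_young_iff[OF assms(1)] by simp
  then have "Pair 0 ` {..r} \<subseteq> D" using young_diagram_down[OF assms(1)] by auto
  moreover have "card (Pair (0::nat) ` {..r}) = Suc r" by (simp add: card_image inj_on_def)
  moreover have "finite D" using assms by (simp add: young_diagram_def)
  ultimately have "Suc r \<le> card D" by (metis card_mono)
  then show False using assms by simp
qed

lemma addable_iff:
  assumes "young_diagram D"
  shows "addable D (a, r) \<longleftrightarrow> a = row_len D r \<and> (r = 0 \<or> row_len D r < row_len D (r - 1))"
proof
  assume *: "addable D (a, r)"
  then have y: "young_diagram (insert (a, r) D)" "(a, r) \<notin> D" by (auto simp: addable_def)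
  have "(a', r') \<in> D" if "a' \<le> a" "r' \<le> r" "(a', r') \<noteq> (a, r)" for a' r'
  proof -
    have "(a', r') \<in> insert (a, r) D" using young_diagram_down[OF y(1), of a r] that(1,2) by simp
    then show ?thesis using that(3) by auto
  qed
  then have 1: "\<And>a' r'. a' \<le> a \<Longrightarrow> r' \<le> r \<Longrightarrow> (a', r') \<noteq> (a, r) \<Longrightarrow> a' < row_len D r'"
    using mem_young_iff[OF assms] by blast
  have "\<not> a < row_len D r" using y mem_young_iff[OF assms] by simp
  moreover have "a \<le> row_len D r" using 1[of "a - 1" r] by (cases a) auto
  ultimately have "a = row_len D r" by simp
  moreover have "r = 0 \<or> a < row_len D (r - 1)" using 1[of a "r - 1"] by (cases r) auto
  ultimately show "a = row_len D r \<and> (r = 0 \<or> row_len D r < row_len D (r - 1))" by simp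
next
  assume *: "a = row_len D r \<and> (r = 0 \<or> row_len D r < row_len D (r - 1))"
  have "(a', r') \<in> D" if "a' \<le> a" "r' \<le> r" "(a', r') \<noteq> (a, r)" for a' r'
  proof (cases "r' = r")
    case True
    then show ?thesis using that * mem_young_iff[OF assms] by auto
  next
    case False
    then have "r' \<le> r - 1" "r \<noteq> 0" using that by auto
    then have "a < row_len D r'" using * row_len_antimono[OF assms, of r' "r - 1"] by auto
    then show ?thesis using that mem_young_iff[OF assms] by auto
  qed
  then have 1: "(a', r') \<in> insert (a, r) D" if "a' \<le> a" "r' \<le> r" for a' r'
    using that by blast
  have 2: "(a', r') \<in> D" if "(x, y) \<in> D" "a' \<le> x" "r' \<le> y" for a' r' x y
    using that young_diagram_down[OF assms] by simp
  have "young_diagram (insert (a, r) D)" unfolding young_diagram_def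
  proof (intro conjI ballI)
    show "finite (insert (a, r) D)" using assms by (simp add: young_diagram_def)
    fix z assume z: "z \<in> insert (a, r) D"
    obtain x y where xy: "z = (x, y)" by (cases z)
    have "(a', r') \<in> insert (a, r) D" if "a' \<le> x" "r' \<le> y" for a' r'
    proof (cases "z = (a, r)")
      case True
      then show ?thesis using 1 that xy by simp
    next
      case False
      then have "(x, y) \<in> D" using xy z by auto
      then show ?thesis using 2[of x y a' r'] that by simp
    qed
    then show "case z of (x, y) \<Rightarrow> \<forall>a' b'. a' \<le> x \<longrightarrow> b' \<le> y \<longrightarrow> (a', b') \<in> insert (a, r) D"
      using xy by simp
  qed
  moreover have "(a, r) \<notin> D" using * mem_young_iff[OF assms] by simp
  ultimately show "addable D (a, r)" using assms by (simp add: addable_def)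
qed

lemma row_len_insert:
  assumes "addable D c"
  shows "row_len (insert c D) r = row_len D r + (if r = snd c then 1 else 0)"
proof -
  have D: "young_diagram D" "young_diagram (insert c D)" using assms by (auto simp: addable_def)
  obtain a s where c: "c = (a, s)" by (cases c)
  have a: "a = row_len D s" using assms addable_iff[OF D(1)] c by simp
  have *: "x < row_len (insert c D) r \<longleftrightarrow> (x = a \<and> r = s) \<or> x < row_len D r" for x
    using mem_young_iff[OF D(2), of x r] mem_young_iff[OF D(1), of x r] c by auto
  have **: "x < row_len (insert c D) r \<longleftrightarrow> x < row_len D r + (if r = snd c then 1 else 0)" for x
    unfolding * using a c by auto
  show ?thesis
    using **[of "row_len (insert c D) r"] **[of "row_len D r + (if r = snd c then 1 else 0)"]
    by (simp only: less_irrefl) linarith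
qed

text \<open>These numbers are the contents of the first free cells of the rows. Being distinct, they
  give distinct interpolation nodes.\<close>

lemma content_strict_decreasing:
  assumes "young_diagram D" "r < r'"
  shows "int (row_len D r') - int r' < int (row_len D r) - int r"
  using row_len_antimono[OF assms(1), of r r'] assms(2) by linarith

section \<open>Standard tableaux as growing chains of diagrams\<close>

lemma standard_young: "standard_tableau T \<Longrightarrow> young_diagram (set T)"
  by (simp add: standard_tableau_def)

lemma standard_distinct: "standard_tableau T \<Longrightarrow> distinct T"
  by (simp add: standard_tableau_def)

lemma standard_order:
  "standard_tableau T \<Longrightarrow> i < length T \<Longrightarrow> j < length T \<Longrightarrow>
    snd (T ! i) = snd (T ! j) \<and> fst (T ! i) < fst (T ! j) \<or>
    fst (T ! i) = fst (T ! j) \<and> snd (T ! i) < snd (T ! j) \<Longrightarrow> i < j"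
  unfolding standard_tableau_def by blast

text \<open>The largest label has no box to its right or above it, so removing it leaves a diagram;
  conversely an addable box has none of the old boxes there. All inductions over tableaux rest on
  this.\<close>

lemma standard_append_iff:
  "standard_tableau (T @ [c]) \<longleftrightarrow> standard_tableau T \<and> addable (set T) c"
proof
  assume *: "standard_tableau (T @ [c])"
  have dist: "distinct (T @ [c])" and yd: "young_diagram (insert c (set T))"
    using * by (auto simp: standard_tableau_def)
  have ord: "i < j" if "i < Suc (length T)" "j < Suc (length T)"
    "snd ((T @ [c]) ! i) = snd ((T @ [c]) ! j) \<and> fst ((T @ [c]) ! i) < fst ((T @ [c]) ! j) \<or>
     fst ((T @ [c]) ! i) = fst ((T @ [c]) ! j) \<and> snd ((T @ [c]) ! i) < snd ((T @ [c]) ! j)" for i j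
    using standard_order[OF *, of i j] that by simp
  have last: "\<not> (snd c = snd d \<and> fst c < fst d \<or> fst c = fst d \<and> snd c < snd d)" if d: "d \<in> set T" for d
  proof
    assume as: "snd c = snd d \<and> fst c < fst d \<or> fst c = fst d \<and> snd c < snd d"
    obtain j where j: "j < length T" "T ! j = d"
      using d unfolding in_set_conv_nth by blast
    have nth: "(T @ [c]) ! length T = c" "(T @ [c]) ! j = d" using j by (simp_all add: nth_append)
    have "length T < j" using ord[of "length T" j, unfolded nth] as j(1) by simp
    then show False using j by simp
  qed
  have yT: "young_diagram (set T)"
    unfolding young_diagram_def
  proof (intro conjI ballI, simp, clarify)
    fix a b a' b' assume m: "(a, b) \<in> set T" "a' \<le> a" "b' \<le> b"
    then have all: "(x, y) \<in> insert c (set T)" if "x \<le> a" "y \<le> b" for x y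
      using young_diagram_down[OF yd, of a b] m(1) that by simp
    show "(a', b') \<in> set T"
    proof (rule ccontr)
      assume "(a', b') \<notin> set T"
      then have c: "c = (a', b')" using all[OF m(2,3)] by auto
      show False
      proof (cases "a' = a")
        case True
        then have "b' < b" using m c dist by (cases "b' = b") auto
        then show False using last[OF m(1)] c True by simp
      next
        case False
        then have "a' < a" using m by simp
        \<comment> \<open>This box lies to the right of \<open>c\<close> in the same row and yet
          carries a smaller label.\<close>
        have "(a, b') \<in> set T" using all[of a b'] m c False by auto
        then show False using last[of "(a, b')"] c \<open>a' < a\<close> by simp
      qed
    qed
  qed
  have "standard_tableau T"
    unfolding standard_tableau_def
  proof (intro conjI allI impI)
    fix i j assume "i < length T" "j < length T"
      "snd (T ! i) = snd (T ! j) \<and> fst (T ! i) < fst (T ! j) \<or>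
       fst (T ! i) = fst (T ! j) \<and> snd (T ! i) < snd (T ! j)"
    then show "i < j" using ord[of i j] by (auto simp: nth_append)
  qed (use dist yT in auto)
  then show "standard_tableau T \<and> addable (set T) c"
    using yT yd dist by (auto simp: addable_def)
next
  assume *: "standard_tableau T \<and> addable (set T) c"
  then have yT: "young_diagram (set T)" by (simp add: addable_def)
  obtain a r where c: "c = (a, r)" by (cases c)
  have notin: "c \<notin> set T" using * by (simp add: addable_def)
  have last: "d \<notin> set T" if "snd c = snd d \<and> fst c < fst d \<or> fst c = fst d \<and> snd c < snd d" for d
  proof
    assume "d \<in> set T"
    then have "(a, r) \<in> set T"
      using that c young_diagram_down[OF yT, of "fst d" "snd d" a r] by auto
    then have "c \<in> set T" using c by simp
    then show False using notin by simp
  qed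
  have T: "standard_tableau T" using * by simp
  show "standard_tableau (T @ [c])"
    unfolding standard_tableau_def
  proof (intro conjI allI impI)
    show "distinct (T @ [c])" using T notin by (simp add: standard_tableau_def)
    show "young_diagram (set (T @ [c]))" using * by (simp add: addable_def)
    fix i j assume ij: "i < length (T @ [c])" "j < length (T @ [c])"
      and as: "snd ((T @ [c]) ! i) = snd ((T @ [c]) ! j) \<and> fst ((T @ [c]) ! i) < fst ((T @ [c]) ! j) \<or>
       fst ((T @ [c]) ! i) = fst ((T @ [c]) ! j) \<and> snd ((T @ [c]) ! i) < snd ((T @ [c]) ! j)"
    show "i < j"
    proof (cases "i < length T")
      case True
      then show ?thesis
        using ij as standard_order[OF T, of i j] by (cases "j < length T") (simp_all add: nth_append)
    next
      case False
      then have i: "(T @ [c]) ! i = c" "i = length T" using ij by (simp_all add: nth_append)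
      show ?thesis
      proof (cases "j < length T")
        case True
        then have "(T @ [c]) ! j \<in> set T" by (simp add: nth_append)
        then show ?thesis using last[of "(T @ [c]) ! j"] as i by simp
      next
        case False
        then have "(T @ [c]) ! j = c" using ij by (simp add: nth_append)
        then show ?thesis using as i by simp
      qed
    qed
  qed
qed

lemma standard_append_two_iff:
  "standard_tableau (T @ [b, a]) \<longleftrightarrow> standard_tableau (T @ [b]) \<and> addable (insert b (set T)) a"
  using standard_append_iff[of "T @ [b]" a] by simp

lemma standard_take: "standard_tableau T \<Longrightarrow> standard_tableau (take k T)"
proof (induction T rule: rev_induct)
  case (snoc c T)
  then show ?case using standard_append_iff[of T c] by (cases "k \<le> length T") auto
qed simp

lemma standard_Nil [simp]: "standard_tableau []"
  by (simp add: standard_tableau_def young_diagram_def)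

lemma addable_empty: "addable {} c \<longleftrightarrow> c = (0, 0)"
proof -
  have "young_diagram {}" by (simp add: young_diagram_def)
  from addable_iff[OF this, of "fst c" "snd c"] show ?thesis by (auto simp: row_len_def prod_eq_iff)
qed

lemma finite_addable: "finite {c. addable D c}"
proof (cases "young_diagram D")
  case True
  have "{c. addable D c} \<subseteq> (\<lambda>r. (row_len D r, r)) ` {..card D}"
  proof
    fix c assume "c \<in> {c. addable D c}"
    then have "addable D (fst c, snd c)" by simp
    then have *: "fst c = row_len D (snd c)" "snd c = 0 \<or> 0 < row_len D (snd c - 1)"
      using addable_iff[OF True, of "fst c" "snd c"] by auto
    then have "snd c \<le> card D" using row_len_eq_0[OF True, of "snd c - 1"] by linarith
    then show "c \<in> (\<lambda>r. (row_len D r, r)) ` {..card D}" using * by (intro image_eqI[of _ _ "snd c"]) (auto simp: prod_eq_iff)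
  qed
  then show ?thesis by (rule finite_subset) simp
qed (simp add: addable_def)

lemma addable_content: "addable D c \<Longrightarrow> box_content c = int (row_len D (snd c)) - int (snd c)"
  using addable_iff[of D "fst c" "snd c"] by (simp add: addable_def box_content_def)

lemma addable_row_less:
  assumes "addable D c" "r < snd c"
  shows "row_len D (snd c) < row_len D r"
proof -
  have D: "young_diagram D" using assms by (simp add: addable_def)
  then have "row_len D (snd c) < row_len D (snd c - 1)"
    using addable_iff[of D "fst c" "snd c"] assms by auto
  also have "\<dots> \<le> row_len D r" by (rule row_len_antimono[OF D]) (use assms in simp)
  finally show ?thesis .
qed

text \<open>Addable boxes lie in different rows, and the lower of the two rows is strictly longer.
  Row length and row index thus contribute at least 1 each to the difference of contents.\<close>

lemma addable_content_distinct:
  assumes "addable D c" "addable D d" "c \<noteq> d"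
  shows "\<bar>box_content c - box_content d\<bar> \<ge> 2"
proof -
  have D: "young_diagram D" using assms by (simp add: addable_def)
  have ne: "snd c \<noteq> snd d"
    using assms addable_iff[OF D, of "fst c" "snd c"] addable_iff[OF D, of "fst d" "snd d"] by (auto simp: prod_eq_iff)
  have "2 \<le> box_content c - box_content d" if "addable D c" "addable D d" "snd c < snd d" for c d
    using addable_row_less[OF that(2,3)] that(3) addable_content[OF that(1)] addable_content[OF that(2)] by linarith
  from this[of c d] this[of d c] ne assms show ?thesis by linarith
qed

lemma addable_insert:
  assumes "addable D b" "addable D a" "a \<noteq> b"
  shows "addable (insert b D) a"
proof -
  have D: "young_diagram D" "young_diagram (insert b D)" using assms by (auto simp: addable_def)
  have ne: "snd a \<noteq> snd b"
    using assms addable_iff[OF D(1), of "fst a" "snd a"] addable_iff[OF D(1), of "fst b" "snd b"] by (auto simp: prod_eq_iff)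
  show ?thesis
    using addable_iff[OF D(2), of "fst a" "snd a"] addable_iff[OF D(1), of "fst a" "snd a"] assms(2) ne
      row_len_insert[OF assms(1)] by auto
qed

text \<open>Adding \<open>b\<close> lengthens one row, which can create a new corner only at the end
  of that row or in the row above it. These two boxes become the unknowns of the linear system for
  the traces.\<close>

lemma addable_insert_cases:
  assumes "addable D b" "addable (insert b D) a"
  shows "a = box_right b \<or> a = box_up b \<or> (addable D a \<and> a \<noteq> b)"
proof -
  have D: "young_diagram D" "young_diagram (insert b D)" using assms by (auto simp: addable_def)
  have a: "fst a = row_len D (snd a) + (if snd a = snd b then 1 else 0)"
     "snd a = 0 \<or> row_len D (snd a) + (if snd a = snd b then 1 else 0)
        < row_len D (snd a - 1) + (if snd a - 1 = snd b then 1 else 0)"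
    using addable_iff[OF D(2), of "fst a" "snd a"] assms(2) row_len_insert[OF assms(1)] by auto
  have b: "fst b = row_len D (snd b)" "snd b = 0 \<or> row_len D (snd b) < row_len D (snd b - 1)"
    using addable_iff[OF D(1), of "fst b" "snd b"] assms(1) by auto
  show ?thesis
  proof (cases "snd a = snd b")
    case True
    then have "a = box_right b" using a b by (simp add: box_right_def prod_eq_iff)
    then show ?thesis by simp
  next
    case ne: False
    show ?thesis
    proof (cases "snd a \<noteq> 0 \<and> snd a - 1 = snd b \<and> row_len D (snd a) = row_len D (snd b)")
      case True
      then have "a = box_up b" using a b ne by (auto simp: box_up_def prod_eq_iff)
      then show ?thesis by simp
    next
      case False
      then have "snd a = 0 \<or> row_len D (snd a) < row_len D (snd a - 1)"
        using a(2) ne row_len_antimono[OF D(1), of "snd a - 1" "snd a"]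
        by (auto split: if_splits)
      then have "addable D (fst a, snd a)" using addable_iff[OF D(1)] a(1) ne by auto
      then show ?thesis using ne by auto
    qed
  qed
qed

lemma content_right [simp]: "box_content (box_right b) = box_content b + 1"
  by (simp add: box_content_def box_right_def)

lemma content_up [simp]: "box_content (box_up b) = box_content b - 1"
  by (simp add: box_content_def box_up_def)

lemma addable_insert_content_ne:
  assumes "addable D b" "addable (insert b D) a"
  shows "box_content a \<noteq> box_content b"
  using addable_insert_cases[OF assms] addable_content_distinct[of D a b] assms by auto

text \<open>At each stage the addable boxes have different contents, so the sequence of contents
  determines the sequence of boxes. Joint eigenvalues of the Jucys-Murphy elements therefore
  separate the idempotents.\<close>

lemma standard_eq_contents:
  assumes "standard_tableau T" "standard_tableau T'" "length T = length T'"
    "\<And>i. i < length T \<Longrightarrow> box_content (T ! i) = box_content (T' ! i)"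
  shows "T = T'"
  using assms
proof (induction T arbitrary: T' rule: rev_induct)
  case (snoc c T)
  then obtain U d where T': "T' = U @ [d]" by (cases T' rule: rev_cases) auto
  have "standard_tableau T" "addable (set T) c" "standard_tableau U" "addable (set U) d"
    using snoc.prems T' standard_append_iff by auto
  moreover have "length T = length U" using snoc.prems T' by simp
  moreover have "box_content (T ! i) = box_content (U ! i)" if "i < length T" for i
    using snoc.prems(4)[of i] that T' \<open>length T = length U\<close> by (simp add: nth_append)
  ultimately have "T = U" using snoc.IH by blast
  moreover have "box_content c = box_content d"
    using snoc.prems(4)[of "length T"] T' \<open>length T = length U\<close> by (simp add: nth_append)
  ultimately have "c = d" using addable_content_distinct[of "set T" c d] \<open>addable (set T) c\<close> \<open>addable (set U) d\<close> by auto
  then show ?case using \<open>T = U\<close> T' by simp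
qed simp

section \<open>Residues of the content function\<close>

text \<open>The polynomial \<open>P\<close>, the numerator minus the denominator minus the
  interpolating sum, has degree below \<open>card A\<close>, because the leading terms cancel. It
  vanishes at all \<open>card A\<close> nodes, so it is zero.\<close>

lemma lagrange_partial_fractions:
  fixes y :: "'i \<Rightarrow> 'a::field"
  assumes A: "finite A" and inj: "inj_on y A" and u: "u \<notin> y ` A"
    and N: "lead_coeff N = 1" "degree N = card A"
  shows "poly N u / (\<Prod>r\<in>A. u - y r) =
    1 + (\<Sum>r\<in>A. poly N (y r) / (\<Prod>s\<in>A - {r}. y r - y s) / (u - y r))"
proof -
  define c where "c r = poly N (y r) / (\<Prod>s\<in>A - {r}. y r - y s)" for r
  define D where "D = (\<Prod>r\<in>A. [:- y r, 1:])"
  define E where "E r = (\<Prod>s\<in>A - {r}. [:- y s, 1:])" for r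
  define P where "P = N - D - (\<Sum>r\<in>A. Polynomial.smult (c r) (E r))"
  have ne: "(\<Prod>s\<in>A - {r}. y r - y s) \<noteq> 0" if "r \<in> A" for r
    using A inj that by (auto simp: prod_zero_iff inj_on_def)
  have pE: "poly (E r) x = (\<Prod>s\<in>A - {r}. x - y s)" for r x
    by (simp add: E_def poly_prod)
  have pD: "poly D x = (\<Prod>s\<in>A. x - y s)" for x
    by (simp add: D_def poly_prod)
  have D: "degree D = card A" "lead_coeff D = 1"
    unfolding D_def lead_coeff_prod by (simp_all add: degree_prod_eq_sum_degree)
  have dE: "degree (E r) < card A" if "r \<in> A" for r
  proof -
    have "degree (E r) = card (A - {r})" unfolding E_def
      by (auto simp: degree_prod_eq_sum_degree)
    also have "\<dots> < card A" using A that by (meson card_Diff1_less)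
    finally show ?thesis .
  qed
  have "P = 0"
  proof (cases "A = {}")
    case True
    then have "degree N = 0" "degree D = 0" using N D by simp_all
    then obtain n d where "N = [:n:]" "D = [:d:]" by (auto elim!: degree_eq_zeroE)
    then show ?thesis using True N D by (simp add: P_def)
  next
    case False
    then have cA: "card A \<noteq> 0" using A by simp
    have "degree (N - D) < card A"
    proof (rule degree_lessI)
      show "N - D \<noteq> 0 \<or> 0 < card A" using cA by simp
      show "\<forall>k\<ge>card A. coeff (N - D) k = 0"
      proof (intro allI impI)
        fix k assume "card A \<le> k"
        then consider "k = card A" | "k > card A" by linarith
        then show "coeff (N - D) k = 0"
          using N D by cases (auto simp: coeff_eq_0)
      qed
    qed
    moreover have "degree (\<Sum>r\<in>A. Polynomial.smult (c r) (E r)) < card A"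
      by (rule degree_sum_less) (use cA dE in \<open>auto intro: le_less_trans[OF Polynomial.degree_smult_le]\<close>)
    ultimately have dP: "degree P < card A" unfolding P_def by (rule degree_diff_less)
    have root: "poly P (y r) = 0" if r: "r \<in> A" for r
    proof -
      have "(\<Sum>s\<in>A. c s * poly (E s) (y r)) = (\<Sum>s\<in>A. if s = r then poly N (y r) else 0)"
      proof (rule sum.cong)
        fix s assume s: "s \<in> A"
        show "c s * poly (E s) (y r) = (if s = r then poly N (y r) else 0)"
        proof (cases "s = r")
          case True
          then show ?thesis using ne[OF r] by (simp add: c_def pE)
        next
          case False
          then have "poly (E s) (y r) = 0" unfolding pE using A r by (auto simp: prod_zero_iff)
          then show ?thesis using False by simp
        qed
      qed simp
      also have "\<dots> = poly N (y r)" using A r by simp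
      finally have "(\<Sum>s\<in>A. c s * poly (E s) (y r)) = poly N (y r)" .
      moreover have "poly D (y r) = 0" unfolding pD using A r by (auto simp: prod_zero_iff)
      ultimately show ?thesis by (simp add: P_def poly_sum)
    qed
    show "P = 0"
    proof (rule ccontr)
      assume "P \<noteq> 0"
      then have "card {x. poly P x = 0} \<le> degree P" "finite {x. poly P x = 0}"
        by (auto intro: card_poly_roots_bound poly_roots_finite)
      moreover have "y ` A \<subseteq> {x. poly P x = 0}" using root by auto
      ultimately have "card (y ` A) \<le> degree P" by (meson card_mono order_trans)
      then show False using dP inj by (simp add: card_image)
    qed
  qed
  moreover have "N = P + D + (\<Sum>r\<in>A. Polynomial.smult (c r) (E r))" by (simp add: P_def)
  ultimately have "poly N u = poly D u + (\<Sum>r\<in>A. c r * poly (E r) u)"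
    by (simp add: poly_sum)
  moreover have Du: "poly D u \<noteq> 0" unfolding pD using A u by (auto simp: prod_zero_iff)
  moreover have "poly (E r) u / poly D u = 1 / (u - y r)" if "r \<in> A" for r
  proof -
    have "poly D u = (u - y r) * poly (E r) u" unfolding pD pE using A that by (rule prod.remove)
    then show ?thesis using Du by auto
  qed
  ultimately show ?thesis
    by (simp add: add_divide_distrib sum_divide_distrib flip: pD c_def times_divide_eq_right) simp
qed

text \<open>The factor R(a). In row r the exponent \<open>row_len D r - r\<close> is the content of
  the first free cell, and one less is that of the last box, if there is one. The row of
  \<open>a\<close> is left out of the denominator, where its factor would vanish. For addable
  \<open>a\<close> any \<open>L\<close> from \<open>card D\<close> on gives the same value: an empty
  row contributes to the numerator what the next one contributes to the denominator.\<close>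

definition rfac :: "'a::field \<Rightarrow> 'a \<Rightarrow> 'a \<Rightarrow> nat \<Rightarrow> box set \<Rightarrow> box \<Rightarrow> 'a" where
  "rfac q h al L D a = (let x = q powi box_content a in
     (x - al) / (h * x) * (\<Prod>r<L. x - q powi (int (row_len D r) - int r - 1)) /
       (\<Prod>r\<in>{..L} - {snd a}. x - q powi (int (row_len D r) - int r)))"

context
  fixes q :: "'a::field"
  assumes nonroot: "\<And>c. q powi c = 1 \<Longrightarrow> c = 0" and q0: "q \<noteq> 0"
begin

lemma powi_eq_iff: "q powi c = q powi d \<longleftrightarrow> c = d"
proof
  assume "q powi c = q powi d"
  then have "q powi (c - d) = 1" using q0 by (simp add: power_int_diff)
  then show "c = d" using nonroot by force
qed simp

lemma powi_pred: "q powi (m - 1) = q powi m * inverse q"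
  using q0 by (simp add: power_int_diff divide_inverse)

text \<open>Partial fractions with one node per row. If row r is not addable, it is as long as row r
  - 1, and then the numerator factor of row r - 1 vanishes at the node of row r. At an addable box
  the residue is \<open>rfac\<close> up to the factor
  \<open>h * q powi box_content a\<close>.\<close>

lemma rfac_row_sum:
  assumes D: "young_diagram D" and L: "card D \<le> L" and h: "h \<noteq> 0"
    and u: "u \<notin> (\<lambda>r. q powi (int (row_len D r) - int r)) ` {..L}"
  shows "(u - al) * (\<Prod>r<L. u - q powi (int (row_len D r) - int r - 1)) /
       (\<Prod>r\<le>L. u - q powi (int (row_len D r) - int r)) =
     1 + (\<Sum>a | addable D a. h * q powi box_content a * rfac q h al L D a / (u - q powi box_content a))"
proof -
  define y where "y r = q powi (int (row_len D r) - int r)" for r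
  define N where "N = [:- al, 1:] * (\<Prod>r<L. [:- (q powi (int (row_len D r) - int r - 1)), 1:])"
  have inj: "inj_on y {..L}"
  proof (rule linorder_inj_onI)
    fix r r' :: nat assume "r < r'"
    then show "y r \<noteq> y r'" using content_strict_decreasing[OF D] by (force simp: y_def powi_eq_iff)
  qed auto
  have N: "lead_coeff N = 1" "degree N = card {..L}"
  proof -
    have "lead_coeff (\<Prod>r<L. [:- (q powi (int (row_len D r) - int r - 1)), 1:]) = 1"
      unfolding lead_coeff_prod by simp
    moreover have "lead_coeff [:- al, 1:] = 1" by simp
    ultimately show "lead_coeff N = 1" unfolding N_def lead_coeff_mult by (simp only: mult_1)
    have "degree (\<Prod>r<L. [:- (q powi (int (row_len D r) - int r - 1)), 1:]) = L"
      by (subst degree_prod_eq_sum_degree) auto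
    moreover have "(\<Prod>r<L. [:- (q powi (int (row_len D r) - int r - 1)), 1:]) \<noteq> 0" by auto
    ultimately show "degree N = card {..L}" unfolding N_def by (subst degree_mult_eq) auto
  qed
  have pN: "poly N x = (x - al) * (\<Prod>r<L. x - q powi (int (row_len D r) - int r - 1))" for x
    by (simp add: N_def poly_prod left_diff_distrib)
  let ?B = "{r. r \<le> L \<and> addable D (row_len D r, r)}"
  let ?f = "\<lambda>r. poly N (y r) / (\<Prod>s\<in>{..L} - {r}. y r - y s) / (u - y r)"
  have zero: "poly N (y r) = 0" if r: "r \<in> {..L} - ?B" for r
  proof -
    have "r \<noteq> 0" "\<not> row_len D r < row_len D (r - 1)" using r addable_iff[OF D, of "row_len D r" r] by auto
    then have "row_len D (r - 1) = row_len D r" using row_len_antimono[OF D, of "r - 1" r] by auto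
    then have "y r - q powi (int (row_len D (r - 1)) - int (r - 1) - 1) = 0"
      using \<open>r \<noteq> 0\<close> by (simp add: y_def of_nat_diff)
    moreover have "r - 1 < L" using r \<open>r \<noteq> 0\<close> by auto
    ultimately have "(\<Prod>s<L. y r - q powi (int (row_len D s) - int s - 1)) = 0"
      by (intro prod_zero) auto
    then show ?thesis by (simp add: pN)
  qed
  have row: "snd a \<le> L" "a = (row_len D (snd a), snd a)" if a: "addable D a" for a
  proof -
    show "a = (row_len D (snd a), snd a)" using a addable_iff[OF D, of "fst a" "snd a"] by (auto simp: prod_eq_iff)
    show "snd a \<le> L"
    proof (rule ccontr)
      assume "\<not> snd a \<le> L"
      then have "row_len D (snd a - 1) = 0" using row_len_eq_0[OF D] L by simp
      then show False using addable_row_less[OF a, of "snd a - 1"] \<open>\<not> snd a \<le> L\<close> by simp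
    qed
  qed
  have B: "?B = snd ` {a. addable D a}"
  proof (intro equalityI subsetI)
    fix r assume "r \<in> ?B"
    then show "r \<in> snd ` {a. addable D a}" by (intro image_eqI[of _ _ "(row_len D r, r)"]) auto
  next
    fix r assume "r \<in> snd ` {a. addable D a}"
    then obtain a where "addable D a" "r = snd a" by auto
    then show "r \<in> ?B" using row[of a] by auto
  qed
  have injs: "inj_on snd {a. addable D a}"
  proof (rule inj_onI)
    fix a b assume *: "a \<in> {a. addable D a}" "b \<in> {a. addable D a}" "snd a = snd b"
    have "a = (row_len D (snd a), snd a)" "b = (row_len D (snd b), snd b)" using * row(2) by blast+
    then show "a = b" using *(3) by metis
  qed
  have "poly N u / (\<Prod>r\<in>{..L}. u - y r) = 1 + (\<Sum>r\<le>L. ?f r)"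
    by (rule lagrange_partial_fractions[OF _ inj _ N]) (use u in \<open>auto simp: y_def\<close>)
  also have "(\<Sum>r\<le>L. ?f r) = (\<Sum>r\<in>?B. ?f r)"
    by (rule sum.mono_neutral_right) (use zero in auto)
  also have "\<dots> = (\<Sum>a | addable D a. ?f (snd a))"
    unfolding B by (subst sum.reindex[OF injs]) simp
  also have "\<dots> = (\<Sum>a | addable D a. h * q powi box_content a * rfac q h al L D a / (u - q powi box_content a))"
  proof (rule sum.cong)
    fix a assume "a \<in> {a. addable D a}"
    then have a: "addable D a" by simp
    have y: "y (snd a) = q powi box_content a" using addable_content[OF a] by (simp add: y_def)
    have "poly N (y (snd a)) / (\<Prod>s\<in>{..L} - {snd a}. y (snd a) - y s) = h * q powi box_content a * rfac q h al L D a"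
      unfolding rfac_def Let_def y pN using h q0 by (simp add: y_def)
    then show "?f (snd a) = h * q powi box_content a * rfac q h al L D a / (u - q powi box_content a)"
      by (simp only: y)
  qed simp
  finally show ?thesis by (simp add: pN y_def)
qed

text \<open>Evaluation of \<open>rfac_row_sum\<close> at u = 0. The numerator nodes are the first
  \<open>L\<close> denominator nodes divided by q, and the last row is empty with node q^(-L), so
  the left side collapses to \<open>al\<close>.\<close>

lemma rfac_sum:
  assumes D: "young_diagram D" and L: "card D \<le> L" and h: "h \<noteq> 0"
  shows "(\<Sum>a | addable D a. rfac q h al L D a) = (1 - al) / h"
proof -
  have 0: "(0::'a) \<notin> (\<lambda>r. q powi (int (row_len D r) - int r)) ` {..L}" using q0 by auto
  let ?y = "\<lambda>r. q powi (int (row_len D r) - int r)"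
  let ?P = "\<Prod>r<L. 0 - ?y r"
  have P0: "?P \<noteq> 0" using q0 by (auto simp: prod_zero_iff)
  have "(\<Prod>r\<le>L. 0 - ?y r) = ?P * (0 - inverse (q ^ L))"
    using row_len_eq_0[OF D L] by (simp add: power_int_minus flip: lessThan_Suc_atMost)
  moreover have "(\<Prod>r<L. 0 - q powi (int (row_len D r) - int r - 1)) = ?P * inverse (q ^ L)"
  proof -
    have "(\<Prod>r<L. 0 - q powi (int (row_len D r) - int r - 1)) = (\<Prod>r<L. (0 - ?y r) * inverse q)"
      using q0 by (intro prod.cong) (simp_all add: powi_pred)
    also have "\<dots> = ?P * inverse (q ^ L)"
      by (simp only: prod.distrib prod_constant card_lessThan power_inverse)
    finally show ?thesis .
  qed
  moreover have gen: "(0 - al) * (P * inverse (q ^ L)) / (P * (0 - inverse (q ^ L))) = al" if "P \<noteq> 0" for P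
    using that q0 by (simp add: field_simps)
  ultimately have "(0 - al) * (\<Prod>r<L. 0 - q powi (int (row_len D r) - int r - 1)) / (\<Prod>r\<le>L. 0 - ?y r) = al"
    using P0 q0 by (simp only: gen)
  with rfac_row_sum[OF D L h 0, of al]
  have "al = 1 + (\<Sum>a | addable D a. - h * rfac q h al L D a)"
    using q0 by simp
  then have "al = 1 - h * (\<Sum>a | addable D a. rfac q h al L D a)"
    by (simp add: sum_negf sum_distrib_left)
  then show ?thesis using h by (simp add: field_simps)
qed

text \<open>Evaluation of \<open>rfac_row_sum\<close> for the enlarged diagram at u = q^(content of
  b). Now \<open>b\<close> is the last box of its row, so a numerator factor vanishes and the left
  side is 0. This is the equation that the Markov axiom with sigma imposes on the traces.\<close>

lemma rfac_sum_insert: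
  assumes b: "addable D b" and L: "card D < L" and h: "h \<noteq> 0"
  shows "(\<Sum>a | addable (insert b D) a.
      h * q powi box_content a / (q powi box_content a - q powi box_content b) * rfac q h al L (insert b D) a) = 1"
proof -
  let ?D = "insert b D"
  have D: "young_diagram D" "young_diagram ?D" using b by (auto simp: addable_def)
  have "finite D" using D by (simp add: young_diagram_def)
  then have L': "card ?D \<le> L" using L card_insert_le_m1[of L] by (simp add: card_insert_if)
  let ?u = "q powi box_content b"
  have rl: "int (row_len ?D (snd b)) - int (snd b) - 1 = box_content b"
    using row_len_insert[OF b] addable_content[OF b] by simp
  have sb: "snd b < L"
  proof (rule ccontr)
    assume "\<not> snd b < L"
    then have "row_len D (snd b - 1) = 0" using row_len_eq_0[OF D(1)] L by simp
    then show False using addable_row_less[OF b, of "snd b - 1"] \<open>\<not> snd b < L\<close> L by auto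
  qed
  \<comment> \<open>The node of the row of \<open>b\<close> has moved on by one content, and the
    nodes of the other rows are separated from the content of \<open>b\<close> already in
    \<open>D\<close>.\<close>
  have u: "?u \<notin> (\<lambda>r. q powi (int (row_len ?D r) - int r)) ` {..L}"
  proof
    assume "?u \<in> (\<lambda>r. q powi (int (row_len ?D r) - int r)) ` {..L}"
    then obtain r where r: "box_content b = int (row_len ?D r) - int r" by (auto simp: powi_eq_iff)
    have 1: "box_content b = int (row_len D (snd b)) - int (snd b)" by (rule addable_content[OF b])
    consider "r < snd b" | "r = snd b" | "r > snd b" by linarith
    then show False
    proof cases
      case 3
      then show False using content_strict_decreasing[OF D(1) 3] 1 r row_len_insert[OF b, of r] by simp
    qed (use 1 r row_len_insert[OF b, of r] content_strict_decreasing[OF D(1), of r "snd b"] in auto)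
  qed
  have "(\<Prod>r<L. ?u - q powi (int (row_len ?D r) - int r - 1)) = 0"
    using sb rl by (intro prod_zero bexI[of _ "snd b"]) (simp_all only: rl, simp_all)
  with rfac_row_sum[OF D(2) L' h u, of al]
  have 2: "0 = 1 + (\<Sum>a | addable ?D a. h * q powi box_content a * rfac q h al L ?D a / (?u - q powi box_content a))"
    by simp
  have flip: "X / (x - y) * Z = - (X * Z / (y - x))" for X x y Z :: 'a
  proof -
    have "x - y = - (y - x)" by simp
    then show ?thesis by (simp only: divide_minus_right) simp
  qed
  have neg: "- S = 1" if "0 = 1 + S" for S :: 'a
  proof -
    have "S = - 1" using that[symmetric] by (simp only: add_eq_0_iff)
    then show ?thesis by simp
  qed
  show ?thesis unfolding flip sum_negf by (rule neg[OF 2])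
qed

text \<open>Only the row of \<open>b\<close> changes. Its numerator node moves from content of b
  minus 1 to content of b, and its denominator node from content of b to content of b plus
  1.\<close>

lemma rfac_insert:
  assumes b: "addable D b" and a: "addable D a" and ab: "a \<noteq> b" and L: "card D < L"
  shows "rfac q h al L (insert b D) a = rfac q h al L D a *
    (q powi box_content a - q powi box_content b)\<^sup>2 /
      ((q powi box_content a - q powi (box_content b + 1)) * (q powi box_content a - q powi (box_content b - 1)))"
proof -
  have D: "young_diagram D" using b by (auto simp: addable_def)
  define x where "x = q powi box_content a"
  have sb: "snd b < L"
  proof (rule ccontr)
    assume "\<not> snd b < L"
    then have "row_len D (snd b - 1) = 0" using row_len_eq_0[OF D] L by simp
    then show False using addable_row_less[OF b, of "snd b - 1"] \<open>\<not> snd b < L\<close> L by auto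
  qed
  have ne: "snd b \<noteq> snd a"
    using ab a b addable_iff[OF D, of "fst a" "snd a"] addable_iff[OF D, of "fst b" "snd b"] by (auto simp: prod_eq_iff)
  have cb: "int (row_len D (snd b)) = box_content b + int (snd b)" using addable_content[OF b] by simp
  have cd: "\<bar>box_content a - box_content b\<bar> \<ge> 2" by (rule addable_content_distinct[OF a b ab])
  let ?A = "{..<L} - {snd b}" and ?B = "{..L} - {snd a} - {snd b}"
  let ?P = "\<lambda>D. \<Prod>r\<in>?A. x - q powi (int (row_len D r) - int r - 1)"
  let ?Q = "\<lambda>D. \<Prod>r\<in>?B. x - q powi (int (row_len D r) - int r)"
  have P: "(\<Prod>r<L. x - q powi (int (row_len D' r) - int r - 1)) =
      (x - q powi (int (row_len D' (snd b)) - int (snd b) - 1)) * ?P D'" for D'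
    using sb by (intro prod.remove) auto
  have Q: "(\<Prod>r\<in>{..L} - {snd a}. x - q powi (int (row_len D' r) - int r)) =
      (x - q powi (int (row_len D' (snd b)) - int (snd b))) * ?Q D'" for D'
    using sb ne by (intro prod.remove) auto
  have P2: "?P (insert b D) = ?P D" by (rule prod.cong) (auto simp: row_len_insert[OF b])
  have Q2: "?Q (insert b D) = ?Q D" by (rule prod.cong) (auto simp: row_len_insert[OF b])
  have nz: "x - q powi (box_content b + 1) \<noteq> 0" "x - q powi (box_content b - 1) \<noteq> 0" "x - q powi (box_content b) \<noteq> 0"
    using cd by (auto simp: x_def powi_eq_iff)
  have *: "U * (z * P) / (w * Q) = (U * (v * P) / (z * Q)) * z\<^sup>2 / (w * v)"
    if "z \<noteq> 0" "v \<noteq> 0" for U P Q v w z :: 'a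
    using that by (cases "w = 0"; cases "Q = 0") (auto simp: field_simps power2_eq_square)
  have e: "int (row_len (insert b D) (snd b)) - int (snd b) - 1 = box_content b"
    "int (row_len (insert b D) (snd b)) - int (snd b) = box_content b + 1"
    "int (row_len D (snd b)) - int (snd b) - 1 = box_content b - 1"
    "int (row_len D (snd b)) - int (snd b) = box_content b"
    unfolding row_len_insert[OF b] using cb by simp_all
  show ?thesis
    unfolding rfac_def Let_def x_def[symmetric] P Q P2 Q2 e add_diff_cancel_right'
    by (rule *[OF nz(3) nz(2)])
qed

end

section \<open>Hecke relations and Jucys-Murphy elements\<close>

text \<open>The word S_m S_(m-1) ... with \<open>j\<close> factors.\<close>

primrec desc_word :: "(nat \<Rightarrow> 'a::monoid_mult) \<Rightarrow> nat \<Rightarrow> nat \<Rightarrow> 'a" where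
  "desc_word S m 0 = 1"
| "desc_word S m (Suc j) = desc_word S m j * S (m - j)"

definition asc_word :: "(nat \<Rightarrow> 'a::monoid_mult) \<Rightarrow> nat \<Rightarrow> 'a" where
  "asc_word S k = foldr (\<lambda>i x. S i * x) [1..<k] 1"

text \<open>The multiplicative Jucys-Murphy element S_(k-1) ... S_1 u S_1 ... S_(k-1). The parameter
  \<open>u\<close> is the unit of the algebra in which it is formed, which need not be the unit of
  the ambient ring.\<close>

fun jucys_murphy :: "'a::monoid_mult \<Rightarrow> (nat \<Rightarrow> 'a) \<Rightarrow> nat \<Rightarrow> 'a" where
  "jucys_murphy u S (Suc (Suc k)) = S (Suc k) * jucys_murphy u S (Suc k) * S (Suc k)"
| "jucys_murphy u S _ = u"

lemma asc_word_Suc: "1 \<le> k \<Longrightarrow> asc_word S (Suc k) = asc_word S k * S k"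
proof -
  have "foldr (\<lambda>i x. S i * x) xs y = foldr (\<lambda>i x. S i * x) xs 1 * y" for xs and y :: 'a
    by (induction xs) (simp_all add: mult.assoc)
  from this[of "[1..<k]" "S k"] show "1 \<le> k \<Longrightarrow> asc_word S (Suc k) = asc_word S k * S k"
    by (simp add: asc_word_def)
qed

lemma desc_word_Suc_left: "desc_word S m (Suc j) = S m * desc_word S (m - 1) j"
  by (induction j) (simp_all add: mult.assoc)

context
  fixes S :: "nat \<Rightarrow> 'a::monoid_mult" and N :: nat
  assumes braid: "\<And>i. 1 \<le> i \<Longrightarrow> i + 1 < N \<Longrightarrow> S i * S (i + 1) * S i = S (i + 1) * S i * S (i + 1)"
    and far: "\<And>i j. 1 \<le> i \<Longrightarrow> i + 2 \<le> j \<Longrightarrow> j < N \<Longrightarrow> S i * S j = S j * S i"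
begin

lemma asc_word_far: "k < j \<Longrightarrow> j < N \<Longrightarrow> asc_word S k * S j = S j * asc_word S k"
proof (induction k)
  case (Suc k)
  show ?case
  proof (cases "1 \<le> k")
    case True
    then have "asc_word S (Suc k) * S j = asc_word S k * (S k * S j)"
      by (simp add: asc_word_Suc mult.assoc)
    also have "\<dots> = asc_word S k * S j * S k" using far[of k j] True Suc.prems by (simp add: mult.assoc)
    also have "\<dots> = S j * (asc_word S k * S k)" using Suc by (simp add: mult.assoc)
    finally show ?thesis using True by (simp add: asc_word_Suc)
  next
    case False
    then show ?thesis by (simp add: asc_word_def)
  qed
qed (simp add: asc_word_def)

text \<open>Moving a generator through the Coxeter word raises its index by one. The letters far
  from S_i commute with it, and the braid relation does the step at i and i + 1.\<close>

lemma asc_word_shift: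
  "1 \<le> i \<Longrightarrow> i + 1 < k \<Longrightarrow> k \<le> N \<Longrightarrow> asc_word S k * S i = S (i + 1) * asc_word S k"
proof (induction k)
  case (Suc k)
  have k: "1 \<le> k" using Suc.prems by simp
  show ?case
  proof (cases "i + 1 < k")
    case True
    have "asc_word S (Suc k) * S i = asc_word S k * (S k * S i)"
      using k by (simp add: asc_word_Suc mult.assoc)
    also have "S k * S i = S i * S k" using far[of i k] True Suc.prems by simp
    also have "asc_word S k * (S i * S k) = S (i + 1) * (asc_word S k * S k)"
      using Suc.IH True Suc.prems by (simp add: mult.assoc[symmetric])
    finally show ?thesis using k by (simp add: asc_word_Suc)
  next
    case False
    then have ki: "k = i + 1" using Suc.prems by simp
    have "asc_word S (Suc k) * S i = asc_word S i * (S i * S k * S i)"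
      using k ki Suc.prems by (simp add: asc_word_Suc mult.assoc)
    also have "S i * S k * S i = S k * S i * S k" using braid[of i] ki Suc.prems by simp
    also have "asc_word S i * (S k * S i * S k) = (asc_word S i * S k) * (S i * S k)"
      by (simp add: mult.assoc)
    also have "asc_word S i * S k = S k * asc_word S i" using asc_word_far[of i k] ki Suc.prems by simp
    also have "S k * asc_word S i * (S i * S k) = S k * asc_word S (Suc k)"
      using k ki Suc.prems by (simp add: asc_word_Suc mult.assoc)
    finally show ?thesis using ki by simp
  qed
qed simp

lemma desc_word_shift:
  "m < k \<Longrightarrow> j < m \<Longrightarrow> k \<le> N \<Longrightarrow> desc_word S m j * asc_word S k = asc_word S k * desc_word S (m - 1) j"
proof (induction j)
  case (Suc j)
  have "S (m - j) * asc_word S k = asc_word S k * S (m - j - 1)"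
    using asc_word_shift[of "m - j - 1" k] Suc.prems by (simp add: Suc_diff_Suc)
  then have "desc_word S m (Suc j) * asc_word S k = desc_word S m j * asc_word S k * S (m - j - 1)"
    by (simp add: mult.assoc)
  also have "\<dots> = asc_word S k * (desc_word S (m - 1) j * S (m - j - 1))"
    using Suc by (simp add: mult.assoc)
  finally show ?case by (simp add: diff_commute)
qed simp

text \<open>Each further factor S_1 ... S_m is pulled to the left through the descending word, whose
  indices drop by one. Its last letter S_m then restores the top of the descending word.\<close>

lemma asc_word_power:
  "1 \<le> m \<Longrightarrow> m < N \<Longrightarrow> j \<le> m \<Longrightarrow> asc_word S (Suc m) ^ j = asc_word S m ^ j * desc_word S m j"
proof (induction j)
  case (Suc j)
  have "asc_word S (Suc m) ^ Suc j = asc_word S m ^ j * (desc_word S m j * asc_word S (Suc m))"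
    using Suc by (simp add: power_Suc2 mult.assoc del: power_Suc)
  also have "desc_word S m j * asc_word S (Suc m) = asc_word S (Suc m) * desc_word S (m - 1) j"
    using desc_word_shift[of m "Suc m" j] Suc.prems by simp
  also have "\<dots> = asc_word S m * desc_word S m (Suc j)"
    using Suc.prems by (simp only: asc_word_Suc desc_word_Suc_left mult.assoc)
  finally show ?case by (simp only: power_Suc2 mult.assoc)
qed simp

lemma jucys_murphy_eq: "m < N \<Longrightarrow> jucys_murphy 1 S (Suc m) = desc_word S m m * asc_word S (Suc m)"
proof (induction m)
  case 0
  then show ?case by (simp add: asc_word_def)
next
  case (Suc m)
  then show ?case
    by (simp only: jucys_murphy.simps desc_word_Suc_left asc_word_Suc[of "Suc m"] mult.assoc diff_Suc_1)
qed

text \<open>In \<open>asc_word_power\<close> with j = m one ascending word is left over behind the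
  descending one, and the two together are the Jucys-Murphy element. The eigenvalues of consecutive
  full twists thus yield the single contents.\<close>

lemma full_twist_Suc:
  "m < N \<Longrightarrow> asc_word S (Suc m) ^ Suc m = asc_word S m ^ m * jucys_murphy 1 S (Suc m)"
proof (cases "m = 0")
  case False
  assume "m < N"
  then show ?thesis
    using asc_word_power[of m m] False jucys_murphy_eq[of m] by (simp only: power_Suc2 mult.assoc)
qed (simp add: asc_word_def)

end

section \<open>A tower of Hecke algebras with trace and idempotents, axiomatically\<close>

abbreviation tableaux_of_size :: "nat \<Rightarrow> box list set" where
  "tableaux_of_size n \<equiv> {T. standard_tableau T \<and> length T = n}"

lemma finite_tableaux_of_size: "finite (tableaux_of_size n)"
proof (induction n)
  case (Suc n)
  have "tableaux_of_size (Suc n) \<subseteq>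
      (\<Union>T\<in>tableaux_of_size n. (\<lambda>c. T @ [c]) ` {c. addable (set T) c})"
  proof
    fix T assume "T \<in> tableaux_of_size (Suc n)"
    then obtain U c where "T = U @ [c]" "standard_tableau (U @ [c])" "length U = n"
      by (cases T rule: rev_cases) auto
    then show "T \<in> (\<Union>T\<in>tableaux_of_size n. (\<lambda>c. T @ [c]) ` {c. addable (set T) c})"
      using standard_append_iff[of U c] by auto
  qed
  then show ?case by (rule finite_subset) (use Suc finite_addable in auto)
qed simp

text \<open>All the algebras live in one ring: H_n is the corner of the central idempotent
  \<open>e n\<close>, which is its unit, so membership in H_n is the equation
  \<open>e n * x = x\<close>. The assumption \<open>span\<close> is the induction principle of H_n:
  scalars, sums and right multiplication by generators reach every element.\<close>

locale markov_tower =
  fixes sc :: "'k::field \<Rightarrow> 'r::ring_1" and qh :: 'k and e :: "nat \<Rightarrow> 'r"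
    and s :: "nat \<Rightarrow> nat \<Rightarrow> 'r" and inc :: "nat \<Rightarrow> 'r \<Rightarrow> 'r"
    and X :: "nat \<Rightarrow> 'r \<Rightarrow> 'l::field" and cst :: "'k \<Rightarrow> 'l" and al :: 'l
    and p :: "box list \<Rightarrow> 'r"
  assumes sc_add: "sc (c + d) = sc c + sc d" and sc_mult: "sc (c * d) = sc c * sc d"
    and sc_1: "sc 1 = 1" and sc_comm: "x * sc c = sc c * x"
    and e_idem: "e n * e n = e n" and e_comm: "x * e n = e n * x"
    and s_mem: "1 \<le> i \<Longrightarrow> i < n \<Longrightarrow> e n * s n i = s n i"
    and braid: "1 \<le> i \<Longrightarrow> i + 1 < n \<Longrightarrow>
      s n i * s n (i + 1) * s n i = s n (i + 1) * s n i * s n (i + 1)"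
    and far: "1 \<le> i \<Longrightarrow> i + 2 \<le> j \<Longrightarrow> j < n \<Longrightarrow> s n i * s n j = s n j * s n i"
    and quad: "1 \<le> i \<Longrightarrow> i < n \<Longrightarrow>
      (s n i - sc qh * e n) * (s n i + sc (inverse qh) * e n) = 0"
    and inc_add: "inc n (x + y) = inc n x + inc n y"
    and inc_mult: "inc n (x * y) = inc n x * inc n y"
    and inc_e: "inc n (e n) = e (Suc n)"
    and inc_sc: "inc n (sc c * x) = sc c * inc n x"
    and inc_mem: "e (Suc n) * inc n x = inc n x"
    and inc_s: "1 \<le> i \<Longrightarrow> i < n \<Longrightarrow> inc n (s n i) = s (Suc n) i"
    and span: "e n * x = x \<Longrightarrow> (\<And>c. Q (sc c * e n)) \<Longrightarrow> (\<And>x y. Q x \<Longrightarrow> Q y \<Longrightarrow> Q (x + y)) \<Longrightarrow>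
      (\<And>x i. e n * x = x \<Longrightarrow> Q x \<Longrightarrow> 1 \<le> i \<Longrightarrow> i < n \<Longrightarrow> Q (x * s n i)) \<Longrightarrow> Q x"
    and X_add: "X n (x + y) = X n x + X n y"
    and X_sc: "X n (sc c * x) = cst c * X n x"
    and X_comm: "X n (x * y) = X n (y * x)"
    and X_inc: "X (Suc n) (inc n x) = X n x * ((1 - al) / (cst qh - inverse (cst qh)))"
    and X_markov: "1 \<le> n \<Longrightarrow> X (Suc n) (inc n x * s (Suc n) n) = X n x"
    and X_0: "X 0 (e 0) = 1"
    and cst_add: "cst (c + d) = cst c + cst d" and cst_mult: "cst (c * d) = cst c * cst d"
    and cst_1: "cst 1 = 1"
    and p_mem: "standard_tableau T \<Longrightarrow> e (length T) * p T = p T"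
    and p_orth: "standard_tableau T \<Longrightarrow> standard_tableau T' \<Longrightarrow> length T = length T' \<Longrightarrow>
      p T * p T' = (if T = T' then p T else 0)"
    and p_sum: "(\<Sum>T\<in>tableaux_of_size n. p T) = e n"
    and p_jm: "standard_tableau T \<Longrightarrow> k < length T \<Longrightarrow>
      jucys_murphy (e (length T)) (s (length T)) (Suc k) * p T =
        sc ((qh\<^sup>2) powi box_content (T ! k)) * p T"
    and qh_nonroot: "(qh\<^sup>2) powi z = 1 \<Longrightarrow> z = 0" and qh0: "qh \<noteq> 0"
begin

definition hq :: 'k where "hq = qh - inverse qh"
definition xc :: "box \<Rightarrow> 'k" where "xc c = (qh\<^sup>2) powi box_content c"
abbreviation J where "J n \<equiv> jucys_murphy (e n) (s n)"
text \<open>The inverse of the generator inside H_n, since the quadratic relation reads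
  \<open>s_sq\<close>.\<close>

definition sinv where "sinv n i = s n i - sc hq * e n"

lemma q0: "qh\<^sup>2 \<noteq> 0" using qh0 by simp

lemma xc_ne0: "xc c \<noteq> 0" using qh0 by (simp add: xc_def)

lemma xc_eq_iff: "xc c = xc d \<longleftrightarrow> box_content c = box_content d"
  unfolding xc_def by (rule powi_eq_iff[OF qh_nonroot q0])

lemma sc_0: "sc 0 = 0" using sc_add[of 0 0] by simp
lemma sc_minus: "sc (- c) = - sc c"
  using sc_add[of c "- c"] sc_0 by (simp add: eq_neg_iff_add_eq_0 add.commute)
lemma sc_diff: "sc (c - d) = sc c - sc d" using sc_add[of c "- d"] by (simp add: sc_minus)
lemma inc_0: "inc n 0 = 0" using inc_add[of n 0 0] by simp
lemma inc_sum: "inc n (sum f A) = (\<Sum>a\<in>A. inc n (f a))"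
  by (induction A rule: infinite_finite_induct) (simp_all add: inc_0 inc_add)
lemma X_zero: "X n 0 = 0" using X_add[of n 0 0] by (metis add.right_neutral add_cancel_right_right)
lemma X_sum: "X n (sum f A) = (\<Sum>a\<in>A. X n (f a))"
  by (induction A rule: infinite_finite_induct) (simp_all add: X_zero X_add)
lemma cst_0: "cst 0 = 0" using cst_add[of 0 0] by (metis add.right_neutral add_cancel_right_right)
lemma cst_minus: "cst (- c) = - cst c"
  using cst_add[of c "- c"] cst_0 by (simp add: eq_neg_iff_add_eq_0 add.commute)
lemma cst_diff: "cst (c - d) = cst c - cst d" using cst_add[of c "- d"] by (simp add: cst_minus)
lemma cst_inverse: "cst (inverse c) = inverse (cst c)"
proof (cases "c = 0")
  case False
  then have "cst c * cst (inverse c) = 1" by (simp add: cst_1 flip: cst_mult)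
  then show ?thesis by (metis inverse_unique)
qed (simp add: cst_0)
lemma cst_divide: "cst (c / d) = cst c / cst d" by (simp add: divide_inverse cst_mult cst_inverse)
lemma cst_eq_0: "cst c = 0 \<longleftrightarrow> c = 0"
proof
  assume "cst c = 0"
  show "c = 0"
  proof (rule ccontr)
    assume "c \<noteq> 0"
    then have "cst c * cst (inverse c) = 1" by (simp add: cst_1 flip: cst_mult)
    then show False using \<open>cst c = 0\<close> by simp
  qed
qed (simp add: cst_0)
lemma cst_power: "cst (c ^ k) = cst c ^ k" by (induction k) (simp_all add: cst_1 cst_mult)
lemma cst_powi: "cst (c powi k) = cst c powi k"
  by (auto simp: power_int_def cst_power cst_inverse)

lemma sc_cancel:
  assumes "sc c * x = 0" "c \<noteq> 0" shows "x = 0"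
proof -
  have "x = sc (inverse c * c) * x" using assms(2) by (simp add: sc_1)
  also have "\<dots> = 0" using assms(1) by (simp add: sc_mult mult.assoc)
  finally show ?thesis .
qed

lemma sc_left: "x * (sc c * y) = sc c * (x * y)"
  by (metis mult.assoc sc_comm)

lemmas sc_pull = sc_left[of "e n" for n] sc_left[of "s n i" for n i] sc_left[of "inc n x" for n x]
  sc_left[of "p T" for T]

lemma sc_sc: "sc c * (sc d * x) = sc (c * d) * x"
  by (simp add: sc_mult mult.assoc)

lemma inc_mem_right: "inc n x * e (Suc n) = inc n x" by (simp add: e_comm inc_mem)

lemma inc_corner: "inc n (e n * x) = inc n x" by (simp add: inc_mult inc_e inc_mem)

lemma s_sq:
  assumes "1 \<le> i" "i < n" shows "s n i * s n i = e n + sc hq * s n i"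
proof -
  have m: "e n * s n i = s n i" "s n i * e n = s n i" using s_mem[OF assms] by (simp_all add: e_comm)
  have i: "sc qh * sc (inverse qh) = 1" using qh0 by (simp add: sc_1 flip: sc_mult)
  have "sc qh * e n * (sc (inverse qh) * e n) = sc qh * (sc (inverse qh) * (e n * e n))"
    by (simp only: mult.assoc sc_pull)
  also have "\<dots> = e n" using i by (simp add: e_idem flip: mult.assoc)
  finally have 1: "sc qh * e n * (sc (inverse qh) * e n) = e n" .
  have 2: "s n i * (sc (inverse qh) * e n) = sc (inverse qh) * s n i" by (simp only: sc_pull m)
  have 3: "sc qh * e n * s n i = sc qh * s n i" by (simp only: mult.assoc m)
  have "0 = s n i * s n i + sc (inverse qh) * s n i - sc qh * s n i - e n"
    using quad[OF assms] by (simp only: distrib_left left_diff_distrib 1 2 3) (simp add: algebra_simps)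
  then show ?thesis by (simp add: hq_def sc_diff algebra_simps)
qed

lemma s_mem_right: "1 \<le> i \<Longrightarrow> i < n \<Longrightarrow> s n i * e n = s n i"
  using s_mem by (simp only: e_comm)

lemma sinv_right: "1 \<le> i \<Longrightarrow> i < n \<Longrightarrow> s n i * sinv n i = e n"
  by (simp add: sinv_def right_diff_distrib s_sq sc_pull s_mem_right)

lemma sinv_left: "1 \<le> i \<Longrightarrow> i < n \<Longrightarrow> sinv n i * s n i = e n"
  by (simp add: sinv_def left_diff_distrib s_sq mult.assoc s_mem)

text \<open>The generators of H_n have indices below n and are far from n + 1, so the commutation
  passes through \<open>span\<close> from generators to all of H_n.\<close>

lemma s_inc_comm:
  assumes v: "e n * v = v"
  shows "s (n + 2) (Suc n) * inc (Suc n) (inc n v) = inc (Suc n) (inc n v) * s (n + 2) (Suc n)"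
proof (rule span[OF v, where Q = "\<lambda>v. s (n + 2) (Suc n) * inc (Suc n) (inc n v) =
      inc (Suc n) (inc n v) * s (n + 2) (Suc n)"])
  fix c
  show "s (n + 2) (Suc n) * inc (Suc n) (inc n (sc c * e n)) =
      inc (Suc n) (inc n (sc c * e n)) * s (n + 2) (Suc n)"
    using s_mem[of "Suc n" "n + 2"] s_mem_right[of "Suc n" "n + 2"]
    by (simp add: inc_sc inc_e sc_pull mult.assoc)
next
  fix x i assume i: "1 \<le> i" "i < n"
    and IH: "s (n + 2) (Suc n) * inc (Suc n) (inc n x) = inc (Suc n) (inc n x) * s (n + 2) (Suc n)"
  have "inc (Suc n) (inc n (s n i)) = s (n + 2) i" using i by (simp add: inc_s)
  moreover have "s (n + 2) i * s (n + 2) (Suc n) = s (n + 2) (Suc n) * s (n + 2) i"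
    using far[of i "Suc n" "n + 2"] i by simp
  ultimately show "s (n + 2) (Suc n) * inc (Suc n) (inc n (x * s n i)) =
      inc (Suc n) (inc n (x * s n i)) * s (n + 2) (Suc n)"
    using IH by (simp add: inc_mult mult.assoc) (simp flip: mult.assoc)
qed (simp add: inc_add distrib_left distrib_right)

lemma s_inc_comm': "s (n + 2) (Suc n) * inc (Suc n) (inc n v) = inc (Suc n) (inc n v) * s (n + 2) (Suc n)"
proof -
  have "e n * (e n * v) = e n * v" by (simp add: e_idem flip: mult.assoc)
  from s_inc_comm[OF this] show ?thesis by (simp only: inc_corner)
qed

lemma sinv_inc_comm: "sinv (n + 2) (Suc n) * inc (Suc n) (inc n v) = inc (Suc n) (inc n v) * sinv (n + 2) (Suc n)"
proof -
  have "sc hq * e (n + 2) * inc (Suc n) (inc n v) = inc (Suc n) (inc n v) * (sc hq * e (n + 2))"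
    by (simp add: sc_pull inc_mem inc_mem_right mult.assoc)
  then show ?thesis
    using s_inc_comm'[of n v] by (simp only: sinv_def left_diff_distrib right_diff_distrib)
qed

section \<open>Spanning of H_(n+1) by H_n and H_n sigma_n H_n\<close>

inductive_set two_step :: "nat \<Rightarrow> 'r set" for n where
  two_step_inc: "inc n v \<in> two_step n"
| two_step_s: "1 \<le> n \<Longrightarrow> inc n v * s (Suc n) n * inc n w \<in> two_step n"
| two_step_add: "x \<in> two_step n \<Longrightarrow> y \<in> two_step n \<Longrightarrow> x + y \<in> two_step n"

lemma two_step_mult_inc: "x \<in> two_step n \<Longrightarrow> x * inc n w \<in> two_step n"
proof (induction rule: two_step.induct)
  case (two_step_inc v)
  show ?case using two_step.two_step_inc[of n "v * w"] by (simp add: inc_mult)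
next
  case (two_step_s v u)
  then show ?case using two_step.two_step_s[of n v "u * w"] by (simp add: inc_mult mult.assoc)
next
  case (two_step_add x y)
  then show ?case by (simp add: distrib_right two_step.two_step_add)
qed

lemma two_step_inc_mult: "x \<in> two_step n \<Longrightarrow> inc n w * x \<in> two_step n"
proof (induction rule: two_step.induct)
  case (two_step_inc v)
  show ?case using two_step.two_step_inc[of n "w * v"] by (simp add: inc_mult)
next
  case (two_step_s v u)
  then show ?case using two_step.two_step_s[of n "w * v" u] by (simp add: inc_mult mult.assoc)
next
  case (two_step_add x y)
  then show ?case by (simp add: distrib_left two_step.two_step_add)
qed

lemma two_step_sc: "x \<in> two_step n \<Longrightarrow> sc c * x \<in> two_step n"
proof (induction rule: two_step.induct)
  case (two_step_inc v)
  show ?case using two_step.two_step_inc[of n "sc c * v"] by (simp add: inc_sc)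
next
  case (two_step_s v u)
  then show ?case using two_step.two_step_s[of n "sc c * v" u] by (simp add: inc_sc mult.assoc)
next
  case (two_step_add x y)
  then show ?case by (simp add: distrib_left two_step.two_step_add)
qed

text \<open>The point is closure under right multiplication by the top generator. A product s w s
  with w in the smaller algebra is handled by decomposing w by the induction hypothesis. What
  commutes with s is pulled out, and the rest is s s, where the quadratic relation applies, or s t
  s, where the braid relation turns it into t s t with a single s.\<close>

lemma two_step_all: "e (Suc n) * x = x \<Longrightarrow> x \<in> two_step n"
proof (induction n arbitrary: x)
  case 0
  show ?case
    by (rule span[OF 0, where Q = "\<lambda>x. x \<in> two_step 0"])
      (use two_step_sc[OF two_step_inc[of 0 "e 0"]] in \<open>auto simp: inc_e intro: two_step_add\<close>)
next
  case (Suc n)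
  let ?s = "s (Suc (Suc n)) (Suc n)"
  have sm: "e (Suc (Suc n)) * ?s = ?s" using s_mem[of "Suc n" "Suc (Suc n)"] by simp
  have s1: "inc (Suc n) v * ?s \<in> two_step (Suc n)" for v
  proof -
    have "?s * e (Suc (Suc n)) = ?s" using sm by (simp only: e_comm)
    then show ?thesis using two_step_s[of "Suc n" v "e (Suc n)"] by (simp add: inc_e mult.assoc)
  qed
  have s2: "?s * inc (Suc n) w * ?s \<in> two_step (Suc n)" if "w \<in> two_step n" for w
    using that
  proof (induction rule: two_step.induct)
    case (two_step_inc v)
    have "?s * inc (Suc n) (inc n v) * ?s = inc (Suc n) (inc n v) * ?s * ?s"
      using s_inc_comm'[of n v] by simp
    also have "\<dots> = inc (Suc n) (inc n v) * (?s * ?s)" by (rule mult.assoc)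
    also have "\<dots> = inc (Suc n) (inc n v) + sc hq * (inc (Suc n) (inc n v) * ?s)"
      using s_sq[of "Suc n" "Suc (Suc n)"] by (simp add: distrib_left sc_pull inc_mem_right)
    also have "\<dots> \<in> two_step (Suc n)"
      by (intro two_step_add two_step_sc s1 two_step.two_step_inc)
    finally show ?case .
  next
    case (two_step_s v u)
    let ?t = "s (Suc (Suc n)) n"
    let ?v = "inc (Suc n) (inc n v)" and ?u = "inc (Suc n) (inc n u)"
    have it: "inc (Suc n) (s (Suc n) n) = ?t" using two_step_s inc_s[of n "Suc n"] by simp
    have "?s * inc (Suc n) (inc n v * s (Suc n) n * inc n u) * ?s = (?s * ?v) * ?t * (?u * ?s)"
      by (simp add: inc_mult it mult.assoc)
    also have "\<dots> = (?v * ?s) * ?t * (?s * ?u)"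
      using s_inc_comm'[of n v] s_inc_comm'[of n u] by simp
    also have "\<dots> = ?v * (?s * ?t * ?s) * ?u" by (simp only: mult.assoc)
    also have "?s * ?t * ?s = ?t * ?s * ?t" using braid[of n "Suc (Suc n)"] two_step_s by simp
    also have "?v * (?t * ?s * ?t) * ?u =
        inc (Suc n) (inc n v * s (Suc n) n) * ?s * inc (Suc n) (s (Suc n) n * inc n u)"
      by (simp add: inc_mult it mult.assoc)
    also have "\<dots> \<in> two_step (Suc n)" by (rule two_step.two_step_s) simp
    finally show ?case .
  next
    case (two_step_add x y)
    then show ?case by (simp add: inc_add distrib_left distrib_right two_step.two_step_add)
  qed
  have s3: "x * ?s \<in> two_step (Suc n)" if "x \<in> two_step (Suc n)" for x
    using that
  proof (induction rule: two_step.induct)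
    case (two_step_s v u)
    have "e (Suc n) * (e (Suc n) * u) = e (Suc n) * u" by (simp add: e_idem flip: mult.assoc)
    then have "e (Suc n) * u \<in> two_step n" by (rule Suc.IH)
    then have "?s * inc (Suc n) u * ?s \<in> two_step (Suc n)" using s2 by (metis inc_corner)
    then show ?case using two_step_inc_mult by (simp add: mult.assoc)
  qed (auto simp: s1 distrib_right intro: two_step_add)
  show ?case
  proof (rule span[OF Suc.prems, where Q = "\<lambda>x. x \<in> two_step (Suc n)"])
    fix c
    show "sc c * e (Suc (Suc n)) \<in> two_step (Suc n)"
      using two_step_sc[OF two_step_inc[of "Suc n" "e (Suc n)"]] by (simp add: inc_e)
  next
    fix x i assume x: "x \<in> two_step (Suc n)" and i: "1 \<le> i" "i < Suc (Suc n)"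
    show "x * s (Suc (Suc n)) i \<in> two_step (Suc n)"
    proof (cases "i = Suc n")
      case False
      then have "s (Suc (Suc n)) i = inc (Suc n) (s (Suc n) i)" using inc_s[of i "Suc n"] i by simp
      then show ?thesis using two_step_mult_inc[OF x] by simp
    qed (use s3[OF x] in simp)
  qed (rule two_step_add)
qed

end

lemma diff_flip: "x - z = y \<Longrightarrow> x - y = z" for x :: "'a::ab_group_add"
  by (metis add_diff_cancel_left' diff_add_cancel)

section \<open>Branching of the idempotents under inclusion\<close>

context markov_tower
begin

lemma p_mem_right: "standard_tableau T \<Longrightarrow> p T * e (length T) = p T"
  using p_mem by (simp only: e_comm)

lemma jm_mem: "k \<le> n \<Longrightarrow> e n * J n k = J n k"
proof (cases "(e n, s n, k)" rule: jucys_murphy.cases)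
  case (1 u S' j)
  assume "k \<le> n"
  with 1 show ?thesis using s_mem[of "Suc j" n] by (simp flip: mult.assoc)
qed (auto simp: e_idem)

lemma jm_inc: "j < n \<Longrightarrow> inc n (J n (Suc j)) = J (Suc n) (Suc j)"
proof (induction j)
  case (Suc j)
  then show ?case using inc_s[of "Suc j" n] by (simp add: inc_mult)
qed (simp add: inc_e)

lemma p_jm':
  assumes "standard_tableau T" "k < length T"
  shows "J (length T) (Suc k) * p T = sc (xc (T ! k)) * p T"
  using p_jm[OF assms] by (simp add: xc_def)

text \<open>Multiplying J by the sum of all idempotents shows that J is a linear combination of the
  \<open>p U\<close>; the left eigenvalues are its coefficients, and orthogonality makes them right
  eigenvalues too.\<close>

lemma p_jm_right:
  assumes T: "standard_tableau T" "k < length T"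
  shows "p T * J (length T) (Suc k) = sc (xc (T ! k)) * p T"
proof -
  let ?n = "length T"
  have "J ?n (Suc k) = J ?n (Suc k) * e ?n"
    using jm_mem[of "Suc k" ?n] T by (simp only: e_comm)
  also have "\<dots> = J ?n (Suc k) * (\<Sum>U\<in>tableaux_of_size ?n. p U)" by (simp only: p_sum)
  also have "\<dots> = (\<Sum>U\<in>tableaux_of_size ?n. sc (xc (U ! k)) * p U)"
    unfolding sum_distrib_left
  proof (rule sum.cong)
    fix U assume "U \<in> tableaux_of_size ?n"
    then show "J ?n (Suc k) * p U = sc (xc (U ! k)) * p U" using p_jm'[of U k] T by simp
  qed simp
  finally have "p T * J ?n (Suc k) = (\<Sum>U\<in>tableaux_of_size ?n. p T * (sc (xc (U ! k)) * p U))"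
    by (simp only: sum_distrib_left)
  also have "\<dots> = (\<Sum>U\<in>tableaux_of_size ?n. if U = T then sc (xc (T ! k)) * p T else 0)"
  proof (rule sum.cong)
    fix U assume "U \<in> tableaux_of_size ?n"
    then show "p T * (sc (xc (U ! k)) * p U) = (if U = T then sc (xc (T ! k)) * p T else 0)"
      using p_orth[of T U] T by (auto simp: sc_pull)
  qed simp
  also have "\<dots> = sc (xc (T ! k)) * p T"
    using T finite_tableaux_of_size by simp
  finally show ?thesis .
qed

lemma sc_diff_cancel:
  assumes "sc c * x = sc d * x" "c \<noteq> d" shows "x = 0"
  using sc_cancel[of "c - d" x] assms by (simp add: sc_diff left_diff_distrib)

lemma restrict_cases:
  assumes T: "standard_tableau T" "length T = Suc n" and T0: "standard_tableau T0" "length T0 = n"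
  shows "take n T = T0 \<or> (\<exists>k<n. xc (T ! k) \<noteq> xc (T0 ! k))"
proof (rule ccontr)
  assume *: "\<not> ?thesis"
  have "take n T = T0"
  proof (rule standard_eq_contents)
    show "standard_tableau (take n T)" by (rule standard_take[OF T(1)])
    fix i assume "i < length (take n T)"
    then show "box_content (take n T ! i) = box_content (T0 ! i)" using * T by (auto simp: xc_eq_iff)
  qed (use T T0 in auto)
  then show False using * by simp
qed

text \<open>Some content of \<open>T0\<close> differs from the content of \<open>T\<close> with the
  same label. The corresponding Jucys-Murphy element is the same in both algebras by
  \<open>jm_inc\<close>, and placed between the two idempotents it acts by two different
  scalars.\<close>

lemma p_inc_zero:
  assumes T: "standard_tableau T" "length T = Suc n" and T0: "standard_tableau T0" "length T0 = n"
    and ne: "take n T \<noteq> T0"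
  shows "p T * inc n (p T0) = 0" "inc n (p T0) * p T = 0"
proof -
  obtain k where k: "k < n" "xc (T ! k) \<noteq> xc (T0 ! k)" using restrict_cases[OF T T0] ne by auto
  let ?J = "J (Suc n) (Suc k)"
  have J: "?J = inc n (J n (Suc k))" using jm_inc[OF k(1)] by simp
  have "sc (xc (T ! k)) * (p T * inc n (p T0)) = p T * ?J * inc n (p T0)"
    using p_jm_right[of T k] T k by (simp add: mult.assoc)
  also have "\<dots> = p T * inc n (J n (Suc k) * p T0)" by (simp add: J inc_mult mult.assoc)
  also have "\<dots> = sc (xc (T0 ! k)) * (p T * inc n (p T0))"
    using p_jm'[of T0 k] T0 k by (simp add: inc_sc sc_pull)
  finally show "p T * inc n (p T0) = 0" using k(2) by (rule sc_diff_cancel)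
  have "sc (xc (T ! k)) * (inc n (p T0) * p T) = inc n (p T0) * (?J * p T)"
    using p_jm'[of T k] T k by (simp add: sc_pull)
  also have "\<dots> = inc n (p T0 * J n (Suc k)) * p T" by (simp add: J inc_mult mult.assoc)
  also have "\<dots> = sc (xc (T0 ! k)) * (inc n (p T0) * p T)"
    using p_jm_right[of T0 k] T0 k by (simp add: inc_sc mult.assoc)
  finally show "inc n (p T0) * p T = 0" using k(2) by (rule sc_diff_cancel)
qed

text \<open>The included idempotents of size n sum up to the unit, and all of them except that of
  the restriction of \<open>T\<close> annihilate \<open>p T\<close>.\<close>

lemma p_inc:
  assumes T: "standard_tableau T" "length T = Suc n" and T0: "standard_tableau T0" "length T0 = n"
  shows "p T * inc n (p T0) = (if take n T = T0 then p T else 0)"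
    and "inc n (p T0) * p T = (if take n T = T0 then p T else 0)"
proof -
  have U: "take n T \<in> tableaux_of_size n" using T standard_take by auto
  have inc_e_sum: "e (Suc n) = (\<Sum>U\<in>tableaux_of_size n. inc n (p U))"
    unfolding inc_sum[symmetric] p_sum inc_e ..
  have "p T = p T * e (Suc n)" using p_mem_right[of T] T by simp
  also have "\<dots> = (\<Sum>U\<in>tableaux_of_size n. p T * inc n (p U))"
    unfolding inc_e_sum sum_distrib_left ..
  also have "\<dots> = (\<Sum>U\<in>{take n T}. p T * inc n (p U))"
  proof (rule sum.mono_neutral_right[OF finite_tableaux_of_size])
    show "{take n T} \<subseteq> tableaux_of_size n" using U by simp
    show "\<forall>V\<in>tableaux_of_size n - {take n T}. p T * inc n (p V) = 0"
    proof
      fix V assume V: "V \<in> tableaux_of_size n - {take n T}"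
      then have "take n T \<noteq> V" "standard_tableau V" "length V = n" by blast+
      then show "p T * inc n (p V) = 0" using p_inc_zero(1)[OF T] by simp
    qed
  qed
  finally show "p T * inc n (p T0) = (if take n T = T0 then p T else 0)"
    using p_inc_zero[OF T T0] by auto
  have "p T = e (Suc n) * p T" using p_mem[of T] T by simp
  also have "\<dots> = (\<Sum>U\<in>tableaux_of_size n. inc n (p U) * p T)"
    unfolding inc_e_sum sum_distrib_right ..
  also have "\<dots> = (\<Sum>U\<in>{take n T}. inc n (p U) * p T)"
  proof (rule sum.mono_neutral_right[OF finite_tableaux_of_size])
    show "{take n T} \<subseteq> tableaux_of_size n" using U by simp
    show "\<forall>V\<in>tableaux_of_size n - {take n T}. inc n (p V) * p T = 0"
    proof
      fix V assume V: "V \<in> tableaux_of_size n - {take n T}"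
      then have "take n T \<noteq> V" "standard_tableau V" "length V = n" by blast+
      then show "inc n (p V) * p T = 0" using p_inc_zero(2)[OF T] by simp
    qed
  qed
  finally show "inc n (p T0) * p T = (if take n T = T0 then p T else 0)"
    using p_inc_zero[OF T T0] by auto
qed

text \<open>The branching rule: in the decomposition of the unit of the larger algebra exactly the
  tableaux extending \<open>T0\<close> survive.\<close>

lemma inc_p_eq_sum:
  assumes T0: "standard_tableau T0"
  shows "inc (length T0) (p T0) = (\<Sum>a | addable (set T0) a. p (T0 @ [a]))"
proof -
  let ?n = "length T0"
  have "inc ?n (p T0) = (\<Sum>T\<in>tableaux_of_size (Suc ?n). p T * inc ?n (p T0))"
    unfolding sum_distrib_right[symmetric] p_sum by (rule inc_mem[symmetric])
  also have "\<dots> = (\<Sum>T\<in>tableaux_of_size (Suc ?n). if take ?n T = T0 then p T else 0)"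
    by (rule sum.cong) (use p_inc T0 in auto)
  also have "\<dots> = (\<Sum>T\<in>{T \<in> tableaux_of_size (Suc ?n). take ?n T = T0}. p T)"
    by (simp only: sum.inter_filter[OF finite_tableaux_of_size])
  also have "{T \<in> tableaux_of_size (Suc ?n). take ?n T = T0} = (\<lambda>a. T0 @ [a]) ` {a. addable (set T0) a}"
  proof (intro equalityI subsetI)
    fix T assume T: "T \<in> {T \<in> tableaux_of_size (Suc ?n). take ?n T = T0}"
    have "T = take (Suc ?n) T" using T by simp
    also have "\<dots> = T0 @ [T ! ?n]" using T by (simp add: take_Suc_conv_app_nth del: take_all)
    finally have "T = T0 @ [T ! ?n]" .
    then show "T \<in> (\<lambda>a. T0 @ [a]) ` {a. addable (set T0) a}"
      using T standard_append_iff[of T0 "T ! ?n"] by (intro image_eqI[of _ _ "T ! ?n"]) auto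
  qed (use T0 in \<open>auto simp: standard_append_iff\<close>)
  also have "sum p ((\<lambda>a. T0 @ [a]) ` {a. addable (set T0) a}) = (\<Sum>a | addable (set T0) a. p (T0 @ [a]))"
    by (subst sum.reindex) (auto simp: inj_on_def)
  finally show ?thesis .
qed

section \<open>Matrix coefficients of a generator between idempotents\<close>

context
  fixes m :: nat
begin

abbreviation (input) S where "S \<equiv> s (Suc (Suc m)) (Suc m)"
abbreviation (input) Si where "Si \<equiv> sinv (Suc (Suc m)) (Suc m)"
abbreviation (input) E2 where "E2 \<equiv> e (Suc (Suc m))"

lemma S_facts: "S * Si = E2" "Si * S = E2" "E2 * S = S" "S * E2 = S" "S * S = E2 + sc hq * S"
  using sinv_left sinv_right s_mem s_mem_right s_sq by simp_all

text \<open>The recursion J_(m+2) = S J_(m+1) S also says that S^(-1) J_(m+2) = J_(m+1) S and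
  J_(m+2) S^(-1) = S J_(m+1). Between two joint eigenidempotents, both sides become scalars times
  coefficients of S and of its inverse.\<close>

lemma psp_relations:
  assumes T: "standard_tableau (U @ [b, a])" "length U = m"
    and T': "standard_tableau (U' @ [b', a'])" "length U' = m"
  defines "P \<equiv> p (U @ [b, a])" and "P' \<equiv> p (U' @ [b', a'])"
  shows "sc (xc a') * (P * Si * P') = sc (xc b) * (P * S * P')"
    and "sc (xc a) * (P * Si * P') = sc (xc b') * (P * S * P')"
proof -
  let ?x = "J (Suc (Suc m)) (Suc m)" and ?y = "J (Suc (Suc m)) (Suc (Suc m))"
  have xm: "?x * E2 = ?x" "E2 * ?x = ?x" using jm_mem[of "Suc m" "Suc (Suc m)"] by (simp_all only: e_comm)
  have y: "?y = S * ?x * S" by simp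
  have P: "P * ?x = sc (xc b) * P" "P * ?y = sc (xc a) * P"
    using p_jm_right[OF T(1), of m] p_jm_right[OF T(1), of "Suc m"] T(2)
    by (simp_all add: P_def nth_append del: jucys_murphy.simps)
  have P': "?x * P' = sc (xc b') * P'" "?y * P' = sc (xc a') * P'"
    using p_jm'[OF T'(1), of m] p_jm'[OF T'(1), of "Suc m"] T'(2)
    by (simp_all add: P'_def nth_append del: jucys_murphy.simps)
  have 1: "Si * ?y = ?x * S"
    unfolding y by (simp only: mult.assoc[symmetric] S_facts xm)
  have 2: "?y * Si = S * ?x"
    unfolding y by (simp only: mult.assoc S_facts xm)
  have "sc (xc a') * (P * Si * P') = P * Si * (?y * P')" unfolding P' by (simp only: sc_left)
  also have "\<dots> = P * (Si * ?y) * P'" by (simp only: mult.assoc)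
  also have "\<dots> = (P * ?x) * S * P'" unfolding 1 by (simp only: mult.assoc)
  also have "\<dots> = sc (xc b) * (P * S * P')" unfolding P by (simp only: mult.assoc)
  finally show "sc (xc a') * (P * Si * P') = sc (xc b) * (P * S * P')" .
  have "sc (xc a) * (P * Si * P') = (P * ?y) * Si * P'" unfolding P by (simp only: mult.assoc)
  also have "\<dots> = P * (?y * Si) * P'" by (simp only: mult.assoc)
  also have "\<dots> = P * S * (?x * P')" unfolding 2 by (simp only: mult.assoc)
  also have "\<dots> = sc (xc b') * (P * S * P')" unfolding P' by (simp only: sc_left)
  finally show "sc (xc a) * (P * Si * P') = sc (xc b') * (P * S * P')" .
qed

text \<open>The diagonal entry of the generator in Young's seminormal form, at a tableau whose last
  two boxes are \<open>b\<close> and then \<open>a\<close>.\<close>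

definition dcoef where "dcoef b a = hq * xc a / (xc a - xc b)"

lemma Si_S: "x * Si * y = x * S * y - sc hq * (x * E2 * y)"
  by (simp add: sinv_def left_diff_distrib right_diff_distrib) (simp only: mult.assoc sc_left)

text \<open>With equal idempotents \<open>psp_relations\<close> compares S and S^(-1) = S - hq at
  the eigenvalues of the last two boxes. The resulting linear equation can be solved because
  successive boxes never have equal contents.\<close>

lemma psp_same:
  assumes T: "standard_tableau (U @ [b, a])" "length U = m"
  defines "P \<equiv> p (U @ [b, a])"
  shows "P * S * P = sc (dcoef b a) * P"
proof -
  have ba: "addable (set U) b" "addable (insert b (set U)) a"
    using T standard_append_two_iff standard_append_iff by auto
  have ne: "xc a \<noteq> xc b" using addable_insert_content_ne[OF ba] by (simp add: xc_eq_iff)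
  have P: "P * P = P" "P * E2 = P"
    using p_orth[OF T(1) T(1)] p_mem_right[OF T(1)] T(2) by (simp_all add: P_def)
  have "sc (xc a) * (P * S * P - sc hq * P) = sc (xc b) * (P * S * P)"
    using psp_relations(1)[OF T T] unfolding P_def[symmetric] Si_S P by simp
  then have "sc (xc a) * (P * S * P) - sc (xc a * hq) * P = sc (xc b) * (P * S * P)"
    by (simp add: right_diff_distrib sc_sc)
  then have "sc (xc a) * (P * S * P) - sc (xc b) * (P * S * P) = sc (xc a * hq) * P"
    by (rule diff_flip)
  then have "sc (xc a - xc b) * (P * S * P) = sc (xc a * hq) * P"
    by (simp add: left_diff_distrib sc_diff)
  then have "sc (1 / (xc a - xc b)) * (sc (xc a - xc b) * (P * S * P)) = sc (1 / (xc a - xc b)) * (sc (xc a * hq) * P)"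
    by simp
  then show ?thesis using ne by (simp add: sc_sc sc_1 dcoef_def mult.commute)
qed

text \<open>If the coefficient were nonzero, the last two contents of one tableau would be those of
  the other in reverse order. The truncations agree as well, since their idempotents commute with S,
  and then the contents force the boxes themselves to be interchanged.\<close>

lemma psp_diff:
  assumes T: "standard_tableau (U @ [b, a])" "length U = m"
    and T': "standard_tableau (U' @ [b', a'])" "length U' = m"
    and ne: "U' @ [b', a'] \<noteq> U @ [b, a]" "\<not> (U' = U \<and> b' = a \<and> a' = b)"
  shows "p (U @ [b, a]) * S * p (U' @ [b', a']) = 0"
proof (rule ccontr)
  let ?P = "p (U @ [b, a])" and ?P' = "p (U' @ [b', a'])"
  assume nz: "?P * S * ?P' \<noteq> 0"
  have orth: "?P * E2 * ?P' = 0"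
    using p_orth[OF T(1) T'(1)] p_mem_right[OF T(1)] T(2) T'(2) ne by auto
  \<comment> \<open>By orthogonality S and its inverse have the same coefficient here, so each
    equation of \<open>psp_relations\<close> compares two eigenvalues.\<close>
  have "?P * Si * ?P' = ?P * S * ?P'" unfolding Si_S orth by simp
  with psp_relations[OF T T'] have c: "xc a' = xc b" "xc a = xc b'"
    using nz sc_diff_cancel by metis+
  have ba: "addable (set U) b" "addable (insert b (set U)) a" "standard_tableau (U @ [b])" "standard_tableau U"
    using T standard_append_two_iff standard_append_iff by auto
  have ba': "addable (set U') b'" "addable (insert b' (set U')) a'" "standard_tableau (U' @ [b'])" "standard_tableau U'"
    using T' standard_append_two_iff standard_append_iff by auto
  \<comment> \<open>The idempotents of \<open>U\<close> and \<open>U'\<close>, included twice, can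
    be moved next to each other through S, where they annihilate each other if \<open>U\<close> and
    \<open>U'\<close> differ.\<close>
  have "U = U'"
  proof (rule ccontr)
    assume UU: "U \<noteq> U'"
    let ?i = "inc (Suc m) (inc m (p U))" and ?i' = "inc (Suc m) (inc m (p U'))"
    have "?P * inc (Suc m) (p (U @ [b])) = ?P"
      using p_inc(1)[of "U @ [b, a]" "Suc m" "U @ [b]"] T ba by simp
    note P1 = this
    have P2: "p (U @ [b]) * inc m (p U) = p (U @ [b])"
      using p_inc(1)[of "U @ [b]" m U] T ba by simp
    have "?P * ?i = ?P * inc (Suc m) (p (U @ [b])) * ?i" by (simp only: P1)
    also have "\<dots> = ?P * inc (Suc m) (p (U @ [b]) * inc m (p U))" by (simp only: inc_mult mult.assoc)
    finally have 1: "?P * ?i = ?P" by (simp only: P1 P2)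
    have "inc (Suc m) (p (U' @ [b'])) * ?P' = ?P'"
      using p_inc(2)[of "U' @ [b', a']" "Suc m" "U' @ [b']"] T' ba' by simp
    note P1' = this
    have P2': "inc m (p U') * p (U' @ [b']) = p (U' @ [b'])"
      using p_inc(2)[of "U' @ [b']" m U'] T' ba' by simp
    have "?i' * ?P' = ?i' * (inc (Suc m) (p (U' @ [b'])) * ?P')" by (simp only: P1')
    also have "\<dots> = inc (Suc m) (inc m (p U') * p (U' @ [b'])) * ?P'" by (simp only: inc_mult mult.assoc)
    finally have 2: "?i' * ?P' = ?P'" by (simp only: P1' P2')
    have "?i * ?i' = inc (Suc m) (inc m (p U * p U'))" by (simp only: inc_mult)
    also have "\<dots> = 0" using p_orth[of U U'] ba ba' T T' UU by (simp add: inc_0)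
    finally have 3: "?i * ?i' = 0" .
    have "?P * S * ?P' = (?P * ?i) * S * (?i' * ?P')" unfolding 1 2 ..
    also have "\<dots> = ?P * (?i * S) * ?i' * ?P'" by (simp only: mult.assoc)
    also have "?i * S = S * ?i" using s_inc_comm'[of m "p U"] by simp
    also have "?P * (S * ?i) * ?i' * ?P' = ?P * S * (?i * ?i') * ?P'" by (simp only: mult.assoc)
    finally show False using nz by (simp add: 3)
  qed
  \<comment> \<open>Otherwise the box \<open>a'\<close> would have the content of \<open>b'\<close>,
    the box placed just before it.\<close>
  moreover have bb: "b \<noteq> b'"
  proof
    assume "b = b'"
    then have "box_content a' = box_content b'" using c by (simp add: xc_eq_iff)
    then show False using addable_insert_content_ne[OF ba'(1,2)] by simp
  qed
  ultimately have "addable (insert b' (set U')) b" "addable (insert b (set U)) b'"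
    using addable_insert ba ba' by metis+
  note ab = this
  have "a' = b"
    using addable_content_distinct[OF ba'(2) ab(1)] c(1) by (cases "a' = b") (simp_all add: xc_eq_iff)
  moreover have "a = b'"
    using addable_content_distinct[OF ba(2) ab(2)] c(2) by (cases "a = b'") (simp_all add: xc_eq_iff)
  ultimately show False using ne \<open>U = U'\<close> by auto
qed

lemma inc_p_append:
  assumes "standard_tableau (U @ [b])" "length U = m"
  shows "inc (Suc m) (p (U @ [b])) = (\<Sum>a | addable (insert b (set U)) a. p (U @ [b, a]))"
  using inc_p_eq_sum[OF assms(1)] assms(2) by simp

text \<open>Both sides are expanded by the branching rule. Off-diagonal terms vanish: both tableaux
  start with \<open>U @ [b]\<close>, whereas interchanging the last two boxes would put
  \<open>a\<close> before \<open>b\<close>.\<close>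

lemma inc_p_s_inc_p:
  assumes U: "standard_tableau (U @ [b])" "length U = m"
  shows "inc (Suc m) (p (U @ [b])) * S * inc (Suc m) (p (U @ [b])) =
    (\<Sum>a | addable (insert b (set U)) a. sc (dcoef b a) * p (U @ [b, a]))"
proof -
  let ?A = "{a. addable (insert b (set U)) a}"
  have std: "standard_tableau (U @ [b, a])" if "a \<in> ?A" for a using U that standard_append_two_iff by simp
  have ab: "a \<noteq> b" if "a \<in> ?A" for a using that by (auto simp: addable_def)
  have "inc (Suc m) (p (U @ [b])) * S * inc (Suc m) (p (U @ [b])) =
      (\<Sum>a\<in>?A. \<Sum>a'\<in>?A. p (U @ [b, a]) * S * p (U @ [b, a']))"
    unfolding inc_p_append[OF U] by (simp only: sum_distrib_left sum_distrib_right) (rule sum.swap)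
  also have "\<dots> = (\<Sum>a\<in>?A. \<Sum>a'\<in>?A. if a' = a then sc (dcoef b a) * p (U @ [b, a]) else 0)"
  proof (intro sum.cong refl)
    fix a a' assume "a \<in> ?A" "a' \<in> ?A"
    then show "p (U @ [b, a]) * S * p (U @ [b, a']) = (if a' = a then sc (dcoef b a) * p (U @ [b, a]) else 0)"
      using psp_same[OF std U(2)] psp_diff[OF std U(2) std U(2), of a a'] ab by (cases "a' = a") auto
  qed
  also have "\<dots> = (\<Sum>a\<in>?A. sc (dcoef b a) * p (U @ [b, a]))"
    using finite_addable by (simp add: sum.delta)
  finally show ?thesis .
qed

lemma inc_p_s_inc_p_diff:
  assumes b: "standard_tableau (U @ [b])" and b': "standard_tableau (U @ [b'])" and ne: "b \<noteq> b'" and U: "length U = m"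
  shows "inc (Suc m) (p (U @ [b])) * S * inc (Suc m) (p (U @ [b'])) = p (U @ [b, b']) * S * p (U @ [b', b])"
proof -
  let ?A = "{a. addable (insert b (set U)) a}" and ?A' = "{a. addable (insert b' (set U)) a}"
  have add: "addable (set U) b" "addable (set U) b'" using b b' standard_append_iff by auto
  then have mem: "b' \<in> ?A" "b \<in> ?A'" using addable_insert ne by auto
  have std: "standard_tableau (U @ [b, a])" if "a \<in> ?A" for a using b that standard_append_two_iff by simp
  have std': "standard_tableau (U @ [b', a])" if "a \<in> ?A'" for a using b' that standard_append_two_iff by simp
  have "inc (Suc m) (p (U @ [b])) * S * inc (Suc m) (p (U @ [b'])) =
      (\<Sum>a\<in>?A. \<Sum>a'\<in>?A'. p (U @ [b, a]) * S * p (U @ [b', a']))"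
    unfolding inc_p_append[OF b U] inc_p_append[OF b' U]
    by (simp only: sum_distrib_left sum_distrib_right) (rule sum.swap)
  also have "\<dots> = (\<Sum>a\<in>?A. \<Sum>a'\<in>?A'. if a = b' then (if a' = b then p (U @ [b, b']) * S * p (U @ [b', b]) else 0) else 0)"
  proof (intro sum.cong refl)
    fix a a' assume "a \<in> ?A" "a' \<in> ?A'"
    then show "p (U @ [b, a]) * S * p (U @ [b', a']) =
        (if a = b' then (if a' = b then p (U @ [b, b']) * S * p (U @ [b', b]) else 0) else 0)"
      using psp_diff[OF std U std' U, of a a'] ne by auto
  qed
  also have "\<dots> = (\<Sum>a\<in>?A. if a = b' then p (U @ [b, b']) * S * p (U @ [b', b]) else 0)"
    using finite_addable mem by (intro sum.cong refl) (simp add: sum.delta)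
  also have "\<dots> = p (U @ [b, b']) * S * p (U @ [b', b])"
    using finite_addable mem by (simp add: sum.delta)
  finally show ?thesis .
qed

text \<open>Write P and P' for the idempotents with the last two boxes in the two orders. The
  expression reduces to P S P' S P. Inserting the sum of all idempotents into P S S P leaves only P
  and P' in the middle, so P S P' S P is P S S P minus the square of the diagonal coefficient. The
  quadratic relation computes P S S P.\<close>

lemma swap_product:
  assumes b: "standard_tableau (U @ [b])" and b': "standard_tableau (U @ [b'])" and ne: "b \<noteq> b'" and U: "length U = m"
  defines "pb \<equiv> inc (Suc m) (p (U @ [b]))" and "pb' \<equiv> inc (Suc m) (p (U @ [b']))"
  shows "pb * S * pb' * S * pb = sc (1 + hq * dcoef b b' - (dcoef b b')\<^sup>2) * p (U @ [b, b'])"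
proof -
  let ?P = "p (U @ [b, b'])" and ?P' = "p (U @ [b', b])" and ?d = "dcoef b b'"
  have add: "addable (set U) b" "addable (set U) b'" using b b' standard_append_iff by auto
  have std: "standard_tableau (U @ [b, b'])" "standard_tableau (U @ [b', b])"
    using b b' addable_insert add ne standard_append_two_iff by metis+
  have idem: "pb' * pb' = pb'" "?P' * ?P' = ?P'" "?P * ?P = ?P"
    using p_orth[OF b' b'] p_orth[OF std(1) std(1)] p_orth[OF std(2) std(2)]
    by (simp_all add: pb'_def flip: inc_mult)
  have PE: "?P * E2 = ?P" using p_mem_right[OF std(1)] U by simp
  have "?P * S = ?P * S * E2" by (simp only: mult.assoc S_facts)
  also have "\<dots> = (\<Sum>T\<in>tableaux_of_size (Suc (Suc m)). ?P * S * p T)"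
    unfolding p_sum[symmetric] sum_distrib_left ..
  also have "\<dots> = (\<Sum>T\<in>{U @ [b, b'], U @ [b', b]}. ?P * S * p T)"
  proof (rule sum.mono_neutral_right[OF finite_tableaux_of_size])
    show "{U @ [b, b'], U @ [b', b]} \<subseteq> tableaux_of_size (Suc (Suc m))" using std U by auto
    show "\<forall>T\<in>tableaux_of_size (Suc (Suc m)) - {U @ [b, b'], U @ [b', b]}. ?P * S * p T = 0"
    proof
      fix T assume T: "T \<in> tableaux_of_size (Suc (Suc m)) - {U @ [b, b'], U @ [b', b]}"
      define V where "V = take m T"
      have Tl: "length T = Suc (Suc m)" using T by simp
      have "T = take (Suc (Suc m)) T" using Tl by simp
      also have "\<dots> = V @ [T ! m, T ! Suc m]" 
        using Tl take_Suc_conv_app_nth[of m T] take_Suc_conv_app_nth[of "Suc m" T] unfolding V_def by simp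
      finally have TV: "T = V @ [T ! m, T ! Suc m]" .
      have Vl: "length V = m" using Tl by (simp add: V_def)
      have "standard_tableau (V @ [T ! m, T ! Suc m])" using T by (simp flip: TV)
      moreover have "V @ [T ! m, T ! Suc m] \<noteq> U @ [b, b']" using T by (simp flip: TV)
      moreover have "\<not> (V = U \<and> T ! m = b' \<and> T ! Suc m = b)" using T TV by force
      ultimately have "?P * S * p (V @ [T ! m, T ! Suc m]) = 0"
        using psp_diff[OF std(1) U _ Vl] by blast
      then show "?P * S * p T = 0" by (simp flip: TV)
    qed
  qed
  also have "\<dots> = ?P * S * ?P + ?P * S * ?P'" using ne by simp
  finally have PS: "?P * S = sc ?d * ?P + ?P * S * ?P'"
    using psp_same[OF std(1) U] by simp
  have "?P * S * S * ?P = (sc ?d * ?P + ?P * S * ?P') * S * ?P" by (simp only: PS[symmetric])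
  also have "\<dots> = sc ?d * (?P * S * ?P) + ?P * S * ?P' * S * ?P"
    by (simp add: distrib_right mult.assoc)
  also have "?P * S * ?P = sc ?d * ?P" by (rule psp_same[OF std(1) U])
  finally have 1: "?P * S * S * ?P = sc (?d\<^sup>2) * ?P + ?P * S * ?P' * S * ?P"
    by (simp add: sc_sc power2_eq_square)
  have "?P * S * S * ?P = ?P * (S * S) * ?P" by (simp only: mult.assoc)
  also have "\<dots> = ?P * E2 * ?P + sc hq * (?P * S * ?P)"
    unfolding S_facts by (simp add: distrib_left distrib_right) (simp only: mult.assoc sc_left)
  also have "\<dots> = sc (1 + hq * ?d) * ?P"
    unfolding psp_same[OF std(1) U] PE idem by (simp add: sc_add sc_1 sc_sc distrib_right)
  finally have 2: "?P * S * ?P' * S * ?P = sc (1 + hq * ?d - ?d\<^sup>2) * ?P"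
    using 1 by (simp add: sc_diff left_diff_distrib eq_diff_eq add.commute)
  have "(pb * S * pb') * (pb' * S * pb) = pb * S * (pb' * pb') * S * pb" by (simp only: mult.assoc)
  then have "pb * S * pb' * S * pb = (pb * S * pb') * (pb' * S * pb)" by (simp only: idem)
  also have "\<dots> = (?P * S * ?P') * (?P' * S * ?P)"
    unfolding pb_def pb'_def using inc_p_s_inc_p_diff[OF b b' ne U] inc_p_s_inc_p_diff[OF b' b _ U] ne by simp
  also have "\<dots> = ?P * S * (?P' * ?P') * S * ?P" by (simp only: mult.assoc)
  also have "\<dots> = ?P * S * ?P' * S * ?P" by (simp only: idem)
  finally show ?thesis using 2 by simp
qed

end

end

section \<open>Traces of the idempotents\<close>

context markov_tower
begin

abbreviation Q where "Q \<equiv> cst (qh\<^sup>2)"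
abbreviation H where "H \<equiv> cst hq"

lemma cst_eq_iff: "cst c = cst d \<longleftrightarrow> c = d"
  using cst_eq_0[of "c - d"] by (simp add: cst_diff)

lemma Q_nonroot: "Q powi z = 1 \<Longrightarrow> z = 0"
  using qh_nonroot[of z] cst_eq_iff[of _ 1] by (simp add: cst_1 flip: cst_powi)

lemma Q0: "Q \<noteq> 0" using qh0 by (simp add: cst_eq_0)

lemma hq_ne0: "hq \<noteq> 0"
proof
  assume "hq = 0"
  then have "qh * qh = qh * inverse qh" by (simp add: hq_def)
  then have "(qh\<^sup>2) powi 1 = 1" using qh0 by (simp add: power2_eq_square)
  then show False using qh_nonroot[of 1] by simp
qed

lemma H_eq: "H = cst qh - inverse (cst qh)" by (simp add: hq_def cst_diff cst_inverse)

lemma X_inc': "X (Suc n) (inc n x) = (1 - al) / H * X n x"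
  using X_inc[of n x] by (simp add: H_eq)

text \<open>The hypothesis says that the partial trace of \<open>z\<close> from H_(m+1) to H_m is
  \<open>\<rho>\<close> times \<open>g\<close>; the conclusion says the same for the conjugate of
  the included \<open>z\<close>, one level up. It suffices to test against H_m and H_m sigma_m H_m,
  where the conjugating generator can be moved next to its inverse or brought into a form in which
  it occurs once.\<close>

lemma partial_trace_conjugate:
  assumes hyp: "\<And>v. X (Suc m) (z * inc m v) = \<rho> * X m (g * v)"
  shows "X (Suc (Suc m)) (s (Suc (Suc m)) (Suc m) * inc (Suc m) z * sinv (Suc (Suc m)) (Suc m) * inc (Suc m) w) =
    \<rho> * X (Suc m) (inc m g * w)"
proof -
  let ?S = "s (Suc (Suc m)) (Suc m)" and ?Si = "sinv (Suc (Suc m)) (Suc m)"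
  let ?X = "X (Suc (Suc m))" and ?i = "inc (Suc m)"
  have comm: "?S * ?i (inc m v) = ?i (inc m v) * ?S" "?Si * ?i (inc m v) = ?i (inc m v) * ?Si" for v
    using s_inc_comm'[of m v] sinv_inc_comm[of m v] by simp_all
  have "?X (?S * ?i z * ?Si * ?i w) = \<rho> * X (Suc m) (inc m g * w)" if "w \<in> two_step m" for w
    using that
  proof (induction rule: two_step.induct)
    case (two_step_inc v)
    have "?X (?S * ?i z * ?Si * ?i (inc m v)) = ?X (?S * (?i z * (?Si * ?i (inc m v))))"
      by (simp only: mult.assoc)
    also have "\<dots> = ?X (?i z * (?i (inc m v) * ?Si) * ?S)"
      by (subst X_comm) (simp only: comm)
    also have "\<dots> = ?X (?i (z * inc m v) * (?Si * ?S))" by (simp only: mult.assoc inc_mult)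
    also have "\<dots> = (1 - al) / H * X (Suc m) (z * inc m v)"
      by (simp only: S_facts inc_mem_right X_inc')
    also have "\<dots> = \<rho> * ((1 - al) / H * X m (g * v))" by (simp add: hyp)
    also have "\<dots> = \<rho> * X (Suc m) (inc m g * inc m v)" by (simp only: X_inc' flip: inc_mult)
    finally show ?case .
  next
    case (two_step_s v v')
    let ?t = "s (Suc m) m" and ?ti = "sinv (Suc m) m"
    let ?\<tau> = "s (Suc (Suc m)) m"
    let ?z = "inc m v' * z * inc m v"
    have it: "?i ?t = ?\<tau>" using two_step_s inc_s[of m "Suc m"] by simp
    have t: "?t * ?ti = e (Suc m)" "?ti * ?t = e (Suc m)" using two_step_s sinv_left sinv_right by simp_all
    have br: "?\<tau> * ?S * ?\<tau> = ?S * ?\<tau> * ?S" using braid[of m "Suc (Suc m)"] two_step_s by simp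
    have tt: "?\<tau> * ?i ?ti = e (Suc (Suc m))" "?\<tau> * e (Suc (Suc m)) = ?\<tau>"
      by (simp_all only: it[symmetric] inc_mem_right) (simp only: t inc_e flip: inc_mult)
    \<comment> \<open>Another form of the braid relation: conjugating sigma_m by sigma_(m+1) is
      conjugating sigma_(m+1) by the inverse of sigma_m.\<close>
    have conj: "?Si * ?\<tau> * ?S = ?\<tau> * ?S * ?i ?ti"
    proof -
      have "?Si * ?\<tau> * ?S = ?Si * ?\<tau> * (?S * (?\<tau> * ?i ?ti))" by (simp only: tt S_facts)
      also have "\<dots> = ?Si * (?\<tau> * ?S * ?\<tau>) * ?i ?ti" by (simp only: mult.assoc)
      also have "\<dots> = (?Si * ?S) * ?\<tau> * ?S * ?i ?ti" unfolding br by (simp only: mult.assoc)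
      also have "\<dots> = ?\<tau> * ?S * ?i ?ti"
        by (simp only: S_facts it[symmetric] inc_mem)
      finally show ?thesis .
    qed
    have m: "1 \<le> m" by fact
    have "?X (?S * ?i z * ?Si * ?i (inc m v * ?t * inc m v')) =
        ?X ((?S * ?i z * (?Si * ?i (inc m v)) * ?\<tau>) * ?i (inc m v'))"
      by (simp only: mult.assoc inc_mult it)
    also have "\<dots> = ?X (?i (inc m v') * (?S * ?i z * (?Si * ?i (inc m v)) * ?\<tau>))" by (rule X_comm)
    also have "\<dots> = ?X ((?i (inc m v') * ?S) * ?i z * (?Si * ?i (inc m v)) * ?\<tau>)"
      by (simp only: mult.assoc)
    also have "\<dots> = ?X ((?S * ?i (inc m v')) * ?i z * (?i (inc m v) * ?Si) * ?\<tau>)" by (simp only: comm)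
    also have "\<dots> = ?X (?S * (?i ?z * ?Si * ?\<tau>))" by (simp only: mult.assoc inc_mult)
    also have "\<dots> = ?X (?i ?z * (?Si * ?\<tau> * ?S))" by (subst X_comm) (simp only: mult.assoc)
    also have "\<dots> = ?X ((?i ?z * ?\<tau> * ?S) * ?i ?ti)" unfolding conj by (simp only: mult.assoc)
    also have "\<dots> = ?X (?i (?ti * ?z * ?t) * ?S)"
      by (subst X_comm) (simp only: mult.assoc inc_mult it)
    \<comment> \<open>The generator sigma_(m+1) now occurs once and the Markov axiom removes it. The
      remaining conjugation by sigma_m cancels under the trace, and the same axiom one level down
      will later put sigma_m back.\<close>
    also have "\<dots> = X (Suc m) (?ti * (?z * ?t))" using X_markov[of "Suc m"] by (simp add: mult.assoc)
    also have "\<dots> = X (Suc m) (?z * (?t * ?ti))" by (subst X_comm) (simp only: mult.assoc)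
    also have "\<dots> = X (Suc m) (inc m v' * (z * inc m v))"
      unfolding t by (simp only: mult.assoc inc_mem_right)
    also have "\<dots> = X (Suc m) (z * inc m (v * v'))" by (subst X_comm) (simp only: mult.assoc inc_mult)
    also have "\<dots> = \<rho> * X m ((g * v) * v')" by (simp only: hyp mult.assoc)
    also have "X m ((g * v) * v') = X m (v' * (g * v))" by (rule X_comm)
    also have "\<dots> = X (Suc m) (inc m (v' * (g * v)) * ?t)" using X_markov[OF m] by simp
    also have "\<dots> = X (Suc m) (inc m v' * (inc m g * inc m v * ?t))" by (simp only: inc_mult mult.assoc)
    also have "\<dots> = X (Suc m) (inc m g * (inc m v * ?t * inc m v'))" by (subst X_comm) (simp only: mult.assoc)
    finally show ?case .
  qed (simp add: inc_add distrib_left X_add)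
  moreover have "e (Suc m) * w \<in> two_step m"
    by (rule two_step_all) (simp add: e_idem flip: mult.assoc)
  ultimately have "?X (?S * ?i z * ?Si * ?i (e (Suc m) * w)) = \<rho> * X (Suc m) (inc m g * (e (Suc m) * w))" by blast
  moreover have "inc m g * (e (Suc m) * w) = inc m g * w" by (simp add: inc_mem_right flip: mult.assoc)
  ultimately show ?thesis by (simp only: inc_corner)
qed

lemma xc_right: "xc (box_right b) = qh\<^sup>2 * xc b"
  using qh0 by (simp add: xc_def power_int_add)

lemma xc_up: "xc (box_up b) = xc b / qh\<^sup>2"
  using qh0 by (simp add: xc_def power_int_diff)

lemma cst_xc: "cst (xc c) = Q powi box_content c" by (simp add: xc_def cst_powi)

text \<open>This is the reciprocal of the factor by which \<open>rfac\<close> changes when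
  \<open>b\<close> is added, see \<open>rfac_insert\<close>.\<close>

lemma dcoef_kappa:
  assumes "xc a \<noteq> xc b"
  shows "1 + hq * dcoef b a - (dcoef b a)\<^sup>2 =
    (xc a - qh\<^sup>2 * xc b) * (xc a - xc b / qh\<^sup>2) / (xc a - xc b)\<^sup>2"
proof -
  define u where "u = xc a - xc b"
  have u: "u \<noteq> 0" "xc a = u + xc b" using assms by (auto simp: u_def)
  show ?thesis unfolding dcoef_def hq_def u_def[symmetric] u(2)
    using u(1) qh0 by (simp add: divide_simps power2_eq_square) (simp add: algebra_simps)
qed

text \<open>The two coefficients are q^(1/2) and -q^(-1/2), the eigenvalues of the generators; their
  equality would force q = -1. The difference is the determinant of the linear system for the two
  new boxes.\<close>

lemma dcoef_right_up: "dcoef b (box_right b) \<noteq> dcoef b (box_up b)"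
proof
  let ?q = "qh\<^sup>2" and ?x = "xc b"
  assume eq: "dcoef b (box_right b) = dcoef b (box_up b)"
  have q1: "?q \<noteq> 1" using qh_nonroot[of 1] by auto
  have "(qh\<^sup>2) powi 2 \<noteq> 1" using qh_nonroot[of 2] by auto
  then have q2: "?q * ?q \<noteq> 1" by (simp add: power2_eq_square)
  have r: "dcoef b (box_right b) = hq * ?q / (?q - 1)"
    unfolding dcoef_def xc_right using xc_ne0[of b] q1 by (simp add: divide_simps) (simp add: algebra_simps)
  have "?x / ?q - ?x = ?x * (1 - ?q) / ?q" using qh0 by (simp add: field_simps)
  then have u: "dcoef b (box_up b) = hq / (1 - ?q)"
    unfolding dcoef_def xc_up using xc_ne0[of b] q1 qh0 by (simp add: divide_simps)
  have cancel: "A = - B" if "A / y = B / (- y)" "y \<noteq> 0" for A B y :: 'k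
    using that by (simp add: field_simps)
  have "1 - ?q = - (?q - 1)" by simp
  then have "hq * ?q / (?q - 1) = hq / (- (?q - 1))" using eq by (simp only: r u)
  then have "hq * ?q = - hq" by (rule cancel) (use q1 in simp)
  then have "?q = - 1" using hq_ne0 by (metis mult_cancel_left mult_minus_right mult.right_neutral)
  then show False using q2 by simp
qed

text \<open>By \<open>swap_product\<close> the idempotent of \<open>U @ [b, a]\<close> is, up to
  kappa, a product of included idempotents of one size less and two generators. Cyclicity turns it
  into the conjugate of the idempotent of \<open>U @ [a]\<close>, to which
  \<open>partial_trace_conjugate\<close> applies.\<close>

lemma trace_idempotent_step_earlier:
  assumes b: "standard_tableau (U @ [b])" and a: "addable (set U) a" and ne: "a \<noteq> b" and L: "length U < L"
    and IH: "\<And>v. X (Suc (length U)) (p (U @ [a]) * inc (length U) v) =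
      rfac Q H al L (set U) a * X (length U) (p U * v)"
  shows "X (length U + 2) (p (U @ [b, a]) * inc (Suc (length U)) w) =
    rfac Q H al L (insert b (set U)) a * X (Suc (length U)) (p (U @ [b]) * w)"
proof -
  let ?m = "length U"
  let ?S = "s (Suc (Suc ?m)) (Suc ?m)" and ?Si = "sinv (Suc (Suc ?m)) (Suc ?m)"
  let ?X = "X (Suc (Suc ?m))"
  define pb where "pb = inc (Suc ?m) (p (U @ [b]))"
  define pa where "pa = inc (Suc ?m) (p (U @ [a]))"
  define W where "W = inc (Suc ?m) w"
  define \<kappa> where "\<kappa> = 1 + hq * dcoef b a - (dcoef b a)\<^sup>2"
  have add: "addable (set U) b" "standard_tableau U" using b standard_append_iff by auto
  have std: "standard_tableau (U @ [a])" using a add standard_append_iff by simp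
  have ne0: "xc a \<noteq> xc b" using addable_content_distinct[OF a add(1) ne] by (auto simp: xc_eq_iff)
  have orth: "p (U @ [a]) * p (U @ [b]) = 0" "p (U @ [b]) * p (U @ [b]) = p (U @ [b])"
    using p_orth[OF std b] p_orth[OF b b] ne by simp_all
  \<comment> \<open>A generator differs from its inverse by a scalar, which disappears between
    orthogonal idempotents. Replacing the second generator by its inverse produces the
    conjugate.\<close>
  have pab: "pa * ?Si * pb = pa * ?S * pb"
  proof -
    have "pa * e (Suc (Suc ?m)) = pa" unfolding pa_def by (rule inc_mem_right)
    moreover have "pa * pb = 0" unfolding pa_def pb_def using orth by (simp add: inc_0 flip: inc_mult)
    ultimately show ?thesis unfolding Si_S by simp
  qed
  have "cst \<kappa> * ?X (p (U @ [b, a]) * W) = ?X (sc \<kappa> * p (U @ [b, a]) * W)"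
    by (simp only: X_sc mult.assoc)
  also have "sc \<kappa> * p (U @ [b, a]) = pb * ?S * pa * ?S * pb"
    unfolding \<kappa>_def pb_def pa_def by (rule swap_product[OF b std ne[symmetric] refl, symmetric])
  also have "?X (pb * ?S * pa * ?S * pb * W) = ?X (pb * (?S * (pa * ?S * pb) * W))"
    by (simp only: mult.assoc)
  also have "\<dots> = ?X (?S * (pa * ?Si * pb) * W * pb)" by (subst X_comm) (simp only: pab)
  also have "\<dots> = ?X (?S * pa * ?Si * inc (Suc ?m) (p (U @ [b]) * w * p (U @ [b])))"
    by (simp only: mult.assoc inc_mult pb_def W_def)
  also have "\<dots> = rfac Q H al L (set U) a * X (Suc ?m) (inc ?m (p U) * (p (U @ [b]) * w * p (U @ [b])))"
    unfolding pa_def by (rule partial_trace_conjugate[OF IH])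
  also have "inc ?m (p U) * (p (U @ [b]) * w * p (U @ [b])) = (inc ?m (p U) * p (U @ [b])) * w * p (U @ [b])"
    by (simp only: mult.assoc)
  also have "inc ?m (p U) * p (U @ [b]) = p (U @ [b])"
    using p_inc(2)[OF b, of ?m U] add by simp
  also have "X (Suc ?m) (p (U @ [b]) * w * p (U @ [b])) = X (Suc ?m) (p (U @ [b]) * p (U @ [b]) * w)"
    by (subst X_comm) (simp only: mult.assoc)
  finally have main: "cst \<kappa> * ?X (p (U @ [b, a]) * W) = rfac Q H al L (set U) a * X (Suc ?m) (p (U @ [b]) * w)"
    by (simp only: orth)
  have k: "\<kappa> = (xc a - qh\<^sup>2 * xc b) * (xc a - xc b / qh\<^sup>2) / (xc a - xc b)\<^sup>2"
    unfolding \<kappa>_def by (rule dcoef_kappa[OF ne0])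
  \<comment> \<open>The numerator vanishes only for contents differing by 1, while two addable boxes
    have contents at least 2 apart.\<close>
  have k0: "\<kappa> \<noteq> 0"
  proof -
    have "xc a \<noteq> xc (box_right b)" "xc a \<noteq> xc (box_up b)"
      using addable_content_distinct[OF a add(1) ne] by (auto simp: xc_eq_iff)
    then show ?thesis unfolding k using ne0 by (simp add: xc_right xc_up)
  qed
  have "distinct U" using standard_distinct[OF add(2)] .
  then have "card (set U) < L" using L by (simp add: distinct_card)
  from rfac_insert[OF Q_nonroot Q0 add(1) a ne this, of H al]
  have "rfac Q H al L (insert b (set U)) a = rfac Q H al L (set U) a / cst \<kappa>"
    unfolding k using Q0
    by (simp add: cst_divide cst_mult cst_diff cst_power cst_xc power_int_add power_int_diff)
  moreover have "?X (p (U @ [b, a]) * W) = rfac Q H al L (set U) a * X (Suc ?m) (p (U @ [b]) * w) / cst \<kappa>"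
    using main k0 by (simp add: eq_divide_eq cst_eq_0 mult.commute)
  ultimately show ?thesis by (simp add: W_def)
qed

text \<open>The defect \<open>f a\<close> between the actual and the predicted trace vanishes at all
  boxes that were addable before \<open>b\<close>. The inclusion axiom and the Markov axiom give two
  linear equations for the two remaining defects, with coefficients (1, 1) and the two values of
  \<open>dcoef\<close>, and \<open>rfac\<close> satisfies the same equations.\<close>

lemma trace_idempotent_append:
  assumes "standard_tableau T" "addable (set T) a" "length T \<le> L"
  shows "X (Suc (length T)) (p (T @ [a]) * inc (length T) v) =
    rfac Q H al L (set T) a * X (length T) (p T * v)"
  using assms
proof (induction T arbitrary: a v rule: rev_induct)
  case Nil
  have A: "{a. addable {} a} = {(0, 0)}" by (auto simp: addable_empty)
  have a: "a = (0, 0)" using Nil by (simp add: addable_empty)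
  have "inc 0 (p []) = p [a]" using inc_p_eq_sum[of "[]"] a A by simp
  then have "p [a] * inc 0 v = inc 0 (p [] * v)" by (simp only: inc_mult)
  then have "X (Suc 0) (p [a] * inc 0 v) = (1 - al) / H * X 0 (p [] * v)"
    by (simp only: X_inc')
  moreover have "rfac Q H al L {} a = (1 - al) / H"
    using rfac_sum[OF Q_nonroot Q0, of "{}" L H al] A a hq_ne0 by (simp add: young_diagram_def cst_eq_0)
  ultimately show ?case by simp
next
  case (snoc b U)
  let ?m = "length U" and ?D = "insert b (set U)" and ?r = "box_right b" and ?u = "box_up b"
  let ?A = "{a. addable ?D a}"
  have b: "standard_tableau U" "addable (set U) b" "standard_tableau (U @ [b])"
    using snoc.prems standard_append_iff by auto
  have L: "length U < L" using snoc.prems by simp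
  have card: "card (set U) < L" "card ?D \<le> L"
    using L standard_distinct[OF b(1)] distinct_card[of U] card_insert_le_m1 by (auto simp: card_insert_if)
  define t where "t = X (Suc ?m) (p (U @ [b]) * v)"
  define g where "g a = X (Suc (Suc ?m)) (p (U @ [b, a]) * inc (Suc ?m) v)" for a
  define R where "R a = rfac Q H al L ?D a" for a
  define d where "d a = cst (dcoef b a)" for a
  \<comment> \<open>The default 0 covers the case that the box to the right of \<open>b\<close> or
    above it is not addable, so that both equations always have two unknowns.\<close>
  define f where "f a = (if a \<in> ?A then g a - R a * t else 0)" for a
  let ?P = "p (U @ [b])"
  have PP: "?P * ?P = ?P" using p_orth[OF b(3) b(3)] by simp
  have "sum g ?A = X (Suc (Suc ?m)) (inc (Suc ?m) ?P * inc (Suc ?m) v)"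
    unfolding inc_p_append[OF b(3) refl] sum_distrib_right X_sum g_def ..
  also have "\<dots> = (1 - al) / H * t" by (simp only: X_inc' t_def flip: inc_mult)
  finally have g1: "sum g ?A = (1 - al) / H * t" .
  \<comment> \<open>The weights \<open>d a\<close> arise by compressing the top generator with the
    idempotent of \<open>U @ [b]\<close>; in the compressed form it occurs once, as the Markov axiom
    requires.\<close>
  have "(\<Sum>a\<in>?A. d a * g a) = X (Suc (Suc ?m)) ((\<Sum>a\<in>?A. sc (dcoef b a) * p (U @ [b, a])) * inc (Suc ?m) v)"
    unfolding sum_distrib_right X_sum g_def d_def by (simp only: X_sc mult.assoc)
  also have "\<dots> = X (Suc (Suc ?m)) (inc (Suc ?m) ?P * s (Suc (Suc ?m)) (Suc ?m) * inc (Suc ?m) ?P * inc (Suc ?m) v)"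
    unfolding inc_p_s_inc_p[OF b(3) refl] ..
  also have "\<dots> = X (Suc (Suc ?m)) (inc (Suc ?m) ?P * s (Suc (Suc ?m)) (Suc ?m) * inc (Suc ?m) (?P * v))"
    by (simp only: mult.assoc inc_mult)
  also have "\<dots> = X (Suc (Suc ?m)) (inc (Suc ?m) (?P * v * ?P) * s (Suc (Suc ?m)) (Suc ?m))"
    by (subst X_comm) (simp only: mult.assoc inc_mult)
  also have "\<dots> = X (Suc ?m) (?P * v * ?P)" by (rule X_markov) simp
  also have "\<dots> = X (Suc ?m) (?P * ?P * v)" by (subst X_comm) (simp only: mult.assoc)
  also have "\<dots> = t" by (simp only: PP t_def)
  finally have g2: "(\<Sum>a\<in>?A. d a * g a) = t" .
  have R1: "sum R ?A = (1 - al) / H"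
    unfolding R_def using card snoc.prems hq_ne0
    by (intro rfac_sum[OF Q_nonroot Q0]) (auto simp: cst_eq_0 addable_def)
  have R2: "(\<Sum>a\<in>?A. d a * R a) = 1"
    using rfac_sum_insert[OF Q_nonroot Q0 b(2) card(1), of H al] hq_ne0
    by (simp add: R_def d_def dcoef_def cst_divide cst_mult cst_diff cst_xc cst_eq_0)
  have f0: "f a = 0" if "a \<noteq> ?r" "a \<noteq> ?u" for a
  proof (cases "a \<in> ?A")
    case True
    then have a: "addable (set U) a" "a \<noteq> b" using addable_insert_cases[OF b(2), of a] that by blast+
    have "g a = R a * t" unfolding g_def R_def t_def
      using trace_idempotent_step_earlier[OF b(3) a L snoc.IH[OF b(1) a(1)]] L by simp
    then show ?thesis by (simp add: f_def)
  qed (simp add: f_def)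
  have ru: "?r \<noteq> ?u" by (simp add: box_right_def box_up_def)
  have fin: "finite ?A" by (rule finite_addable)
  have sum_ru: "(\<Sum>a\<in>?A. c a * f a) = c ?r * f ?r + c ?u * f ?u" for c
  proof -
    have "(\<Sum>a\<in>?A. c a * f a) = (\<Sum>a\<in>?A \<union> {?r, ?u}. c a * f a)"
      by (rule sum.mono_neutral_left) (use fin in \<open>auto simp: f_def\<close>)
    also have "\<dots> = (\<Sum>a\<in>{?r, ?u}. c a * f a)"
      by (rule sum.mono_neutral_right) (use fin f0 in auto)
    finally show ?thesis using ru by simp
  qed
  have fA: "(\<Sum>a\<in>?A. c a * f a) = (\<Sum>a\<in>?A. c a * g a) - (\<Sum>a\<in>?A. c a * R a) * t" for c
  proof -
    have "(\<Sum>a\<in>?A. c a * f a) = (\<Sum>a\<in>?A. c a * g a - c a * R a * t)"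
      by (rule sum.cong) (simp_all add: f_def right_diff_distrib mult.assoc)
    then show ?thesis by (simp add: sum_subtractf sum_distrib_right)
  qed
  have "f ?r + f ?u = 0" using sum_ru[of "\<lambda>_. 1"] fA[of "\<lambda>_. 1"] g1 R1 by simp
  moreover have "d ?r * f ?r + d ?u * f ?u = 0" using sum_ru[of d] fA[of d] g2 R2 by simp
  moreover have "(D - E) * x = 0 \<and> y = - x" if "x + y = 0" "D * x + E * y = 0" for x y D E :: 'l
  proof -
    have "y = - x" using that(1) by (simp add: eq_neg_iff_add_eq_0 add.commute)
    with that(2) show ?thesis by (simp add: left_diff_distrib)
  qed
  ultimately have "(d ?r - d ?u) * f ?r = 0" "f ?u = - f ?r" by blast+
  moreover have "d ?r - d ?u \<noteq> 0" using dcoef_right_up by (simp add: d_def cst_eq_iff)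
  ultimately have "f ?r = 0" "f ?u = 0" by simp_all
  then have "f a = 0" using f0 by metis
  then show ?case using snoc.prems by (simp add: f_def g_def R_def t_def)
qed

theorem trace_idempotent:
  assumes "standard_tableau T" "length T \<le> L"
  shows "X (length T) (p T) = (\<Prod>i<length T. rfac Q H al L (set (take i T)) (T ! i))"
  using assms
proof (induction T rule: rev_induct)
  case Nil
  have "tableaux_of_size 0 = {[]}" by auto
  then have "p [] = e 0" using p_sum[of 0] by simp
  then show ?case by (simp add: X_0)
next
  case (snoc a T)
  have a: "standard_tableau T" "addable (set T) a" using snoc.prems standard_append_iff by auto
  have "X (Suc (length T)) (p (T @ [a])) = X (Suc (length T)) (p (T @ [a]) * inc (length T) (e (length T)))"
    using p_mem_right[OF snoc.prems(1)] by (simp add: inc_e)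
  also have "\<dots> = rfac Q H al L (set T) a * X (length T) (p T * e (length T))"
    by (rule trace_idempotent_append[OF a]) (use snoc.prems in simp)
  also have "\<dots> = rfac Q H al L (set T) a * (\<Prod>i<length T. rfac Q H al L (set (take i T)) (T ! i))"
    using snoc a p_mem_right[OF a(1)] by simp
  also have "\<dots> = (\<Prod>i<Suc (length T). rfac Q H al L (set (take i (T @ [a]))) ((T @ [a]) ! i))"
    by (simp add: nth_append mult.commute)
  finally show ?case by simp
qed

end

section \<open>The Hecke algebras\<close>

interpretation free: ring "free_algebra n" for n by (rule free_algebra_ring)

lemma free_algebra_carrier_mono: "f \<in> carrier (free_algebra n) \<Longrightarrow> f \<in> carrier (free_algebra (Suc n))"
  by (force simp: free_algebra_def)

lemma free_algebra_ops:
  "mult (free_algebra n) = mult (free_algebra 0)" "add (free_algebra n) = add (free_algebra 0)"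
  "one (free_algebra n) = one (free_algebra 0)" "zero (free_algebra n) = zero (free_algebra 0)"
  by (simp_all add: free_algebra_def)

lemma free_algebra_uminus:
  assumes "f \<in> carrier (free_algebra n)"
  shows "\<ominus>\<^bsub>free_algebra n\<^esub> f = (\<lambda>w. - f w)"
proof (rule free.minus_equality)
  show "(\<lambda>w. - f w) \<oplus>\<^bsub>free_algebra n\<^esub> f = \<zero>\<^bsub>free_algebra n\<^esub>" by (simp add: free_algebra_def)
  show "(\<lambda>w. - f w) \<in> carrier (free_algebra n)" using assms by (simp add: free_algebra_def)
qed (rule assms)

lemma free_gen_carrier: "1 \<le> i \<Longrightarrow> i < n \<Longrightarrow> free_gen i \<in> carrier (free_algebra n)"
  by (auto simp: free_algebra_def free_gen_def)

lemma free_scalar_carrier: "free_scalar c \<in> carrier (free_algebra n)"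
  by (auto simp: free_algebra_def free_scalar_def)

lemma free_minus_mono:
  assumes "f \<in> carrier (free_algebra n)" "g \<in> carrier (free_algebra n)"
  shows "f \<ominus>\<^bsub>free_algebra n\<^esub> g = f \<ominus>\<^bsub>free_algebra (Suc n)\<^esub> g"
  unfolding a_minus_def free_algebra_uminus[OF assms(2)]
    free_algebra_uminus[OF free_algebra_carrier_mono[OF assms(2)]]
  by (simp add: free_algebra_def)

lemma hecke_relators_carrier: "hecke_relators n \<subseteq> carrier (free_algebra n)"
  unfolding hecke_relators_def Let_def
  by (auto intro!: free.minus_closed free.m_closed free.a_closed free_gen_carrier free_scalar_carrier)

lemma hecke_ideal: "ideal (hecke_ideal n) (free_algebra n)"
  unfolding hecke_ideal_def by (rule free.genideal_ideal[OF hecke_relators_carrier])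

lemma hecke_ring: "ring (hecke n)"
  unfolding hecke_def by (rule ideal.quotient_is_ring[OF hecke_ideal])

interpretation hecke: ring "hecke n" for n by (rule hecke_ring)

interpretation cls: ring_hom_ring "free_algebra n" "hecke n" "hecke_class n" for n
proof (rule ring_hom_ringI2[OF free_algebra_ring hecke_ring])
  show "hecke_class n \<in> Ring.ring_hom (free_algebra n) (hecke n)"
    unfolding hecke_class_def[abs_def] hecke_def by (rule ideal.rcos_ring_hom[OF hecke_ideal])
qed

lemma hecke_carrier: "carrier (hecke n) = hecke_class n ` carrier (free_algebra n)"
  by (auto simp: hecke_def FactRing_def A_RCOSETS_def' hecke_class_def)

lemma hecke_class_zero: "f \<in> hecke_ideal n \<Longrightarrow> hecke_class n f = \<zero>\<^bsub>hecke n\<^esub>"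
  unfolding hecke_class_def hecke_def FactRing_def
  using abelian_subgroup.a_rcos_const[OF abelian_subgroupI3[OF ideal.axioms(1)[OF hecke_ideal] free.is_abelian_group]]
  by simp

lemma relator_class: "r \<in> hecke_relators n \<Longrightarrow> hecke_class n r = \<zero>\<^bsub>hecke n\<^esub>"
  by (rule hecke_class_zero) (use free.genideal_self[OF hecke_relators_carrier] in \<open>auto simp: hecke_ideal_def\<close>)

text \<open>The larger ideal cut down to the smaller free algebra is an ideal containing the
  relators, so it contains the ideal they generate.\<close>

lemma hecke_ideal_mono: "hecke_ideal n \<subseteq> hecke_ideal (Suc n)"
proof -
  let ?I = "hecke_ideal (Suc n) \<inter> carrier (free_algebra n)"
  have I: "ideal (hecke_ideal (Suc n)) (free_algebra (Suc n))" by (rule hecke_ideal)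
  have "ideal ?I (free_algebra n)"
  proof (rule idealI[OF free_algebra_ring])
    show "subgroup ?I (add_monoid (free_algebra n))"
    proof (rule free.add.subgroupI)
      show "?I \<noteq> {}" using additive_subgroup.zero_closed[OF ideal.axioms(1)[OF I]]
        free.zero_closed[of n] by (auto simp: free_algebra_ops(4)[of n] free_algebra_ops(4)[of "Suc n"])
    next
      fix a assume a: "a \<in> ?I"
      then have "\<ominus>\<^bsub>free_algebra (Suc n)\<^esub> a \<in> hecke_ideal (Suc n)"
        using additive_subgroup.a_inv_closed[OF ideal.axioms(1)[OF I]] by blast
      moreover have "\<ominus>\<^bsub>free_algebra (Suc n)\<^esub> a = \<ominus>\<^bsub>free_algebra n\<^esub> a"
        using a free_algebra_uminus free_algebra_carrier_mono by auto
      ultimately show "\<ominus>\<^bsub>free_algebra n\<^esub> a \<in> ?I" using a by auto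
    next
      fix a b assume "a \<in> ?I" "b \<in> ?I"
      then show "a \<oplus>\<^bsub>free_algebra n\<^esub> b \<in> ?I"
        using additive_subgroup.a_closed[OF ideal.axioms(1)[OF I], of a b] free.a_closed[of a n b]
        by (auto simp: free_algebra_ops(2)[of n] free_algebra_ops(2)[of "Suc n"])
    qed auto
  next
    fix a x assume a: "a \<in> ?I" and x: "x \<in> carrier (free_algebra n)"
    then show "x \<otimes>\<^bsub>free_algebra n\<^esub> a \<in> ?I" "a \<otimes>\<^bsub>free_algebra n\<^esub> x \<in> ?I"
      using ideal.I_l_closed[OF I, of a x] ideal.I_r_closed[OF I, of a x] free_algebra_carrier_mono[OF x]
        free.m_closed[of x n a] free.m_closed[of a n x]
      by (auto simp: free_algebra_ops(1)[of n] free_algebra_ops(1)[of "Suc n"])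
  qed
  moreover have "hecke_relators n \<subseteq> ?I"
  proof -
    have g: "free_gen i \<in> carrier (free_algebra n)" if "1 \<le> i" "i < n" for i
      using that by (rule free_gen_carrier)
    have "hecke_relators n \<subseteq> hecke_relators (Suc n)"
      unfolding hecke_relators_def Let_def
    proof (intro Un_mono subsetI)
      fix x assume "x \<in> {free_gen i \<otimes>\<^bsub>free_algebra n\<^esub> free_gen (i + 1) \<otimes>\<^bsub>free_algebra n\<^esub> free_gen i \<ominus>\<^bsub>free_algebra n\<^esub>
         free_gen (i + 1) \<otimes>\<^bsub>free_algebra n\<^esub> free_gen i \<otimes>\<^bsub>free_algebra n\<^esub> free_gen (i + 1) | i. 1 \<le> i \<and> i + 1 < n}"
      then obtain i where i: "1 \<le> i" "i + 1 < n" and x: "x = free_gen i \<otimes>\<^bsub>free_algebra n\<^esub> free_gen (i + 1) \<otimes>\<^bsub>free_algebra n\<^esub> free_gen i \<ominus>\<^bsub>free_algebra n\<^esub>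
         free_gen (i + 1) \<otimes>\<^bsub>free_algebra n\<^esub> free_gen i \<otimes>\<^bsub>free_algebra n\<^esub> free_gen (i + 1)" by blast
      have "x = free_gen i \<otimes>\<^bsub>free_algebra (Suc n)\<^esub> free_gen (i + 1) \<otimes>\<^bsub>free_algebra (Suc n)\<^esub> free_gen i \<ominus>\<^bsub>free_algebra (Suc n)\<^esub>
         free_gen (i + 1) \<otimes>\<^bsub>free_algebra (Suc n)\<^esub> free_gen i \<otimes>\<^bsub>free_algebra (Suc n)\<^esub> free_gen (i + 1)"
        unfolding x using i g[of i] g[of "i + 1"]
        by (subst free_minus_mono) (auto simp: free_algebra_ops(1)[of "Suc n"] free_algebra_ops(1)[of n, symmetric] intro!: free.m_closed)
      then show "x \<in> {free_gen i \<otimes>\<^bsub>free_algebra (Suc n)\<^esub> free_gen (i + 1) \<otimes>\<^bsub>free_algebra (Suc n)\<^esub> free_gen i \<ominus>\<^bsub>free_algebra (Suc n)\<^esub>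
         free_gen (i + 1) \<otimes>\<^bsub>free_algebra (Suc n)\<^esub> free_gen i \<otimes>\<^bsub>free_algebra (Suc n)\<^esub> free_gen (i + 1) | i. 1 \<le> i \<and> i + 1 < Suc n}"
        using i by auto
    next
      fix x assume "x \<in> {free_gen i \<otimes>\<^bsub>free_algebra n\<^esub> free_gen j \<ominus>\<^bsub>free_algebra n\<^esub> free_gen j \<otimes>\<^bsub>free_algebra n\<^esub> free_gen i | i j. 1 \<le> i \<and> i + 2 \<le> j \<and> j < n}"
      then obtain i j where i: "1 \<le> i" "i + 2 \<le> j" "j < n" and x: "x = free_gen i \<otimes>\<^bsub>free_algebra n\<^esub> free_gen j \<ominus>\<^bsub>free_algebra n\<^esub> free_gen j \<otimes>\<^bsub>free_algebra n\<^esub> free_gen i" by blast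
      have "x = free_gen i \<otimes>\<^bsub>free_algebra (Suc n)\<^esub> free_gen j \<ominus>\<^bsub>free_algebra (Suc n)\<^esub> free_gen j \<otimes>\<^bsub>free_algebra (Suc n)\<^esub> free_gen i"
        unfolding x using i g[of i] g[of j]
        by (subst free_minus_mono) (auto simp: free_algebra_ops(1)[of "Suc n"] free_algebra_ops(1)[of n, symmetric] intro!: free.m_closed)
      moreover have "1 \<le> i \<and> i + 2 \<le> j \<and> j < Suc n" using i by simp
      ultimately show "x \<in> {free_gen i \<otimes>\<^bsub>free_algebra (Suc n)\<^esub> free_gen j \<ominus>\<^bsub>free_algebra (Suc n)\<^esub> free_gen j \<otimes>\<^bsub>free_algebra (Suc n)\<^esub> free_gen i | i j. 1 \<le> i \<and> i + 2 \<le> j \<and> j < Suc n}"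
        by blast
    next
      fix x assume "x \<in> {(free_gen i \<ominus>\<^bsub>free_algebra n\<^esub> free_scalar qhalf) \<otimes>\<^bsub>free_algebra n\<^esub> (free_gen i \<oplus>\<^bsub>free_algebra n\<^esub> free_scalar (inverse qhalf)) | i. 1 \<le> i \<and> i < n}"
      then obtain i where i: "1 \<le> i" "i < n" and x: "x = (free_gen i \<ominus>\<^bsub>free_algebra n\<^esub> free_scalar qhalf) \<otimes>\<^bsub>free_algebra n\<^esub> (free_gen i \<oplus>\<^bsub>free_algebra n\<^esub> free_scalar (inverse qhalf))" by blast
      have "x = (free_gen i \<ominus>\<^bsub>free_algebra (Suc n)\<^esub> free_scalar qhalf) \<otimes>\<^bsub>free_algebra (Suc n)\<^esub> (free_gen i \<oplus>\<^bsub>free_algebra (Suc n)\<^esub> free_scalar (inverse qhalf))"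
        unfolding x free_minus_mono[OF g[OF i] free_scalar_carrier]
        by (simp only: free_algebra_ops(1,2)[of "Suc n"] free_algebra_ops(1,2)[of n])
      then show "x \<in> {(free_gen i \<ominus>\<^bsub>free_algebra (Suc n)\<^esub> free_scalar qhalf) \<otimes>\<^bsub>free_algebra (Suc n)\<^esub> (free_gen i \<oplus>\<^bsub>free_algebra (Suc n)\<^esub> free_scalar (inverse qhalf)) | i. 1 \<le> i \<and> i < Suc n}"
        using i by auto
    qed
    also have "\<dots> \<subseteq> hecke_ideal (Suc n)"
      unfolding hecke_ideal_def by (rule free.genideal_self[OF hecke_relators_carrier])
    finally show ?thesis using hecke_relators_carrier by auto
  qed
  ultimately have "Idl\<^bsub>free_algebra n\<^esub> (hecke_relators n) \<subseteq> ?I" by (rule free.genideal_minimal)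
  then show ?thesis by (auto simp: hecke_ideal_def)
qed

text \<open>The smaller ideal is absorbed by the larger one, so adding the larger ideal to a coset
  of \<open>f\<close> gives the coset of \<open>f\<close>.\<close>

lemma hecke_incl_class:
  assumes f: "f \<in> carrier (free_algebra n)"
  shows "hecke_incl n (hecke_class n f) = hecke_class (Suc n) f"
proof -
  have I: "ideal (hecke_ideal (Suc n)) (free_algebra (Suc n))" by (rule hecke_ideal)
  have I0: "\<zero>\<^bsub>free_algebra (Suc n)\<^esub> \<in> hecke_ideal n"
    using additive_subgroup.zero_closed[OF ideal.axioms(1)[OF hecke_ideal[of n]]]
    by (simp add: free_algebra_ops(4)[of n] free_algebra_ops(4)[of "Suc n"])
  have sub: "hecke_ideal (Suc n) \<subseteq> carrier (free_algebra (Suc n))"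
    using additive_subgroup.a_subset[OF ideal.axioms(1)[OF I]] .
  note f' = free_algebra_carrier_mono[OF f]
  show ?thesis
  proof (intro equalityI subsetI)
    fix x assume "x \<in> hecke_incl n (hecke_class n f)"
    then obtain a b where ab: "a \<in> hecke_ideal (Suc n)" "b \<in> hecke_ideal n" "x = a \<oplus>\<^bsub>free_algebra (Suc n)\<^esub> (b \<oplus>\<^bsub>free_algebra n\<^esub> f)"
      by (auto simp: hecke_incl_def hecke_class_def set_add_def' a_r_coset_def')
    have b: "b \<in> hecke_ideal (Suc n)" using ab hecke_ideal_mono by auto
    have "a \<in> carrier (free_algebra (Suc n))" "b \<in> carrier (free_algebra (Suc n))" using ab(1) b sub by auto
    then have "x = (a \<oplus>\<^bsub>free_algebra (Suc n)\<^esub> b) \<oplus>\<^bsub>free_algebra (Suc n)\<^esub> f"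
      unfolding ab(3) using f' free.a_assoc[of a "Suc n" b f]
      by (simp add: free_algebra_ops(2)[of n] free_algebra_ops(2)[of "Suc n"])
    moreover have "a \<oplus>\<^bsub>free_algebra (Suc n)\<^esub> b \<in> hecke_ideal (Suc n)"
      using additive_subgroup.a_closed[OF ideal.axioms(1)[OF I] ab(1) b] .
    ultimately show "x \<in> hecke_class (Suc n) f" by (auto simp: hecke_class_def a_r_coset_def')
  next
    fix x assume "x \<in> hecke_class (Suc n) f"
    then obtain a where a: "a \<in> hecke_ideal (Suc n)" "x = a \<oplus>\<^bsub>free_algebra (Suc n)\<^esub> f"
      by (auto simp: hecke_class_def a_r_coset_def')
    have "x = a \<oplus>\<^bsub>free_algebra (Suc n)\<^esub> (\<zero>\<^bsub>free_algebra (Suc n)\<^esub> \<oplus>\<^bsub>free_algebra n\<^esub> f)"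
      unfolding a(2) using free.l_zero[OF f'] by (simp add: free_algebra_ops(2)[of n] free_algebra_ops(2)[of "Suc n"])
    then show "x \<in> hecke_incl n (hecke_class n f)"
      using a I0 by (auto simp: hecke_incl_def hecke_class_def set_add_def' a_r_coset_def')
  qed
qed

text \<open>All the algebras \<open>H_n\<close> are collected in one unital ring, their product, so that computations in
  them can use the type class \<^class>\<open>ring_1\<close>; \<open>H_n\<close> is the corner of a central idempotent.\<close>

typedef hecke_product = "{f :: nat \<Rightarrow> (nat list \<Rightarrow> Kq) set. \<forall>n. f n \<in> carrier (hecke n)}"
  morphisms component Abs_hecke_product
proof
  show "(\<lambda>n. \<zero>\<^bsub>hecke n\<^esub>) \<in> {f. \<forall>n. f n \<in> carrier (hecke n)}" by simp
qed

setup_lifting type_definition_hecke_product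

lemma component_carrier [simp]: "component x n \<in> carrier (hecke n)"
  using component[of x] by simp

lemma hecke_product_eqI: "(\<And>n. component x n = component y n) \<Longrightarrow> x = y"
  using component_inject[of x y] by auto

text \<open>For n = 0 there are no relators, so the ideal is zero and H_0 is not the zero ring. One
  such factor makes 0 and 1 distinct in the product of all H_n.\<close>

lemma hecke_zero_ne_one: "\<zero>\<^bsub>hecke 0\<^esub> \<noteq> \<one>\<^bsub>hecke 0\<^esub>"
proof
  assume eq: "\<zero>\<^bsub>hecke 0\<^esub> = \<one>\<^bsub>hecke 0\<^esub>"
  have "hecke_relators 0 \<subseteq> {\<zero>\<^bsub>free_algebra 0\<^esub>}" by (auto simp: hecke_relators_def Let_def)
  then have I: "hecke_ideal 0 \<subseteq> {\<zero>\<^bsub>free_algebra 0\<^esub>}"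
    unfolding hecke_ideal_def by (rule free.genideal_minimal[OF free.zeroideal])
  have "\<one>\<^bsub>free_algebra 0\<^esub> \<in> hecke_class 0 \<one>\<^bsub>free_algebra 0\<^esub>"
    unfolding hecke_class_def
    by (rule abelian_subgroup.a_rcos_self[OF abelian_subgroupI3[OF ideal.axioms(1)[OF hecke_ideal] free.is_abelian_group]]) simp
  also have "\<dots> = \<zero>\<^bsub>hecke 0\<^esub>" using eq cls.hom_one[of 0] by simp
  also have "\<dots> = hecke_ideal 0" by (simp add: hecke_def FactRing_def)
  finally have "\<one>\<^bsub>free_algebra 0\<^esub> = \<zero>\<^bsub>free_algebra 0\<^esub>" using I by blast
  from fun_cong[OF this, of "[]"] show False by (simp add: free_algebra_def)
qed

instantiation hecke_product :: ring_1
begin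

lift_definition zero_hecke_product :: hecke_product is "\<lambda>n. \<zero>\<^bsub>hecke n\<^esub>" by simp
lift_definition one_hecke_product :: hecke_product is "\<lambda>n. \<one>\<^bsub>hecke n\<^esub>" by simp
lift_definition plus_hecke_product :: "hecke_product \<Rightarrow> hecke_product \<Rightarrow> hecke_product"
  is "\<lambda>x y n. x n \<oplus>\<^bsub>hecke n\<^esub> y n" by simp
lift_definition uminus_hecke_product :: "hecke_product \<Rightarrow> hecke_product"
  is "\<lambda>x n. \<ominus>\<^bsub>hecke n\<^esub> x n" by simp
lift_definition minus_hecke_product :: "hecke_product \<Rightarrow> hecke_product \<Rightarrow> hecke_product"
  is "\<lambda>x y n. x n \<ominus>\<^bsub>hecke n\<^esub> y n" by simp
lift_definition times_hecke_product :: "hecke_product \<Rightarrow> hecke_product \<Rightarrow> hecke_product"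
  is "\<lambda>x y n. x n \<otimes>\<^bsub>hecke n\<^esub> y n" by simp

instance
proof
  fix x y z :: hecke_product
  show "x * y * z = x * (y * z)" by transfer (auto simp: hecke.m_assoc)
  show "1 * x = x" "x * 1 = x" by (transfer, auto)+
  show "x + y + z = x + (y + z)" by transfer (auto simp: hecke.a_assoc)
  show "x + y = y + x" by transfer (auto simp: hecke.a_comm)
  show "0 + x = x" by transfer auto
  show "- x + x = 0" by transfer (auto simp: hecke.l_neg)
  show "x - y = x + - y" by transfer (auto simp: a_minus_def)
  show "(x + y) * z = x * z + y * z" by transfer (auto simp: hecke.l_distr)
  show "x * (y + z) = x * y + x * z" by transfer (auto simp: hecke.r_distr)
  show "(0::hecke_product) \<noteq> 1"
  proof
    assume "(0::hecke_product) = 1"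
    then have "component 0 0 = component 1 0" by simp
    then show False using hecke_zero_ne_one by (simp add: zero_hecke_product.rep_eq one_hecke_product.rep_eq)
  qed
qed

end

lemmas component_simps [simp] = zero_hecke_product.rep_eq one_hecke_product.rep_eq plus_hecke_product.rep_eq
  uminus_hecke_product.rep_eq minus_hecke_product.rep_eq times_hecke_product.rep_eq

lift_definition embed :: "nat \<Rightarrow> (nat list \<Rightarrow> Kq) set \<Rightarrow> hecke_product"
  is "\<lambda>n x m. if m = n \<and> x \<in> carrier (hecke n) then x else \<zero>\<^bsub>hecke m\<^esub>" by simp

lift_definition scalar :: "Kq \<Rightarrow> hecke_product" is "\<lambda>c n. hecke_class n (free_scalar c)"
  by (simp add: free_scalar_carrier)

definition unit_elt :: "nat \<Rightarrow> hecke_product" where "unit_elt n = embed n \<one>\<^bsub>hecke n\<^esub>"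
definition gen_elt :: "nat \<Rightarrow> nat \<Rightarrow> hecke_product" where "gen_elt n i = embed n (sigma n i)"
definition incl_elt :: "nat \<Rightarrow> hecke_product \<Rightarrow> hecke_product" where
  "incl_elt n x = embed (Suc n) (hecke_incl n (component x n))"

lemma component_embed: "x \<in> carrier (hecke n) \<Longrightarrow> component (embed n x) m = (if m = n then x else \<zero>\<^bsub>hecke m\<^esub>)"
  by (simp add: embed.rep_eq)

lemma component_unit [simp]: "component (unit_elt n) m = (if m = n then \<one>\<^bsub>hecke m\<^esub> else \<zero>\<^bsub>hecke m\<^esub>)"
  by (simp add: unit_elt_def component_embed)

lemma component_scalar [simp]: "component (scalar c) n = hecke_class n (free_scalar c)"
  by (rule scalar.rep_eq[THEN fun_cong])

lemma sigma_carrier: "1 \<le> i \<Longrightarrow> i < n \<Longrightarrow> sigma n i \<in> carrier (hecke n)"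
  by (simp add: sigma_def free_gen_carrier)

lemma component_gen: "1 \<le> i \<Longrightarrow> i < n \<Longrightarrow> component (gen_elt n i) m = (if m = n then sigma n i else \<zero>\<^bsub>hecke m\<^esub>)"
  by (simp add: gen_elt_def component_embed sigma_carrier)

lemma class_cases:
  assumes "x \<in> carrier (hecke n)"
  obtains f where "f \<in> carrier (free_algebra n)" "x = hecke_class n f"
  using assms by (auto simp: hecke_carrier)

lemma hecke_incl_carrier: "x \<in> carrier (hecke n) \<Longrightarrow> hecke_incl n x \<in> carrier (hecke (Suc n))"
  by (auto elim!: class_cases simp: hecke_incl_class free_algebra_carrier_mono)

lemma component_incl [simp]:
  "component (incl_elt n x) m = (if m = Suc n then hecke_incl n (component x n) else \<zero>\<^bsub>hecke m\<^esub>)"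
  by (simp add: incl_elt_def component_embed hecke_incl_carrier)

lemma hecke_incl_add:
  assumes "x \<in> carrier (hecke n)" "y \<in> carrier (hecke n)"
  shows "hecke_incl n (x \<oplus>\<^bsub>hecke n\<^esub> y) = hecke_incl n x \<oplus>\<^bsub>hecke (Suc n)\<^esub> hecke_incl n y"
proof -
  obtain f g where f: "f \<in> carrier (free_algebra n)" "x = hecke_class n f" and g: "g \<in> carrier (free_algebra n)" "y = hecke_class n g"
    using assms by (auto elim!: class_cases)
  have "x \<oplus>\<^bsub>hecke n\<^esub> y = hecke_class n (f \<oplus>\<^bsub>free_algebra n\<^esub> g)" using f g by simp
  then have "hecke_incl n (x \<oplus>\<^bsub>hecke n\<^esub> y) = hecke_class (Suc n) (f \<oplus>\<^bsub>free_algebra n\<^esub> g)"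
    using hecke_incl_class[OF free.a_closed[OF f(1) g(1)]] by (simp only:)
  also have "f \<oplus>\<^bsub>free_algebra n\<^esub> g = f \<oplus>\<^bsub>free_algebra (Suc n)\<^esub> g"
    by (simp add: free_algebra_def)
  finally show ?thesis using f g by (simp add: hecke_incl_class free_algebra_carrier_mono)
qed

lemma hecke_incl_mult:
  assumes "x \<in> carrier (hecke n)" "y \<in> carrier (hecke n)"
  shows "hecke_incl n (x \<otimes>\<^bsub>hecke n\<^esub> y) = hecke_incl n x \<otimes>\<^bsub>hecke (Suc n)\<^esub> hecke_incl n y"
proof -
  obtain f g where f: "f \<in> carrier (free_algebra n)" "x = hecke_class n f" and g: "g \<in> carrier (free_algebra n)" "y = hecke_class n g"
    using assms by (auto elim!: class_cases)
  have "x \<otimes>\<^bsub>hecke n\<^esub> y = hecke_class n (f \<otimes>\<^bsub>free_algebra n\<^esub> g)" using f g by simp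
  then have "hecke_incl n (x \<otimes>\<^bsub>hecke n\<^esub> y) = hecke_class (Suc n) (f \<otimes>\<^bsub>free_algebra n\<^esub> g)"
    using hecke_incl_class[OF free.m_closed[OF f(1) g(1)]] by (simp only:)
  also have "f \<otimes>\<^bsub>free_algebra n\<^esub> g = f \<otimes>\<^bsub>free_algebra (Suc n)\<^esub> g"
    by (simp add: free_algebra_def)
  finally show ?thesis using f g by (simp add: hecke_incl_class free_algebra_carrier_mono)
qed

lemma hecke_incl_one: "hecke_incl n \<one>\<^bsub>hecke n\<^esub> = \<one>\<^bsub>hecke (Suc n)\<^esub>"
proof -
  have "hecke_incl n \<one>\<^bsub>hecke n\<^esub> = hecke_incl n (hecke_class n \<one>\<^bsub>free_algebra n\<^esub>)" by simp
  also have "\<dots> = hecke_class (Suc n) \<one>\<^bsub>free_algebra n\<^esub>" by (rule hecke_incl_class) simp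
  also have "\<one>\<^bsub>free_algebra n\<^esub> = \<one>\<^bsub>free_algebra (Suc n)\<^esub>" by (simp add: free_algebra_def)
  finally show ?thesis by simp
qed

lemma hecke_incl_sigma: "1 \<le> i \<Longrightarrow> i < n \<Longrightarrow> hecke_incl n (sigma n i) = sigma (Suc n) i"
  by (simp add: sigma_def hecke_incl_class free_gen_carrier)

lemma free_scalar_ops:
  "free_scalar (c + d) = free_scalar c \<oplus>\<^bsub>free_algebra n\<^esub> free_scalar d"
  "free_scalar (c * d) = free_scalar c \<otimes>\<^bsub>free_algebra n\<^esub> free_scalar d"
  "free_scalar 1 = \<one>\<^bsub>free_algebra n\<^esub>"
proof -
  show "free_scalar (c * d) = free_scalar c \<otimes>\<^bsub>free_algebra n\<^esub> free_scalar d"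
  proof
    fix w :: "nat list"
    have "(free_scalar c \<otimes>\<^bsub>free_algebra n\<^esub> free_scalar d) w = (\<Sum>k\<le>length w. if k = 0 then (if w = [] then c * d else 0) else 0)"
      unfolding free_algebra_def monoid.simps by (rule sum.cong) (auto simp: free_scalar_def)
    then show "free_scalar (c * d) w = (free_scalar c \<otimes>\<^bsub>free_algebra n\<^esub> free_scalar d) w"
      by (simp add: free_scalar_def)
  qed
qed (auto simp: free_scalar_def free_algebra_def)

lemma free_scalar_comm: "f \<otimes>\<^bsub>free_algebra n\<^esub> free_scalar c = free_scalar c \<otimes>\<^bsub>free_algebra n\<^esub> f"
proof
  fix w :: "nat list"
  have "(free_scalar c \<otimes>\<^bsub>free_algebra n\<^esub> f) w = (\<Sum>k\<le>length w. if k = 0 then c * f w else 0)"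
    unfolding free_algebra_def monoid.simps by (rule sum.cong) (auto simp: free_scalar_def)
  moreover have "(f \<otimes>\<^bsub>free_algebra n\<^esub> free_scalar c) w = (\<Sum>k\<le>length w. if k = length w then c * f w else 0)"
    unfolding free_algebra_def monoid.simps by (rule sum.cong) (auto simp: free_scalar_def)
  ultimately show "(f \<otimes>\<^bsub>free_algebra n\<^esub> free_scalar c) w = (free_scalar c \<otimes>\<^bsub>free_algebra n\<^esub> f) w" by simp
qed

lemma hecke_incl_scalar: "hecke_incl n (hecke_class n (free_scalar c)) = hecke_class (Suc n) (free_scalar c)"
  by (simp add: hecke_incl_class free_scalar_carrier)

lemma scalar_add: "scalar (c + d) = scalar c + scalar d"
proof (rule hecke_product_eqI)
  fix n
  show "component (scalar (c + d)) n = component (scalar c + scalar d) n"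
    using free_scalar_ops(1)[where c = c and d = d and n = n] by (simp add: free_scalar_carrier)
qed

lemma scalar_mult: "scalar (c * d) = scalar c * scalar d"
proof (rule hecke_product_eqI)
  fix n
  show "component (scalar (c * d)) n = component (scalar c * scalar d) n"
    using free_scalar_ops(2)[where c = c and d = d and n = n] by (simp add: free_scalar_carrier)
qed

lemma scalar_one: "scalar 1 = 1"
proof (rule hecke_product_eqI)
  fix n
  show "component (scalar 1) n = component (1) n"
    using free_scalar_ops(3)[where n = n] by (simp add: free_scalar_carrier)
qed

lemma scalar_comm: "x * scalar c = scalar c * x"
proof (rule hecke_product_eqI)
  fix n
  obtain f where f: "f \<in> carrier (free_algebra n)" "component x n = hecke_class n f"
    by (rule class_cases[OF component_carrier])
  then show "component (x * scalar c) n = component (scalar c * x) n"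
    using free_scalar_comm[where f = f and n = n and c = c] by (simp add: free_scalar_carrier flip: cls.hom_mult)
qed

lemma component_in_corner: "unit_elt n * x = x \<Longrightarrow> m \<noteq> n \<Longrightarrow> component x m = \<zero>\<^bsub>hecke m\<^esub>"
proof -
  assume "unit_elt n * x = x" "m \<noteq> n"
  then have "component x m = component (unit_elt n * x) m" by simp
  then show ?thesis using \<open>m \<noteq> n\<close> by simp
qed

lemma corner_eq_embed: "unit_elt n * x = x \<Longrightarrow> x = embed n (component x n)"
  by (rule hecke_product_eqI) (simp add: component_embed component_in_corner)

text \<open>An element of H_n is the class of a finite combination of words, and a word grows by
  appending letters on the right. This supplies the assumption \<open>span\<close> of the
  tower.\<close>

lemma hecke_product_corner_induct:
  assumes x: "unit_elt n * x = x"
    and sc: "\<And>c. Q (scalar c * unit_elt n)"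
    and add: "\<And>x y. Q x \<Longrightarrow> Q y \<Longrightarrow> Q (x + y)"
    and gen: "\<And>x i. unit_elt n * x = x \<Longrightarrow> Q x \<Longrightarrow> 1 \<le> i \<Longrightarrow> i < n \<Longrightarrow> Q (x * gen_elt n i)"
  shows "Q x"
proof -
  define hc where "hc f = embed n (hecke_class n f)" for f
  define single where "single w c = (\<lambda>v. if v = w then c else 0)" for w :: "nat list" and c :: Kq
  have single_carrier: "set w \<subseteq> {1..<n} \<Longrightarrow> single w c \<in> carrier (free_algebra n)" for w c
    by (auto simp: single_def free_algebra_def)
  have hc_corner: "f \<in> carrier (free_algebra n) \<Longrightarrow> unit_elt n * hc f = hc f" for f
    by (rule hecke_product_eqI) (simp add: hc_def component_embed)
  have Q_single: "set w \<subseteq> {1..<n} \<Longrightarrow> Q (hc (single w c))" for w c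
  proof (induction w rule: rev_induct)
    case Nil
    have "hc (single [] c) = scalar c * unit_elt n"
      by (rule hecke_product_eqI) (auto simp: hc_def component_embed single_def free_scalar_def free_scalar_carrier[unfolded free_scalar_def])
    then show ?case using sc by simp
  next
    case (snoc i w)
    have i: "1 \<le> i" "i < n" "set w \<subseteq> {1..<n}" using snoc.prems by auto
    have "single (w @ [i]) c = single w c \<otimes>\<^bsub>free_algebra n\<^esub> free_gen i"
    proof
      fix v
      have "(single w c \<otimes>\<^bsub>free_algebra n\<^esub> free_gen i) v =
          (\<Sum>k\<le>length v. if k = length w then (if v = w @ [i] then c else 0) else 0)"
        unfolding free_algebra_def monoid.simps
      proof (rule sum.cong)
        fix k assume "k \<in> {..length v}"
        then show "single w c (take k v) * free_gen i (drop k v) = (if k = length w then (if v = w @ [i] then c else 0) else 0)"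
          by (auto simp: single_def free_gen_def) (metis append_take_drop_id)+
      qed simp
      also have "\<dots> = single (w @ [i]) c v" by (auto simp: single_def)
      finally show "single (w @ [i]) c v = (single w c \<otimes>\<^bsub>free_algebra n\<^esub> free_gen i) v" ..
    qed
    then have "hc (single (w @ [i]) c) = hc (single w c) * gen_elt n i"
      using i by (intro hecke_product_eqI) (simp add: hc_def component_embed component_gen sigma_def single_carrier free_gen_carrier)
    then show ?case using gen[OF hc_corner[OF single_carrier[OF i(3)]]] snoc i by simp
  qed
  have Q_hc: "f \<in> carrier (free_algebra n) \<Longrightarrow> Q (hc f)" for f
  proof -
    \<comment> \<open>\<open>W\<close> is a finite superset of the support, so that erasing one
      coefficient of \<open>f\<close> fits the induction hypothesis.\<close>
    have "finite W \<Longrightarrow> {w. f w \<noteq> 0} \<subseteq> W \<Longrightarrow> f \<in> carrier (free_algebra n) \<Longrightarrow> Q (hc f)" for W f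
    proof (induction W arbitrary: f rule: finite_induct)
      case empty
      then have "f = single [] 0" by (auto simp: single_def)
      then show ?case using Q_single[of "[]" 0] by simp
    next
      case (insert w W)
      show ?case
      proof (cases "f w = 0")
        case True
        then show ?thesis using insert by auto
      next
        case False
        then have w: "set w \<subseteq> {1..<n}" using insert.prems by (simp add: free_algebra_def)
        let ?g = "f(w := 0)"
        have g: "?g \<in> carrier (free_algebra n)"
        proof -
          have "{v. ?g v \<noteq> 0} \<subseteq> {v. f v \<noteq> 0}" by auto
          then show ?thesis using insert.prems(2) by (auto simp: free_algebra_def intro: finite_subset)
        qed
        have "f = single w (f w) \<oplus>\<^bsub>free_algebra n\<^esub> ?g" by (auto simp: single_def free_algebra_def)
        then have "hc f = hc (single w (f w) \<oplus>\<^bsub>free_algebra n\<^esub> ?g)" by simp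
        also have "\<dots> = hc (single w (f w)) + hc ?g"
          using g single_carrier[OF w] by (intro hecke_product_eqI) (simp add: hc_def component_embed)
        finally have hf: "hc f = hc (single w (f w)) + hc ?g" .
        have "{v. ?g v \<noteq> 0} \<subseteq> W" using insert.prems(1) by auto
        from add[OF Q_single[OF w] insert.IH[OF this g]] show ?thesis unfolding hf .
      qed
    qed
    then show "f \<in> carrier (free_algebra n) \<Longrightarrow> Q (hc f)" by (auto simp: free_algebra_def)
  qed
  obtain f where f: "f \<in> carrier (free_algebra n)" "component x n = hecke_class n f"
    by (rule class_cases[OF component_carrier])
  then have "x = hc f" using corner_eq_embed[OF x] by (simp add: hc_def)
  then show ?thesis using Q_hc[OF f(1)] by simp
qed

section \<open>Constants and the indeterminate in fields of rational functions\<close>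

lemma const_fract_add: "const_fract (c + d) = const_fract c + const_fract d"
  by (simp add: const_fract_def)

lemma const_fract_mult: "const_fract (c * d) = const_fract c * const_fract d"
  by (simp add: const_fract_def mult.commute)

lemma const_fract_1: "const_fract 1 = 1"
  by (simp add: const_fract_def One_fract_def one_pCons)

lemma indet_power: "(indet :: 'a::field poly fract) ^ k = Fract (Polynomial.monom 1 k) 1"
proof (induction k)
  case (Suc k)
  then have "indet ^ Suc k = indet * Fract (Polynomial.monom (1::'a) k) 1" by simp
  also have "\<dots> = Fract (Polynomial.monom 1 (Suc k)) 1" by (simp add: indet_def Polynomial.monom_Suc)
  finally show ?case .
qed (simp add: One_fract_def)

lemma indet_power_ne_1: "0 < k \<Longrightarrow> (indet :: 'a::field poly fract) ^ k \<noteq> 1"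
proof
  assume k: "0 < k" and "(indet :: 'a poly fract) ^ k = 1"
  then have "Polynomial.monom (1::'a) k = 1" by (simp add: indet_power One_fract_def eq_fract)
  then have "degree (Polynomial.monom (1::'a) k) = 0" by simp
  then show False using k by (simp add: degree_monom_eq)
qed

lemma indet_ne_0: "(indet :: 'a::field poly fract) \<noteq> 0"
  by (simp add: indet_def Zero_fract_def eq_fract)

lemma indet_nonroot:
  assumes "0 < k" "((indet :: 'a::field poly fract) ^ k) powi z = 1"
  shows "z = 0"
proof (rule ccontr)
  assume z: "z \<noteq> 0"
  have "(indet :: 'a poly fract) ^ (k * nat \<bar>z\<bar>) = 1"
  proof (cases "z \<ge> 0")
    case True
    then show ?thesis using assms(2) by (simp add: power_int_def power_mult)
  next
    case False
    then have "inverse ((indet ^ k :: 'a poly fract) ^ nat (- z)) = 1"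
      using assms(2) by (simp add: power_int_def power_inverse)
    then show ?thesis using False by (simp add: power_mult)
  qed
  then show False using indet_power_ne_1[of "k * nat \<bar>z\<bar>"] z assms(1) by auto
qed

lemma foldr_component:
  assumes "set xs \<subseteq> {1..<n}"
  shows "component (foldr (\<lambda>i x. S i * x) xs 1) n =
    foldr (\<lambda>i x. component (S i) n \<otimes>\<^bsub>hecke n\<^esub> x) xs \<one>\<^bsub>hecke n\<^esub>"
  by (induction xs) auto

lemma power_component: "component (x ^ k) n = component x n [^]\<^bsub>hecke n\<^esub> k"
proof (induction k)
  case (Suc k)
  have "component (x ^ Suc k) n = component (x ^ k * x) n" by (simp only: power_Suc2)
  then show ?case using Suc by (simp add: hecke.nat_pow_Suc)
qed simp

lemma sum_component: "finite A \<Longrightarrow> component (sum f A) n = (\<Oplus>\<^bsub>hecke n\<^esub> a \<in> A. component (f a) n)"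
  by (induction A rule: finite_induct) (simp_all add: hecke.finsum_insert)

text \<open>The generator continued by units in the other factors, so that words and powers in it
  are formed with the unit of the whole product.\<close>

lift_definition gen_full :: "nat \<Rightarrow> nat \<Rightarrow> hecke_product"
  is "\<lambda>n i m. if m = n \<and> 1 \<le> i \<and> i < n then sigma n i else \<one>\<^bsub>hecke m\<^esub>"
  by (auto simp: sigma_carrier)

lemma component_gen_full: "1 \<le> i \<Longrightarrow> i < n \<Longrightarrow> component (gen_full n i) m = (if m = n then sigma n i else \<one>\<^bsub>hecke m\<^esub>)"
  by (simp add: gen_full.rep_eq)

lemma full_twist_component:
  assumes "k \<le> n"
  shows "component (asc_word (gen_full n) k ^ k) n = full_twist n k"
proof -
  have "foldr (\<lambda>i x. component (gen_full n i) n \<otimes>\<^bsub>hecke n\<^esub> x) [1..<k] \<one>\<^bsub>hecke n\<^esub> =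
      foldr (\<lambda>i x. sigma n i \<otimes>\<^bsub>hecke n\<^esub> x) [1..<k] \<one>\<^bsub>hecke n\<^esub>"
    by (rule foldr_cong) (use assms in \<open>auto simp: component_gen_full\<close>)
  moreover have "set [1..<k] \<subseteq> {1..<n}" using assms by auto
  ultimately show ?thesis
    using foldr_component[of "[1..<k]" n "gen_full n"] by (simp add: power_component asc_word_def full_twist_def)
qed

lemma a_minus_eq_zero_D:
  assumes "x \<in> carrier (hecke n)" "y \<in> carrier (hecke n)" "x \<ominus>\<^bsub>hecke n\<^esub> y = \<zero>\<^bsub>hecke n\<^esub>"
  shows "x = y"
proof -
  have "x = x \<oplus>\<^bsub>hecke n\<^esub> (\<ominus>\<^bsub>hecke n\<^esub> y \<oplus>\<^bsub>hecke n\<^esub> y)" using assms by (simp add: hecke.l_neg)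
  also have "\<dots> = (x \<ominus>\<^bsub>hecke n\<^esub> y) \<oplus>\<^bsub>hecke n\<^esub> y"
    unfolding a_minus_def using assms by (simp add: hecke.a_assoc)
  finally show ?thesis using assms by simp
qed

lemma sigma_braid:
  assumes "1 \<le> i" "i + 1 < n"
  shows "sigma n i \<otimes>\<^bsub>hecke n\<^esub> sigma n (i + 1) \<otimes>\<^bsub>hecke n\<^esub> sigma n i =
    sigma n (i + 1) \<otimes>\<^bsub>hecke n\<^esub> sigma n i \<otimes>\<^bsub>hecke n\<^esub> sigma n (i + 1)"
proof (rule a_minus_eq_zero_D)
  have g: "free_gen i \<in> carrier (free_algebra n)" "free_gen (i + 1) \<in> carrier (free_algebra n)"
    using assms by (auto intro: free_gen_carrier)
  let ?r = "(free_gen i \<otimes>\<^bsub>free_algebra n\<^esub> free_gen (i + 1) \<otimes>\<^bsub>free_algebra n\<^esub> free_gen i) \<ominus>\<^bsub>free_algebra n\<^esub>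
    (free_gen (i + 1) \<otimes>\<^bsub>free_algebra n\<^esub> free_gen i \<otimes>\<^bsub>free_algebra n\<^esub> free_gen (i + 1))"
  have "?r \<in> hecke_relators n" unfolding hecke_relators_def Let_def using assms by blast
  from relator_class[OF this] show "sigma n i \<otimes>\<^bsub>hecke n\<^esub> sigma n (i + 1) \<otimes>\<^bsub>hecke n\<^esub> sigma n i \<ominus>\<^bsub>hecke n\<^esub>
     sigma n (i + 1) \<otimes>\<^bsub>hecke n\<^esub> sigma n i \<otimes>\<^bsub>hecke n\<^esub> sigma n (i + 1) = \<zero>\<^bsub>hecke n\<^esub>"
    using g by (simp add: a_minus_def sigma_def)
qed (use assms in \<open>auto intro!: hecke.m_closed sigma_carrier\<close>)

lemma sigma_far:
  assumes "1 \<le> i" "i + 2 \<le> j" "j < n"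
  shows "sigma n i \<otimes>\<^bsub>hecke n\<^esub> sigma n j = sigma n j \<otimes>\<^bsub>hecke n\<^esub> sigma n i"
proof (rule a_minus_eq_zero_D)
  have g: "free_gen i \<in> carrier (free_algebra n)" "free_gen j \<in> carrier (free_algebra n)"
    using assms by (auto intro: free_gen_carrier)
  let ?r = "(free_gen i \<otimes>\<^bsub>free_algebra n\<^esub> free_gen j) \<ominus>\<^bsub>free_algebra n\<^esub> (free_gen j \<otimes>\<^bsub>free_algebra n\<^esub> free_gen i)"
  have "?r \<in> hecke_relators n" unfolding hecke_relators_def Let_def using assms by blast
  from relator_class[OF this] show "sigma n i \<otimes>\<^bsub>hecke n\<^esub> sigma n j \<ominus>\<^bsub>hecke n\<^esub> sigma n j \<otimes>\<^bsub>hecke n\<^esub> sigma n i = \<zero>\<^bsub>hecke n\<^esub>"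
    using g by (simp add: a_minus_def sigma_def)
qed (use assms in \<open>auto intro!: hecke.m_closed sigma_carrier\<close>)

lemma sigma_quad:
  assumes "1 \<le> i" "i < n"
  shows "(sigma n i \<ominus>\<^bsub>hecke n\<^esub> hecke_class n (free_scalar qhalf)) \<otimes>\<^bsub>hecke n\<^esub>
    (sigma n i \<oplus>\<^bsub>hecke n\<^esub> hecke_class n (free_scalar (inverse qhalf))) = \<zero>\<^bsub>hecke n\<^esub>"
proof -
  have g: "free_gen i \<in> carrier (free_algebra n)" using assms by (rule free_gen_carrier)
  let ?r = "(free_gen i \<ominus>\<^bsub>free_algebra n\<^esub> free_scalar qhalf) \<otimes>\<^bsub>free_algebra n\<^esub> (free_gen i \<oplus>\<^bsub>free_algebra n\<^esub> free_scalar (inverse qhalf))"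
  have "?r \<in> hecke_relators n" unfolding hecke_relators_def Let_def using assms by blast
  from relator_class[OF this] show ?thesis
    using g by (simp add: a_minus_def sigma_def free_scalar_carrier)
qed

lemma unit_elt_jucys_murphy:
  "k < n \<Longrightarrow> unit_elt n * jucys_murphy 1 (gen_full n) (Suc k) = jucys_murphy (unit_elt n) (gen_elt n) (Suc k)"
proof (induction k)
  case (Suc k)
  have g: "unit_elt n * gen_full n (Suc k) = gen_elt n (Suc k)" "gen_full n (Suc k) * unit_elt n = gen_elt n (Suc k)"
    using Suc.prems by (auto intro!: hecke_product_eqI simp: component_gen_full component_gen sigma_carrier)
  have c: "unit_elt n * x = x * unit_elt n" for x by (rule hecke_product_eqI) simp
  have i: "unit_elt n * unit_elt n = unit_elt n" by (rule hecke_product_eqI) simp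
  let ?j = "jucys_murphy 1 (gen_full n) (Suc k)" and ?g = "gen_full n (Suc k)"
  have "gen_elt n (Suc k) * (unit_elt n * ?j) * gen_elt n (Suc k) =
      unit_elt n * ?g * (unit_elt n * ?j) * (unit_elt n * ?g)" by (simp only: g)
  also have "\<dots> = unit_elt n * ?g * (unit_elt n * (?j * unit_elt n)) * ?g" by (simp only: mult.assoc)
  also have "?j * unit_elt n = unit_elt n * ?j" by (simp only: c)
  also have "unit_elt n * (unit_elt n * ?j) = unit_elt n * ?j" by (simp only: i flip: mult.assoc)
  also have "unit_elt n * ?g * (unit_elt n * ?j) * ?g = unit_elt n * (?g * unit_elt n) * ?j * ?g" by (simp only: mult.assoc)
  also have "?g * unit_elt n = unit_elt n * ?g" by (simp only: c)
  also have "unit_elt n * (unit_elt n * ?g) = unit_elt n * ?g" by (simp only: i flip: mult.assoc)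
  finally show ?case using Suc by (simp add: mult.assoc)
qed simp

lemma scalar_left: "x * (scalar c * y) = scalar c * (x * y)"
  by (simp only: mult.assoc[symmetric] scalar_comm[of x])

section \<open>The concrete Hecke algebras as an instance of the tower\<close>

locale traced_idempotents =
  fixes \<chi> :: "nat \<Rightarrow> (nat list \<Rightarrow> Kq) set \<Rightarrow> Kqa" and p :: "box list \<Rightarrow> (nat list \<Rightarrow> Kq) set"
  assumes trace: "markov_trace \<chi>" and idem: "hecke_idempotents p"
begin

definition p_elt :: "box list \<Rightarrow> hecke_product" where "p_elt T = embed (length T) (p T)"

lemma p_carrier: "standard_tableau T \<Longrightarrow> p T \<in> carrier (hecke (length T))"
  using idem unfolding hecke_idempotents_def Let_def by blast

lemma component_p: "standard_tableau T \<Longrightarrow> component (p_elt T) m = (if m = length T then p T else \<zero>\<^bsub>hecke m\<^esub>)"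
  by (simp add: p_elt_def component_embed p_carrier)

lemma p_elt_orth:
  assumes "standard_tableau T" "standard_tableau T'" "length T = length T'"
  shows "p_elt T * p_elt T' = (if T = T' then p_elt T else 0)"
proof (rule hecke_product_eqI)
  fix m
  have "p T \<otimes>\<^bsub>hecke (length T)\<^esub> p T' = (if T = T' then p T else \<zero>\<^bsub>hecke (length T)\<^esub>)"
    using idem assms unfolding hecke_idempotents_def Let_def by auto
  then show "component (p_elt T * p_elt T') m = component (if T = T' then p_elt T else 0) m"
    using assms by (cases "T = T'") (simp_all add: component_p p_carrier)
qed

lemma p_elt_sum: "(\<Sum>T\<in>tableaux_of_size n. p_elt T) = unit_elt n"
proof (rule hecke_product_eqI)
  fix m
  have s: "(\<Oplus>\<^bsub>hecke n\<^esub> T \<in> tableaux_of_size n. p T) = \<one>\<^bsub>hecke n\<^esub>"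
    using idem unfolding hecke_idempotents_def Let_def by blast
  have "component (\<Sum>T\<in>tableaux_of_size n. p_elt T) m = (\<Oplus>\<^bsub>hecke m\<^esub> T \<in> tableaux_of_size n. component (p_elt T) m)"
    by (rule sum_component[OF finite_tableaux_of_size])
  also have "\<dots> = (\<Oplus>\<^bsub>hecke m\<^esub> T \<in> tableaux_of_size n. if m = n then p T else \<zero>\<^bsub>hecke m\<^esub>)"
    by (rule hecke.finsum_cong') (auto simp: component_p p_carrier)
  also have "\<dots> = component (unit_elt n) m"
    using s by (cases "m = n") (simp_all add: hecke.finsum_zero)
  finally show "component (\<Sum>T\<in>tableaux_of_size n. p_elt T) m = component (unit_elt n) m" .
qed

lemma p_elt_mem: "standard_tableau T \<Longrightarrow> unit_elt (length T) * p_elt T = p_elt T"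
  by (rule hecke_product_eqI) (simp add: component_p p_carrier)

lemma twist_p_elt:
  assumes T: "standard_tableau T" and k: "k \<le> length T"
  shows "asc_word (gen_full (length T)) k ^ k * p_elt T =
    scalar ((qhalf\<^sup>2) powi (\<Sum>i<k. box_content (T ! i))) * p_elt T"
proof (cases "k = 0")
  case True
  then show ?thesis by (simp add: scalar_one)
next
  case False
  let ?n = "length T"
  have "full_twist ?n k \<otimes>\<^bsub>hecke ?n\<^esub> p T =
      hecke_scale ?n ((qhalf\<^sup>2) powi (\<Sum>i<k. box_content (T ! i))) (p T)"
    using idem T k False unfolding hecke_idempotents_def Let_def by auto
  then show ?thesis using full_twist_component[OF k] T
    by (intro hecke_product_eqI) (simp add: component_p hecke_scale_def free_scalar_carrier)
qed

text \<open>The full twists FT_(k+1) = FT_k J_(k+1) and FT_k have known eigenvalues on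
  \<open>p_elt T\<close>, so FT_k annihilates the defect \<open>z\<close> of the claim. The twist
  FT_k acts by a nonzero scalar on each idempotent, hence every idempotent annihilates
  \<open>z\<close>, and they sum up to the unit.\<close>

lemma p_elt_jm:
  assumes T: "standard_tableau T" and k: "k < length T"
  shows "jucys_murphy (unit_elt (length T)) (gen_elt (length T)) (Suc k) * p_elt T =
    scalar ((qhalf\<^sup>2) powi box_content (T ! k)) * p_elt T"
proof -
  let ?n = "length T" and ?q = "qhalf\<^sup>2"
  let ?S = "gen_full ?n"
  let ?F = "\<lambda>k. asc_word ?S k ^ k" and ?c = "\<lambda>T k. ?q powi (\<Sum>i<k. box_content (T ! i))"
  have q0: "?q \<noteq> 0" using indet_ne_0 by (simp add: qhalf_def)
  have braid: "?S i * ?S (i + 1) * ?S i = ?S (i + 1) * ?S i * ?S (i + 1)" if "1 \<le> i" "i + 1 < ?n" for i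
    using that sigma_braid[OF that] by (intro hecke_product_eqI) (simp add: component_gen_full)
  have far: "?S i * ?S j = ?S j * ?S i" if "1 \<le> i" "i + 2 \<le> j" "j < ?n" for i j
    using that sigma_far[OF that] by (intro hecke_product_eqI) (simp add: component_gen_full)
  have F: "?F (Suc k) = ?F k * jucys_murphy 1 ?S (Suc k)" 
    by (rule full_twist_Suc[where N = ?n, OF _ _ k]) (use braid far in blast)+
  define z where "z = jucys_murphy 1 ?S (Suc k) * p_elt T - scalar (?q powi box_content (T ! k)) * p_elt T"
  have ez: "unit_elt ?n * z = z"
  proof -
    have c: "unit_elt ?n * x = x * unit_elt ?n" for x by (rule hecke_product_eqI) simp
    have "z * unit_elt ?n = z" unfolding z_def using p_elt_mem[OF T] c[of "p_elt T"]
      by (simp add: left_diff_distrib mult.assoc)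
    then show ?thesis by (simp only: c)
  qed
  have "?F k * (scalar (?q powi box_content (T ! k)) * p_elt T) =
      scalar (?q powi box_content (T ! k)) * (?F k * p_elt T)"
    by (rule scalar_left)
  also have "\<dots> = scalar (?q powi box_content (T ! k) * ?c T k) * p_elt T"
    using twist_p_elt[OF T, of k] k by (simp add: scalar_mult mult.assoc)
  also have "?q powi box_content (T ! k) * ?c T k = ?c T (Suc k)"
    using q0 by (simp add: power_int_add)
  also have "scalar (?c T (Suc k)) * p_elt T = ?F (Suc k) * p_elt T"
    using twist_p_elt[OF T, of "Suc k"] k by simp
  finally have "?F k * z = 0" by (simp add: z_def right_diff_distrib F mult.assoc del: power_Suc)
  \<comment> \<open>The unit in front of \<open>z\<close> is split into all idempotents, each an
    eigenvector of the twist.\<close>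
  moreover have "?F k * z = (\<Sum>U\<in>tableaux_of_size ?n. scalar (?c U k) * (p_elt U * z))"
  proof -
    have "?F k * z = ?F k * (\<Sum>U\<in>tableaux_of_size ?n. p_elt U) * z"
      using ez by (simp only: p_elt_sum mult.assoc)
    also have "\<dots> = (\<Sum>U\<in>tableaux_of_size ?n. (?F k * p_elt U) * z)"
      by (simp only: sum_distrib_left sum_distrib_right)
    also have "\<dots> = (\<Sum>U\<in>tableaux_of_size ?n. scalar (?c U k) * (p_elt U * z))"
    proof (rule sum.cong)
      fix U assume U: "U \<in> tableaux_of_size ?n"
      then show "(?F k * p_elt U) * z = scalar (?c U k) * (p_elt U * z)"
        using twist_p_elt[of U k] k by (simp add: mult.assoc)
    qed simp
    finally show ?thesis .
  qed
  ultimately have sum0: "(\<Sum>U\<in>tableaux_of_size ?n. scalar (?c U k) * (p_elt U * z)) = 0" by simp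
  have "p_elt V * z = 0" if V: "V \<in> tableaux_of_size ?n" for V
  proof -
    have "0 = p_elt V * (\<Sum>U\<in>tableaux_of_size ?n. scalar (?c U k) * (p_elt U * z))" by (simp add: sum0)
    also have "\<dots> = (\<Sum>U\<in>tableaux_of_size ?n. if U = V then scalar (?c V k) * (p_elt V * z) else 0)"
      unfolding sum_distrib_left
    proof (rule sum.cong)
      fix U assume U: "U \<in> tableaux_of_size ?n"
      have "p_elt V * (scalar (?c U k) * (p_elt U * z)) = scalar (?c U k) * ((p_elt V * p_elt U) * z)"
        by (simp only: scalar_left mult.assoc)
      then show "p_elt V * (scalar (?c U k) * (p_elt U * z)) = (if U = V then scalar (?c V k) * (p_elt V * z) else 0)"
        using p_elt_orth[of V U] U V by auto
    qed simp
    also have "\<dots> = scalar (?c V k) * (p_elt V * z)" using V finite_tableaux_of_size by simp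
    finally have "scalar (inverse (?c V k)) * (scalar (?c V k) * (p_elt V * z)) = 0" by simp
    then have "scalar (inverse (?c V k) * ?c V k) * (p_elt V * z) = 0" by (simp only: scalar_mult mult.assoc)
    then show ?thesis using q0 by (simp add: scalar_one)
  qed
  then have "(\<Sum>V\<in>tableaux_of_size ?n. p_elt V * z) = 0" by (intro sum.neutral) blast
  then have "z = 0" using ez by (simp only: p_elt_sum flip: sum_distrib_right)
  then have 1: "jucys_murphy 1 ?S (Suc k) * p_elt T = scalar (?q powi box_content (T ! k)) * p_elt T"
    by (simp add: z_def)
  have "jucys_murphy (unit_elt ?n) (gen_elt ?n) (Suc k) * p_elt T = unit_elt ?n * (jucys_murphy 1 ?S (Suc k) * p_elt T)"
    by (simp only: unit_elt_jucys_murphy[OF k] mult.assoc[symmetric])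
  also have "\<dots> = scalar (?q powi box_content (T ! k)) * (unit_elt ?n * p_elt T)"
    unfolding 1 by (rule scalar_left)
  finally show ?thesis by (simp only: p_elt_mem[OF T])
qed

sublocale markov_tower scalar qhalf unit_elt gen_elt incl_elt "\<lambda>n x. \<chi> n (component x n)" const_fract avar p_elt
proof (unfold_locales, goal_cases)
  case 1 show ?case by (rule scalar_add)
next
  case 2 show ?case by (rule scalar_mult)
next
  case 3 show ?case by (rule scalar_one)
next
  case 4 show ?case by (rule scalar_comm)
next
  case 5 show ?case by (rule hecke_product_eqI) simp
next
  case 6 show ?case by (rule hecke_product_eqI) simp
next
  case 7 then show ?case by (intro hecke_product_eqI) (simp add: component_gen sigma_carrier)
next
  case (8 i n) then show ?case using sigma_braid[of i n] by (intro hecke_product_eqI) (simp add: component_gen)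
next
  case (9 i j n) then show ?case using sigma_far[of i j n] by (intro hecke_product_eqI) (simp add: component_gen)
next
  case (10 i n) then show ?case using sigma_quad[of i n]
    by (intro hecke_product_eqI) (simp add: component_gen free_scalar_carrier sigma_carrier)
next
  case 11 show ?case by (rule hecke_product_eqI) (simp add: hecke_incl_add)
next
  case 12 show ?case by (rule hecke_product_eqI) (simp add: hecke_incl_mult)
next
  case 13 show ?case by (rule hecke_product_eqI) (simp add: hecke_incl_one)
next
  case 14 show ?case by (rule hecke_product_eqI) (simp add: hecke_incl_mult hecke_incl_scalar free_scalar_carrier)
next
  case 15 show ?case by (rule hecke_product_eqI) (simp add: hecke_incl_carrier)
next
  case 16 then show ?case by (intro hecke_product_eqI) (simp add: component_gen hecke_incl_sigma)
next
  case (17 n x Q) then show ?case by (rule hecke_product_corner_induct)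
next
  case 18 show ?case using trace by (simp add: markov_trace_def)
next
  case (19 n c x)
  have "\<chi> n (hecke_scale n c (component x n)) = const_fract c * \<chi> n (component x n)"
    using trace by (simp add: markov_trace_def)
  then show ?case by (simp add: hecke_scale_def)
next
  case 20 show ?case using trace by (simp add: markov_trace_def)
next
  case 21 show ?case using trace by (simp add: markov_trace_def qhalf_a_def)
next
  case (22 n x)
  then show ?case using trace by (simp add: markov_trace_def component_gen)
next
  case 23 show ?case using trace by (simp add: markov_trace_def)
next
  case 24 show ?case by (rule const_fract_add)
next
  case 25 show ?case by (rule const_fract_mult)
next
  case 26 show ?case by (rule const_fract_1)
next
  case 27 then show ?case by (rule p_elt_mem)
next
  case 28 then show ?case by (rule p_elt_orth)
next
  case 29 show ?case by (rule p_elt_sum)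
next
  case 30 then show ?case by (rule p_elt_jm)
next
  case (31 z) then show ?case using indet_nonroot[of 2 z] by (simp add: qhalf_def)
next
  case 32 show ?case using indet_ne_0 by (simp add: qhalf_def)
qed

end

theorem markov_trace_idempotent:
  assumes "markov_trace \<chi>" "hecke_idempotents p" "standard_tableau T" "length T \<le> L"
  shows "\<chi> (length T) (p T) =
    (\<Prod>i<length T. rfac (qhalf_a\<^sup>2) (qhalf_a - inverse qhalf_a) avar L (set (take i T)) (T ! i))"
proof -
  interpret traced_idempotents \<chi> p by unfold_locales (use assms in auto)
  have "const_fract (qhalf\<^sup>2) = qhalf_a\<^sup>2" "const_fract hq = qhalf_a - inverse qhalf_a"
    by (simp_all only: cst_power H_eq qhalf_a_def)
  then show ?thesis
    using trace_idempotent[OF assms(3,4)] component_p[OF assms(3), of "length T"] by simp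
qed

section \<open>Dependence on the shape only\<close>

lemma young_eq_rows:
  assumes D: "young_diagram D" and L: "card D \<le> L"
  shows "D = (\<lambda>(r, a). (a, r)) ` (SIGMA r:{..<L}. {..<row_len D r})"
proof (intro equalityI subsetI)
  fix c assume c: "c \<in> D"
  have "fst c < row_len D (snd c)" using mem_young_iff[OF D, of "fst c" "snd c"] c by simp
  moreover have "snd c < L"
  proof (rule ccontr)
    assume "\<not> snd c < L"
    then show False using row_len_eq_0[OF D, of "snd c"] L calculation by simp
  qed
  ultimately show "c \<in> (\<lambda>(r, a). (a, r)) ` (SIGMA r:{..<L}. {..<row_len D r})"
    by (intro image_eqI[of _ _ "(snd c, fst c)"]) auto
qed (use mem_young_iff[OF D] in auto)

lemma prod_young:
  fixes f :: "box \<Rightarrow> 'a::comm_monoid_mult"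
  assumes D: "young_diagram D" and L: "card D \<le> L"
  shows "prod f D = (\<Prod>r<L. \<Prod>a<row_len D r. f (a, r))"
proof -
  have "prod f D = prod f ((\<lambda>(r, a). (a, r)) ` (SIGMA r:{..<L}. {..<row_len D r}))"
    using young_eq_rows[OF D L] by simp
  also have "\<dots> = (\<Prod>(r, a)\<in>(SIGMA r:{..<L}. {..<row_len D r}). f (a, r))"
    by (subst prod.reindex) (auto simp: inj_on_def intro!: prod.cong)
  also have "\<dots> = (\<Prod>r<L. \<Prod>a<row_len D r. f (a, r))"
    by (subst prod.Sigma) auto
  finally show ?thesis .
qed

text \<open>The rows below the row of \<open>a\<close> are strictly longer and those above are at
  most as long. No factor of \<open>rfac\<close> vanishes therefore, except the one left out of the
  denominator.\<close>

lemma addable_row_content_ne: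
  assumes a: "addable D a"
  shows "int (row_len D r) - int r - 1 \<noteq> box_content a"
    and "r \<noteq> snd a \<Longrightarrow> int (row_len D r) - int r \<noteq> box_content a"
proof -
  have D: "young_diagram D" using a by (simp add: addable_def)
  have c: "box_content a = int (row_len D (snd a)) - int (snd a)" by (rule addable_content[OF a])
  show "int (row_len D r) - int r - 1 \<noteq> box_content a"
  proof (cases "r < snd a")
    case True
    then show ?thesis using addable_row_less[OF a True] c by linarith
  next
    case False
    then have "row_len D r \<le> row_len D (snd a)" by (intro row_len_antimono[OF D]) simp
    then show ?thesis using False c by linarith
  qed
  assume "r \<noteq> snd a"
  then show "int (row_len D r) - int r \<noteq> box_content a"
    using content_strict_decreasing[OF D, of r "snd a"] content_strict_decreasing[OF D, of "snd a" r] c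
    by (cases "r < snd a") auto
qed

context
  fixes q :: "'a::field"
  assumes nonroot: "\<And>c. q powi c = 1 \<Longrightarrow> c = 0" and q0: "q \<noteq> 0"
begin

text \<open>Contents enter only through the differences \<open>q^c - q^d\<close>; replacing the vanishing ones by \<open>1\<close>
  keeps all telescoping products meaningful.\<close>

definition content_diff :: "int \<Rightarrow> int \<Rightarrow> 'a" where
  "content_diff c d = (if c = d then 1 else q powi c - q powi d)"

text \<open>The factor with which an added box of content \<open>d\<close> enters
  \<open>rfac\<close> of a box of content \<open>c\<close>, compare
  \<open>rfac_insert\<close>.\<close>

definition pair_factor :: "int \<Rightarrow> int \<Rightarrow> 'a" where
  "pair_factor c d = content_diff c d ^ 2 / (content_diff c (d + 1) * content_diff c (d - 1))"

lemma content_diff_ne_0: "content_diff c d \<noteq> 0"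
  using powi_eq_iff[OF nonroot q0] by (simp add: content_diff_def)

text \<open>Exchanging the contents changes both factors of the denominator by the same reordering.
  Contents at distance 1 are different, since there a vanishing factor has been replaced by
  1.\<close>

lemma pair_factor_commute:
  assumes "\<bar>c - d\<bar> \<noteq> 1"
  shows "pair_factor c d = pair_factor d c"
proof (cases "c = d")
  case False
  define x y where "x = q powi c" and "y = q powi d"
  have e: "q powi (c + 1) = q * x" "q powi (d + 1) = q * y" "q powi (c - 1) = x / q" "q powi (d - 1) = y / q"
    using q0 by (simp_all add: x_def y_def power_int_add power_int_diff)
  have ne: "c \<noteq> d + 1" "c \<noteq> d - 1" "d \<noteq> c + 1" "d \<noteq> c - 1" using assms by auto
  have "(x - q * y) * (x - y / q) = (y - q * x) * (y - x / q)"
    using q0 by (simp add: field_simps)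
  moreover have "(x - y)\<^sup>2 = (y - x)\<^sup>2" by (rule power2_commute)
  ultimately show ?thesis using False ne
    by (simp add: pair_factor_def content_diff_def e x_def[symmetric] y_def[symmetric])
qed simp

text \<open>Each factor has the form t_a^2 / (t_(a+1) t_(a-1)), so only the two ends of the row
  remain.\<close>

lemma pair_factor_row:
  "(\<Prod>a<l. pair_factor c (int a - int r)) =
    content_diff c (- int r) * content_diff c (int l - int r - 1) /
      (content_diff c (int l - int r) * content_diff c (- int r - 1))"
proof (induction l)
  case 0
  then show ?case using content_diff_ne_0 by simp
next
  case (Suc l)
  have e: "int (Suc l) - int r - 1 = int l - int r" "int (Suc l) - int r = int l - int r + 1" by simp_all
  have p: "pair_factor c (int l - int r) = content_diff c (int l - int r) ^ 2 /
      (content_diff c (int l - int r + 1) * content_diff c (int l - int r - 1))"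
    by (rule pair_factor_def)
  show ?case unfolding prod.lessThan_Suc Suc p e
    using content_diff_ne_0 by (simp add: field_simps power2_eq_square)
qed

lemma content_diff_telescope:
  "(\<Prod>r<L. content_diff c (- int r) / content_diff c (- int r - 1)) = content_diff c 0 / content_diff c (- int L)"
proof (induction L)
  case 0
  then show ?case using content_diff_ne_0 by simp
next
  case (Suc L)
  have "- int (Suc L) = - int L - 1" by simp
  note e = this
  show ?case unfolding prod.lessThan_Suc Suc e using content_diff_ne_0 by simp
qed

text \<open>Along every row the pair factors telescope to the ends. The right ends give the product
  over rows in \<open>rfac\<close>; the left ends have contents 0, -1, -2, ... and telescope once
  more over the rows. What they leave at content -L cancels against the empty row \<open>L\<close>
  of the denominator.\<close>

lemma rfac_box_form:
  assumes a: "addable D a" and L: "card D \<le> L"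
  shows "rfac q h al L D a = (q powi box_content a - al) / (h * q powi box_content a) /
      content_diff (box_content a) 0 * (\<Prod>b\<in>D. pair_factor (box_content a) (box_content b))"
proof -
  let ?c = "box_content a"
  have D: "young_diagram D" using a by (simp add: addable_def)
  have num: "(\<Prod>r<L. q powi ?c - q powi (int (row_len D r) - int r - 1)) =
      (\<Prod>r<L. content_diff ?c (int (row_len D r) - int r - 1))"
    using addable_row_content_ne(1)[OF a, THEN not_sym] by (intro prod.cong) (auto simp: content_diff_def)
  have "(\<Prod>r\<in>{..L} - {snd a}. q powi ?c - q powi (int (row_len D r) - int r)) =
      (\<Prod>r\<in>{..L} - {snd a}. content_diff ?c (int (row_len D r) - int r))"
    using addable_row_content_ne(2)[OF a, THEN not_sym] by (intro prod.cong) (auto simp: content_diff_def)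
  also have "\<dots> = (\<Prod>r\<le>L. content_diff ?c (int (row_len D r) - int r))"
    using addable_content[OF a] by (intro prod.mono_neutral_left) (auto simp: content_diff_def)
  also have "\<dots> = (\<Prod>r<L. content_diff ?c (int (row_len D r) - int r)) * content_diff ?c (- int L)"
    using row_len_eq_0[OF D L] by (simp flip: lessThan_Suc_atMost)
  finally have den: "(\<Prod>r\<in>{..L} - {snd a}. q powi ?c - q powi (int (row_len D r) - int r)) =
      (\<Prod>r<L. content_diff ?c (int (row_len D r) - int r)) * content_diff ?c (- int L)" .
  have "(\<Prod>b\<in>D. pair_factor ?c (box_content b)) = (\<Prod>r<L. \<Prod>a<row_len D r. pair_factor ?c (int a - int r))"
    by (simp add: prod_young[OF D L] box_content_def)
  also have "\<dots> = (\<Prod>r<L. (content_diff ?c (- int r) / content_diff ?c (- int r - 1)) *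
      (content_diff ?c (int (row_len D r) - int r - 1) / content_diff ?c (int (row_len D r) - int r)))"
    unfolding pair_factor_row by (rule prod.cong) simp_all
  also have "\<dots> = content_diff ?c 0 / content_diff ?c (- int L) *
      ((\<Prod>r<L. content_diff ?c (int (row_len D r) - int r - 1)) / (\<Prod>r<L. content_diff ?c (int (row_len D r) - int r)))"
    by (simp only: prod.distrib content_diff_telescope) (simp only: prod_dividef)
  finally have box: "(\<Prod>b\<in>D. pair_factor ?c (box_content b)) = content_diff ?c 0 / content_diff ?c (- int L) *
      ((\<Prod>r<L. content_diff ?c (int (row_len D r) - int r - 1)) / (\<Prod>r<L. content_diff ?c (int (row_len D r) - int r)))" .
  have cancel: "U * N / (E * k) = U / z * (z / k * (N / E))" if "z \<noteq> 0" for U N E k z :: 'a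
    using that by (cases "k = 0"; cases "E = 0") (auto simp: field_simps)
  show ?thesis unfolding rfac_def Let_def num den box by (rule cancel[OF content_diff_ne_0])
qed

text \<open>The lexicographic order on boxes serves to take every pair once, in an order that does
  not depend on a tableau.\<close>

definition diagram_factor :: "box set \<Rightarrow> 'a" where
  "diagram_factor D = (\<Prod>(x, y)\<in>{(x, y) \<in> D \<times> D. y < x}. pair_factor (box_content x) (box_content y))"

text \<open>If the lexicographically smaller box \<open>b\<close> is added later than
  \<open>d\<close>, it lies strictly to the left of and strictly above \<open>d\<close>. The
  contents then differ by at least 2 and the pair factor is symmetric.\<close>

lemma addable_pair_commute:
  assumes b: "addable D b" and d: "d \<in> D" "b < d"
  shows "pair_factor (box_content d) (box_content b) = pair_factor (box_content b) (box_content d)"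
proof (rule pair_factor_commute)
  have D: "young_diagram D" "b \<notin> D" using b by (auto simp: addable_def)
  have "\<not> (fst b \<le> fst d \<and> snd b \<le> snd d)"
    using young_diagram_down[OF D(1), of "fst d" "snd d" "fst b" "snd b"] d D(2) by auto
  moreover have "fst b < fst d \<or> fst b = fst d \<and> snd b < snd d"
    using d(2) by (auto simp: less_prod_def' less_le)
  ultimately show "\<bar>box_content d - box_content b\<bar> \<noteq> 1" by (auto simp: box_content_def)
qed

lemma diagram_factor_insert:
  assumes b: "addable D b"
  shows "diagram_factor (insert b D) = diagram_factor D * (\<Prod>d\<in>D. pair_factor (box_content b) (box_content d))"
proof -
  have D: "finite D" "b \<notin> D" using b by (auto simp: addable_def young_diagram_def)
  let ?p = "\<lambda>(x, y). pair_factor (box_content x) (box_content y)"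
  let ?A = "{(x, y) \<in> D \<times> D. y < x}" and ?B = "Pair b ` {d \<in> D. d < b}" and ?C = "(\<lambda>d. (d, b)) ` {d \<in> D. b < d}"
  have fin: "finite ?A" "finite ?B" "finite ?C"
    using D by (auto intro: finite_subset[of _ "D \<times> D"])
  have "{(x, y) \<in> insert b D \<times> insert b D. y < x} = ?A \<union> ?B \<union> ?C" by auto
  moreover have "?A \<inter> ?B = {}" "(?A \<union> ?B) \<inter> ?C = {}" using D by auto
  ultimately have "diagram_factor (insert b D) = prod ?p ?A * prod ?p ?B * prod ?p ?C"
    unfolding diagram_factor_def using fin by (simp add: prod.union_disjoint)
  also have "prod ?p ?B = (\<Prod>d\<in>{d \<in> D. d < b}. pair_factor (box_content b) (box_content d))"
    by (subst prod.reindex) (auto simp: inj_on_def)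
  also have "prod ?p ?C = (\<Prod>d\<in>{d \<in> D. b < d}. pair_factor (box_content b) (box_content d))"
    by (subst prod.reindex) (auto simp: inj_on_def addable_pair_commute[OF b] intro!: prod.cong)
  also have "prod ?p ?A * (\<Prod>d\<in>{d \<in> D. d < b}. pair_factor (box_content b) (box_content d)) *
      (\<Prod>d\<in>{d \<in> D. b < d}. pair_factor (box_content b) (box_content d)) =
      prod ?p ?A * (\<Prod>d\<in>{d \<in> D. d < b} \<union> {d \<in> D. b < d}. pair_factor (box_content b) (box_content d))"
    using D by (subst prod.union_disjoint) (auto simp: mult.assoc)
  also have "{d \<in> D. d < b} \<union> {d \<in> D. b < d} = D"
  proof -
    have "d < b \<or> b < d" if "d \<in> D" for d using that D(2) neq_iff[of d b] by auto
    then show ?thesis by blast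
  qed
  finally show ?thesis by (simp add: diagram_factor_def)
qed

text \<open>Adding a box multiplies \<open>diagram_factor\<close> by its pair factors with all
  earlier boxes, which is the box form of \<open>rfac\<close>. The right side depends on the set of
  boxes only, so tableaux of the same shape have the same product.\<close>

lemma prod_rfac_shape:
  assumes "standard_tableau T" "length T \<le> L"
  shows "(\<Prod>i<length T. rfac q h al L (set (take i T)) (T ! i)) =
    diagram_factor (set T) * (\<Prod>a\<in>set T. (q powi box_content a - al) / (h * q powi box_content a) /
      content_diff (box_content a) 0)"
  using assms
proof (induction T rule: rev_induct)
  case Nil
  then show ?case by (simp add: diagram_factor_def)
next
  case (snoc b T)
  have b: "standard_tableau T" "addable (set T) b" "b \<notin> set T"
    using snoc.prems standard_append_iff by (auto simp: addable_def)
  have "card (set T) \<le> L" using snoc.prems standard_distinct[OF b(1)] by (simp add: distinct_card)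
  note r = rfac_box_form[OF b(2) this, of h al]
  have "(\<Prod>i<length (T @ [b]). rfac q h al L (set (take i (T @ [b]))) ((T @ [b]) ! i)) =
      (\<Prod>i<length T. rfac q h al L (set (take i T)) (T ! i)) * rfac q h al L (set T) b"
    by (simp add: nth_append)
  then show ?case using snoc b by (simp add: r diagram_factor_insert)
qed

end

section \<open>Specialization of characters\<close>

lemma specializes_at_mult:
  assumes "specializes_at c f x" "specializes_at c g y"
  shows "specializes_at c (f * g) (x * y)"
proof -
  obtain N D M E where f: "f = Fract N D" "poly D c \<noteq> 0" "x = poly N c / poly D c"
    and g: "g = Fract M E" "poly E c \<noteq> 0" "y = poly M c / poly E c"
    using assms unfolding specializes_at_def by blast
  show ?thesis unfolding specializes_at_def
    by (rule exI[of _ "N * M"], rule exI[of _ "D * E"]) (use f g in simp)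
qed

lemma specializes_at_inverse:
  assumes "specializes_at c f x" "x \<noteq> 0"
  shows "specializes_at c (inverse f) (inverse x)"
proof -
  obtain N D where f: "f = Fract N D" "poly D c \<noteq> 0" "x = poly N c / poly D c"
    using assms unfolding specializes_at_def by blast
  show ?thesis unfolding specializes_at_def
    by (rule exI[of _ D], rule exI[of _ N]) (use f assms(2) in auto)
qed

lemma specializes_at_divide:
  "specializes_at c f x \<Longrightarrow> specializes_at c g y \<Longrightarrow> y \<noteq> 0 \<Longrightarrow> specializes_at c (f / g) (x / y)"
  unfolding divide_inverse by (intro specializes_at_mult specializes_at_inverse)

lemma specializes_at_diff:
  assumes "specializes_at c f x" "specializes_at c g y"
  shows "specializes_at c (f - g) (x - y)"
proof -
  obtain N D M E where f: "f = Fract N D" "poly D c \<noteq> 0" "x = poly N c / poly D c"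
    and g: "g = Fract M E" "poly E c \<noteq> 0" "y = poly M c / poly E c"
    using assms unfolding specializes_at_def by blast
  have "D \<noteq> 0" "E \<noteq> 0" using f g by auto
  note ne = this
  show ?thesis unfolding specializes_at_def
    by (rule exI[of _ "N * E - M * D"], rule exI[of _ "D * E"])
      (use f(1,2) g(1,2) ne in \<open>simp add: f(3) g(3) diff_frac_eq\<close>)
qed

lemma specializes_at_const: "specializes_at c (const_fract x) x"
  unfolding specializes_at_def const_fract_def by (intro exI[of _ "[:x:]"] exI[of _ 1]) simp

lemma specializes_at_indet: "specializes_at c indet c"
  unfolding specializes_at_def indet_def by (intro exI[of _ "[:0, 1:]"] exI[of _ 1]) simp

lemma specializes_at_1: "specializes_at c 1 1"
  using specializes_at_const[of c 1] by (simp add: const_fract_1)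

lemma specializes_at_power: "specializes_at c f x \<Longrightarrow> specializes_at c (f ^ k) (x ^ k)"
  by (induction k) (simp_all add: specializes_at_1 specializes_at_mult)

lemma specializes_at_powi: "specializes_at c f x \<Longrightarrow> x \<noteq> 0 \<Longrightarrow> specializes_at c (f powi k) (x powi k)"
  unfolding power_int_def by (simp add: specializes_at_power specializes_at_inverse)

lemma specializes_at_prod:
  "(\<And>i. i \<in> A \<Longrightarrow> specializes_at c (f i) (g i)) \<Longrightarrow> specializes_at c (prod f A) (prod g A)"
  by (induction A rule: infinite_finite_induct) (simp_all add: specializes_at_1 specializes_at_mult)

section \<open>Characters at t = 1/q\<close>

abbreviation qa :: Kqa where "qa \<equiv> qhalf_a\<^sup>2"

lemma const_fract_eq_0: "const_fract x = 0 \<longleftrightarrow> x = 0"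
  by (simp add: const_fract_def Zero_fract_def eq_fract)

lemma const_fract_inverse: "const_fract (inverse x) = inverse (const_fract x)"
proof (cases "x = 0")
  case False
  then have "const_fract x * const_fract (inverse x) = 1" by (simp add: const_fract_1 flip: const_fract_mult)
  then show ?thesis by (metis inverse_unique)
qed (simp add: const_fract_eq_0[THEN iffD2])

lemma const_fract_power: "const_fract (x ^ k) = const_fract x ^ k"
  by (induction k) (simp_all add: const_fract_1 const_fract_mult)

lemma const_fract_powi: "const_fract (x powi k) = const_fract x powi k"
  by (simp add: power_int_def const_fract_power const_fract_inverse)

lemma const_fract_inj: "const_fract x = const_fract y \<longleftrightarrow> x = y"
  by (simp add: const_fract_def eq_fract)

lemma qhalf_a_ne_0: "qhalf_a \<noteq> 0"
  by (simp add: qhalf_a_def const_fract_eq_0 qhalf_def indet_ne_0)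

lemma qa_nonroot: "qa powi z = 1 \<Longrightarrow> z = 0"
proof -
  assume "qa powi z = 1"
  then have "const_fract ((qhalf\<^sup>2) powi z) = (const_fract 1 :: Kqa)"
    by (simp only: const_fract_powi const_fract_power qhalf_a_def const_fract_1)
  then show "z = 0" using indet_nonroot[of 2 z] by (simp add: const_fract_inj qhalf_def)
qed

lemma qa_ne_0: "qa \<noteq> 0" using qhalf_a_ne_0 by simp

text \<open>The variable t is transcendental over the field containing q, and q is not a root of
  unity. A negative power of t is made positive by inverting the whole equation.\<close>

lemma character_eq_1: "character w = 1 \<longleftrightarrow> w = 0"
proof
  assume 1: "character w = 1"
  let ?Q = "const_fract qa :: Kqat" and ?t = "indet :: Kqat"
  have pos: False if "?Q powi m * ?t ^ k = 1" "0 < k" for m k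
  proof -
    have "const_fract (qa powi m) * ?t ^ k = 1" using that(1) by (simp add: const_fract_powi)
    then have "Fract (Polynomial.monom (qa powi m) k) 1 = (1 :: Kqat)"
      by (simp add: indet_power const_fract_def smult_monom)
    then have "Polynomial.monom (qa powi m) k = 1" by (simp add: One_fract_def eq_fract)
    then have "degree (Polynomial.monom (qa powi m) k) = 0" by simp
    then show False using that(2) qa_ne_0 by (simp add: degree_monom_eq)
  qed
  obtain m l where w: "w = (m, l)" by (cases w)
  have e: "?Q powi m * ?t powi l = 1" using 1 w by (simp add: character_def)
  have "l = 0"
  proof (rule ccontr)
    assume "l \<noteq> 0"
    then consider "l > 0" | "l < 0" by linarith
    then show False
    proof cases
      case 1
      then show False using pos[of m "nat l"] e by (simp add: power_int_def)
    next
      case 2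
      have "inverse (?Q powi m * ?t powi l) = 1" using e by simp
      then have "?Q powi (- m) * ?t powi (- l) = 1" by (simp add: power_int_minus)
      then show False using pos[of "- m" "nat (- l)"] 2 by (simp add: power_int_def)
    qed
  qed
  moreover have "m = 0"
  proof -
    have "const_fract (qa powi m) = (const_fract 1 :: Kqat)" using e \<open>l = 0\<close> by (simp add: const_fract_powi const_fract_1)
    then show ?thesis using qa_nonroot by (simp add: const_fract_inj)
  qed
  ultimately show "w = 0" by (simp add: w zero_prod_def)
qed (simp add: character_def)

lemma specializes_at_character:
  "specializes_at (inverse qa) (character w) (qa powi (fst w - snd w))"
proof -
  have "specializes_at (inverse qa) (character w) (qa powi fst w * inverse qa powi snd w)"
    unfolding character_def using qa_ne_0
    by (intro specializes_at_mult specializes_at_powi specializes_at_const specializes_at_indet) auto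
  then show ?thesis using qa_ne_0 by (simp add: power_int_diff power_int_inverse divide_inverse)
qed

text \<open>For weight 0 the true factor would be 0. Generators and relations of weight 0 are the
  ones eliminated from the chart, so 1 is the factor they should leave in the series.\<close>

definition koszul_factor :: "weight \<Rightarrow> Kqat" where
  "koszul_factor w = (if w = 0 then 1 else 1 - character w)"

lemma koszul_factor_ne_0: "koszul_factor w \<noteq> 0"
  using character_eq_1[of w] by (auto simp: koszul_factor_def)

lemma specializes_at_koszul_factor:
  "w \<noteq> 0 \<Longrightarrow> specializes_at (inverse qa) (koszul_factor w) (1 - qa powi (fst w - snd w))"
  unfolding koszul_factor_def using specializes_at_diff[OF specializes_at_1 specializes_at_character] by simp

text \<open>The contribution of one row of the matrices: \<open>a\<close> is the box of the row
  index and \<open>D\<close> consists of the boxes with smaller labels. The numerator comes from the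
  commutator entries, the denominator from the free entries of X and of Y.\<close>

definition row_series :: "box set \<Rightarrow> box \<Rightarrow> Kqat" where
  "row_series D a = (\<Prod>d\<in>D. koszul_factor (box_weight d - box_weight a + (1, 1))) /
    ((\<Prod>d | d \<in> insert a D \<and> box_right d \<notin> insert a D. koszul_factor (box_weight d - box_weight a + (1, 0))) *
     (\<Prod>d | d \<in> D \<and> \<not> (fst d = 0 \<and> box_up d \<in> insert a D). koszul_factor (box_weight d - box_weight a + (0, 1))))"

text \<open>Let M c r be the factor of the cell (c, r) relative to \<open>a\<close>. A box (c, r)
  gives M (c+1) (r+1) through its relation and M c (r+1) through its entry of Y; these cancel along
  a row of the diagram except at the ends. The free entries of X sit at the row ends and give M at
  the next cell. Empty rows up to \<open>L\<close> are then added above and below to make the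
  products uniform.\<close>

lemma row_series_eq:
  assumes a: "addable D a" and L: "card D \<le> L" "snd a \<le> L"
  shows "row_series D a = (\<Prod>r<L. koszul_factor (box_weight (row_len D r, Suc r) - box_weight a)) /
    (koszul_factor (1, 0) * (\<Prod>r\<le>L. koszul_factor (box_weight (row_len D r, r) - box_weight a)))"
proof -
  define M where "M c r = koszul_factor (box_weight (c, r) - box_weight a)" for c r
  have M0: "M c r \<noteq> 0" for c r by (simp add: M_def koszul_factor_ne_0)
  let ?D = "insert a D" and ?R = "snd a"
  have D: "young_diagram D" "young_diagram ?D" "finite D" using a by (auto simp: addable_def young_diagram_def)
  have ax: "a = (row_len D ?R, ?R)" using a addable_iff[OF D(1), of "fst a" "snd a"] by (auto simp: prod_eq_iff)
  let ?l = "row_len D" and ?l' = "row_len ?D"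
  have l': "?l' r = ?l r + (if r = ?R then 1 else 0)" for r by (rule row_len_insert[OF a])
  have lL: "?l r = 0" if "L \<le> r" for r using row_len_eq_0[OF D(1)] L(1) that by simp
  let ?P = "\<lambda>r. 0 < ?l r"
  have num: "(\<Prod>d\<in>D. koszul_factor (box_weight d - box_weight a + (1, 1))) = (\<Prod>r<L. \<Prod>c<?l r. M (Suc c) (Suc r))"
    unfolding prod_young[OF D(1) L(1)] M_def
    by (intro prod.cong refl) (simp add: box_weight_def algebra_simps)
  have row: "(\<Prod>c<l. M (Suc c) r) = (if 0 < l then M l r else 1) * (\<Prod>c<l. if c = 0 then 1 else M c r)" for l r
  proof (induction l)
    case (Suc l)
    then show ?case by (cases "l = 0") (simp_all add: mult.commute)
  qed simp
  have num': "(\<Prod>r<L. \<Prod>c<?l r. M (Suc c) (Suc r)) =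
      (\<Prod>r<L. if ?P r then M (?l r) (Suc r) else 1) * (\<Prod>r<L. \<Prod>c<?l r. if c = 0 then 1 else M c (Suc r))"
    unfolding row by (rule prod.distrib)
  \<comment> \<open>Row r is the top row, also after \<open>a\<close> is added. Only there is the
    entry of Y from the first column free.\<close>
  let ?U = "\<lambda>r. ?P r \<and> ?l' (Suc r) = 0"
  have Y: "(\<Prod>d | d \<in> D \<and> \<not> (fst d = 0 \<and> box_up d \<in> ?D). koszul_factor (box_weight d - box_weight a + (0, 1))) =
      (\<Prod>r<L. if ?U r then M 0 (Suc r) else 1) * (\<Prod>r<L. \<Prod>c<?l r. if c = 0 then 1 else M c (Suc r))"
  proof -
    have "(\<Prod>d | d \<in> D \<and> \<not> (fst d = 0 \<and> box_up d \<in> ?D). koszul_factor (box_weight d - box_weight a + (0, 1))) =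
        (\<Prod>d\<in>D. if \<not> (fst d = 0 \<and> box_up d \<in> ?D) then koszul_factor (box_weight d - box_weight a + (0, 1)) else 1)"
      using D(3) by (simp only: prod.inter_filter)
    also have "\<dots> = (\<Prod>r<L. \<Prod>c<?l r. (if c = 0 \<and> ?l' (Suc r) = 0 then M 0 (Suc r) else 1) * (if c = 0 then 1 else M c (Suc r)))"
      unfolding prod_young[OF D(1) L(1)]
    proof (intro prod.cong refl)
      fix r c
      have "(0, Suc r) \<in> ?D \<longleftrightarrow> ?l' (Suc r) \<noteq> 0" using mem_young_iff[OF D(2), of 0 "Suc r"] by simp
      then show "(if \<not> (fst (c, r) = 0 \<and> box_up (c, r) \<in> ?D) then koszul_factor (box_weight (c, r) - box_weight a + (0, 1)) else 1) =
          (if c = 0 \<and> ?l' (Suc r) = 0 then M 0 (Suc r) else 1) * (if c = 0 then 1 else M c (Suc r))"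
        by (auto simp: box_up_def M_def box_weight_def algebra_simps)
    qed
    also have "\<dots> = (\<Prod>r<L. (if ?U r then M 0 (Suc r) else 1) * (\<Prod>c<?l r. if c = 0 then 1 else M c (Suc r)))"
    proof (intro prod.cong refl)
      fix r
      have "(\<Prod>c<l. if c = 0 \<and> b then x else 1) = (if 0 < l \<and> b then x else 1)" for l :: nat and b and x :: Kqat
        by (induction l) auto
      then show "(\<Prod>c<?l r. (if c = 0 \<and> ?l' (Suc r) = 0 then M 0 (Suc r) else 1) * (if c = 0 then 1 else M c (Suc r))) =
          (if ?U r then M 0 (Suc r) else 1) * (\<Prod>c<?l r. if c = 0 then 1 else M c (Suc r))"
        by (simp only: prod.distrib)
    qed
    finally show ?thesis by (simp only: prod.distrib)
  qed
  \<comment> \<open>The row that contains \<open>a\<close> ends with \<open>a\<close>; its free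
    entry is the diagonal entry of X, of weight q.\<close>
  have X: "(\<Prod>d | d \<in> ?D \<and> box_right d \<notin> ?D. koszul_factor (box_weight d - box_weight a + (1, 0))) =
      koszul_factor (1, 0) * (\<Prod>r\<le>L. if r \<noteq> ?R \<and> ?P r then M (?l r) r else 1)"
  proof -
    have "{d. d \<in> ?D \<and> box_right d \<notin> ?D} = (\<lambda>r. (?l' r - 1, r)) ` {r. r \<le> L \<and> 0 < ?l' r}"
    proof (intro equalityI subsetI)
      fix d assume "d \<in> {d. d \<in> ?D \<and> box_right d \<notin> ?D}"
      then have "fst d < ?l' (snd d)" "\<not> fst d + 1 < ?l' (snd d)"
        using mem_young_iff[OF D(2), of "fst d" "snd d"] mem_young_iff[OF D(2), of "fst d + 1" "snd d"]
        by (auto simp: box_right_def)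
      moreover from this have "snd d \<le> L" using lL[of "snd d"] l'[of "snd d"] L(2) by (cases "snd d \<le> L") (auto split: if_splits)
      ultimately show "d \<in> (\<lambda>r. (?l' r - 1, r)) ` {r. r \<le> L \<and> 0 < ?l' r}"
        by (intro image_eqI[of _ _ "snd d"]) (auto simp: prod_eq_iff)
    next
      fix d assume "d \<in> (\<lambda>r. (?l' r - 1, r)) ` {r. r \<le> L \<and> 0 < ?l' r}"
      then obtain r where r: "0 < ?l' r" "d = (?l' r - 1, r)" by blast
      then show "d \<in> {d. d \<in> ?D \<and> box_right d \<notin> ?D}"
        using mem_young_iff[OF D(2), of "?l' r - 1" r] mem_young_iff[OF D(2), of "?l' r" r]
        by (simp add: box_right_def del: insert_iff)
    qed
    then have "(\<Prod>d | d \<in> ?D \<and> box_right d \<notin> ?D. koszul_factor (box_weight d - box_weight a + (1, 0))) =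
        (\<Prod>r\<in>{r. r \<le> L \<and> 0 < ?l' r}. koszul_factor (box_weight (?l' r - 1, r) - box_weight a + (1, 0)))"
      by (simp add: prod.reindex inj_on_def)
    also have "\<dots> = (\<Prod>r\<in>{r \<in> {..L}. 0 < ?l' r}. M (?l' r) r)"
      by (intro prod.cong) (auto simp: M_def box_weight_def algebra_simps of_nat_diff)
    also have "\<dots> = (\<Prod>r\<le>L. if 0 < ?l' r then M (?l' r) r else 1)"
      by (simp only: prod.inter_filter finite_atMost)
    also have "\<dots> = (\<Prod>r\<le>L. (if r = ?R then koszul_factor (1, 0) else 1) * (if r \<noteq> ?R \<and> ?P r then M (?l r) r else 1))"
    proof (intro prod.cong refl)
      fix r
      have "M (Suc (?l ?R)) ?R = koszul_factor (1, 0)" unfolding M_def by (subst (3) ax) (simp add: box_weight_def)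
      then show "(if 0 < ?l' r then M (?l' r) r else 1) =
          (if r = ?R then koszul_factor (1, 0) else 1) * (if r \<noteq> ?R \<and> ?P r then M (?l r) r else 1)"
        by (simp add: l')
    qed
    also have "\<dots> = koszul_factor (1, 0) * (\<Prod>r\<le>L. if r \<noteq> ?R \<and> ?P r then M (?l r) r else 1)"
      using L(2) by (simp add: prod.distrib)
    finally show ?thesis .
  qed
  \<comment> \<open>The first free cell in the row of \<open>a\<close> is \<open>a\<close> itself,
    of relative weight 0. This is the row which \<open>rfac\<close> leaves out of its
    denominator.\<close>
  have MR: "M (?l ?R) ?R = 1" unfolding M_def by (subst (3) ax) (simp add: koszul_factor_def box_weight_def)
  have s1: "(\<Prod>r\<le>L. M (?l r) r) =
      (\<Prod>r\<le>L. if r \<noteq> ?R \<and> ?P r then M (?l r) r else 1) * (\<Prod>r\<le>L. if r \<noteq> ?R \<and> \<not> ?P r then M 0 r else 1)"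
    unfolding prod.distrib[symmetric] by (rule prod.cong) (auto simp: MR)
  have s2: "(\<Prod>r<L. M (?l r) (Suc r)) =
      (\<Prod>r<L. if ?P r then M (?l r) (Suc r) else 1) * (\<Prod>r<L. if \<not> ?P r then M 0 (Suc r) else 1)"
    unfolding prod.distrib[symmetric] by (rule prod.cong) auto
  have R_row: "?l ?R < ?l (?R - 1)" if "?R \<noteq> 0"
    using addable_row_less[OF a, of "?R - 1"] that by simp
  \<comment> \<open>An empty row other than that of \<open>a\<close> lies above another empty row or
    directly above the top row, so shifting the index by one splits the product.\<close>
  have s3: "(\<Prod>r\<le>L. if r \<noteq> ?R \<and> \<not> ?P r then M 0 r else 1) =
      (\<Prod>r<L. if \<not> ?P r then M 0 (Suc r) else 1) * (\<Prod>r<L. if ?U r then M 0 (Suc r) else 1)"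
  proof -
    have z: "0 = ?R \<or> ?P 0"
    proof (rule ccontr)
      assume "\<not> (0 = ?R \<or> ?P 0)"
      then show False using R_row row_len_antimono[OF D(1), of 0 "?R - 1"] by auto
    qed
    have "(\<Prod>r\<le>L. if r \<noteq> ?R \<and> \<not> ?P r then M 0 r else 1) =
        (\<Prod>r<Suc L. if r \<noteq> ?R \<and> \<not> ?P r then M 0 r else 1)" by (simp only: lessThan_Suc_atMost)
    also have "\<dots> = (\<Prod>r<L. if Suc r \<noteq> ?R \<and> \<not> ?P (Suc r) then M 0 (Suc r) else 1)"
      unfolding prod.lessThan_Suc_shift using z by auto
    also have "\<dots> = (\<Prod>r<L. (if \<not> ?P r then M 0 (Suc r) else 1) * (if ?U r then M 0 (Suc r) else 1))"
    proof (intro prod.cong refl)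
      fix r
      have "?l (Suc r) \<le> ?l r" using row_len_antimono[OF D(1)] by simp
      moreover have "?P r" if sr: "Suc r = ?R"
      proof -
        have "?R - 1 = r" "?R \<noteq> 0" using sr by simp_all
        then show ?thesis using R_row by simp
      qed
      ultimately show "(if Suc r \<noteq> ?R \<and> \<not> ?P (Suc r) then M 0 (Suc r) else 1) =
          (if \<not> ?P r then M 0 (Suc r) else 1) * (if ?U r then M 0 (Suc r) else 1)"
        by (auto simp: l')
    qed
    finally show ?thesis by (simp only: prod.distrib)
  qed
  have ne: "(\<Prod>r\<in>A. f r) \<noteq> 0" if "finite A" "\<And>r. f r \<noteq> 0" for A :: "nat set" and f :: "nat \<Rightarrow> Kqat"
    using that by simp
  have frac: "(A * W) / (k * B * (C * W)) = (A * E) / (k * (B * (E * C)))"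
    if "W \<noteq> 0" "E \<noteq> 0" for A B C E W k :: Kqat
    using that by (simp add: field_simps)
  have n1: "(\<Prod>r<L. \<Prod>c<?l r. if c = 0 then 1 else M c (Suc r)) \<noteq> 0"
    by (intro ne) (auto simp: M0)
  have n2: "(\<Prod>r<L. if \<not> ?P r then M 0 (Suc r) else 1) \<noteq> 0"
    by (intro ne) (auto simp: M0)
  show ?thesis
    unfolding row_series_def num num' X Y M_def[symmetric] s1 s2 s3
    by (rule frac[OF n1 n2])
qed

text \<open>A weight (m, l) becomes q^(m-l), so cells turn into contents and
  \<open>row_series_eq\<close> into the product of \<open>rfac\<close>. Writing every factor as a
  difference divided by x = q^(content of a) produces the same power x^L above and below. The factor
  -q^(-1/2) comes from 1 / (1 - q), the diagonal entry of X.\<close>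

lemma specializes_row_series:
  assumes a: "addable D a" and L: "card D \<le> L" "snd a \<le> L"
  shows "specializes_at (inverse qa) (row_series D a * (1 - const_fract avar * character (- box_weight a)))
    (- inverse qhalf_a * rfac qa (qhalf_a - inverse qhalf_a) avar L D a)"
proof -
  let ?l = "row_len D" and ?c = "box_content a" and ?h = "qhalf_a - inverse qhalf_a"
  have D: "young_diagram D" using a by (simp add: addable_def)
  have q1: "qa \<noteq> 1" using qa_nonroot[of 1] by auto
  have ne_iff: "qa powi m \<noteq> 1" if "m \<noteq> 0" for m using qa_nonroot that by blast
  have num: "specializes_at (inverse qa) (koszul_factor (box_weight (?l r, Suc r) - box_weight a))
      (1 - qa powi (int (?l r) - int r - 1 - ?c))" for r
  proof -
    have "int (?l r) - int r - 1 \<noteq> ?c" by (rule addable_row_content_ne(1)[OF a])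
    then have "box_weight (?l r, Suc r) - box_weight a \<noteq> 0"
      by (auto simp: box_weight_def box_content_def zero_prod_def prod_eq_iff)
    from specializes_at_koszul_factor[OF this] show ?thesis
      by (simp add: box_weight_def box_content_def algebra_simps)
  qed
  have den: "specializes_at (inverse qa) (koszul_factor (box_weight (?l r, r) - box_weight a))
      (if r = snd a then 1 else 1 - qa powi (int (?l r) - int r - ?c))" for r
  proof (cases "r = snd a")
    case True
    then have "(?l r, r) = a" using a addable_iff[OF D, of "fst a" "snd a"] by (auto simp: prod_eq_iff)
    then show ?thesis using True by (simp add: koszul_factor_def specializes_at_1)
  next
    case False
    then have "box_weight (?l r, r) - box_weight a \<noteq> 0"
      by (auto simp: box_weight_def zero_prod_def prod_eq_iff)
    from specializes_at_koszul_factor[OF this] show ?thesis using False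
      by (simp add: box_weight_def box_content_def algebra_simps)
  qed
  have k10: "specializes_at (inverse qa) (koszul_factor (1, 0)) (1 - qa)"
    using specializes_at_koszul_factor[of "(1, 0)"] by (simp add: zero_prod_def)
  have ext: "specializes_at (inverse qa) (1 - const_fract avar * character (- box_weight a)) (1 - avar * qa powi (- ?c))"
  proof -
    have "specializes_at (inverse qa) (1 - const_fract avar * character (- box_weight a))
        (1 - avar * qa powi (fst (- box_weight a) - snd (- box_weight a)))"
      by (intro specializes_at_diff specializes_at_1 specializes_at_mult specializes_at_const specializes_at_character)
    then show ?thesis by (simp add: box_weight_def box_content_def)
  qed
  let ?N = "\<Prod>r<L. 1 - qa powi (int (?l r) - int r - 1 - ?c)"
  let ?E = "\<Prod>r\<le>L. if r = snd a then 1 else 1 - qa powi (int (?l r) - int r - ?c)"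
  \<comment> \<open>A nonzero weight could still specialize to 1; here the contents themselves
    differ, so there is no pole at t = 1/q.\<close>
  have E0: "?E \<noteq> 0"
    using ne_iff addable_row_content_ne(2)[OF a] by (auto simp: prod_zero_iff)
  have main: "specializes_at (inverse qa) (row_series D a * (1 - const_fract avar * character (- box_weight a)))
      (?N / ((1 - qa) * ?E) * (1 - avar * qa powi (- ?c)))"
    unfolding row_series_eq[OF a L]
    by (intro specializes_at_mult specializes_at_divide specializes_at_prod num den k10 ext)
      (use q1 E0 in simp)
  define x where "x = qa powi ?c"
  have x0: "x \<noteq> 0" using qa_ne_0 by (simp add: x_def)
  have sh: "1 - qa powi (m - ?c) = (x - qa powi m) / x" for m
    using x0 qa_ne_0 by (simp add: x_def power_int_diff field_simps)
  have N: "?N = (\<Prod>r<L. x - qa powi (int (?l r) - int r - 1)) / x ^ L"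
    by (simp add: sh prod_dividef)
  have "?E = (\<Prod>r\<in>{..L} - {snd a}. 1 - qa powi (int (?l r) - int r - ?c))"
    by (rule prod.mono_neutral_cong_right) auto
  also have "\<dots> = (\<Prod>r\<in>{..L} - {snd a}. x - qa powi (int (?l r) - int r)) / x ^ L"
    using L(2) by (simp add: sh prod_dividef)
  finally have E: "?E = (\<Prod>r\<in>{..L} - {snd a}. x - qa powi (int (?l r) - int r)) / x ^ L" .
  have A: "1 - avar * qa powi (- ?c) = (x - avar) / x"
    using x0 by (simp add: x_def power_int_minus field_simps)
  have h: "1 / (1 - qa) = - inverse qhalf_a * (1 / ?h)"
  proof -
    have "?h * qhalf_a = qa - 1" using qhalf_a_ne_0 by (simp add: power2_eq_square algebra_simps)
    moreover from this have "?h \<noteq> 0" using q1 by auto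
    ultimately show ?thesis using q1 qhalf_a_ne_0 by (simp add: divide_simps)
  qed
  have fin: "(P / y) / (k * (R / y)) * (z / x) = (1 / k) * (z / x * P / R)"
    if "y \<noteq> 0" for P R y k z :: Kqa using that by (simp add: field_simps)
  have "?N / ((1 - qa) * ?E) * (1 - avar * qa powi (- ?c)) = (1 / (1 - qa)) *
      ((x - avar) / x * (\<Prod>r<L. x - qa powi (int (?l r) - int r - 1)) /
        (\<Prod>r\<in>{..L} - {snd a}. x - qa powi (int (?l r) - int r)))"
    unfolding N E A by (rule fin) (use x0 in simp)
  also have "\<dots> = - inverse qhalf_a * rfac qa ?h avar L D a"
    unfolding h rfac_def Let_def x_def[symmetric] by (simp add: mult_ac)
  finally have "?N / ((1 - qa) * ?E) * (1 - avar * qa powi (- ?c)) = - inverse qhalf_a * rfac qa ?h avar L D a" .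
  then show ?thesis using main by simp
qed

text \<open>The series of the unreduced chart with every factor of weight 0 replaced by 1, hence the
  series after elimination.\<close>

definition chart_series :: "box list \<Rightarrow> Kqat" where
  "chart_series T =
    (\<Prod>(i, j)\<in>{(i, j). j < i \<and> i < length T}.
      koszul_factor (box_weight (T ! j) - box_weight (T ! i) + (1, 1))) /
    ((\<Prod>(i, j)\<in>{(i, j). x_free T i j}.
        koszul_factor (box_weight (T ! j) - box_weight (T ! i) + (1, 0))) *
     (\<Prod>(i, j)\<in>{(i, j). y_free T i j}.
        koszul_factor (box_weight (T ! j) - box_weight (T ! i) + (0, 1))))"

lemma prod_take:
  assumes "distinct T" "i \<le> length T"
  shows "(\<Prod>j | j < i \<and> R (T ! j). f (T ! j)) = (\<Prod>d | d \<in> set (take i T) \<and> R d. f d)"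
proof -
  have "{d. d \<in> set (take i T) \<and> R d} = (\<lambda>j. T ! j) ` {j. j < i \<and> R (T ! j)}"
    using assms(2) by (auto simp: in_set_conv_nth)
  moreover have "inj_on (\<lambda>j. T ! j) {j. j < i \<and> R (T ! j)}"
    using assms by (auto simp: inj_on_def nth_eq_iff_index_eq)
  ultimately show ?thesis by (simp add: prod.reindex)
qed

lemma chart_series_eq:
  assumes T: "standard_tableau T"
  shows "chart_series T = (\<Prod>i<length T. row_series (set (take i T)) (T ! i))"
proof -
  let ?n = "length T"
  have d: "distinct T" using T by (rule standard_distinct)
  have ins: "set (take (Suc i) T) = insert (T ! i) (set (take i T))" if "i < ?n" for i
    using that by (simp add: take_Suc_conv_app_nth)
  have ex: "(\<exists>r\<le>i. T ! r = c) \<longleftrightarrow> c \<in> insert (T ! i) (set (take i T))" if "i < ?n" for i c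
    unfolding ins[OF that, symmetric] using that by (auto simp: in_set_conv_nth less_Suc_eq_le)
  have N: "(\<Prod>(i, j)\<in>{(i, j). j < i \<and> i < ?n}. f i j) = (\<Prod>i<?n. \<Prod>j | j < i \<and> True. f i j)" for f :: "nat \<Rightarrow> nat \<Rightarrow> Kqat"
    by (subst prod.Sigma) (auto intro!: prod.cong)
  have X: "(\<Prod>(i, j)\<in>{(i, j). x_free T i j}. f i j) =
      (\<Prod>i<?n. \<Prod>j | j < Suc i \<and> box_right (T ! j) \<notin> insert (T ! i) (set (take i T)). f i j)" for f :: "nat \<Rightarrow> nat \<Rightarrow> Kqat"
  proof -
    have "x_free T i j \<longleftrightarrow> i < ?n \<and> j < Suc i \<and> box_right (T ! j) \<notin> insert (T ! i) (set (take i T))" for i j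
    proof (cases "i < ?n")
      case True
      then show ?thesis unfolding x_free_def ex[OF True] by (auto simp: less_Suc_eq_le)
    qed (simp add: x_free_def)
    then have "{(i, j). x_free T i j} =
        (SIGMA i:{..<?n}. {j. j < Suc i \<and> box_right (T ! j) \<notin> insert (T ! i) (set (take i T))})"
      by blast
    then show ?thesis by (simp only:) (subst prod.Sigma, auto)
  qed
  have Y: "(\<Prod>(i, j)\<in>{(i, j). y_free T i j}. f i j) =
      (\<Prod>i<?n. \<Prod>j | j < i \<and> \<not> (fst (T ! j) = 0 \<and> box_up (T ! j) \<in> insert (T ! i) (set (take i T))). f i j)" for f :: "nat \<Rightarrow> nat \<Rightarrow> Kqat"
  proof -
    have "y_free T i j \<longleftrightarrow> i < ?n \<and> j < i \<and>
        \<not> (fst (T ! j) = 0 \<and> box_up (T ! j) \<in> insert (T ! i) (set (take i T)))" for i j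
    proof (cases "i < ?n")
      case True
      then show ?thesis unfolding y_free_def ex[OF True] by auto
    qed (simp add: y_free_def)
    then have "{(i, j). y_free T i j} = (SIGMA i:{..<?n}.
        {j. j < i \<and> \<not> (fst (T ! j) = 0 \<and> box_up (T ! j) \<in> insert (T ! i) (set (take i T)))})"
      by blast
    then show ?thesis by (simp only:) (subst prod.Sigma, auto)
  qed
  show ?thesis
    unfolding chart_series_def N X Y prod.distrib[symmetric] prod_dividef[symmetric]
  proof (rule prod.cong)
    fix i assume "i \<in> {..<?n}"
    then have i: "i < ?n" by simp
    let ?a = "T ! i" and ?D = "set (take i T)"
    have 1: "(\<Prod>j | j < i \<and> True. koszul_factor (box_weight (T ! j) - box_weight ?a + (1, 1))) =
        (\<Prod>d\<in>?D. koszul_factor (box_weight d - box_weight ?a + (1, 1)))"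
      using prod_take[OF d, of i, where R = "\<lambda>_. True" and f = "\<lambda>c. koszul_factor (box_weight c - box_weight ?a + (1, 1))"] i by simp
    have 2: "(\<Prod>j | j < Suc i \<and> box_right (T ! j) \<notin> insert ?a ?D. koszul_factor (box_weight (T ! j) - box_weight ?a + (1, 0))) =
        (\<Prod>d | d \<in> insert ?a ?D \<and> box_right d \<notin> insert ?a ?D. koszul_factor (box_weight d - box_weight ?a + (1, 0)))"
      unfolding ins[OF i, symmetric] using i by (intro prod_take[OF d]) simp
    have 3: "(\<Prod>j | j < i \<and> \<not> (fst (T ! j) = 0 \<and> box_up (T ! j) \<in> insert ?a ?D). koszul_factor (box_weight (T ! j) - box_weight ?a + (0, 1))) =
        (\<Prod>d | d \<in> ?D \<and> \<not> (fst d = 0 \<and> box_up d \<in> insert ?a ?D). koszul_factor (box_weight d - box_weight ?a + (0, 1)))"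
      using i by (intro prod_take[OF d]) simp
    show "(\<Prod>j | j < i \<and> True. koszul_factor (box_weight (T ! j) - box_weight ?a + (1, 1))) /
        ((\<Prod>j | j < Suc i \<and> box_right (T ! j) \<notin> insert ?a ?D. koszul_factor (box_weight (T ! j) - box_weight ?a + (1, 0))) *
         (\<Prod>j | j < i \<and> \<not> (fst (T ! j) = 0 \<and> box_up (T ! j) \<in> insert ?a ?D). koszul_factor (box_weight (T ! j) - box_weight ?a + (0, 1)))) =
      row_series ?D ?a"
      unfolding 1 2 3 row_series_def ..
  qed simp
qed

theorem specializes_chart_series:
  assumes T: "standard_tableau T"
  shows "specializes_at (inverse qa) (chart_series T * exterior_character T)
    ((- inverse qhalf_a) ^ length T *
      (\<Prod>i<length T. rfac qa (qhalf_a - inverse qhalf_a) avar (length T) (set (take i T)) (T ! i)))"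
proof -
  let ?n = "length T" and ?h = "qhalf_a - inverse qhalf_a"
  have "specializes_at (inverse qa)
      (\<Prod>i<?n. row_series (set (take i T)) (T ! i) * (1 - const_fract avar * character (- box_weight (T ! i))))
      (\<Prod>i<?n. - inverse qhalf_a * rfac qa ?h avar ?n (set (take i T)) (T ! i))"
  proof (intro specializes_at_prod specializes_row_series)
    fix i assume i: "i \<in> {..<?n}"
    have "standard_tableau (take i T @ [T ! i])"
      using standard_take[OF T, of "Suc i"] i by (simp add: take_Suc_conv_app_nth)
    then show a: "addable (set (take i T)) (T ! i)" using standard_append_iff by blast
    have "card (set (take i T)) \<le> length (take i T)" by (rule card_length)
    then show c: "card (set (take i T)) \<le> ?n" using i by simp
    show "snd (T ! i) \<le> ?n"
    proof (rule ccontr)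
      assume *: "\<not> snd (T ! i) \<le> ?n"
      have "row_len (set (take i T)) (snd (T ! i) - 1) = 0"
        by (rule row_len_eq_0) (use a c * in \<open>auto simp: addable_def\<close>)
      then show False using addable_row_less[OF a, of "snd (T ! i) - 1"] * by simp
    qed
  qed
  then show ?thesis
    by (simp only: chart_series_eq[OF T] exterior_character_def prod.distrib prod_constant card_lessThan)
qed

section \<open>The exterior product\<close>

definition ext_mult :: "('b::linorder set \<Rightarrow> 'r::comm_ring_1) \<Rightarrow> ('b set \<Rightarrow> 'r) \<Rightarrow> 'b set \<Rightarrow> 'r" where
  "ext_mult u v S = (\<Sum>A\<in>Pow S. shuffle_sign A (S - A) * u A * v (S - A))"

text \<open>The interior product, the odd derivation with theta_b sent to \<open>c b\<close>. With
  the relations as coefficients it is the Koszul differential.\<close>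

definition contract :: "'b::linorder set \<Rightarrow> ('b \<Rightarrow> 'r::comm_ring_1) \<Rightarrow> ('b set \<Rightarrow> 'r) \<Rightarrow> 'b set \<Rightarrow> 'r" where
  "contract B c u S = (\<Sum>b\<in>B - S. shuffle_sign {b} S * c b * u (insert b S))"

text \<open>Left multiplication by the generator theta_b.\<close>

definition wedge :: "'b::linorder \<Rightarrow> ('b set \<Rightarrow> 'r::comm_ring_1) \<Rightarrow> 'b set \<Rightarrow> 'r" where
  "wedge b u S = (if b \<in> S then shuffle_sign {b} (S - {b}) * u (S - {b}) else 0)"

text \<open>The parity automorphism, which carries the signs when an odd operator passes an
  element.\<close>

definition sign_twist :: "('b set \<Rightarrow> 'r::comm_ring_1) \<Rightarrow> 'b set \<Rightarrow> 'r" where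
  "sign_twist u S = (- 1) ^ card S * u S"

definition ext_scalar :: "'r::comm_ring_1 \<Rightarrow> 'b set \<Rightarrow> 'r" where
  "ext_scalar x S = (if S = {} then x else 0)"

definition supported :: "'b set \<Rightarrow> ('b set \<Rightarrow> 'r::comm_ring_1) \<Rightarrow> bool" where
  "supported B u \<longleftrightarrow> (\<forall>S. \<not> S \<subseteq> B \<longrightarrow> u S = 0)"

lemma shuffle_sign_single: "shuffle_sign {b} S = (- 1) ^ card {s \<in> S. s < b}"
proof -
  have "{(a, s). a \<in> {b} \<and> s \<in> S \<and> s < a} = Pair b ` {s \<in> S. s < b}" by auto
  then show ?thesis by (simp add: shuffle_sign_def card_image inj_on_def)
qed

lemma shuffle_sign_single_insert:
  assumes "finite S" "x \<notin> S"
  shows "(shuffle_sign {b} (insert x S) :: 'r::comm_ring_1) = (if x < b then - 1 else 1) * shuffle_sign {b} S"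
proof -
  have "{s \<in> insert x S. s < b} = (if x < b then insert x {s \<in> S. s < b} else {s \<in> S. s < b})" by auto
  then show ?thesis using assms by (simp add: shuffle_sign_single)
qed

lemma shuffle_sign_single_sq [simp]: "shuffle_sign {b} S * shuffle_sign {b} S = (1 :: 'r::comm_ring_1)"
  by (simp add: shuffle_sign_single flip: power_mult_distrib)

lemma shuffle_sign_single_sq' [simp]: "shuffle_sign {b} S * (shuffle_sign {b} S * x) = (x :: 'r::comm_ring_1)"
  by (simp flip: mult.assoc)

lemma shuffle_sign_insert:
  assumes "finite A" "finite C" "b \<notin> A"
  shows "(shuffle_sign (insert b A) C :: 'r::comm_ring_1) = shuffle_sign A C * shuffle_sign {b} C"
proof -
  have "{(a, c). a \<in> insert b A \<and> c \<in> C \<and> c < a} =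
      {(a, c). a \<in> A \<and> c \<in> C \<and> c < a} \<union> {(a, c). a \<in> {b} \<and> c \<in> C \<and> c < a}" by auto
  moreover have "finite {(a, c). a \<in> A \<and> c \<in> C \<and> c < a}" "finite {(a, c). a \<in> {b} \<and> c \<in> C \<and> c < a}"
    using assms by (auto intro: finite_subset[of _ "A \<times> C"] finite_subset[of _ "{b} \<times> C"])
  moreover have "{(a, c). a \<in> A \<and> c \<in> C \<and> c < a} \<inter> {(a, c). a \<in> {b} \<and> c \<in> C \<and> c < a} = {}"
    using assms by auto
  ultimately show ?thesis by (simp add: shuffle_sign_def card_Un_disjoint power_add)
qed

lemma shuffle_sign_single_Un:
  assumes "finite A" "finite C" "A \<inter> C = {}"
  shows "(shuffle_sign {b} (A \<union> C) :: 'r::comm_ring_1) = shuffle_sign {b} A * shuffle_sign {b} C"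
proof -
  have "{s \<in> A \<union> C. s < b} = {s \<in> A. s < b} \<union> {s \<in> C. s < b}" by auto
  then show ?thesis using assms by (subst (1 2 3) shuffle_sign_single) (simp add: card_Un_disjoint disjoint_iff power_add)
qed

lemma shuffle_sign_empty [simp]: "shuffle_sign {} C = 1" "shuffle_sign A {} = 1"
  by (simp_all add: shuffle_sign_def)

lemma shuffle_sign_swap:
  assumes "finite S" "a \<noteq> b" "a \<notin> S" "b \<notin> S"
  shows "(shuffle_sign {a} (insert b S) * shuffle_sign {b} S :: 'r::comm_ring_1) =
    - (shuffle_sign {b} (insert a S) * shuffle_sign {a} S)"
  using assms by (auto simp: shuffle_sign_single_insert not_less)

lemma sum_insert_Diff:
  assumes "finite B" "b \<in> B"
  shows "sum f B = f b + sum f (B - {b})"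
  using assms by (rule sum.remove)

lemma wedge_add: "wedge b (\<lambda>S. u S + v S) = (\<lambda>S. wedge b u S + wedge b v S)"
  by (auto simp: wedge_def distrib_left)

lemma wedge_zero: "wedge b (\<lambda>S. 0) = (\<lambda>S. 0)" by (auto simp: wedge_def)

lemma wedge_wedge_same: "wedge b (wedge b u) = (\<lambda>S. 0)" by (auto simp: wedge_def)

lemma wedge_uminus: "wedge b (\<lambda>S. - u S) = (\<lambda>S. - wedge b u S)"
  by (auto simp: wedge_def)

lemma wedge_smult: "wedge b (\<lambda>S. x * u S) = (\<lambda>S. x * wedge b u S)"
  by (auto simp: wedge_def mult_ac)

lemma contract_add: "contract B c (\<lambda>S. u S + v S) = (\<lambda>S. contract B c u S + contract B c v S)"
  by (auto simp: contract_def distrib_left sum.distrib)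

lemma contract_smult: "contract B c (\<lambda>S. x * u S) = (\<lambda>S. x * contract B c u S)"
  by (auto simp: contract_def sum_distrib_left mult_ac)

lemma contract_zero: "contract B c (\<lambda>S. 0) = (\<lambda>S. 0)" by (rule ext) (simp add: contract_def)

lemma contract_uminus: "contract B c (\<lambda>S. - u S) = (\<lambda>S. - contract B c u S)"
  using contract_smult[of B c "- 1" u] by simp

lemma contract_diff: "contract B c (\<lambda>S. u S - v S) = (\<lambda>S. contract B c u S - contract B c v S)"
  using contract_add[of B c u "\<lambda>S. - v S"] by (simp add: contract_uminus)

lemma ext_mult_add_left: "ext_mult (\<lambda>S. u S + u' S) v = (\<lambda>S. ext_mult u v S + ext_mult u' v S)"
  by (auto simp: ext_mult_def distrib_left distrib_right sum.distrib)

lemma ext_mult_add_right: "ext_mult u (\<lambda>S. v S + v' S) = (\<lambda>S. ext_mult u v S + ext_mult u v' S)"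
  by (auto simp: ext_mult_def distrib_left distrib_right sum.distrib)

lemma ext_mult_smult_left: "ext_mult (\<lambda>S. x * u S) v = (\<lambda>S. x * ext_mult u v S)"
  by (auto simp: ext_mult_def sum_distrib_left mult_ac)

lemma ext_mult_uminus_left: "ext_mult (\<lambda>S. - u S) v = (\<lambda>S. - ext_mult u v S)"
  using ext_mult_smult_left[of "- 1" u v] by simp

lemma ext_mult_diff_left: "ext_mult (\<lambda>S. u S - u' S) v = (\<lambda>S. ext_mult u v S - ext_mult u' v S)"
  using ext_mult_add_left[of u "\<lambda>S. - u' S" v] by (simp add: ext_mult_uminus_left)

lemma sign_twist_add: "sign_twist (\<lambda>S. u S + v S) = (\<lambda>S. sign_twist u S + sign_twist v S)"
  by (auto simp: sign_twist_def distrib_left)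

lemma sign_twist_wedge: "supported B u \<Longrightarrow> finite B \<Longrightarrow> sign_twist (wedge b u) = (\<lambda>S. - wedge b (sign_twist u) S)"
proof
  fix S assume u: "supported B u" "finite B"
  show "sign_twist (wedge b u) S = - wedge b (sign_twist u) S"
  proof (cases "b \<in> S \<and> S - {b} \<subseteq> B")
    case True
    define U where "U = S - {b}"
    have "finite U" unfolding U_def using True u(2) finite_subset by blast
    then have U: "S = insert b U" "b \<notin> U" "finite U"
      using True by (auto simp: U_def)
    then have "card S = Suc (card U)" by simp
    then show ?thesis using True unfolding sign_twist_def wedge_def U_def[symmetric] by simp
  next
    case False
    then show ?thesis using u by (auto simp: sign_twist_def wedge_def supported_def)
  qed
qed

lemma supported_wedge: "supported B u \<Longrightarrow> b \<in> B \<Longrightarrow> supported B (wedge b u)"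
  unfolding supported_def
proof (intro allI impI)
  fix S assume *: "\<forall>S. \<not> S \<subseteq> B \<longrightarrow> u S = 0" "b \<in> B" "\<not> S \<subseteq> B"
  then have "\<not> S - {b} \<subseteq> B" by auto
  then show "wedge b u S = 0" using * by (simp add: wedge_def)
qed

lemma supported_contract: "supported B u \<Longrightarrow> supported B (contract C c u)"
  by (auto simp: supported_def contract_def)

lemma supported_sign_twist: "supported B u \<Longrightarrow> supported B (sign_twist u)"
  by (auto simp: supported_def sign_twist_def)

lemma supported_add: "supported B u \<Longrightarrow> supported B v \<Longrightarrow> supported B (\<lambda>S. u S + v S)"
  by (auto simp: supported_def)

text \<open>The exterior algebra is built from scalars by sums and left multiplication by
  generators. Identities between operators then need a check against a single \<open>wedge\<close>
  instead of signs of shuffles.\<close>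

lemma supported_induct [consumes 2, case_names scalar wedge add]:
  fixes u :: "'b::linorder set \<Rightarrow> 'r::comm_ring_1"
  assumes B: "finite B" and u: "supported B u"
    and scalar: "\<And>x. P (ext_scalar x)"
    and wedge: "\<And>b u. b \<in> B \<Longrightarrow> supported B u \<Longrightarrow> P u \<Longrightarrow> P (wedge b u)"
    and add: "\<And>u v. supported B u \<Longrightarrow> supported B v \<Longrightarrow> P u \<Longrightarrow> P v \<Longrightarrow> P (\<lambda>S. u S + v S)"
  shows "P u"
proof -
  define single where "single A x = (\<lambda>S. if S = A then x else 0)" for A :: "'b set" and x :: 'r
  have sup: "A \<subseteq> B \<Longrightarrow> supported B (single A x)" for A x by (auto simp: single_def supported_def)
  have P_single: "A \<subseteq> B \<Longrightarrow> P (single A x)" if "finite A" for A x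
    using that
  proof (induction A arbitrary: x rule: finite_induct)
    case empty
    have "single {} x = ext_scalar x" by (auto simp: single_def ext_scalar_def)
    then show ?case using scalar by simp
  next
    case (insert b A)
    \<comment> \<open>The sign in the coefficient cancels the one that \<open>wedge\<close>
      introduces.\<close>
    have "single (insert b A) x = wedge b (single A (shuffle_sign {b} A * x))"
    proof
      fix S
      show "single (insert b A) x S = wedge b (single A (shuffle_sign {b} A * x)) S"
        using insert.hyps by (auto simp: single_def wedge_def)
    qed
    then show ?case using wedge[OF _ sup insert.IH] insert.prems by auto
  qed
  have "P v" if "finite F" "F \<subseteq> Pow B" "\<And>S. S \<notin> F \<Longrightarrow> v S = 0" for F v
    using that
  proof (induction F arbitrary: v rule: finite_induct)
    case empty
    then have "v = ext_scalar 0" by (auto simp: ext_scalar_def)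
    then show ?case using scalar by simp
  next
    case (insert A F)
    let ?v = "v(A := 0)"
    have A: "A \<subseteq> B" "finite A" using insert.prems B finite_subset by auto
    have "supported B ?v" unfolding supported_def using insert.prems by (metis PowD fun_upd_apply subsetD insertE)
    moreover have "P ?v" by (rule insert.IH) (use insert.prems in auto)
    moreover have "v = (\<lambda>S. single A (v A) S + ?v S)" by (auto simp: single_def)
    ultimately show ?case using add[OF sup[OF A(1)] _ P_single[OF A(2,1)]] by metis
  qed
  from this[of "Pow B"] show ?thesis using B u by (auto simp: supported_def)
qed

lemma wedge_anticommute:
  assumes B: "finite B" and u: "supported B u"
  shows "wedge a (wedge b u) = (\<lambda>S. - wedge b (wedge a u) S)"
proof
  fix S
  show "wedge a (wedge b u) S = - wedge b (wedge a u) S"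
  proof (cases "a \<in> S \<and> b \<in> S \<and> a \<noteq> b \<and> S - {a, b} \<subseteq> B")
    case True
    define U where "U = S - {a, b}"
    have f: "finite U" using True B finite_subset unfolding U_def by blast
    have S: "S - {a} = insert b U" "S - {b} = insert a U" "insert b U - {b} = U" "insert a U - {a} = U"
      using True by (auto simp: U_def)
    have "a \<notin> U" "b \<notin> U" by (auto simp: U_def)
    from shuffle_sign_swap[OF f _ this, where 'r = 'b] True show ?thesis
      by (simp add: wedge_def S flip: mult.assoc)
  next
    case False
    have e: "S - {a} - {b} = S - {a, b}" "S - {b} - {a} = S - {a, b}" by auto
    have "a \<notin> S \<or> b \<notin> S \<or> a = b \<or> u (S - {a, b}) = 0"
    proof (cases "S - {a, b} \<subseteq> B")
      case True
      then show ?thesis using False by blast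
    qed (use u in \<open>simp add: supported_def\<close>)
    then show ?thesis by (elim disjE) (simp_all add: wedge_def e)
  qed
qed

text \<open>The Leibniz rule for one generator. It carries the sign computation from which the other
  properties of \<open>contract\<close> follow by \<open>supported_induct\<close>.\<close>

lemma contract_wedge:
  assumes B: "finite B" and u: "supported B u" and b: "b \<in> B"
  shows "contract B c (wedge b u) = (\<lambda>S. c b * u S - wedge b (contract B c u) S)"
proof
  fix S
  show "contract B c (wedge b u) S = c b * u S - wedge b (contract B c u) S"
  proof (cases "S \<subseteq> B")
    case False
    then have "contract B c (wedge b u) S = 0" "wedge b (contract B c u) S = 0"
      using supported_contract[OF supported_wedge[OF u b]] supported_wedge[OF supported_contract[OF u] b]
      by (auto simp: supported_def)
    then show ?thesis using u False by (simp add: supported_def)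
  next
    case S: True
    then have f: "finite S" using B finite_subset by blast
    show ?thesis
    proof (cases "b \<in> S")
      case False
      have "contract B c (wedge b u) S = (\<Sum>x\<in>B - S. if x = b then c b * u S else 0)"
        unfolding contract_def
      proof (rule sum.cong)
        fix x assume "x \<in> B - S"
        then show "shuffle_sign {x} S * c x * wedge b u (insert x S) = (if x = b then c b * u S else 0)"
          using False by (auto simp: wedge_def mult_ac)
      qed simp
      also have "\<dots> = c b * u S" using B b False by simp
      finally show ?thesis using False by (simp add: wedge_def)
    next
      case True
      define U where "U = S - {b}"
      have U: "b \<notin> U" "S = insert b U" "finite U" using True f by (auto simp: U_def)
      \<comment> \<open>The summand at \<open>b\<close> returns the coefficient of \<open>u\<close>
        at \<open>S\<close>. Every other summand differs from its counterpart in the contraction of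
        the wedge by a transposition of two generators, hence by a sign.\<close>
      have "shuffle_sign {b} U * contract B c u U =
          shuffle_sign {b} U * (shuffle_sign {b} U * c b * u (insert b U)) +
          shuffle_sign {b} U * (\<Sum>x\<in>B - S. shuffle_sign {x} U * c x * u (insert x U))"
      proof -
        have "B - U - {b} = B - S" using U by auto
        then show ?thesis unfolding contract_def using B b U
          by (subst sum_insert_Diff[of "B - U" b]) (auto simp: distrib_left)
      qed
      also have "shuffle_sign {b} U * (shuffle_sign {b} U * c b * u (insert b U)) = c b * u S"
        using U by (simp add: mult.assoc)
      also have "shuffle_sign {b} U * (\<Sum>x\<in>B - S. shuffle_sign {x} U * c x * u (insert x U)) =
          (\<Sum>x\<in>B - S. - (shuffle_sign {x} S * c x * wedge b u (insert x S)))"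
        unfolding sum_distrib_left
      proof (rule sum.cong)
        fix x assume x: "x \<in> B - S"
        then have xb: "x \<noteq> b" "x \<notin> U" using U by auto
        have "insert x S - {b} = insert x U" using U xb by auto
        then have w: "wedge b u (insert x S) = shuffle_sign {b} (insert x U) * u (insert x U)"
          using True by (simp add: wedge_def)
        have sw: "shuffle_sign {x} (insert b U) * shuffle_sign {b} U = - (shuffle_sign {b} (insert x U) * shuffle_sign {x} U :: 'b)"
          by (rule shuffle_sign_swap) (use U xb in auto)
        have "shuffle_sign {x} S * shuffle_sign {b} (insert x U) = - (shuffle_sign {b} U * shuffle_sign {x} U :: 'b)"
        proof -
          have "shuffle_sign {x} (insert b U) * shuffle_sign {b} U * shuffle_sign {b} U * shuffle_sign {b} (insert x U) =
              - (shuffle_sign {b} (insert x U) * shuffle_sign {x} U * shuffle_sign {b} U * shuffle_sign {b} (insert x U) :: 'b)"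
            using sw by simp
          then show ?thesis by (simp add: U(2) mult_ac)
        qed
        note key = this
        have "shuffle_sign {x} S * c x * wedge b u (insert x S) =
            (shuffle_sign {x} S * shuffle_sign {b} (insert x U)) * c x * u (insert x U)"
          unfolding w by (simp only: mult_ac)
        also have "\<dots> = - (shuffle_sign {b} U * shuffle_sign {x} U) * c x * u (insert x U)"
          by (simp only: key)
        finally show "shuffle_sign {b} U * (shuffle_sign {x} U * c x * u (insert x U)) =
            - (shuffle_sign {x} S * c x * wedge b u (insert x S))" by (simp add: mult.assoc)
      qed simp
      finally have "wedge b (contract B c u) S = c b * u S - contract B c (wedge b u) S"
        using True by (simp add: wedge_def contract_def U_def sum_negf)
      then show ?thesis by simp
    qed
  qed
qed

lemma contract_scalar: "contract B c (ext_scalar x) = (\<lambda>S. 0)"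
  by (auto simp: contract_def ext_scalar_def)

lemma contract_contract:
  assumes B: "finite B" and u: "supported B u"
  shows "contract B c (contract B c u) = (\<lambda>S. 0)"
  using B u
proof (induction rule: supported_induct)
  case (scalar x)
  then show ?case by (simp add: contract_scalar contract_zero)
next
  case (wedge b u)
  then show ?case
    using contract_wedge[OF B supported_contract[OF wedge(2)] wedge(1)]
    by (simp add: contract_wedge[OF B] contract_diff contract_smult wedge_zero)
next
  case (add u v)
  then show ?case by (simp add: contract_add)
qed

lemma contract_anticommute:
  assumes B: "finite B" and u: "supported B u"
  shows "contract B c (contract B d u) = (\<lambda>S. - contract B d (contract B c u) S)"
  using B u
proof (induction rule: supported_induct)
  case (scalar x)
  then show ?case by (simp add: contract_scalar contract_zero)
next
  case (wedge b u)
  then show ?case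
    using contract_wedge[OF B supported_contract[OF wedge(2)] wedge(1)]
    by (simp add: contract_wedge[OF B] contract_diff contract_smult wedge_uminus; simp add: fun_eq_iff)
next
  case (add u v)
  then show ?case by (simp add: contract_add)
qed

text \<open>Only the subsets containing \<open>b\<close> contribute. Moving theta_b to the front
  past all of the remaining set is moving it past the two parts of the shuffle separately.\<close>

lemma ext_mult_wedge_left:
  assumes B: "finite B" and u: "supported B u" and v: "supported B v"
  shows "ext_mult (wedge b u) v = wedge b (ext_mult u v)"
proof
  fix S
  show "ext_mult (wedge b u) v S = wedge b (ext_mult u v) S"
  proof (cases "b \<in> S \<and> finite S")
    case False
    then consider "b \<notin> S" | "infinite S" "b \<in> S" by blast
    then show ?thesis
    proof cases
      case 1
      then have "ext_mult (wedge b u) v S = 0" unfolding ext_mult_def by (intro sum.neutral) (auto simp: wedge_def)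
      then show ?thesis using 1 by (simp add: wedge_def)
    next
      case 2
      then show ?thesis by (simp add: ext_mult_def wedge_def)
    qed
  next
    case True
    define U where "U = S - {b}"
    have U: "b \<notin> U" "S = insert b U" "finite U" using True by (auto simp: U_def)
    have P: "Pow S = Pow U \<union> insert b ` Pow U" unfolding U(2) by (rule Pow_insert)
    have "ext_mult (wedge b u) v S = (\<Sum>A\<in>insert b ` Pow U. shuffle_sign A (S - A) * wedge b u A * v (S - A))"
      unfolding ext_mult_def
      by (rule sum.mono_neutral_right) (use U P in \<open>auto simp: wedge_def\<close>)
    also have "\<dots> = (\<Sum>A\<in>Pow U. shuffle_sign (insert b A) (S - insert b A) * wedge b u (insert b A) * v (S - insert b A))"
      by (subst sum.reindex) (use U in \<open>auto simp: inj_on_def\<close>)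
    also have "\<dots> = (\<Sum>A\<in>Pow U. shuffle_sign {b} U * (shuffle_sign A (U - A) * u A * v (U - A)))"
    proof (rule sum.cong)
      fix A assume "A \<in> Pow U"
      then have A: "A \<subseteq> U" "b \<notin> A" "finite A" using U finite_subset by auto
      have e: "S - insert b A = U - A" "insert b A - {b} = A" using U A by auto
      have f: "finite (U - A)" using U by simp
      have "U = A \<union> (U - A)" using A by auto
      then have k: "(shuffle_sign {b} U :: 'b) = shuffle_sign {b} A * shuffle_sign {b} (U - A)"
        using shuffle_sign_single_Un[of A "U - A" b] A f by auto
      have "shuffle_sign (insert b A) (S - insert b A) * wedge b u (insert b A) * v (S - insert b A) =
          shuffle_sign A (U - A) * shuffle_sign {b} (U - A) * (shuffle_sign {b} A * u A) * v (U - A)"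
        by (simp only: e wedge_def shuffle_sign_insert[OF A(3) f A(2)] insertI1 if_True)
      also have "\<dots> = shuffle_sign {b} U * (shuffle_sign A (U - A) * u A * v (U - A))"
        unfolding k by (simp only: mult_ac)
      finally show "shuffle_sign (insert b A) (S - insert b A) * wedge b u (insert b A) * v (S - insert b A) =
          shuffle_sign {b} U * (shuffle_sign A (U - A) * u A * v (U - A))" .
    qed simp
    also have "\<dots> = wedge b (ext_mult u v) S"
      using True by (simp add: wedge_def ext_mult_def U_def sum_distrib_left)
    finally show ?thesis .
  qed
qed

lemma ext_mult_scalar_left:
  assumes "finite B" "supported B v"
  shows "ext_mult (ext_scalar x) v = (\<lambda>S. x * v S)"
proof
  fix S
  show "ext_mult (ext_scalar x) v S = x * v S"
  proof (cases "finite S")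
    case True
    have "ext_mult (ext_scalar x) v S = (\<Sum>A\<in>Pow S. if A = {} then x * v S else 0)"
      unfolding ext_mult_def by (rule sum.cong) (auto simp: ext_scalar_def)
    also have "\<dots> = x * v S" using True by simp
    finally show ?thesis .
  next
    case False
    then have "\<not> S \<subseteq> B" using assms finite_subset by blast
    then show ?thesis using assms False by (simp add: ext_mult_def supported_def)
  qed
qed

lemma supported_ext_mult:
  assumes "supported B u" "supported B v"
  shows "supported B (ext_mult u v)"
  unfolding supported_def
proof (intro allI impI)
  fix S assume S: "\<not> S \<subseteq> B"
  have "shuffle_sign A (S - A) * u A * v (S - A) = 0" if "A \<in> Pow S" for A
  proof (cases "A \<subseteq> B")
    case True
    then have "\<not> S - A \<subseteq> B" using S by auto
    then show ?thesis using assms by (simp add: supported_def)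
  next
    case False
    then show ?thesis using assms by (simp add: supported_def)
  qed
  then show "ext_mult u v S = 0" unfolding ext_mult_def by (intro sum.neutral) blast
qed

lemma sign_twist_scalar: "sign_twist (ext_scalar x) = ext_scalar x"
  by (auto simp: sign_twist_def ext_scalar_def)

text \<open>The generator has to pass \<open>u\<close> before it stands on the left, which is what
  the parity automorphism records.\<close>

lemma ext_mult_wedge_right:
  assumes B: "finite B" and u: "supported B u" and v: "supported B v" and b: "b \<in> B"
  shows "ext_mult u (wedge b v) = wedge b (ext_mult (sign_twist u) v)"
  using B u
proof (induction rule: supported_induct)
  case (scalar x)
  then show ?case
    by (simp add: ext_mult_scalar_left[OF B supported_wedge[OF v b]] ext_mult_scalar_left[OF B v] sign_twist_scalar wedge_smult)
next
  case (wedge a u)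
  have s: "supported B (sign_twist u)" by (rule supported_sign_twist[OF wedge(2)])
  show ?case
    using wedge wedge_anticommute[OF B supported_ext_mult[OF s v], of a b]
    by (simp add: wedge_uminus ext_mult_wedge_left[OF B _ supported_wedge[OF v b]] sign_twist_wedge[OF _ B]
        ext_mult_uminus_left ext_mult_wedge_left[OF B s v])
next
  case (add u v')
  then show ?case by (simp add: ext_mult_add_left sign_twist_add wedge_add)
qed

lemma contract_ext_mult:
  assumes B: "finite B" and u: "supported B u" and v: "supported B v"
  shows "contract B c (ext_mult u v) =
    (\<lambda>S. ext_mult (contract B c u) v S + ext_mult (sign_twist u) (contract B c v) S)"
  using B u
proof (induction rule: supported_induct)
  case (scalar x)
  have "ext_mult (\<lambda>S. 0) v = (\<lambda>S. 0)" by (rule ext) (simp add: ext_mult_def)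
  then show ?case
    by (simp add: ext_mult_scalar_left[OF B v] ext_mult_scalar_left[OF B supported_contract[OF v]]
        contract_smult contract_scalar sign_twist_scalar)
next
  case (wedge b u)
  have s: "supported B (sign_twist u)" by (rule supported_sign_twist[OF wedge(2)])
  have cu: "supported B (contract B c u)" by (rule supported_contract[OF wedge(2)])
  show ?case
    using wedge
    by (simp add: ext_mult_wedge_left[OF B _ v] contract_wedge[OF B supported_ext_mult[OF wedge(2) v]]
        contract_wedge[OF B] ext_mult_diff_left ext_mult_smult_left cu sign_twist_wedge[OF _ B]
        ext_mult_uminus_left ext_mult_wedge_left[OF B s supported_contract[OF v]] wedge_add; simp add: fun_eq_iff)
next
  case (add u v')
  then show ?case by (simp add: ext_mult_add_left sign_twist_add contract_add algebra_simps)
qed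

section \<open>Evaluation of polynomials\<close>

lemma poly_mapping_eq_sum: "p = (\<Sum>m\<in>Poly_Mapping.keys p. Poly_Mapping.single m (Poly_Mapping.lookup p m))"
proof (rule poly_mapping_eqI)
  fix k
  have "Poly_Mapping.lookup (\<Sum>m\<in>Poly_Mapping.keys p. Poly_Mapping.single m (Poly_Mapping.lookup p m)) k =
      (\<Sum>m\<in>Poly_Mapping.keys p. if m = k then Poly_Mapping.lookup p k else 0)"
    unfolding lookup_sum by (rule sum.cong) (auto simp: lookup_single when_def)
  also have "\<dots> = Poly_Mapping.lookup p k" by (simp add: in_keys_iff)
  finally show "Poly_Mapping.lookup p k = Poly_Mapping.lookup (\<Sum>m\<in>Poly_Mapping.keys p. Poly_Mapping.single m (Poly_Mapping.lookup p m)) k" ..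
qed

definition mono_eval :: "('v \<Rightarrow> 'r::comm_ring_1) \<Rightarrow> ('v \<Rightarrow>\<^sub>0 nat) \<Rightarrow> 'r" where
  "mono_eval x m = (\<Prod>v\<in>Poly_Mapping.keys m. x v ^ Poly_Mapping.lookup m v)"

text \<open>The map \<open>h\<close> on coefficients lets one definition serve both the value at a
  point (\<open>h\<close> the identity) and the substitution of polynomials
  (\<open>h = pconst\<close>).\<close>

definition poly_eval :: "(complex \<Rightarrow> 'r::comm_ring_1) \<Rightarrow> ('v \<Rightarrow> 'r) \<Rightarrow> 'v cpoly \<Rightarrow> 'r" where
  "poly_eval h x p = (\<Sum>m\<in>Poly_Mapping.keys p. h (Poly_Mapping.lookup p m) * mono_eval x m)"

lemma poly_value_eq: "poly_value x = poly_eval (\<lambda>c. c) x"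
  by (rule ext) (simp add: poly_value_def poly_eval_def mono_eval_def)

lemma mono_eval_superset:
  "finite F \<Longrightarrow> Poly_Mapping.keys m \<subseteq> F \<Longrightarrow> mono_eval x m = (\<Prod>v\<in>F. x v ^ Poly_Mapping.lookup m v)"
  unfolding mono_eval_def by (rule prod.mono_neutral_left) (auto simp: in_keys_iff)

lemma mono_eval_add: "mono_eval x (m + m') = mono_eval x m * mono_eval x m'"
proof -
  let ?F = "Poly_Mapping.keys m \<union> Poly_Mapping.keys m'"
  have "mono_eval x (m + m') = (\<Prod>v\<in>?F. x v ^ Poly_Mapping.lookup (m + m') v)"
    by (rule mono_eval_superset) (use keys_add[of m m'] in auto)
  also have "\<dots> = mono_eval x m * mono_eval x m'"
    by (simp add: lookup_add power_add prod.distrib mono_eval_superset[of ?F m] mono_eval_superset[of ?F m'])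
  finally show ?thesis .
qed

lemma mono_eval_0 [simp]: "mono_eval x 0 = 1" by (simp add: mono_eval_def)

lemma mono_eval_single: "mono_eval x (Poly_Mapping.single v k) = x v ^ k"
  by (cases "k = 0") (simp_all add: mono_eval_def)

context
  fixes h :: "complex \<Rightarrow> 'r::comm_ring_1"
  assumes h0: "h 0 = 0" and h1: "h 1 = 1" and hadd: "\<And>c d. h (c + d) = h c + h d"
    and hmult: "\<And>c d. h (c * d) = h c * h d"
begin

lemma poly_eval_superset:
  "finite F \<Longrightarrow> Poly_Mapping.keys p \<subseteq> F \<Longrightarrow> poly_eval h x p = (\<Sum>m\<in>F. h (Poly_Mapping.lookup p m) * mono_eval x m)"
  unfolding poly_eval_def by (rule sum.mono_neutral_left) (auto simp: in_keys_iff h0)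

lemma poly_eval_add: "poly_eval h x (p + q) = poly_eval h x p + poly_eval h x q"
proof -
  let ?F = "Poly_Mapping.keys p \<union> Poly_Mapping.keys q"
  have "poly_eval h x (p + q) = (\<Sum>m\<in>?F. h (Poly_Mapping.lookup (p + q) m) * mono_eval x m)"
    by (rule poly_eval_superset) (use keys_add[of p q] in auto)
  also have "\<dots> = poly_eval h x p + poly_eval h x q"
    by (simp add: lookup_add hadd distrib_right sum.distrib poly_eval_superset[of ?F p] poly_eval_superset[of ?F q])
  finally show ?thesis .
qed

lemma poly_eval_0: "poly_eval h x 0 = 0" by (simp add: poly_eval_def)

lemma poly_eval_sum: "poly_eval h x (sum f A) = (\<Sum>a\<in>A. poly_eval h x (f a))"
  by (induction A rule: infinite_finite_induct) (simp_all add: poly_eval_0 poly_eval_add)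

lemma poly_eval_single: "poly_eval h x (Poly_Mapping.single m c) = h c * mono_eval x m"
  by (cases "c = 0") (simp_all add: poly_eval_def h0)

lemma poly_eval_mult: "poly_eval h x (p * q) = poly_eval h x p * poly_eval h x q"
proof -
  have "p * q = (\<Sum>m\<in>Poly_Mapping.keys p. \<Sum>n\<in>Poly_Mapping.keys q.
      Poly_Mapping.single (m + n) (Poly_Mapping.lookup p m * Poly_Mapping.lookup q n))"
    by (subst poly_mapping_eq_sum[of p], subst poly_mapping_eq_sum[of q]) (simp add: sum_product mult_single)
  then have "poly_eval h x (p * q) = (\<Sum>m\<in>Poly_Mapping.keys p. \<Sum>n\<in>Poly_Mapping.keys q.
      (h (Poly_Mapping.lookup p m) * mono_eval x m) * (h (Poly_Mapping.lookup q n) * mono_eval x n))"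
    by (simp add: poly_eval_sum poly_eval_single hmult mono_eval_add mult_ac)
  then show ?thesis by (simp add: poly_eval_def sum_product)
qed

lemma poly_eval_pconst: "poly_eval h x (pconst c) = h c"
  by (simp add: pconst_def poly_eval_single)

lemma poly_eval_pvar: "poly_eval h x (pvar v) = x v"
  by (simp add: pvar_def poly_eval_single h1 mono_eval_single)

lemma poly_eval_1: "poly_eval h x 1 = 1"
  using poly_eval_pconst[of x 1] by (simp add: pconst_def h1)

lemma poly_eval_uminus: "poly_eval h x (- p) = - poly_eval h x p"
  using poly_eval_add[of x p "- p"] by (simp add: poly_eval_0 eq_neg_iff_add_eq_0 add.commute)

lemma poly_eval_diff: "poly_eval h x (p - q) = poly_eval h x p - poly_eval h x q"
  using poly_eval_add[of x p "- q"] by (simp add: poly_eval_uminus)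

end

lemmas poly_value_simps = poly_eval_add[of "\<lambda>c. c"] poly_eval_mult[of "\<lambda>c. c"] poly_eval_pconst[of "\<lambda>c. c"]
  poly_eval_pvar[of "\<lambda>c. c"] poly_eval_1[of "\<lambda>c. c"] poly_eval_0[of "\<lambda>c. c"] poly_eval_uminus[of "\<lambda>c. c"]
  poly_eval_diff[of "\<lambda>c. c"]

lemma pconst_hom: "pconst 0 = 0" "pconst 1 = 1" "pconst (c + d) = pconst c + pconst d" "pconst (c * d) = pconst c * pconst d"
  by (simp_all add: pconst_def single_add mult_single)

lemmas subst_simps = poly_eval_add[of pconst, OF pconst_hom] poly_eval_mult[of pconst, OF pconst_hom]
  poly_eval_pconst[of pconst, OF pconst_hom] poly_eval_pvar[of pconst, OF pconst_hom]
  poly_eval_1[of pconst, OF pconst_hom] poly_eval_0[of pconst, OF pconst_hom]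
  poly_eval_uminus[of pconst, OF pconst_hom] poly_eval_diff[of pconst, OF pconst_hom]

section \<open>Weights of polynomials and induction on homogeneous polynomials\<close>

lemma monomial_weight_superset:
  "finite F \<Longrightarrow> Poly_Mapping.keys m \<subseteq> F \<Longrightarrow> monomial_weight g m =
    (\<Sum>v\<in>F. (int (Poly_Mapping.lookup m v) * fst (g v), int (Poly_Mapping.lookup m v) * snd (g v)))"
  unfolding monomial_weight_def by (rule sum.mono_neutral_left) (auto simp: in_keys_iff zero_prod_def)

lemma monomial_weight_add: "monomial_weight g (m + m') = monomial_weight g m + monomial_weight g m'"
proof -
  let ?F = "Poly_Mapping.keys m \<union> Poly_Mapping.keys m'"
  have "monomial_weight g (m + m') = (\<Sum>v\<in>?F. (int (Poly_Mapping.lookup (m + m') v) * fst (g v), int (Poly_Mapping.lookup (m + m') v) * snd (g v)))"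
    by (rule monomial_weight_superset) (use keys_add[of m m'] in auto)
  also have "\<dots> = (\<Sum>v\<in>?F. (int (Poly_Mapping.lookup m v) * fst (g v), int (Poly_Mapping.lookup m v) * snd (g v)) +
      (int (Poly_Mapping.lookup m' v) * fst (g v), int (Poly_Mapping.lookup m' v) * snd (g v)))"
    by (rule sum.cong) (simp_all add: lookup_add distrib_right)
  also have "\<dots> = monomial_weight g m + monomial_weight g m'"
    by (simp only: sum.distrib monomial_weight_superset[of ?F m] monomial_weight_superset[of ?F m'] finite_Un finite_keys Un_upper1 Un_upper2)
  finally show ?thesis .
qed

lemma homogeneous_add: "homogeneous g w p \<Longrightarrow> homogeneous g w q \<Longrightarrow> homogeneous g w (p + q)"
  using keys_add[of p q] by (auto simp: homogeneous_def)

lemma homogeneous_0 [simp]: "homogeneous g w 0" by (simp add: homogeneous_def)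

lemma homogeneous_uminus: "homogeneous g w p \<Longrightarrow> homogeneous g w (- p)"
  by (simp add: homogeneous_def)

lemma homogeneous_diff: "homogeneous g w p \<Longrightarrow> homogeneous g w q \<Longrightarrow> homogeneous g w (p - q)"
  using homogeneous_add[of g w p "- q"] by (simp add: homogeneous_uminus)

lemma homogeneous_mult:
  assumes "homogeneous g w p" "homogeneous g w' q" shows "homogeneous g (w + w') (p * q)"
  unfolding homogeneous_def
proof
  fix m assume "m \<in> Poly_Mapping.keys (p * q)"
  then obtain a b where "m = a + b" "a \<in> Poly_Mapping.keys p" "b \<in> Poly_Mapping.keys q"
    using keys_mult[of p q] by blast
  then show "monomial_weight g m = w + w'" using assms by (simp add: homogeneous_def monomial_weight_add)
qed

lemma homogeneous_pconst: "homogeneous g 0 (pconst c)"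
  by (simp add: homogeneous_def pconst_def monomial_weight_def)

lemma homogeneous_pvar: "homogeneous g (g v) (pvar v)"
  by (simp add: homogeneous_def pvar_def monomial_weight_def)

lemma homogeneous_1: "homogeneous g 0 1"
  using homogeneous_pconst[of g 1] by (simp add: pconst_hom)

lemma polys_in_add: "p \<in> polys_in V \<Longrightarrow> q \<in> polys_in V \<Longrightarrow> p + q \<in> polys_in V"
  using keys_add[of p q] by (auto simp: polys_in_def)

lemma polys_in_0 [simp]: "0 \<in> polys_in V" by (simp add: polys_in_def)

lemma polys_in_uminus: "p \<in> polys_in V \<Longrightarrow> - p \<in> polys_in V" by (simp add: polys_in_def)

lemma polys_in_diff: "p \<in> polys_in V \<Longrightarrow> q \<in> polys_in V \<Longrightarrow> p - q \<in> polys_in V"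
  using polys_in_add[of p V "- q"] by (simp add: polys_in_uminus)

lemma polys_in_mult:
  assumes "p \<in> polys_in V" "q \<in> polys_in V" shows "p * q \<in> polys_in V"
  unfolding polys_in_def
proof (intro CollectI ballI)
  fix m assume "m \<in> Poly_Mapping.keys (p * q)"
  then obtain a b where "m = a + b" "a \<in> Poly_Mapping.keys p" "b \<in> Poly_Mapping.keys q"
    using keys_mult[of p q] by blast
  then show "Poly_Mapping.keys m \<subseteq> V" using assms keys_add[of a b] by (fastforce simp: polys_in_def)
qed

lemma polys_in_pconst [simp]: "pconst c \<in> polys_in V" by (simp add: polys_in_def pconst_def)

lemma polys_in_1 [simp]: "1 \<in> polys_in V" using polys_in_pconst[of 1 V] by (simp add: pconst_hom)

lemma polys_in_pvar: "v \<in> V \<Longrightarrow> pvar v \<in> polys_in V" by (simp add: polys_in_def pvar_def)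

lemma polys_in_mono: "V \<subseteq> W \<Longrightarrow> polys_in V \<subseteq> polys_in W" by (auto simp: polys_in_def)

text \<open>The weight is an argument of the predicate, so that sums are formed within one weight
  and products add weights. A homogeneous polynomial is a sum of monomials of its weight, and these
  are products of variables and a constant.\<close>

lemma homogeneous_induct [consumes 2, case_names zero const var add mult]:
  assumes p: "p \<in> polys_in V" "homogeneous g w p"
    and zero: "\<And>w. Q w 0" and const: "\<And>c. Q 0 (pconst c)" and var: "\<And>v. v \<in> V \<Longrightarrow> Q (g v) (pvar v)"
    and add: "\<And>w a b. Q w a \<Longrightarrow> Q w b \<Longrightarrow> Q w (a + b)"
    and mult: "\<And>w w' a b. Q w a \<Longrightarrow> Q w' b \<Longrightarrow> Q (w + w') (a * b)"
  shows "Q w p"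
proof -
  have pow: "Q (int k * fst (g v), int k * snd (g v)) (Poly_Mapping.single (Poly_Mapping.single v k) 1)" if "v \<in> V" for v k
  proof (induction k)
    case 0
    then show ?case using const[of 1] by (simp add: zero_prod_def pconst_def)
  next
    case (Suc k)
    have "Poly_Mapping.single (Poly_Mapping.single v (Suc k)) 1 = pvar v * (Poly_Mapping.single (Poly_Mapping.single v k) 1 :: 'a cpoly)"
      by (simp add: pvar_def mult_single flip: single_add)
    then show ?case using mult[OF var[OF that] Suc] by (cases "g v") (simp add: algebra_simps)
  qed
  have mon: "Q (\<Sum>v\<in>F. (int (k v) * fst (g v), int (k v) * snd (g v))) (Poly_Mapping.single (\<Sum>v\<in>F. Poly_Mapping.single v (k v)) 1)"
    if "finite F" "F \<subseteq> V" for F k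
    using that
  proof (induction F rule: finite_induct)
    case empty
    then show ?case using const[of 1] by (simp add: pconst_def)
  next
    case (insert v F)
    have "Poly_Mapping.single (\<Sum>v\<in>insert v F. Poly_Mapping.single v (k v)) (1::complex) =
        Poly_Mapping.single (Poly_Mapping.single v (k v)) 1 * Poly_Mapping.single (\<Sum>v\<in>F. Poly_Mapping.single v (k v)) 1"
      using insert by (simp add: mult_single)
    then show ?case using mult[OF pow[of v "k v"] insert.IH] insert by simp
  qed
  have single: "Q (monomial_weight g m) (Poly_Mapping.single m c)" if "Poly_Mapping.keys m \<subseteq> V" for m c
  proof -
    have "Q (monomial_weight g m) (Poly_Mapping.single m 1)"
      using mon[OF finite_keys that, of "Poly_Mapping.lookup m"] unfolding monomial_weight_def poly_mapping_eq_sum[of m, symmetric] .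
    then have "Q (0 + monomial_weight g m) (pconst c * Poly_Mapping.single m 1)" by (rule mult[OF const])
    then show ?thesis by (simp add: pconst_def mult_single)
  qed
  have "Q w (\<Sum>m\<in>F. Poly_Mapping.single m (Poly_Mapping.lookup p m))" if "finite F" "F \<subseteq> Poly_Mapping.keys p" for F
    using that
  proof (induction F rule: finite_induct)
    case (insert m F)
    have "m \<in> Poly_Mapping.keys p" using insert by simp
    then have "Q w (Poly_Mapping.single m (Poly_Mapping.lookup p m))"
      using single[of m] p by (auto simp: polys_in_def homogeneous_def)
    then show ?case using insert add by simp
  qed (simp add: zero)
  from this[of "Poly_Mapping.keys p"] show ?thesis using poly_mapping_eq_sum[of p] by simp
qed

lemma polys_in_induct [consumes 1, case_names const var add mult]:
  assumes p: "p \<in> polys_in V"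
    and const: "\<And>c. Q (pconst c)" and var: "\<And>v. v \<in> V \<Longrightarrow> Q (pvar v)"
    and add: "\<And>a b. Q a \<Longrightarrow> Q b \<Longrightarrow> Q (a + b)" and mult: "\<And>a b. Q a \<Longrightarrow> Q b \<Longrightarrow> Q (a * b)"
  shows "Q p"
proof -
  \<comment> \<open>For the trivial grading every polynomial is homogeneous, which reduces the claim
    to the graded induction.\<close>
  have "homogeneous (\<lambda>_. 0) 0 p" by (simp add: homogeneous_def monomial_weight_def flip: zero_prod_def)
  with p show ?thesis
    by (induction rule: homogeneous_induct) (use const[of 0] const var add mult in \<open>auto simp: pconst_hom\<close>)
qed

section \<open>Localized Koszul algebras\<close>

lemma denominators_mult: "d \<in> denominators P \<Longrightarrow> e \<in> denominators P \<Longrightarrow> d * e \<in> denominators P"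
  using homogeneous_mult[of "gen_wt P" 0 d 0 e]
  by (auto simp: denominators_def polys_in_mult poly_value_eq poly_value_simps)

lemma denominators_1: "1 \<in> denominators P"
  by (auto simp: denominators_def homogeneous_1 poly_value_eq poly_value_simps)

lemma denominators_ne_0: "d \<in> denominators P \<Longrightarrow> d \<noteq> 0"
  by (auto simp: denominators_def poly_value_eq poly_value_simps)

lemma local_ring_Fract: "p \<in> polys_in (gens P) \<Longrightarrow> d \<in> denominators P \<Longrightarrow> Fract p d \<in> local_ring P"
  by (auto simp: local_ring_def)

lemma local_ring_poly: "p \<in> polys_in (gens P) \<Longrightarrow> Fract p 1 \<in> local_ring P"
  by (rule local_ring_Fract[OF _ denominators_1])

lemma local_ringE:
  assumes "x \<in> local_ring P"
  obtains p d where "p \<in> polys_in (gens P)" "d \<in> denominators P" "x = Fract p d"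
  using assms by (auto simp: local_ring_def)

lemma denominators_polys: "d \<in> denominators P \<Longrightarrow> d \<in> polys_in (gens P)"
  by (simp add: denominators_def)

lemma local_ring_add: "x \<in> local_ring P \<Longrightarrow> y \<in> local_ring P \<Longrightarrow> x + y \<in> local_ring P"
proof (elim local_ringE)
  fix p d q e assume p: "p \<in> polys_in (gens P)" "d \<in> denominators P" "x = Fract p d"
    and q: "q \<in> polys_in (gens P)" "e \<in> denominators P" "y = Fract q e"
  have "Fract (p * e + q * d) (d * e) \<in> local_ring P"
    by (intro local_ring_Fract polys_in_add polys_in_mult denominators_mult p q denominators_polys[OF p(2)] denominators_polys[OF q(2)])
  then show ?thesis using p q by (simp add: denominators_ne_0)
qed

lemma local_ring_mult: "x \<in> local_ring P \<Longrightarrow> y \<in> local_ring P \<Longrightarrow> x * y \<in> local_ring P"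
  by (elim local_ringE) (auto intro!: local_ring_Fract polys_in_mult denominators_mult)

lemma local_ring_uminus: "x \<in> local_ring P \<Longrightarrow> - x \<in> local_ring P"
  by (elim local_ringE) (auto intro!: local_ring_Fract polys_in_uminus)

lemma local_ring_0: "0 \<in> local_ring P"
  using local_ring_poly[of 0 P] by (simp add: Zero_fract_def)

lemma local_ring_sum: "(\<And>a. a \<in> A \<Longrightarrow> f a \<in> local_ring P) \<Longrightarrow> sum f A \<in> local_ring P"
  by (induction A rule: infinite_finite_induct) (auto simp: local_ring_0 local_ring_add)

lemma sign_cases: "(shuffle_sign A B :: 'r::comm_ring_1) = 1 \<or> (shuffle_sign A B :: 'r) = - 1"
proof -
  have "(- 1) ^ n = (1 :: 'r) \<or> (- 1) ^ n = (- 1 :: 'r)" for n by (induction n) auto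
  then show ?thesis unfolding shuffle_sign_def .
qed

lemma sign_mult_cases: "shuffle_sign A B * x = x \<or> shuffle_sign A B * x = - x" for x :: "'r::comm_ring_1"
proof -
  have "(shuffle_sign A B :: 'r) = 1 \<or> (shuffle_sign A B :: 'r) = - 1" by (rule sign_cases)
  then show ?thesis by auto
qed

lemma local_ring_sign: "x \<in> local_ring P \<Longrightarrow> shuffle_sign A B * x \<in> local_ring P"
  using sign_mult_cases[of A B x] local_ring_uminus[of x P] by (elim disjE) (simp_all only:)

lemma local_componentE:
  assumes "x \<in> local_component P w"
  obtains p d where "p \<in> polys_in (gens P)" "homogeneous (gen_wt P) w p" "d \<in> denominators P" "x = Fract p d"
  using assms by (auto simp: local_component_def)

lemma local_component_Fract: "p \<in> polys_in (gens P) \<Longrightarrow> homogeneous (gen_wt P) w p \<Longrightarrow> d \<in> denominators P \<Longrightarrow> Fract p d \<in> local_component P w"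
  by (auto simp: local_component_def)

lemma denominators_homogeneous: "d \<in> denominators P \<Longrightarrow> homogeneous (gen_wt P) 0 d"
  by (simp add: denominators_def)

lemma local_component_add:
  assumes "x \<in> local_component P w" "y \<in> local_component P w" shows "x + y \<in> local_component P w"
proof -
  obtain p d where p: "p \<in> polys_in (gens P)" "homogeneous (gen_wt P) w p" "d \<in> denominators P" "x = Fract p d"
    using assms(1) by (rule local_componentE)
  obtain q e where q: "q \<in> polys_in (gens P)" "homogeneous (gen_wt P) w q" "e \<in> denominators P" "y = Fract q e"
    using assms(2) by (rule local_componentE)
  have "homogeneous (gen_wt P) w (p * e + q * d)"
    using homogeneous_mult[OF p(2) denominators_homogeneous[OF q(3)]] homogeneous_mult[OF q(2) denominators_homogeneous[OF p(3)]]
    by (intro homogeneous_add) auto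
  then have "Fract (p * e + q * d) (d * e) \<in> local_component P w"
    by (intro local_component_Fract polys_in_add polys_in_mult denominators_mult p q denominators_polys[OF p(3)] denominators_polys[OF q(3)])
  then show ?thesis using p q by (simp add: denominators_ne_0)
qed

lemma local_component_mult:
  assumes "x \<in> local_component P w" "y \<in> local_component P w'" shows "x * y \<in> local_component P (w + w')"
  using assms by (elim local_componentE) (auto intro!: local_component_Fract polys_in_mult homogeneous_mult denominators_mult)

lemma local_component_poly: "p \<in> polys_in (gens P) \<Longrightarrow> homogeneous (gen_wt P) w p \<Longrightarrow> Fract p 1 \<in> local_component P w"
  by (rule local_component_Fract[OF _ _ denominators_1])

lemma local_component_0: "0 \<in> local_component P w"
  using local_component_poly[of 0 P w] by (simp add: Zero_fract_def)

lemma local_component_uminus: "x \<in> local_component P w \<Longrightarrow> - x \<in> local_component P w"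
  by (elim local_componentE) (auto intro!: local_component_Fract polys_in_uminus homogeneous_uminus)

lemma local_component_sign: "x \<in> local_component P w \<Longrightarrow> shuffle_sign A B * x \<in> local_component P w"
  using sign_mult_cases[of A B x] local_component_uminus[of x P w] by (elim disjE) (simp_all only:)

lemma local_component_sum: "(\<And>a. a \<in> A \<Longrightarrow> f a \<in> local_component P w) \<Longrightarrow> sum f A \<in> local_component P w"
  by (induction A rule: infinite_finite_induct) (auto simp: local_component_0 local_component_add)

section \<open>Well-formed Koszul data and composition of quasi-isomorphisms\<close>

definition koszul_wf :: "('v::linorder, 'b::linorder) koszul \<Rightarrow> bool" where
  "koszul_wf P \<longleftrightarrow> finite (gens P) \<and> finite (rels P) \<and>
    (\<forall>b\<in>rels P. rel P b \<in> polys_in (gens P) \<and> homogeneous (gen_wt P) (rel_wt P b) (rel P b))"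

abbreviation rel_frac :: "('v::linorder, 'b::linorder) koszul \<Rightarrow> 'b \<Rightarrow> 'v cpoly fract" where
  "rel_frac P b \<equiv> Fract (rel P b) 1"

lemma koszul_diff_eq: "koszul_diff P = contract (rels P) (rel_frac P)"
  by (auto simp: koszul_diff_def contract_def fun_eq_iff)

lemma koszul_carrier_iff:
  "u \<in> carrier (koszul_algebra P) \<longleftrightarrow> supported (rels P) u \<and> (\<forall>S. u S \<in> local_ring P)"
  by (auto simp: koszul_algebra_def supported_def)

lemma koszul_ops:
  "mult (koszul_algebra P) = ext_mult" "add (koszul_algebra P) u v = (\<lambda>S. u S + v S)"
  "one (koszul_algebra P) = ext_scalar 1" "zero (koszul_algebra P) = (\<lambda>S. 0)"
  by (auto simp: koszul_algebra_def ext_mult_def ext_scalar_def fun_eq_iff)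

lemma koszul_diff_add: "koszul_diff P (\<lambda>S. u S + v S) = (\<lambda>S. koszul_diff P u S + koszul_diff P v S)"
  unfolding koszul_diff_eq by (rule contract_add)

lemma koszul_quasi_isoD:
  assumes "koszul_quasi_iso P Q \<phi>"
  shows "\<phi> \<in> Ring.ring_hom (koszul_algebra P) (koszul_algebra Q)"
    and "\<phi> (koszul_const c) = koszul_const c"
    and "u \<in> carrier (koszul_algebra P) \<Longrightarrow> \<phi> (koszul_diff P u) = koszul_diff Q (\<phi> u)"
    and "x \<in> koszul_component P k w \<Longrightarrow> \<phi> x \<in> koszul_component Q k w"
    and "u \<in> koszul_cycles P \<Longrightarrow> \<phi> u \<in> koszul_boundaries Q \<Longrightarrow> u \<in> koszul_boundaries P"
    and "u' \<in> koszul_cycles Q \<Longrightarrow> \<exists>u\<in>koszul_cycles P. \<exists>b\<in>koszul_boundaries Q. u' = \<phi> u \<oplus>\<^bsub>koszul_algebra Q\<^esub> b"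
  using assms unfolding koszul_quasi_iso_def by blast+

lemma koszul_quasi_iso_trans:
  assumes P: "koszul_wf P" and \<phi>: "koszul_quasi_iso P Q \<phi>" and \<psi>: "koszul_quasi_iso Q R \<psi>"
  shows "koszul_quasi_iso P R (\<psi> \<circ> \<phi>)"
proof -
  have hom: "\<phi> \<in> Ring.ring_hom (koszul_algebra P) (koszul_algebra Q)" "\<psi> \<in> Ring.ring_hom (koszul_algebra Q) (koszul_algebra R)"
    using \<phi> \<psi> unfolding koszul_quasi_iso_def by blast+
  have cl: "\<phi> u \<in> carrier (koszul_algebra Q)" if "u \<in> carrier (koszul_algebra P)" for u
    using ring_hom_closed[OF hom(1) that] .
  have zero: "(\<lambda>S. 0) \<in> carrier (koszul_algebra T)" for T :: "('x::linorder, 'y::linorder) koszul"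
    by (auto simp: koszul_carrier_iff supported_def local_ring_0)
  have \<phi>0: "\<phi> (\<lambda>S. 0) = (\<lambda>S. 0)"
  proof -
    have e: "\<phi> (\<lambda>S. 0) = (\<lambda>S. \<phi> (\<lambda>S. 0) S + \<phi> (\<lambda>S. 0) S)"
      using ring_hom_add[OF hom(1) zero zero] by (simp only: koszul_ops add_0_right)
    show ?thesis
    proof
      fix S
      show "\<phi> (\<lambda>S. 0) S = 0" using fun_cong[OF e, of S] by (simp only: add_cancel_right_right)
    qed
  qed
  have cyc: "\<phi> u \<in> koszul_cycles Q" if u: "u \<in> koszul_cycles P" for u
  proof -
    have uc: "u \<in> carrier (koszul_algebra P)" "koszul_diff P u = (\<lambda>S. 0)"
      using u by (simp_all add: koszul_cycles_def koszul_ops)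
    then have "koszul_diff Q (\<phi> u) = (\<lambda>S. 0)" using koszul_quasi_isoD(3)[OF \<phi> uc(1)] \<phi>0 by simp
    then show ?thesis using cl[OF uc(1)] by (simp add: koszul_cycles_def koszul_ops)
  qed
  show ?thesis
    unfolding koszul_quasi_iso_def
  proof (intro conjI allI ballI impI)
    show "\<psi> \<circ> \<phi> \<in> Ring.ring_hom (koszul_algebra P) (koszul_algebra R)" using ring_hom_trans[OF hom] .
    show "(\<psi> \<circ> \<phi>) (koszul_const c) = koszul_const c" for c
      by (simp add: koszul_quasi_isoD(2)[OF \<phi>] koszul_quasi_isoD(2)[OF \<psi>])
    show "(\<psi> \<circ> \<phi>) (koszul_diff P u) = koszul_diff R ((\<psi> \<circ> \<phi>) u)" if "u \<in> carrier (koszul_algebra P)" for u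
      by (simp add: koszul_quasi_isoD(3)[OF \<phi> that] koszul_quasi_isoD(3)[OF \<psi> cl[OF that]])
    show "(\<psi> \<circ> \<phi>) ` koszul_component P k w \<subseteq> koszul_component R k w" for k w
    proof (rule image_subsetI)
      fix x assume "x \<in> koszul_component P k w"
      then show "(\<psi> \<circ> \<phi>) x \<in> koszul_component R k w"
        unfolding comp_def by (intro koszul_quasi_isoD(4)[OF \<psi>] koszul_quasi_isoD(4)[OF \<phi>])
    qed
    show "u \<in> koszul_boundaries P" if "u \<in> koszul_cycles P" "(\<psi> \<circ> \<phi>) u \<in> koszul_boundaries R" for u
      using koszul_quasi_isoD(5)[OF \<psi> cyc[OF that(1)]] koszul_quasi_isoD(5)[OF \<phi> that(1)] that(2) by simp
    show "\<exists>u\<in>koszul_cycles P. \<exists>b\<in>koszul_boundaries R. u' = (\<psi> \<circ> \<phi>) u \<oplus>\<^bsub>koszul_algebra R\<^esub> b"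
      if u': "u' \<in> koszul_cycles R" for u'
    proof -
      obtain v b where v: "v \<in> koszul_cycles Q" "b \<in> koszul_boundaries R" "u' = \<psi> v \<oplus>\<^bsub>koszul_algebra R\<^esub> b"
        using koszul_quasi_isoD(6)[OF \<psi> u'] by blast
      obtain u y where u: "u \<in> koszul_cycles P" "y \<in> koszul_boundaries Q" "v = \<phi> u \<oplus>\<^bsub>koszul_algebra Q\<^esub> y"
        using koszul_quasi_isoD(6)[OF \<phi> v(1)] by blast
      obtain x where x: "x \<in> carrier (koszul_algebra Q)" "y = koszul_diff Q x" using u(2) by (auto simp: koszul_boundaries_def)
      obtain z where z: "z \<in> carrier (koszul_algebra R)" "b = koszul_diff R z" using v(2) by (auto simp: koszul_boundaries_def)
      have cu: "\<phi> u \<in> carrier (koszul_algebra Q)" using u(1) cl by (simp add: koszul_cycles_def)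
      \<comment> \<open>The boundary is a difference of two elements of the algebra; additivity of
        the second morphism can then be applied to it.\<close>
      have "y \<in> carrier (koszul_algebra Q)"
      proof -
        have "y = (\<lambda>S. v S - \<phi> u S)" using u(3) by (simp add: koszul_ops fun_eq_iff)
        moreover have "v \<in> carrier (koszul_algebra Q)" using v(1) by (simp add: koszul_cycles_def)
        moreover have "a - b \<in> local_ring Q" if "a \<in> local_ring Q" "b \<in> local_ring Q" for a b
          using local_ring_add[OF that(1) local_ring_uminus[OF that(2)]] by simp
        ultimately show ?thesis using cu by (simp add: koszul_carrier_iff supported_def)
      qed
      then have "\<psi> v = (\<lambda>S. \<psi> (\<phi> u) S + \<psi> y S)"
        using ring_hom_add[OF hom(2) cu] u(3) by (simp add: koszul_ops)
      moreover have "\<psi> y = koszul_diff R (\<psi> x)" unfolding x(2) by (rule koszul_quasi_isoD(3)[OF \<psi> x(1)])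
      ultimately have "u' = (\<lambda>S. \<psi> (\<phi> u) S + koszul_diff R (\<lambda>S. \<psi> x S + z S) S)"
        using v(3) z(2) by (simp add: koszul_ops koszul_diff_add fun_eq_iff add.assoc)
      moreover have "(\<lambda>S. \<psi> x S + z S) \<in> carrier (koszul_algebra R)"
        using z(1) ring_hom_closed[OF hom(2) x(1)] by (auto simp: koszul_carrier_iff supported_def local_ring_add)
      ultimately show ?thesis using u(1) by (auto simp: koszul_boundaries_def koszul_ops)
    qed
  qed
qed

section \<open>Morphisms of Koszul algebras induced by maps of polynomials\<close>

definition frac_lift :: "('a::idom \<Rightarrow> 'c::idom) \<Rightarrow> 'a set \<Rightarrow> 'a fract \<Rightarrow> 'c fract" where
  "frac_lift \<sigma> D x = (SOME y. \<exists>p d. d \<in> D \<and> x = Fract p d \<and> y = Fract (\<sigma> p) (\<sigma> d))"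

text \<open>\<open>\<tau>\<close> places the relations of \<open>Q\<close> among those of
  \<open>P\<close>. The induced map applies \<open>\<sigma>\<close> to coefficients and sends
  theta_a to 0 for every relation \<open>a\<close> of \<open>P\<close> outside the image, which is
  compatible with the differential because \<open>\<sigma>\<close> kills that relation. Monotonicity
  of \<open>\<tau>\<close> preserves the shuffle signs.\<close>

locale koszul_push =
  fixes P :: "('v::linorder, 'b::linorder) koszul" and Q :: "('w::linorder, 'c::linorder) koszul"
    and \<sigma> :: "'v cpoly \<Rightarrow> 'w cpoly" and \<tau> :: "'c \<Rightarrow> 'b"
  assumes wf: "koszul_wf P" "koszul_wf Q"
    and \<sigma>_add: "\<sigma> (p + p') = \<sigma> p + \<sigma> p'" and \<sigma>_mult: "\<sigma> (p * p') = \<sigma> p * \<sigma> p'"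
    and \<sigma>_pconst: "\<sigma> (pconst c) = pconst c"
    and \<sigma>_value: "p \<in> polys_in (gens P) \<Longrightarrow> poly_value (point Q) (\<sigma> p) = poly_value (point P) p"
    and \<sigma>_polys: "p \<in> polys_in (gens P) \<Longrightarrow> \<sigma> p \<in> polys_in (gens Q)"
    and \<sigma>_homogeneous: "p \<in> polys_in (gens P) \<Longrightarrow> homogeneous (gen_wt P) w p \<Longrightarrow> homogeneous (gen_wt Q) w (\<sigma> p)"
    and \<tau>_mono: "b \<in> rels Q \<Longrightarrow> b' \<in> rels Q \<Longrightarrow> b < b' \<Longrightarrow> \<tau> b < \<tau> b'"
    and \<tau>_rels: "b \<in> rels Q \<Longrightarrow> \<tau> b \<in> rels P"
    and \<tau>_wt: "b \<in> rels Q \<Longrightarrow> rel_wt P (\<tau> b) = rel_wt Q b"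
    and \<sigma>_rel: "b \<in> rels Q \<Longrightarrow> \<sigma> (rel P (\<tau> b)) = rel Q b"
    and \<sigma>_rel_0: "a \<in> rels P \<Longrightarrow> a \<notin> \<tau> ` rels Q \<Longrightarrow> \<sigma> (rel P a) = 0"
begin

abbreviation F where "F \<equiv> frac_lift \<sigma> (denominators P)"

definition push :: "('b set \<Rightarrow> 'v cpoly fract) \<Rightarrow> 'c set \<Rightarrow> 'w cpoly fract" where
  "push u S = (if S \<subseteq> rels Q then F (u (\<tau> ` S)) else 0)"

lemma \<sigma>_0: "\<sigma> 0 = 0" and \<sigma>_1: "\<sigma> 1 = 1"
  using \<sigma>_pconst[of 0] \<sigma>_pconst[of 1] by (simp_all add: pconst_hom)

lemma \<sigma>_denominators: "d \<in> denominators P \<Longrightarrow> \<sigma> d \<in> denominators Q"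
  by (auto simp: denominators_def \<sigma>_value \<sigma>_polys \<sigma>_homogeneous)

text \<open>Two representations of a fraction are related by cross multiplication, which
  \<open>\<sigma>\<close> preserves, and images of denominators are denominators again. The chosen
  representative is therefore irrelevant.\<close>

lemma F_Fract:
  assumes d: "d \<in> denominators P"
  shows "F (Fract p d) = Fract (\<sigma> p) (\<sigma> d)"
proof -
  have "\<exists>q e. e \<in> denominators P \<and> Fract p d = Fract q e \<and> F (Fract p d) = Fract (\<sigma> q) (\<sigma> e)"
    unfolding frac_lift_def
    by (rule someI[of "\<lambda>y. \<exists>q e. e \<in> denominators P \<and> Fract p d = Fract q e \<and> y = Fract (\<sigma> q) (\<sigma> e)" "Fract (\<sigma> p) (\<sigma> d)"])
      (use d in blast)
  then obtain q e where e: "e \<in> denominators P" "Fract p d = Fract q e" "F (Fract p d) = Fract (\<sigma> q) (\<sigma> e)" by blast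
  have "p * e = q * d" using e(2) d e(1) by (simp add: eq_fract denominators_ne_0)
  then have "\<sigma> p * \<sigma> e = \<sigma> q * \<sigma> d" by (simp flip: \<sigma>_mult)
  then show ?thesis using e(3) \<sigma>_denominators[OF d] \<sigma>_denominators[OF e(1)]
    by (simp add: eq_fract denominators_ne_0)
qed

lemma F_poly: "F (Fract p 1) = Fract (\<sigma> p) 1"
  using F_Fract[OF denominators_1, of p] by (simp add: \<sigma>_1)

lemma F_0 [simp]: "F 0 = 0" using F_poly[of 0] by (simp add: Zero_fract_def \<sigma>_0)
lemma F_1 [simp]: "F 1 = 1" using F_poly[of 1] by (simp add: One_fract_def \<sigma>_1)

lemma F_add: "x \<in> local_ring P \<Longrightarrow> y \<in> local_ring P \<Longrightarrow> F (x + y) = F x + F y"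
proof (elim local_ringE)
  fix p d q e assume p: "d \<in> denominators P" "x = Fract p d" and q: "e \<in> denominators P" "y = Fract q e"
  have "F (Fract (p * e + q * d) (d * e)) = Fract (\<sigma> p * \<sigma> e + \<sigma> q * \<sigma> d) (\<sigma> d * \<sigma> e)"
    using F_Fract[OF denominators_mult[OF p(1) q(1)]] by (simp add: \<sigma>_add \<sigma>_mult)
  then show ?thesis using p q \<sigma>_denominators[OF p(1)] \<sigma>_denominators[OF q(1)]
    by (simp add: denominators_ne_0 F_Fract)
qed

lemma F_mult: "x \<in> local_ring P \<Longrightarrow> y \<in> local_ring P \<Longrightarrow> F (x * y) = F x * F y"
proof (elim local_ringE)
  fix p d q e assume p: "d \<in> denominators P" "x = Fract p d" and q: "e \<in> denominators P" "y = Fract q e"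
  then show ?thesis using F_Fract[OF denominators_mult[OF p(1) q(1)]] by (simp add: \<sigma>_mult F_Fract)
qed

lemma F_uminus: "x \<in> local_ring P \<Longrightarrow> F (- x) = - F x"
  using F_add[of x "- x"] local_ring_uminus[of x P] by (simp add: eq_neg_iff_add_eq_0 add.commute)

lemma F_sum: "(\<And>a. a \<in> A \<Longrightarrow> f a \<in> local_ring P) \<Longrightarrow> F (sum f A) = (\<Sum>a\<in>A. F (f a))"
  by (induction A rule: infinite_finite_induct) (auto simp: F_add local_ring_sum)

lemma F_local: "x \<in> local_ring P \<Longrightarrow> F x \<in> local_ring Q"
  by (elim local_ringE) (auto simp: F_Fract intro!: local_ring_Fract \<sigma>_polys \<sigma>_denominators)

lemma F_component: "x \<in> local_component P w \<Longrightarrow> F x \<in> local_component Q w"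
  by (elim local_componentE) (auto simp: F_Fract intro!: local_component_Fract \<sigma>_polys \<sigma>_denominators \<sigma>_homogeneous)

lemma inj_\<tau>: "S \<subseteq> rels Q \<Longrightarrow> inj_on \<tau> S"
proof (rule linorder_inj_onI)
  fix x y assume "S \<subseteq> rels Q" "x \<in> S" "y \<in> S" "x < y"
  then have "\<tau> x < \<tau> y" using \<tau>_mono[of x y] by blast
  then show "\<tau> x \<noteq> \<tau> y" by simp
qed auto

lemma \<tau>_less_iff: "b \<in> rels Q \<Longrightarrow> b' \<in> rels Q \<Longrightarrow> \<tau> b < \<tau> b' \<longleftrightarrow> b < b'"
  using \<tau>_mono[of b b'] \<tau>_mono[of b' b] by (cases b b' rule: linorder_cases) auto

lemma shuffle_sign_\<tau>:
  assumes "A \<subseteq> rels Q" "C \<subseteq> rels Q"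
  shows "(shuffle_sign (\<tau> ` A) (\<tau> ` C) :: 'r::comm_ring_1) = shuffle_sign A C"
proof -
  have "{(a, c). a \<in> \<tau> ` A \<and> c \<in> \<tau> ` C \<and> c < a} = map_prod \<tau> \<tau> ` {(a, c). a \<in> A \<and> c \<in> C \<and> c < a}"
  proof (intro equalityI subsetI)
    fix z assume "z \<in> {(a, c). a \<in> \<tau> ` A \<and> c \<in> \<tau> ` C \<and> c < a}"
    then obtain a c where z: "a \<in> A" "c \<in> C" "z = (\<tau> a, \<tau> c)" "\<tau> c < \<tau> a" by blast
    then have "c < a" using assms \<tau>_less_iff[of c a] by blast
    then show "z \<in> map_prod \<tau> \<tau> ` {(a, c). a \<in> A \<and> c \<in> C \<and> c < a}" using z by force
  next
    fix z assume "z \<in> map_prod \<tau> \<tau> ` {(a, c). a \<in> A \<and> c \<in> C \<and> c < a}"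
    then obtain a c where z: "a \<in> A" "c \<in> C" "z = (\<tau> a, \<tau> c)" "c < a" by auto
    then have "\<tau> c < \<tau> a" using assms \<tau>_less_iff[of c a] by blast
    then show "z \<in> {(a, c). a \<in> \<tau> ` A \<and> c \<in> \<tau> ` C \<and> c < a}" using z by simp
  qed
  moreover have "inj_on (map_prod \<tau> \<tau>) {(a, c). a \<in> A \<and> c \<in> C \<and> c < a}"
    using inj_\<tau>[OF assms(1)] inj_\<tau>[OF assms(2)] by (auto simp: inj_on_def)
  ultimately show ?thesis by (simp add: shuffle_sign_def card_image)
qed

lemma push_carrier: "u \<in> carrier (koszul_algebra P) \<Longrightarrow> push u \<in> carrier (koszul_algebra Q)"
  by (auto simp: koszul_carrier_iff supported_def push_def F_local local_ring_0)

lemma carrier_local: "u \<in> carrier (koszul_algebra P) \<Longrightarrow> u S \<in> local_ring P"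
  by (simp add: koszul_carrier_iff)

lemma push_add:
  "u \<in> carrier (koszul_algebra P) \<Longrightarrow> v \<in> carrier (koszul_algebra P) \<Longrightarrow> push (\<lambda>S. u S + v S) = (\<lambda>S. push u S + push v S)"
  by (auto simp: push_def F_add carrier_local fun_eq_iff)

lemma push_diff: "u \<in> carrier (koszul_algebra P) \<Longrightarrow> v \<in> carrier (koszul_algebra P) \<Longrightarrow>
    push (\<lambda>S. u S - v S) = (\<lambda>S. push u S - push v S)"
  using F_add[OF carrier_local local_ring_uminus[OF carrier_local], of u v] F_uminus[OF carrier_local, of v]
  by (auto simp: push_def fun_eq_iff)

lemma F_sign: "x \<in> local_ring P \<Longrightarrow> F (shuffle_sign A B * x) = shuffle_sign A B * F x"
  unfolding shuffle_sign_def
proof -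
  assume x: "x \<in> local_ring P"
  have "(- 1) ^ n * x = (if even n then x else - x)" "(- 1) ^ n * F x = (if even n then F x else - F x)" for n
    by (induction n) auto
  then show "F ((- 1) ^ card {(a, b). a \<in> A \<and> b \<in> B \<and> b < a} * x) = (- 1) ^ card {(a, b). a \<in> A \<and> b \<in> B \<and> b < a} * F x"
    using F_uminus[OF x] by simp
qed

lemma push_chain:
  assumes u: "u \<in> carrier (koszul_algebra P)"
  shows "push (koszul_diff P u) = koszul_diff Q (push u)"
proof
  fix S
  have fin: "finite (rels P)" "finite (rels Q)" using wf by (auto simp: koszul_wf_def)
  show "push (koszul_diff P u) S = koszul_diff Q (push u) S"
  proof (cases "S \<subseteq> rels Q")
    case False
    then show ?thesis by (auto simp: push_def koszul_diff_def)
  next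
    case S: True
    have rl: "rel_frac P b \<in> local_ring P" if "b \<in> rels P" for b
      using wf that by (auto simp: koszul_wf_def intro!: local_ring_poly)
    let ?t = "\<lambda>b. F (shuffle_sign {b} (\<tau> ` S) * (rel_frac P b * u (insert b (\<tau> ` S))))"
    have "push (koszul_diff P u) S = (\<Sum>b\<in>rels P - \<tau> ` S. ?t b)"
    proof -
      have "push (koszul_diff P u) S = F (\<Sum>b\<in>rels P - \<tau> ` S. shuffle_sign {b} (\<tau> ` S) * (rel_frac P b * u (insert b (\<tau> ` S))))"
        using S by (simp add: push_def koszul_diff_def mult.assoc)
      then show ?thesis
        by (simp only:) (rule F_sum, use rl u in \<open>simp add: local_ring_sign local_ring_mult carrier_local\<close>)
    qed
    also have "\<dots> = (\<Sum>b\<in>\<tau> ` (rels Q - S). ?t b)"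
    proof (rule sum.mono_neutral_right)
      show "\<tau> ` (rels Q - S) \<subseteq> rels P - \<tau> ` S"
      proof
        fix x assume "x \<in> \<tau> ` (rels Q - S)"
        then obtain b where b: "b \<in> rels Q" "b \<notin> S" "x = \<tau> b" by blast
        then have "\<tau> b \<notin> \<tau> ` S" using inj_onD[OF inj_\<tau>[OF order_refl], of b] S by blast
        then show "x \<in> rels P - \<tau> ` S" using b \<tau>_rels by simp
      qed
      show "\<forall>b\<in>rels P - \<tau> ` S - \<tau> ` (rels Q - S). ?t b = 0"
      proof
        fix b assume b: "b \<in> rels P - \<tau> ` S - \<tau> ` (rels Q - S)"
        then have "b \<in> rels P" "b \<notin> \<tau> ` rels Q" by auto
        then have "F (rel_frac P b) = 0" using \<sigma>_rel_0[of b] by (simp add: F_poly flip: Zero_fract_def)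
        then show "?t b = 0" using rl u \<open>b \<in> rels P\<close>
          by (simp add: F_sign F_mult local_ring_mult carrier_local)
      qed
    qed (use fin in simp)
    also have "\<dots> = (\<Sum>b\<in>rels Q - S. ?t (\<tau> b))"
      by (subst sum.reindex) (use inj_\<tau>[of "rels Q - S"] in auto)
    also have "\<dots> = (\<Sum>b\<in>rels Q - S. shuffle_sign {b} S * rel_frac Q b * push u (insert b S))"
    proof (rule sum.cong)
      fix b assume b: "b \<in> rels Q - S"
      have "(shuffle_sign {\<tau> b} (\<tau> ` S) :: 'w cpoly fract) = shuffle_sign {b} S"
        using shuffle_sign_\<tau>[of "{b}" S] b S by simp
      moreover have "push u (insert b S) = F (u (insert (\<tau> b) (\<tau> ` S)))" using b S by (simp add: push_def)
      moreover have "F (rel_frac P (\<tau> b)) = rel_frac Q b" using \<sigma>_rel[of b] b by (simp add: F_poly)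
      ultimately show "?t (\<tau> b) = shuffle_sign {b} S * rel_frac Q b * push u (insert b S)"
        using rl[OF \<tau>_rels] u b by (simp add: F_sign F_mult local_ring_mult carrier_local mult.assoc)
    qed simp
    also have "\<dots> = koszul_diff Q (push u) S" by (simp add: koszul_diff_def)
    finally show ?thesis .
  qed
qed

lemma push_mult:
  assumes u: "u \<in> carrier (koszul_algebra P)" and v: "v \<in> carrier (koszul_algebra P)"
  shows "push (ext_mult u v) = ext_mult (push u) (push v)"
proof
  fix S
  show "push (ext_mult u v) S = ext_mult (push u) (push v) S"
  proof (cases "S \<subseteq> rels Q")
    case False
    have "supported (rels Q) (ext_mult (push u) (push v))"
      using push_carrier[OF u] push_carrier[OF v] by (intro supported_ext_mult) (auto simp: koszul_carrier_iff)
    then show ?thesis using False by (simp add: push_def supported_def)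
  next
    case S: True
    have "Pow (\<tau> ` S) = image \<tau> ` Pow S" by (simp add: image_Pow_surj)
    then have "push (ext_mult u v) S = (\<Sum>A\<in>image \<tau> ` Pow S. F (shuffle_sign A (\<tau> ` S - A) * (u A * v (\<tau> ` S - A))))"
      using S u v by (simp add: push_def ext_mult_def mult.assoc F_sum local_ring_sign local_ring_mult carrier_local)
    also have "\<dots> = (\<Sum>A\<in>Pow S. F (shuffle_sign (\<tau> ` A) (\<tau> ` S - \<tau> ` A) * (u (\<tau> ` A) * v (\<tau> ` S - \<tau> ` A))))"
      by (subst sum.reindex) (use inj_on_image_Pow[OF inj_\<tau>[OF S]] in auto)
    also have "\<dots> = (\<Sum>A\<in>Pow S. shuffle_sign A (S - A) * push u A * push v (S - A))"
    proof (rule sum.cong)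
      fix A assume "A \<in> Pow S"
      then have A: "A \<subseteq> S" by simp
      have e: "\<tau> ` S - \<tau> ` A = \<tau> ` (S - A)" using inj_on_image_set_diff[OF inj_\<tau>[OF S], of S A] A by auto
      have "(shuffle_sign (\<tau> ` A) (\<tau> ` (S - A)) :: 'w cpoly fract) = shuffle_sign A (S - A)"
        by (rule shuffle_sign_\<tau>) (use A S in auto)
      moreover have "push u A = F (u (\<tau> ` A))" "push v (S - A) = F (v (\<tau> ` (S - A)))"
        using A S by (auto simp: push_def)
      ultimately show "F (shuffle_sign (\<tau> ` A) (\<tau> ` S - \<tau> ` A) * (u (\<tau> ` A) * v (\<tau> ` S - \<tau> ` A))) =
          shuffle_sign A (S - A) * push u A * push v (S - A)"
        using u v unfolding e by (simp add: F_sign F_mult local_ring_mult carrier_local mult.assoc)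
    qed simp
    finally show ?thesis by (simp add: ext_mult_def)
  qed
qed

lemma push_scalar: "push (ext_scalar x) = ext_scalar (F x)"
  by (auto simp: push_def ext_scalar_def fun_eq_iff)

lemma push_const: "push (koszul_const c) = koszul_const c"
  by (auto simp: push_def koszul_const_def fun_eq_iff F_poly \<sigma>_pconst)

lemma push_component:
  assumes u: "u \<in> koszul_component P k w"
  shows "push u \<in> koszul_component Q k w"
proof -
  have uc: "u \<in> carrier (koszul_algebra P)" using u by (simp add: koszul_component_def)
  have "card S = k \<and> push u S \<in> local_component Q (w - (\<Sum>b\<in>S. rel_wt Q b))" if "push u S \<noteq> 0" for S
  proof -
    have S: "S \<subseteq> rels Q" "u (\<tau> ` S) \<noteq> 0" using that by (auto simp: push_def split: if_splits)
    then have "card (\<tau> ` S) = k" "u (\<tau> ` S) \<in> local_component P (w - (\<Sum>b\<in>\<tau> ` S. rel_wt P b))"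
      using u by (auto simp: koszul_component_def)
    moreover have "(\<Sum>b\<in>\<tau> ` S. rel_wt P b) = (\<Sum>b\<in>S. rel_wt Q b)"
      by (subst sum.reindex[OF inj_\<tau>[OF S(1)]]) (use S(1) \<tau>_wt in \<open>auto intro!: sum.cong\<close>)
    ultimately show ?thesis using S F_component by (auto simp: card_image[OF inj_\<tau>[OF S(1)]] push_def)
  qed
  then show ?thesis using push_carrier[OF uc] by (simp add: koszul_component_def)
qed

lemma push_hom: "push \<in> Ring.ring_hom (koszul_algebra P) (koszul_algebra Q)"
  by (rule ring_hom_memI) (simp_all add: push_carrier koszul_ops push_mult push_add push_scalar)

lemma push_0: "push (\<lambda>S. 0) = (\<lambda>S. 0)" by (auto simp: push_def)

end

text \<open>The two induced maps are inverse to each other on the algebras themselves, not only on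
  homology, so cycles and boundaries correspond.\<close>

lemma koszul_push_iso:
  assumes 1: "koszul_push P Q \<sigma> \<tau>" and 2: "koszul_push Q P \<sigma>' \<tau>'"
    and \<sigma>: "\<And>p. p \<in> polys_in (gens P) \<Longrightarrow> \<sigma>' (\<sigma> p) = p" "\<And>p. p \<in> polys_in (gens Q) \<Longrightarrow> \<sigma> (\<sigma>' p) = p"
    and \<tau>: "\<And>b. b \<in> rels P \<Longrightarrow> \<tau> (\<tau>' b) = b" "\<And>b. b \<in> rels Q \<Longrightarrow> \<tau>' (\<tau> b) = b"
  shows "koszul_quasi_iso P Q (koszul_push.push P Q \<sigma> \<tau>)"
proof -
  interpret A: koszul_push P Q \<sigma> \<tau> by fact
  interpret B: koszul_push Q P \<sigma>' \<tau>' by fact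
  have BA: "B.push (A.push u) = u" if u: "u \<in> carrier (koszul_algebra P)" for u
  proof
    fix S
    show "B.push (A.push u) S = u S"
    proof (cases "S \<subseteq> rels P")
      case True
      then have t: "\<tau> ` \<tau>' ` S = S" "\<tau>' ` S \<subseteq> rels Q" using \<tau>(1) B.\<tau>_rels by (force simp: image_image)+
      obtain p d where p: "p \<in> polys_in (gens P)" "d \<in> denominators P" "u S = Fract p d"
        using A.carrier_local[OF u] by (rule local_ringE)
      then show ?thesis using True t \<sigma>(1)
        by (simp add: B.push_def A.push_def A.F_Fract B.F_Fract A.\<sigma>_denominators denominators_polys)
    qed (use u in \<open>simp add: B.push_def koszul_carrier_iff supported_def\<close>)
  qed
  have AB: "A.push (B.push u) = u" if u: "u \<in> carrier (koszul_algebra Q)" for u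
  proof
    fix S
    show "A.push (B.push u) S = u S"
    proof (cases "S \<subseteq> rels Q")
      case True
      then have t: "\<tau>' ` \<tau> ` S = S" "\<tau> ` S \<subseteq> rels P" using \<tau>(2) A.\<tau>_rels by (force simp: image_image)+
      obtain p d where p: "p \<in> polys_in (gens Q)" "d \<in> denominators Q" "u S = Fract p d"
        using B.carrier_local[OF u] by (rule local_ringE)
      then show ?thesis using True t \<sigma>(2)
        by (simp add: B.push_def A.push_def A.F_Fract B.F_Fract B.\<sigma>_denominators denominators_polys)
    qed (use u in \<open>simp add: A.push_def koszul_carrier_iff supported_def\<close>)
  qed
  show ?thesis unfolding koszul_quasi_iso_def
  proof (intro conjI allI ballI impI)
    fix u assume u: "u \<in> koszul_cycles P" "A.push u \<in> koszul_boundaries Q"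
    then obtain v where v: "v \<in> carrier (koszul_algebra Q)" "A.push u = koszul_diff Q v" by (auto simp: koszul_boundaries_def)
    have "u = koszul_diff P (B.push v)"
      using BA[of u] u(1) v B.push_chain[OF v(1)] by (simp add: koszul_cycles_def)
    then show "u \<in> koszul_boundaries P" using B.push_carrier[OF v(1)] by (simp add: koszul_boundaries_def)
  next
    fix u' assume u': "u' \<in> koszul_cycles Q"
    then have uc: "u' \<in> carrier (koszul_algebra Q)" "koszul_diff Q u' = (\<lambda>S. 0)" by (simp_all add: koszul_cycles_def koszul_ops)
    have "koszul_diff P (B.push u') = (\<lambda>S. 0)" using B.push_chain[OF uc(1)] uc(2) B.push_0 by simp
    then have c: "B.push u' \<in> koszul_cycles P" using B.push_carrier[OF uc(1)] by (simp add: koszul_cycles_def koszul_ops)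
    have z: "(\<lambda>S. 0) \<in> koszul_boundaries Q"
      unfolding koszul_boundaries_def
      by (rule image_eqI[of _ _ "\<lambda>S. 0"]) (auto simp: koszul_diff_def koszul_carrier_iff supported_def local_ring_0)
    show "\<exists>u\<in>koszul_cycles P. \<exists>b\<in>koszul_boundaries Q. u' = A.push u \<oplus>\<^bsub>koszul_algebra Q\<^esub> b"
      by (rule bexI[OF _ c], rule bexI[OF _ z]) (simp add: koszul_ops AB[OF uc(1)])
  qed (use A.push_hom A.push_const A.push_chain A.push_component in auto)
qed

section \<open>Eliminating a variable from a Koszul algebra\<close>

definition subst_var :: "'v \<Rightarrow> 'v cpoly \<Rightarrow> 'v cpoly \<Rightarrow> 'v cpoly" where
  "subst_var w s = poly_eval pconst (\<lambda>v. if v = w then s else pvar v)"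

lemma subst_var_simps:
  "subst_var w s (p + q) = subst_var w s p + subst_var w s q"
  "subst_var w s (p * q) = subst_var w s p * subst_var w s q"
  "subst_var w s (pconst c) = pconst c"
  "subst_var w s (pvar v) = (if v = w then s else pvar v)"
  "subst_var w s (p - q) = subst_var w s p - subst_var w s q"
  by (simp_all add: subst_var_def subst_simps)

lemma subst_var_id: "p \<in> polys_in V \<Longrightarrow> w \<notin> V \<Longrightarrow> subst_var w s p = p"
  by (induction rule: polys_in_induct) (auto simp: subst_var_simps)

lemma subst_var_polys:
  "p \<in> polys_in V \<Longrightarrow> s \<in> polys_in (V - {w}) \<Longrightarrow> subst_var w s p \<in> polys_in (V - {w})"
  by (induction rule: polys_in_induct) (auto simp: subst_var_simps intro: polys_in_add polys_in_mult polys_in_pvar)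

lemma subst_var_value:
  "p \<in> polys_in V \<Longrightarrow> poly_value x s = x w \<Longrightarrow> poly_value x (subst_var w s p) = poly_value x p"
  by (induction rule: polys_in_induct) (auto simp: subst_var_simps poly_value_eq poly_value_simps)

text \<open>Substituting s for w changes a polynomial by a multiple of s - w. Since s - w has weight
  0, the cofactor can be chosen of the weight of the polynomial, and this is carried through the
  induction.\<close>

lemma subst_var_homogeneous:
  assumes "p \<in> polys_in V" "homogeneous g k p" "g w = 0" "homogeneous g 0 s" "s \<in> polys_in V"
  shows "homogeneous g k (subst_var w s p) \<and>
    (\<exists>r. r \<in> polys_in V \<and> homogeneous g k r \<and> subst_var w s p = p + (s - pvar w) * r)"
proof -
  have "p \<in> polys_in V \<and> homogeneous g k p \<and> homogeneous g k (subst_var w s p) \<and> subst_var w s p \<in> polys_in V \<and>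
      (\<exists>r. r \<in> polys_in V \<and> homogeneous g k r \<and> subst_var w s p = p + (s - pvar w) * r)"
    using assms(1,2)
  proof (induction rule: homogeneous_induct)
    case (zero k)
    then show ?case using subst_var_simps(3)[of w s 0] by (auto simp: pconst_hom intro!: exI[of _ 0])
  next
    case (const c)
    then show ?case by (auto simp: subst_var_simps homogeneous_pconst intro!: exI[of _ 0])
  next
    case (var v)
    show ?case
    proof (cases "v = w")
      case True
      then show ?thesis using var assms homogeneous_pvar[of g w]
        by (auto simp: subst_var_simps polys_in_pvar homogeneous_1 intro!: exI[of _ 1])
    next
      case False
      then show ?thesis using var by (auto simp: subst_var_simps polys_in_pvar homogeneous_pvar intro!: exI[of _ 0])
    qed
  next
    case (add k a b)
    then have a: "a \<in> polys_in V" "homogeneous g k a" "homogeneous g k (subst_var w s a)" "subst_var w s a \<in> polys_in V"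
      and b: "b \<in> polys_in V" "homogeneous g k b" "homogeneous g k (subst_var w s b)" "subst_var w s b \<in> polys_in V"
      by simp_all
    obtain r where r: "r \<in> polys_in V" "homogeneous g k r" "subst_var w s a = a + (s - pvar w) * r" using add(1) by blast
    obtain t where t: "t \<in> polys_in V" "homogeneous g k t" "subst_var w s b = b + (s - pvar w) * t" using add(2) by blast
    have "subst_var w s (a + b) = a + b + (s - pvar w) * (r + t)"
      unfolding subst_var_simps r(3) t(3) by (simp add: algebra_simps)
    then show ?case unfolding subst_var_simps(1)
      by (intro conjI exI[of _ "r + t"] polys_in_add homogeneous_add a b r t)
  next
    case (mult k k' a b)
    then have a: "a \<in> polys_in V" "homogeneous g k a" "homogeneous g k (subst_var w s a)" "subst_var w s a \<in> polys_in V"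
      and b: "b \<in> polys_in V" "homogeneous g k' b" "homogeneous g k' (subst_var w s b)" "subst_var w s b \<in> polys_in V"
      by simp_all
    obtain r where r: "r \<in> polys_in V" "homogeneous g k r" "subst_var w s a = a + (s - pvar w) * r" using mult(1) by blast
    obtain t where t: "t \<in> polys_in V" "homogeneous g k' t" "subst_var w s b = b + (s - pvar w) * t" using mult(2) by blast
    have "subst_var w s (a * b) = subst_var w s a * subst_var w s b" by (rule subst_var_simps(2))
    also have "\<dots> = a * subst_var w s b + (s - pvar w) * (r * subst_var w s b)"
      unfolding r(3) by (simp only: distrib_right mult.assoc)
    also have "a * subst_var w s b = a * b + (s - pvar w) * (a * t)"
      unfolding t(3) by (simp only: distrib_left mult.left_commute)
    finally have "subst_var w s (a * b) = a * b + (s - pvar w) * (a * t + r * subst_var w s b)"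
      by (simp only: distrib_left add.assoc)
    then show ?case unfolding subst_var_simps(2)
      by (intro conjI exI[of _ "a * t + r * subst_var w s b"] polys_in_add homogeneous_add polys_in_mult homogeneous_mult a b r t)
  qed
  then show ?thesis by blast
qed

definition eliminate :: "'v \<Rightarrow> 'v cpoly \<Rightarrow> 'b \<Rightarrow> ('v, 'b) koszul \<Rightarrow> ('v, 'b) koszul" where
  "eliminate w s b Q = Q\<lparr>gens := gens Q - {w}, rels := rels Q - {b}, rel := \<lambda>c. subst_var w s (rel Q c)\<rparr>"

lemma eliminate_sel [simp]:
  "gens (eliminate w s b Q) = gens Q - {w}" "rels (eliminate w s b Q) = rels Q - {b}"
  "gen_wt (eliminate w s b Q) = gen_wt Q" "rel_wt (eliminate w s b Q) = rel_wt Q"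
  "point (eliminate w s b Q) = point Q" "rel (eliminate w s b Q) c = subst_var w s (rel Q c)"
  by (simp_all add: eliminate_def)

locale koszul_elimination =
  fixes Q :: "('v::linorder, 'b::linorder) koszul" and w :: 'v and s :: "'v cpoly" and b0 :: 'b
  assumes wf: "koszul_wf Q" and w: "w \<in> gens Q" "gen_wt Q w = 0" and b0: "b0 \<in> rels Q" "rel_wt Q b0 = 0"
    and s: "s \<in> polys_in (gens Q - {w})" "homogeneous (gen_wt Q) 0 s" "poly_value (point Q) s = point Q w"
    and rel_b0: "rel Q b0 = s - pvar w"
begin

abbreviation "Q1 \<equiv> eliminate w s b0 Q"
abbreviation "B \<equiv> rels Q"

lemma s_gens: "s \<in> polys_in (gens Q)" using s(1) polys_in_mono[of "gens Q - {w}" "gens Q"] by auto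

lemma wf1: "koszul_wf Q1"
  unfolding koszul_wf_def eliminate_sel
proof (intro conjI ballI)
  fix b assume "b \<in> rels Q - {b0}"
  then have b: "rel Q b \<in> polys_in (gens Q)" "homogeneous (gen_wt Q) (rel_wt Q b) (rel Q b)"
    using wf by (simp_all add: koszul_wf_def)
  show "subst_var w s (rel Q b) \<in> polys_in (gens Q - {w})" by (rule subst_var_polys[OF b(1) s(1)])
  show "homogeneous (gen_wt Q) (rel_wt Q b) (subst_var w s (rel Q b))"
    using subst_var_homogeneous[OF b w(2) s(2) s_gens] by blast
qed (use wf in \<open>simp_all add: koszul_wf_def\<close>)

sublocale ev: koszul_push Q Q1 "subst_var w s" "\<lambda>b. b"
proof
  show "koszul_wf Q" "koszul_wf Q1" by (rule wf, rule wf1)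
  show "subst_var w s (rel Q a) = 0" if "a \<in> rels Q" "a \<notin> (\<lambda>b. b) ` rels Q1" for a
  proof -
    have "a = b0" using that by simp
    then show ?thesis using subst_var_id[OF s(1)] by (simp add: rel_b0 subst_var_simps)
  qed
  show "homogeneous (gen_wt Q1) k (subst_var w s p)" if "p \<in> polys_in (gens Q)" "homogeneous (gen_wt Q) k p" for p k
    using subst_var_homogeneous[OF that w(2) s(2) s_gens] by simp
qed (use subst_var_polys[OF _ s(1)] subst_var_value[OF _ s(3)] in \<open>auto simp: subst_var_simps\<close>)

lemma finB: "finite B" using wf by (simp add: koszul_wf_def)

lemma denominators_Q1: "d \<in> denominators Q1 \<Longrightarrow> d \<in> denominators Q"
  using polys_in_mono[of "gens Q - {w}" "gens Q"] by (auto simp: denominators_def)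

lemma local_ring_Q1: "x \<in> local_ring Q1 \<Longrightarrow> x \<in> local_ring Q"
  using polys_in_mono[of "gens Q - {w}" "gens Q"]
  by (elim local_ringE) (auto intro!: local_ring_Fract denominators_Q1)

lemma local_component_Q1: "x \<in> local_component Q1 k \<Longrightarrow> x \<in> local_component Q k"
  using polys_in_mono[of "gens Q - {w}" "gens Q"]
  by (elim local_componentE) (auto intro!: local_component_Fract denominators_Q1)

abbreviation "r0 \<equiv> rel_frac Q b0"

text \<open>The cofactor of s - w in the change of relation \<open>b\<close> under the
  substitution.\<close>

definition quot :: "'b \<Rightarrow> 'v cpoly" where
  "quot b = (SOME r. r \<in> polys_in (gens Q) \<and> homogeneous (gen_wt Q) (rel_wt Q b) r \<and>
    subst_var w s (rel Q b) = rel Q b + (s - pvar w) * r)"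

definition cf :: "'b \<Rightarrow> 'v cpoly fract" where "cf b = Fract (quot b) 1"

lemma quot:
  assumes "b \<in> B"
  shows "quot b \<in> polys_in (gens Q)" "homogeneous (gen_wt Q) (rel_wt Q b) (quot b)"
    "subst_var w s (rel Q b) = rel Q b + (s - pvar w) * quot b"
proof -
  have "\<exists>r. r \<in> polys_in (gens Q) \<and> homogeneous (gen_wt Q) (rel_wt Q b) r \<and>
    subst_var w s (rel Q b) = rel Q b + (s - pvar w) * r"
    using subst_var_homogeneous[OF _ _ w(2) s(2) s_gens, of "rel Q b"] wf assms by (auto simp: koszul_wf_def)
  from someI_ex[OF this] show "quot b \<in> polys_in (gens Q)" "homogeneous (gen_wt Q) (rel_wt Q b) (quot b)"
    "subst_var w s (rel Q b) = rel Q b + (s - pvar w) * quot b" unfolding quot_def by blast+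
qed

lemma rel_frac_Q1: "b \<in> B \<Longrightarrow> rel_frac Q1 b = rel_frac Q b + r0 * cf b"
  by (simp add: quot(3) rel_b0 cf_def)

lemma r0_ne_0: "r0 \<noteq> 0"
proof
  assume "r0 = 0"
  then have "s = pvar w" by (simp add: rel_b0 Zero_fract_def eq_fract)
  then have "pvar w \<in> polys_in (gens Q - {w})" using s(1) by simp
  then show False by (simp add: polys_in_def pvar_def)
qed

lemma supported_Q1: "supported (rels Q1) u \<Longrightarrow> supported B u"
  by (auto simp: supported_def)

text \<open>Each relation of the smaller algebra is the old one plus \<open>r0\<close> times its
  cofactor, and contraction is linear in its coefficients.\<close>

lemma diff_Q1:
  assumes u: "supported (rels Q1) u"
  shows "koszul_diff Q1 u = (\<lambda>S. koszul_diff Q u S + r0 * contract B cf u S)"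
proof
  fix S
  have "koszul_diff Q1 u S = (\<Sum>b\<in>B - S. shuffle_sign {b} S * rel_frac Q1 b * u (insert b S))"
    unfolding koszul_diff_def
  proof (rule sum.mono_neutral_left)
    show "\<forall>i\<in>B - S - (rels Q1 - S). shuffle_sign {i} S * rel_frac Q1 i * u (insert i S) = 0"
    proof
      fix i assume "i \<in> B - S - (rels Q1 - S)"
      then have "i = b0" by auto
      then have "u (insert i S) = 0" using u by (simp add: supported_def)
      then show "shuffle_sign {i} S * rel_frac Q1 i * u (insert i S) = 0" by simp
    qed
  qed (use finB in auto)
  also have "\<dots> = (\<Sum>b\<in>B - S. shuffle_sign {b} S * rel_frac Q b * u (insert b S) +
      r0 * (shuffle_sign {b} S * cf b * u (insert b S)))"
  proof (rule sum.cong)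
    fix b assume "b \<in> B - S"
    then have "rel_frac Q1 b = rel_frac Q b + r0 * cf b" using rel_frac_Q1 by simp
    then show "shuffle_sign {b} S * rel_frac Q1 b * u (insert b S) =
        shuffle_sign {b} S * rel_frac Q b * u (insert b S) + r0 * (shuffle_sign {b} S * cf b * u (insert b S))"
      by (simp only: distrib_left distrib_right mult_ac)
  qed simp
  also have "\<dots> = koszul_diff Q u S + r0 * contract B cf u S"
    by (simp add: koszul_diff_def contract_def sum.distrib sum_distrib_left)
  finally show "koszul_diff Q1 u S = koszul_diff Q u S + r0 * contract B cf u S" .
qed

text \<open>This is the algebra map with \<open>\<theta>_b \<mapsto> \<theta>_b + c_b \<theta>_(b0)\<close>, where \<open>c_b = quot b\<close> measures the change of
  \<open>rel b\<close> under the substitution. The substitution itself is only a left inverse of it.\<close>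

definition lift :: "('b set \<Rightarrow> 'v cpoly fract) \<Rightarrow> 'b set \<Rightarrow> 'v cpoly fract" where
  "lift u = (\<lambda>S. u S + wedge b0 (contract B cf u) S)"

lemma local_contract:
  assumes "\<And>S. u S \<in> local_ring Q" shows "contract B cf u S \<in> local_ring Q"
  unfolding contract_def mult.assoc
  by (intro local_ring_sum local_ring_sign local_ring_mult assms) (auto simp: cf_def intro!: local_ring_poly quot)

lemma local_wedge: "(\<And>S. u S \<in> local_ring Q) \<Longrightarrow> wedge b u S \<in> local_ring Q"
  by (simp add: wedge_def local_ring_sign local_ring_0)

lemma lift_carrier: "u \<in> carrier (koszul_algebra Q1) \<Longrightarrow> lift u \<in> carrier (koszul_algebra Q)"
proof -
  assume "u \<in> carrier (koszul_algebra Q1)"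
  then have u: "supported B u" "\<And>S. u S \<in> local_ring Q"
    using supported_Q1 local_ring_Q1 unfolding koszul_carrier_iff by blast+
  show ?thesis unfolding koszul_carrier_iff lift_def
    by (intro conjI allI supported_add u supported_wedge supported_contract b0 local_ring_add local_wedge local_contract)
qed

lemma supported_carrier: "u \<in> carrier (koszul_algebra Q1) \<Longrightarrow> supported (rels Q1) u \<and> supported B u"
  using supported_Q1[of u] by (simp add: koszul_carrier_iff)

text \<open>Write d for the old differential, i for the contraction with the cofactors and theta_0
  for the generator of \<open>b0\<close>. The Leibniz rule gives d(u + theta_0 i u) = d u + r0 i u -
  theta_0 d i u. The first two terms are the new differential of u, and the last is theta_0 i
  applied to it, because i anticommutes with d and squares to 0.\<close>

lemma lift_chain:
  assumes u: "u \<in> carrier (koszul_algebra Q1)"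
  shows "lift (koszul_diff Q1 u) = koszul_diff Q (lift u)"
proof -
  let ?c = "contract B cf" and ?d = "contract B (rel_frac Q)"
  have su: "supported (rels Q1) u" "supported B u" using supported_carrier[OF u] by auto
  have "?c (koszul_diff Q1 u) = (\<lambda>S. ?c (?d u) S + r0 * ?c (?c u) S)"
    unfolding diff_Q1[OF su(1)] unfolding koszul_diff_eq contract_add contract_smult ..
  also have "\<dots> = (\<lambda>S. - ?d (?c u) S)"
    using contract_contract[OF finB su(2), of cf] contract_anticommute[OF finB su(2), of cf "rel_frac Q"] by simp
  finally have 1: "?c (koszul_diff Q1 u) = (\<lambda>S. - ?d (?c u) S)" .
  have "koszul_diff Q (lift u) = (\<lambda>S. ?d u S + ?d (wedge b0 (?c u)) S)"
    unfolding koszul_diff_eq lift_def by (rule contract_add)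
  also have "\<dots> = (\<lambda>S. ?d u S + (r0 * ?c u S - wedge b0 (?d (?c u)) S))"
    unfolding contract_wedge[OF finB supported_contract[OF su(2)] b0(1)] ..
  finally show ?thesis
    unfolding lift_def 1 wedge_uminus unfolding diff_Q1[OF su(1)] unfolding koszul_diff_eq
    by (simp add: fun_eq_iff)
qed

text \<open>The operator theta_0 i obeys an ungraded product rule, its two odd factors compensating
  each other's signs. The product of the two correction terms vanishes since it contains theta_0
  twice.\<close>

lemma lift_mult:
  assumes u: "u \<in> carrier (koszul_algebra Q1)" and v: "v \<in> carrier (koszul_algebra Q1)"
  shows "lift (ext_mult u v) = ext_mult (lift u) (lift v)"
proof -
  let ?c = "contract B cf"
  have su: "supported B u" "supported B v" using supported_carrier[OF u] supported_carrier[OF v] by auto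
  have sc: "supported B (?c u)" "supported B (?c v)" using supported_contract su by auto
  have sw: "supported B (wedge b0 (?c u))" "supported B (wedge b0 (?c v))" using supported_wedge[OF _ b0(1)] sc by auto
  have st: "supported B (sign_twist u)" "supported B (sign_twist (?c u))" using supported_sign_twist su sc by auto
  have 4: "ext_mult (wedge b0 (?c u)) (wedge b0 (?c v)) = (\<lambda>S. 0)"
    unfolding ext_mult_wedge_left[OF finB sc(1) sw(2)] ext_mult_wedge_right[OF finB sc(1) sc(2) b0(1)]
    by (rule wedge_wedge_same)
  have "ext_mult (lift u) (lift v) = (\<lambda>S. ext_mult u v S + wedge b0 (ext_mult (sign_twist u) (?c v)) S +
      wedge b0 (ext_mult (?c u) v) S)"
    unfolding lift_def ext_mult_add_left ext_mult_add_right 4 ext_mult_wedge_right[OF finB su(1) sc(2) b0(1)]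
      ext_mult_wedge_left[OF finB sc(1) su(2)] by (simp add: add_ac)
  moreover have "lift (ext_mult u v) = (\<lambda>S. ext_mult u v S + (wedge b0 (ext_mult (?c u) v) S +
      wedge b0 (ext_mult (sign_twist u) (?c v)) S))"
    unfolding lift_def contract_ext_mult[OF finB su] wedge_add ..
  ultimately show ?thesis by (simp add: add_ac)
qed

lemma lift_scalar: "lift (ext_scalar x) = ext_scalar x"
  by (simp add: lift_def contract_scalar wedge_zero)

lemma lift_hom: "lift \<in> Ring.ring_hom (koszul_algebra Q1) (koszul_algebra Q)"
proof (rule ring_hom_memI)
  fix u v
  show "lift (u \<oplus>\<^bsub>koszul_algebra Q1\<^esub> v) = lift u \<oplus>\<^bsub>koszul_algebra Q\<^esub> lift v"
    by (simp add: koszul_ops lift_def contract_add wedge_add add_ac)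
qed (simp_all add: lift_carrier koszul_ops lift_mult lift_scalar)

lemma koszul_const_eq: "koszul_const c = ext_scalar (Fract (pconst c) 1)"
  by (auto simp: koszul_const_def ext_scalar_def)

text \<open>A summand of the correction trades theta_b for its cofactor, which has the weight of
  relation \<open>b\<close>, and for theta_0, which has weight 0. Degree and weight are
  kept.\<close>

lemma lift_component:
  assumes u: "u \<in> koszul_component Q1 k m"
  shows "lift u \<in> koszul_component Q k m"
proof -
  have uc: "u \<in> carrier (koszul_algebra Q1)" using u by (simp add: koszul_component_def)
  have su: "supported (rels Q1) u" using supported_carrier[OF uc] by simp
  have comp: "u S \<in> local_component Q (m - (\<Sum>b\<in>S. rel_wt Q b))" for S
    using u local_component_Q1 local_component_0[of Q] by (cases "u S = 0") (auto simp: koszul_component_def)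
  have card: "card S = k" if "u S \<noteq> 0" for S using u that by (auto simp: koszul_component_def)
  have "card S = k \<and> lift u S \<in> local_component Q (m - (\<Sum>b\<in>S. rel_wt Q b))" if nz: "lift u S \<noteq> 0" for S
  proof (cases "b0 \<in> S")
    case False
    then have "lift u S = u S" by (simp add: lift_def wedge_def)
    then show ?thesis using nz comp card by simp
  next
    case True
    define U where "U = S - {b0}"
    have U: "b0 \<notin> U" "S = insert b0 U" using True by (auto simp: U_def)
    have "u S = 0" using su True by (auto simp: supported_def)
    then have l: "lift u S = shuffle_sign {b0} U * contract B cf u U"
      using True by (simp add: lift_def wedge_def U_def)
    have SB: "S \<subseteq> B"
    proof (rule ccontr)
      assume "\<not> S \<subseteq> B"
      then show False using lift_carrier[OF uc] nz by (simp add: koszul_carrier_iff supported_def)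
    qed
    then have fU: "finite U" using finB U finite_subset by auto
    have "contract B cf u U \<noteq> 0" using nz l by auto
    then obtain b where b: "b \<in> B - U" "shuffle_sign {b} U * cf b * u (insert b U) \<noteq> 0"
      unfolding contract_def by (rule sum.not_neutral_contains_not_neutral)
    then have "card (insert b U) = k" using card by auto
    then have cS: "card S = k" using b U fU by simp
    have wS: "(\<Sum>b\<in>S. rel_wt Q b) = (\<Sum>b\<in>U. rel_wt Q b)" using U fU b0 by simp
    have "contract B cf u U \<in> local_component Q (m - (\<Sum>b\<in>U. rel_wt Q b))"
      unfolding contract_def mult.assoc
    proof (intro local_component_sum local_component_sign)
      fix b assume b: "b \<in> B - U"
      have "cf b \<in> local_component Q (rel_wt Q b)"
        unfolding cf_def by (rule local_component_poly) (use quot b in auto)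
      from local_component_mult[OF this comp[of "insert b U"]]
      show "cf b * u (insert b U) \<in> local_component Q (m - (\<Sum>b\<in>U. rel_wt Q b))"
        using b fU by (simp add: algebra_simps)
    qed
    then show ?thesis using cS l wS local_component_sign by simp
  qed
  then show ?thesis using lift_carrier[OF uc] by (simp add: koszul_component_def)
qed

text \<open>Evaluation kills theta_0 and fixes coefficients in which w does not occur. Hence it is a
  left inverse of \<open>lift\<close>, which yields injectivity on homology.\<close>

lemma ev_lift:
  assumes u: "u \<in> carrier (koszul_algebra Q1)"
  shows "ev.push (lift u) = u"
proof
  fix S
  show "ev.push (lift u) S = u S"
  proof (cases "S \<subseteq> rels Q1")
    case True
    then have "b0 \<notin> S" by auto
    then have l: "lift u S = u S" by (simp add: lift_def wedge_def)
    have "u S \<in> local_ring Q1" using u by (simp add: koszul_carrier_iff)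
    then obtain p d where p: "p \<in> polys_in (gens Q1)" "d \<in> denominators Q1" "u S = Fract p d" by (rule local_ringE)
    have "subst_var w s p = p" "subst_var w s d = d"
      using p(1) denominators_polys[OF p(2)] by (auto intro!: subst_var_id)
    then show ?thesis using True l p ev.F_Fract[OF denominators_Q1[OF p(2)]] by (simp add: ev.push_def)
  qed (use u in \<open>simp add: ev.push_def koszul_carrier_iff supported_def\<close>)
qed

text \<open>A polynomial that vanishes after the substitution is a multiple of s - w, and the
  denominators stay invertible.\<close>

lemma ev_kernel:
  assumes x: "x \<in> local_ring Q" "ev.F x = 0"
  shows "\<exists>y\<in>local_ring Q. x = r0 * y"
proof -
  obtain p d where p: "p \<in> polys_in (gens Q)" "d \<in> denominators Q" "x = Fract p d" using x(1) by (rule local_ringE)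
  have "Fract (subst_var w s p) (subst_var w s d) = 0" using x(2) ev.F_Fract[OF p(2)] p(3) by simp
  then have z: "subst_var w s p = 0"
    using ev.\<sigma>_denominators[OF p(2)] by (simp add: Zero_fract_def eq_fract denominators_ne_0)
  \<comment> \<open>The divisibility statement is applied with the trivial grading, since
    \<open>p\<close> need not be homogeneous.\<close>
  have "homogeneous (\<lambda>_. 0) 0 q" for q :: "'v cpoly" by (simp add: homogeneous_def monomial_weight_def flip: zero_prod_def)
  then obtain r where r: "r \<in> polys_in (gens Q)" "subst_var w s p = p + (s - pvar w) * r"
    using subst_var_homogeneous[OF p(1) _ _ _ s_gens, of "\<lambda>_. 0" 0 w] by blast
  have "p = (s - pvar w) * (- r)" using z r(2) by (simp add: eq_neg_iff_add_eq_0)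
  then have "x = r0 * Fract (- r) d" by (simp add: p(3) rel_b0)
  then show ?thesis using local_ring_Fract[OF polys_in_uminus[OF r(1)] p(2)] by blast
qed

text \<open>The coefficients of \<open>z\<close> without theta_0 lie in the kernel of the evaluation
  and are r0 times those of some \<open>y\<close>. Then \<open>z\<close> is the boundary of theta_0
  y: without theta_0 this is the choice of \<open>y\<close>, and with theta_0 it follows from the
  cycle condition after cancelling r0.\<close>

lemma kernel_acyclic:
  assumes z: "z \<in> carrier (koszul_algebra Q)" "koszul_diff Q z = (\<lambda>S. 0)" "ev.push z = (\<lambda>S. 0)"
  shows "z \<in> koszul_boundaries Q"
proof -
  \<comment> \<open>The value 0 elsewhere keeps \<open>y\<close> free of theta_0.\<close>
  define y where "y S = (if S \<subseteq> rels Q1 then SOME y. y \<in> local_ring Q \<and> z S = r0 * y else 0)" for S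
  have y: "y S \<in> local_ring Q \<and> z S = r0 * y S" if S: "S \<subseteq> rels Q1" for S
  proof -
    have "ev.F (z S) = 0" using fun_cong[OF z(3), of S] S by (simp add: ev.push_def)
    then have "\<exists>y. y \<in> local_ring Q \<and> z S = r0 * y"
      using ev_kernel[of "z S"] z(1) by (auto simp: koszul_carrier_iff)
    from someI_ex[OF this] show ?thesis using S by (simp add: y_def)
  qed
  have y0: "y S = 0" if "\<not> S \<subseteq> rels Q1" for S using that by (simp add: y_def)
  have ysup: "supported B y" using y0 by (auto simp: supported_def)
  have ycar: "y \<in> carrier (koszul_algebra Q)"
    unfolding koszul_carrier_iff
  proof (intro conjI allI ysup)
    show "y S \<in> local_ring Q" for S using y[of S] y0[of S] local_ring_0[of Q] by (cases "S \<subseteq> rels Q1") (simp_all del: eliminate_sel)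
  qed
  have zsup: "supported B z" using z(1) by (simp add: koszul_carrier_iff)
  have d: "koszul_diff Q (wedge b0 y) = (\<lambda>S. r0 * y S - wedge b0 (koszul_diff Q y) S)"
    unfolding koszul_diff_eq by (rule contract_wedge[OF finB ysup b0(1)])
  have "z S = koszul_diff Q (wedge b0 y) S" for S
  proof (cases "S \<subseteq> B")
    case False
    then show ?thesis using zsup supported_contract[OF supported_wedge[OF ysup b0(1)]]
      by (simp add: koszul_diff_eq supported_def)
  next
    case S: True
    show ?thesis
    proof (cases "b0 \<in> S")
      case False
      then have "S \<subseteq> rels Q1" using S by auto
      then show ?thesis using y[of S] False by (simp add: d wedge_def)
    next
      case True
      define U where "U = S - {b0}"
      have U: "b0 \<notin> U" "S = insert b0 U" "U \<subseteq> rels Q1" using True S by (auto simp: U_def)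
      \<comment> \<open>The cycle condition at \<open>U\<close> expresses r0 times the coefficient
        at \<open>S\<close> through coefficients without theta_0, all of which are divisible by
        r0.\<close>
      have "0 = koszul_diff Q z U" by (simp add: z(2))
      also have "\<dots> = shuffle_sign {b0} U * r0 * z S +
          (\<Sum>b\<in>B - U - {b0}. shuffle_sign {b} U * rel_frac Q b * z (insert b U))"
        unfolding koszul_diff_def U(2) using finB b0 U by (intro sum.remove) auto
      also have "(\<Sum>b\<in>B - U - {b0}. shuffle_sign {b} U * rel_frac Q b * z (insert b U)) =
          (\<Sum>b\<in>B - U - {b0}. r0 * (shuffle_sign {b} U * rel_frac Q b * y (insert b U)))"
      proof (rule sum.cong)
        fix b assume "b \<in> B - U - {b0}"
        then have "insert b U \<subseteq> rels Q1" using U by auto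
        from y[OF this] have e: "z (insert b U) = r0 * y (insert b U)" by simp
        show "shuffle_sign {b} U * rel_frac Q b * z (insert b U) = r0 * (shuffle_sign {b} U * rel_frac Q b * y (insert b U))"
          unfolding e by (simp only: mult_ac)
      qed simp
      also have "\<dots> = (\<Sum>b\<in>B - U. r0 * (shuffle_sign {b} U * rel_frac Q b * y (insert b U)))"
        using finB U(2) y0[of S] by (intro sum.mono_neutral_left) auto
      also have "\<dots> = r0 * koszul_diff Q y U" by (simp add: koszul_diff_def sum_distrib_left)
      finally have "r0 * (shuffle_sign {b0} U * z S + koszul_diff Q y U) = 0" by (simp add: algebra_simps)
      then have "shuffle_sign {b0} U * z S = - koszul_diff Q y U" using r0_ne_0 by (simp add: eq_neg_iff_add_eq_0)
      then have "shuffle_sign {b0} U * (shuffle_sign {b0} U * z S) = shuffle_sign {b0} U * - koszul_diff Q y U" by simp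
      then have "z S = - (shuffle_sign {b0} U * koszul_diff Q y U)" by simp
      moreover have "y S = 0" using y0[of S] True by auto
      ultimately show ?thesis using True by (simp add: d wedge_def U_def)
    qed
  qed
  then have "z = koszul_diff Q (wedge b0 y)" by (rule ext)
  moreover have "wedge b0 y \<in> carrier (koszul_algebra Q)"
    using ycar supported_wedge[OF ysup b0(1)] local_wedge[of y] by (simp add: koszul_carrier_iff)
  ultimately show ?thesis by (simp add: koszul_boundaries_def)
qed

text \<open>Injectivity on homology comes from the left inverse. A cycle minus the lift of its
  evaluation is a cycle in the kernel of the evaluation, hence a boundary, which is
  surjectivity.\<close>

theorem lift_quasi_iso: "koszul_quasi_iso Q1 Q lift"
  unfolding koszul_quasi_iso_def
proof (intro conjI allI ballI impI)
  show "lift \<in> Ring.ring_hom (koszul_algebra Q1) (koszul_algebra Q)" by (rule lift_hom)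
  show "lift (koszul_const c) = koszul_const c" for c by (simp add: koszul_const_eq lift_scalar)
  show "lift (koszul_diff Q1 u) = koszul_diff Q (lift u)" if "u \<in> carrier (koszul_algebra Q1)" for u
    using that by (rule lift_chain)
  show "lift ` koszul_component Q1 k m \<subseteq> koszul_component Q k m" for k m
    using lift_component by (rule image_subsetI)
next
  fix u assume u: "u \<in> koszul_cycles Q1" "lift u \<in> koszul_boundaries Q"
  then obtain v where v: "v \<in> carrier (koszul_algebra Q)" "lift u = koszul_diff Q v" by (auto simp: koszul_boundaries_def)
  have "u = koszul_diff Q1 (ev.push v)"
    using ev_lift[of u] u(1) v ev.push_chain[OF v(1)] by (simp add: koszul_cycles_def)
  then show "u \<in> koszul_boundaries Q1" using ev.push_carrier[OF v(1)] by (simp add: koszul_boundaries_def)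
next
  fix u' assume u': "u' \<in> koszul_cycles Q"
  then have uc: "u' \<in> carrier (koszul_algebra Q)" "koszul_diff Q u' = (\<lambda>S. 0)" by (simp_all add: koszul_cycles_def koszul_ops)
  define u where "u = ev.push u'"
  have cu: "u \<in> carrier (koszul_algebra Q1)" unfolding u_def by (rule ev.push_carrier[OF uc(1)])
  have du: "koszul_diff Q1 u = (\<lambda>S. 0)" unfolding u_def using ev.push_chain[OF uc(1)] uc(2) ev.push_0 by simp
  define z where "z = (\<lambda>S. u' S - lift u S)"
  have lc: "lift u \<in> carrier (koszul_algebra Q)" by (rule lift_carrier[OF cu])
  have "z \<in> carrier (koszul_algebra Q)"
    unfolding z_def koszul_carrier_iff
  proof (intro conjI allI)
    show "supported B (\<lambda>S. u' S - lift u S)" using uc(1) lc unfolding koszul_carrier_iff supported_def by simp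
    show "u' S - lift u S \<in> local_ring Q" for S
      using local_ring_add[OF _ local_ring_uminus, of "u' S" Q "lift u S"] uc(1) lc by (simp add: koszul_carrier_iff)
  qed
  moreover have "koszul_diff Q z = (\<lambda>S. 0)"
  proof -
    have "lift (\<lambda>S. 0) = (\<lambda>S. 0)" by (simp add: lift_def contract_zero wedge_zero)
    then have "koszul_diff Q (lift u) = (\<lambda>S. 0)" using lift_chain[OF cu] du by simp
    then show ?thesis using uc(2) unfolding z_def koszul_diff_eq contract_diff by simp
  qed
  moreover have "ev.push z = (\<lambda>S. 0)"
    unfolding z_def ev.push_diff[OF uc(1) lc] ev_lift[OF cu] by (simp add: u_def)
  ultimately have "z \<in> koszul_boundaries Q" by (rule kernel_acyclic)
  moreover have "u \<in> koszul_cycles Q1" using cu du by (simp add: koszul_cycles_def koszul_ops)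
  moreover have "u' = lift u \<oplus>\<^bsub>koszul_algebra Q\<^esub> z" by (simp add: koszul_ops z_def)
  ultimately show "\<exists>u\<in>koszul_cycles Q1. \<exists>b\<in>koszul_boundaries Q. u' = lift u \<oplus>\<^bsub>koszul_algebra Q\<^esub> b" by blast
qed

end

section \<open>Eliminating several variables and renaming generators\<close>

lemma koszul_quasi_iso_id:
  fixes Q :: "('v::linorder, 'b::linorder) koszul"
  shows "koszul_quasi_iso Q Q (\<lambda>u. u)"
  unfolding koszul_quasi_iso_def
proof (intro conjI allI ballI impI)
  show "(\<lambda>u. u) \<in> Ring.ring_hom (koszul_algebra Q) (koszul_algebra Q)" by (rule ring_hom_memI) simp_all
  fix u assume u: "u \<in> koszul_cycles Q"
  have "(\<lambda>S. 0) = koszul_diff Q (\<lambda>S. 0)" by (simp add: koszul_diff_def)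
  moreover have "(\<lambda>S. 0) \<in> carrier (koszul_algebra Q)" by (simp add: koszul_carrier_iff local_ring_0 supported_def)
  ultimately have "(\<lambda>S. 0) \<in> koszul_boundaries Q" unfolding koszul_boundaries_def by (rule image_eqI)
  moreover have "u = u \<oplus>\<^bsub>koszul_algebra Q\<^esub> (\<lambda>S. 0)" by (simp add: koszul_ops)
  ultimately show "\<exists>u'\<in>koszul_cycles Q. \<exists>b\<in>koszul_boundaries Q. u = u' \<oplus>\<^bsub>koszul_algebra Q\<^esub> b" using u by blast
qed (simp_all add: image_def)

text \<open>The variables are eliminated from the largest index downwards. The right side of
  relation i involves no variable of index i or more, so the earlier substitutions leave it as it
  is.\<close>

lemma koszul_eliminate_all:
  fixes Q :: "('v::linorder, 'b::linorder) koszul" and w :: "nat \<Rightarrow> 'v" and b :: "nat \<Rightarrow> 'b"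
  assumes "koszul_wf Q" "I \<subseteq> {..<N}" "inj_on w I" "inj_on b I"
    and "\<And>i. i \<in> I \<Longrightarrow> w i \<in> gens Q \<and> gen_wt Q (w i) = 0 \<and> b i \<in> rels Q \<and> rel_wt Q (b i) = 0"
    and "\<And>i. i \<in> I \<Longrightarrow> \<exists>s\<in>polys_in (gens Q - w ` {j\<in>I. i \<le> j}). homogeneous (gen_wt Q) 0 s \<and>
        poly_value (point Q) s = point Q (w i) \<and> rel Q (b i) = s - pvar (w i)"
  shows "\<exists>P \<phi>. koszul_wf P \<and> koszul_quasi_iso P Q \<phi> \<and> gens P = gens Q - w ` I \<and> rels P = rels Q - b ` I \<and>
    gen_wt P = gen_wt Q \<and> rel_wt P = rel_wt Q \<and> point P = point Q"
  using assms
proof (induction N arbitrary: Q I)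
  case 0
  then have "I = {}" by simp
  then show ?case using "0.prems"(1) koszul_quasi_iso_id[of Q]
    by (intro exI[of _ Q] exI[of _ "\<lambda>u. u"]) simp
next
  case (Suc N)
  note pr = Suc.prems
  show ?case
  proof (cases "N \<in> I")
    case False
    then have "I \<subseteq> {..<N}" using pr(2) by (auto simp: less_Suc_eq)
    from Suc.IH[OF pr(1) this pr(3-6)] show ?thesis .
  next
    case True
    define J where "J = I - {N}"
    have J: "J \<subseteq> {..<N}" "J \<subseteq> I" "N \<notin> J" "I = insert N J" using pr(2) True by (auto simp: J_def less_Suc_eq)
    have "{j\<in>I. N \<le> j} = {N}" using J True by auto
    then obtain s where s: "s \<in> polys_in (gens Q - {w N})" "homogeneous (gen_wt Q) 0 s"
      "poly_value (point Q) s = point Q (w N)" "rel Q (b N) = s - pvar (w N)"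
      using pr(6)[OF True] by auto
    define Q1 where "Q1 = eliminate (w N) s (b N) Q"
    interpret koszul_elimination Q "w N" s "b N"
      by unfold_locales (use pr(1) pr(5)[OF True] s in auto)
    have wJ: "w i \<noteq> w N" "b i \<noteq> b N" if "i \<in> J" for i
      using inj_onD[OF pr(3), of i N] inj_onD[OF pr(4), of i N] that J True by auto
    have "\<exists>P \<phi>. koszul_wf P \<and> koszul_quasi_iso P Q1 \<phi> \<and> gens P = gens Q1 - w ` J \<and> rels P = rels Q1 - b ` J \<and>
      gen_wt P = gen_wt Q1 \<and> rel_wt P = rel_wt Q1 \<and> point P = point Q1"
    proof (rule Suc.IH)
      show "koszul_wf Q1" unfolding Q1_def by (rule wf1)
      show "J \<subseteq> {..<N}" by (rule J)
      show "inj_on w J" "inj_on b J" using pr(3,4) J(2) inj_on_subset by blast+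
      fix i assume i: "i \<in> J"
      then have iI: "i \<in> I" using J by blast
      show "w i \<in> gens Q1 \<and> gen_wt Q1 (w i) = 0 \<and> b i \<in> rels Q1 \<and> rel_wt Q1 (b i) = 0"
        using pr(5)[OF iI] wJ[OF i] by (simp add: Q1_def)
      have e: "gens Q - w ` {j\<in>I. i \<le> j} = gens Q1 - w ` {j\<in>J. i \<le> j}"
      proof -
        have "i \<le> N" using i J by auto
        then have "{j\<in>I. i \<le> j} = insert N {j\<in>J. i \<le> j}" using J(4) by auto
        then show ?thesis by (auto simp: Q1_def)
      qed
      from pr(6)[OF iI] obtain r where r: "r \<in> polys_in (gens Q1 - w ` {j\<in>J. i \<le> j})"
        "homogeneous (gen_wt Q) 0 r" "poly_value (point Q) r = point Q (w i)" "rel Q (b i) = r - pvar (w i)"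
        unfolding e by blast
      \<comment> \<open>The index i is at most N, so the variable of N is among those that
        \<open>r\<close> avoids.\<close>
      have "subst_var (w N) s r = r" by (rule subst_var_id[OF r(1)]) (simp add: Q1_def)
      then have "rel Q1 (b i) = r - pvar (w i)" using wJ[OF i] by (simp add: Q1_def r(4) subst_var_simps)
      then show "\<exists>s\<in>polys_in (gens Q1 - w ` {j\<in>J. i \<le> j}). homogeneous (gen_wt Q1) 0 s \<and>
          poly_value (point Q1) s = point Q1 (w i) \<and> rel Q1 (b i) = s - pvar (w i)"
        using r(1-3) by (intro bexI[of _ r]) (simp_all add: Q1_def)
    qed
    then obtain P \<phi> where P: "koszul_wf P" "koszul_quasi_iso P Q1 \<phi>" "gens P = gens Q1 - w ` J" "rels P = rels Q1 - b ` J"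
      "gen_wt P = gen_wt Q1" "rel_wt P = rel_wt Q1" "point P = point Q1" by blast
    have "koszul_quasi_iso P Q (lift \<circ> \<phi>)"
      using koszul_quasi_iso_trans[OF P(1,2)] lift_quasi_iso unfolding Q1_def by blast
    moreover have "gens P = gens Q - w ` I" "rels P = rels Q - b ` I" using P(3,4) J(4) by (auto simp: Q1_def)
    ultimately show ?thesis using P by (intro exI[of _ P] exI[of _ "lift \<circ> \<phi>"]) (simp add: Q1_def o_def)
  qed
qed

lemma relabel_push:
  fixes P :: "('v::linorder, 'b::linorder) koszul" and Q :: "('w::linorder, 'c::linorder) koszul"
  assumes wf: "koszul_wf P" "koszul_wf Q"
    and \<rho>: "\<And>v. v \<in> gens P \<Longrightarrow> \<rho> v \<in> gens Q \<and> gen_wt Q (\<rho> v) = gen_wt P v \<and> point Q (\<rho> v) = point P v"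
    and mono: "\<And>b b'. b \<in> rels Q \<Longrightarrow> b' \<in> rels Q \<Longrightarrow> b < b' \<Longrightarrow> \<tau> b < \<tau> b'"
    and onto: "\<tau> ` rels Q = rels P"
    and wt: "\<And>b. b \<in> rels Q \<Longrightarrow> rel_wt P (\<tau> b) = rel_wt Q b"
    and rel: "\<And>b. b \<in> rels Q \<Longrightarrow> poly_eval pconst (\<lambda>v. pvar (\<rho> v)) (rel P (\<tau> b)) = rel Q b"
  shows "koszul_push P Q (poly_eval pconst (\<lambda>v. pvar (\<rho> v))) \<tau>"
proof
  let ?\<sigma> = "poly_eval pconst (\<lambda>v. pvar (\<rho> v))"
  show "koszul_wf P" "koszul_wf Q" by (rule wf)+
  show "?\<sigma> (p + p') = ?\<sigma> p + ?\<sigma> p'" "?\<sigma> (p * p') = ?\<sigma> p * ?\<sigma> p'" "?\<sigma> (pconst c) = pconst c" for p p' c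
    by (simp_all only: subst_simps)
  show "poly_value (point Q) (?\<sigma> p) = poly_value (point P) p" if "p \<in> polys_in (gens P)" for p
    using that by (induction rule: polys_in_induct) (auto simp: subst_simps poly_value_eq poly_value_simps \<rho>)
  show "?\<sigma> p \<in> polys_in (gens Q)" if "p \<in> polys_in (gens P)" for p
    using that by (induction rule: polys_in_induct) (auto simp: subst_simps \<rho> intro: polys_in_add polys_in_mult polys_in_pvar)
  show "homogeneous (gen_wt Q) w (?\<sigma> p)" if "p \<in> polys_in (gens P)" "homogeneous (gen_wt P) w p" for p w
    using that
  proof (induction rule: homogeneous_induct)
    case (var v)
    then show ?case using homogeneous_pvar[of "gen_wt Q" "\<rho> v"] \<rho>[of v] by (simp add: subst_simps)
  qed (simp_all add: subst_simps homogeneous_pconst homogeneous_add homogeneous_mult)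
  show "\<tau> b \<in> rels P" if "b \<in> rels Q" for b using onto that by blast
  show "?\<sigma> (rel P a) = 0" if "a \<in> rels P" "a \<notin> \<tau> ` rels Q" for a using that onto by blast
qed (use mono wt rel in auto)

lemma poly_eval_relabel:
  assumes "p \<in> polys_in V" "\<And>v. v \<in> V \<Longrightarrow> \<rho>' (\<rho> v) = v"
  shows "poly_eval pconst (\<lambda>v. pvar (\<rho>' v)) (poly_eval pconst (\<lambda>v. pvar (\<rho> v)) p) = p"
  using assms(1) by (induction rule: polys_in_induct) (simp_all add: subst_simps assms(2))

lemma finite_rank:
  fixes B :: "'b::linorder set"
  assumes "finite B" "b \<in> B" "b < b'"
  shows "card {c\<in>B. c < b} < card {c\<in>B. c < b'}"
proof (rule psubset_card_mono)
  show "{c\<in>B. c < b} \<subset> {c\<in>B. c < b'}" using assms by auto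
qed (use assms in simp)

text \<open>The Euler characteristic is defined by presentations with generators and relations named
  by naturals. Any injection will do for the generators, but the relations have to keep their order
  because of the signs.\<close>

lemma koszul_relabel:
  fixes Q :: "('v::linorder, 'b::linorder) koszul"
  assumes wf: "koszul_wf Q" and pt: "\<And>v. v \<in> gens Q \<Longrightarrow> point Q v = 0"
  obtains P :: "(nat, nat) koszul" and \<phi> where "koszul_wf P" "koszul_quasi_iso P Q \<phi>" "point P = (\<lambda>v. 0)"
    "gen_wt P ` gens P = gen_wt Q ` gens Q" "poincare_series P = poincare_series Q"
proof -
  have fin: "finite (gens Q)" "finite (rels Q)" using wf by (simp_all add: koszul_wf_def)
  obtain \<rho> :: "'v \<Rightarrow> nat" where \<rho>: "inj_on \<rho> (gens Q)" using finite_imp_inj_to_nat_seg[OF fin(1)] by blast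
  \<comment> \<open>The rank of a relation: an order-preserving injection into the naturals.\<close>
  define \<tau> where "\<tau> b = card {c\<in>rels Q. c < b}" for b
  have \<tau>_less: "\<tau> b < \<tau> b'" if "b \<in> rels Q" "b < b'" for b b' unfolding \<tau>_def using finite_rank[OF fin(2) that] .
  have \<tau>: "inj_on \<tau> (rels Q)"
  proof (rule inj_onI, rule ccontr)
    fix x y assume "x \<in> rels Q" "y \<in> rels Q" "\<tau> x = \<tau> y" "x \<noteq> y"
    then show False using \<tau>_less[of x y] \<tau>_less[of y x] by (cases x y rule: linorder_cases) auto
  qed
  define \<rho>' where "\<rho>' = inv_into (gens Q) \<rho>"
  define \<tau>' where "\<tau>' = inv_into (rels Q) \<tau>"
  have rho_cancel': "\<rho>' (\<rho> v) = v" if "v \<in> gens Q" for v unfolding \<rho>'_def by (rule inv_into_f_f[OF \<rho> that])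
  have tau_cancel': "\<tau>' (\<tau> b) = b" if "b \<in> rels Q" for b unfolding \<tau>'_def by (rule inv_into_f_f[OF \<tau> that])
  let ?\<sigma> = "poly_eval pconst (\<lambda>v. pvar (\<rho> v)) :: 'v cpoly \<Rightarrow> nat cpoly"
  define P where "P = \<lparr>gens = \<rho> ` gens Q, gen_wt = (\<lambda>v. gen_wt Q (\<rho>' v)), point = (\<lambda>_. 0),
    rels = \<tau> ` rels Q, rel_wt = (\<lambda>b. rel_wt Q (\<tau>' b)), rel = (\<lambda>b. ?\<sigma> (rel Q (\<tau>' b)))\<rparr>"
  have sel: "gens P = \<rho> ` gens Q" "gen_wt P = (\<lambda>v. gen_wt Q (\<rho>' v))" "point P = (\<lambda>_. 0)" "rels P = \<tau> ` rels Q"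
    "rel_wt P = (\<lambda>b. rel_wt Q (\<tau>' b))" "rel P = (\<lambda>b. ?\<sigma> (rel Q (\<tau>' b)))" by (simp_all add: P_def)
  have sub_polys: "?\<sigma> p \<in> polys_in (gens P)" if "p \<in> polys_in (gens Q)" for p
    using that by (induction rule: polys_in_induct) (auto simp: subst_simps sel intro: polys_in_add polys_in_mult polys_in_pvar)
  have sub_hom: "homogeneous (gen_wt P) k (?\<sigma> p)" if "p \<in> polys_in (gens Q)" "homogeneous (gen_wt Q) k p" for p k
    using that
  proof (induction rule: homogeneous_induct)
    case (var v)
    then show ?case using homogeneous_pvar[of "gen_wt P" "\<rho> v"] rho_cancel'[of v] by (simp add: subst_simps sel)
  qed (simp_all add: subst_simps homogeneous_pconst homogeneous_add homogeneous_mult)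
  have relsD: "rel Q b \<in> polys_in (gens Q)" "homogeneous (gen_wt Q) (rel_wt Q b) (rel Q b)" if "b \<in> rels Q" for b
    using wf that by (simp_all add: koszul_wf_def)
  have wfP: "koszul_wf P"
    unfolding koszul_wf_def
  proof (intro conjI ballI)
    fix c assume "c \<in> rels P"
    then obtain b where b: "b \<in> rels Q" "c = \<tau> b" by (auto simp: sel)
    show "rel P c \<in> polys_in (gens P)" using sub_polys[OF relsD(1)] b tau_cancel' by (simp add: sel(6))
    show "homogeneous (gen_wt P) (rel_wt P c) (rel P c)" using sub_hom[OF relsD] b tau_cancel' by (simp add: sel(5,6))
  qed (use fin in \<open>simp_all add: sel\<close>)
  have rho_cancel: "\<rho> (\<rho>' v) = v" if "v \<in> gens P" for v using that rho_cancel' by (auto simp: sel)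
  have tau_cancel: "\<tau> (\<tau>' b) = b" if "b \<in> rels P" for b using that tau_cancel' by (auto simp: sel)
  have backward: "koszul_push P Q (poly_eval pconst (\<lambda>v. pvar (\<rho>' v))) \<tau>"
  proof (rule relabel_push[OF wfP wf])
    fix b assume b: "b \<in> rels Q"
    show "poly_eval pconst (\<lambda>v. pvar (\<rho>' v)) (rel P (\<tau> b)) = rel Q b"
      using poly_eval_relabel[of "rel Q b" "gens Q" \<rho>' \<rho>] relsD(1)[OF b] rho_cancel' b by (simp add: sel(6) tau_cancel')
  qed (use rho_cancel' tau_cancel' \<tau>_less pt in \<open>auto simp: sel\<close>)
  have forward: "koszul_push Q P ?\<sigma> \<tau>'"
  proof (rule relabel_push[OF wf wfP])
    fix b b' assume b: "b \<in> rels P" "b' \<in> rels P" "b < b'"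
    then obtain c c' where c: "c \<in> rels Q" "c' \<in> rels Q" "b = \<tau> c" "b' = \<tau> c'" by (auto simp: sel)
    then show "\<tau>' b < \<tau>' b'" using b(3) \<tau>_less[of c' c] tau_cancel' by (cases c c' rule: linorder_cases) auto
  qed (use rho_cancel' tau_cancel' pt in \<open>auto simp: sel image_image\<close>)
  have iso: "koszul_quasi_iso P Q (koszul_push.push P Q (poly_eval pconst (\<lambda>v. pvar (\<rho>' v))) \<tau>)"
  proof (rule koszul_push_iso[OF backward forward])
    show "?\<sigma> (poly_eval pconst (\<lambda>v. pvar (\<rho>' v)) p) = p" if "p \<in> polys_in (gens P)" for p
      using that rho_cancel by (rule poly_eval_relabel)
    show "poly_eval pconst (\<lambda>v. pvar (\<rho>' v)) (?\<sigma> p) = p" if "p \<in> polys_in (gens Q)" for p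
      using that rho_cancel' by (rule poly_eval_relabel)
  qed (rule tau_cancel tau_cancel', assumption)+
  have "gen_wt P ` gens P = gen_wt Q ` gens Q" using rho_cancel' by (force simp: sel image_image)
  moreover have "poincare_series P = poincare_series Q"
    unfolding poincare_series_def sel(1,4) prod.reindex[OF \<rho>] prod.reindex[OF \<tau>]
    using rho_cancel' tau_cancel' by (intro arg_cong2[of _ _ _ _ "(/)"] prod.cong) (simp_all add: sel)
  ultimately show thesis using that wfP iso sel(3) by blast
qed

section \<open>The chart of the flag Hilbert scheme\<close>

lemma homogeneous_sum: "(\<And>a. a \<in> A \<Longrightarrow> homogeneous g w (f a)) \<Longrightarrow> homogeneous g w (sum f A)"
  by (induction A rule: infinite_finite_induct) (simp_all add: homogeneous_add)

lemma polys_in_sum: "(\<And>a. a \<in> A \<Longrightarrow> f a \<in> polys_in V) \<Longrightarrow> sum f A \<in> polys_in V"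
  by (induction A rule: infinite_finite_induct) (simp_all add: polys_in_add)

definition chart_X :: "box list \<Rightarrow> nat \<Rightarrow> nat \<Rightarrow> (bool \<times> nat \<times> nat) cpoly" where
  "chart_X T i j = (if x_free T i j then pvar (False, i, j) else if T ! i = box_right (T ! j) then 1 else 0)"

definition chart_Y :: "box list \<Rightarrow> nat \<Rightarrow> nat \<Rightarrow> (bool \<times> nat \<times> nat) cpoly" where
  "chart_Y T i j = (if y_free T i j then pvar (True, i, j) else if T ! i = box_up (T ! j) then 1 else 0)"

lemma fhilb_chart_sel:
  "gens (fhilb_chart T) = {(False, i, j) | i j. x_free T i j} \<union> {(True, i, j) | i j. y_free T i j}"
  "gen_wt (fhilb_chart T) (s, i, j) = box_weight (T ! j) - box_weight (T ! i) + (if s then (0, 1) else (1, 0))"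
  "point (fhilb_chart T) (s, i, j) = (if T ! i = (if s then box_up (T ! j) else box_right (T ! j)) then 1 else 0)"
  "rels (fhilb_chart T) = {(i, j). j < i \<and> i < length T}"
  "rel_wt (fhilb_chart T) (i, j) = box_weight (T ! j) - box_weight (T ! i) + (1, 1)"
  by (simp_all add: fhilb_chart_def Let_def)

lemma fhilb_chart_rel:
  assumes "i < length T" "j < length T"
  shows "rel (fhilb_chart T) (i, j) =
    (\<Sum>k<length T. chart_X T i k * chart_Y T k j) - (\<Sum>k<length T. chart_Y T i k * chart_X T k j)"
  using assms by (simp add: fhilb_chart_def Let_def slice_X_def slice_Y_def scalar_prod_def
      chart_X_def chart_Y_def atLeast0LessThan)

lemma box_weight_right: "box_weight (box_right c) = box_weight c + (1, 0)"
  by (simp add: box_weight_def box_right_def)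

lemma box_weight_up: "box_weight (box_up c) = box_weight c + (0, 1)"
  by (simp add: box_weight_def box_up_def)

lemma box_weight_inj: "box_weight c = box_weight d \<longleftrightarrow> c = d"
  by (auto simp: box_weight_def prod_eq_iff)

lemma chart_X_homogeneous:
  "homogeneous (gen_wt (fhilb_chart T)) (box_weight (T ! j) - box_weight (T ! i) + (1, 0)) (chart_X T i j)"
  using homogeneous_pvar[of "gen_wt (fhilb_chart T)" "(False, i, j)"] homogeneous_1[of "gen_wt (fhilb_chart T)"]
  by (simp add: chart_X_def fhilb_chart_sel box_weight_right zero_prod_def)

lemma chart_Y_homogeneous:
  "homogeneous (gen_wt (fhilb_chart T)) (box_weight (T ! j) - box_weight (T ! i) + (0, 1)) (chart_Y T i j)"
  using homogeneous_pvar[of "gen_wt (fhilb_chart T)" "(True, i, j)"] homogeneous_1[of "gen_wt (fhilb_chart T)"]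
  by (simp add: chart_Y_def fhilb_chart_sel box_weight_up zero_prod_def)

lemma chart_X_polys: "(False, i, j) \<notin> W \<Longrightarrow> chart_X T i j \<in> polys_in (gens (fhilb_chart T) - W)"
  by (auto simp: chart_X_def fhilb_chart_sel intro!: polys_in_pvar)

lemma chart_Y_polys: "(True, i, j) \<notin> W \<Longrightarrow> chart_Y T i j \<in> polys_in (gens (fhilb_chart T) - W)"
  by (auto simp: chart_Y_def fhilb_chart_sel intro!: polys_in_pvar)

lemma chart_X_value:
  "poly_value (point (fhilb_chart T)) (chart_X T i j) = (if T ! i = box_right (T ! j) then 1 else 0)"
  by (simp add: chart_X_def poly_value_eq poly_value_simps fhilb_chart_sel)

lemma chart_Y_value:
  "poly_value (point (fhilb_chart T)) (chart_Y T i j) = (if T ! i = box_up (T ! j) then 1 else 0)"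
  by (simp add: chart_Y_def poly_value_eq poly_value_simps fhilb_chart_sel)

lemma poly_value_sum: "poly_value x (sum f A) = (\<Sum>a\<in>A. poly_value x (f a))"
  by (simp add: poly_value_eq poly_eval_sum[of "\<lambda>c. c"])

lemma rel_homogeneous:
  assumes "i < length T" "j < length T"
  shows "homogeneous (gen_wt (fhilb_chart T)) (rel_wt (fhilb_chart T) (i, j)) (rel (fhilb_chart T) (i, j))"
  unfolding fhilb_chart_rel[OF assms]
proof (intro homogeneous_diff homogeneous_sum)
  fix k
  have 1: "rel_wt (fhilb_chart T) (i, j) = (box_weight (T ! k) - box_weight (T ! i) + (1, 0)) + (box_weight (T ! j) - box_weight (T ! k) + (0, 1))"
    and 2: "rel_wt (fhilb_chart T) (i, j) = (box_weight (T ! k) - box_weight (T ! i) + (0, 1)) + (box_weight (T ! j) - box_weight (T ! k) + (1, 0))"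
    by (simp_all add: fhilb_chart_sel box_weight_def)
  show "homogeneous (gen_wt (fhilb_chart T)) (rel_wt (fhilb_chart T) (i, j)) (chart_X T i k * chart_Y T k j)"
    unfolding 1 by (intro homogeneous_mult chart_X_homogeneous chart_Y_homogeneous)
  show "homogeneous (gen_wt (fhilb_chart T)) (rel_wt (fhilb_chart T) (i, j)) (chart_Y T i k * chart_X T k j)"
    unfolding 2 by (intro homogeneous_mult chart_X_homogeneous chart_Y_homogeneous)
qed

lemma finite_free: "finite {(i, j). x_free T i j}" "finite {(i, j). y_free T i j}"
proof -
  have "{(i, j). x_free T i j} \<subseteq> {..<length T} \<times> {..<length T}" "{(i, j). y_free T i j} \<subseteq> {..<length T} \<times> {..<length T}"
    by (auto simp: x_free_def y_free_def)
  then show "finite {(i, j). x_free T i j}" "finite {(i, j). y_free T i j}" by (auto dest: finite_subset)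
qed

lemma gens_fhilb_chart:
  "gens (fhilb_chart T) = Pair False ` {(i, j). x_free T i j} \<union> Pair True ` {(i, j). y_free T i j}"
  by (auto simp: fhilb_chart_sel)

lemma finite_rels_chart: "finite (rels (fhilb_chart T))"
proof (rule finite_subset)
  show "rels (fhilb_chart T) \<subseteq> {..<length T} \<times> {..<length T}" by (auto simp: fhilb_chart_sel)
qed simp

lemma koszul_wf_chart: "koszul_wf (fhilb_chart T)"
  unfolding koszul_wf_def
proof (intro conjI ballI)
  show "finite (gens (fhilb_chart T))" unfolding gens_fhilb_chart using finite_free by simp
  show "finite (rels (fhilb_chart T))" by (rule finite_rels_chart)
  fix c assume "c \<in> rels (fhilb_chart T)"
  then obtain i j where c: "c = (i, j)" "i < length T" "j < length T" by (auto simp: fhilb_chart_sel)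
  show "homogeneous (gen_wt (fhilb_chart T)) (rel_wt (fhilb_chart T) c) (rel (fhilb_chart T) c)"
    unfolding c(1) by (rule rel_homogeneous[OF c(2,3)])
  show "rel (fhilb_chart T) c \<in> polys_in (gens (fhilb_chart T))"
    unfolding c(1) fhilb_chart_rel[OF c(2,3)]
    using chart_X_polys[of _ _ "{}" T] chart_Y_polys[of _ _ "{}" T]
    by (intro polys_in_diff polys_in_sum polys_in_mult) simp_all
qed

section \<open>Weight zero coordinates and relations of the chart\<close>

definition box_index :: "box list \<Rightarrow> box \<Rightarrow> nat" where
  "box_index T c = (SOME j. j < length T \<and> T ! j = c)"

lemma box_index: "c \<in> set T \<Longrightarrow> box_index T c < length T \<and> T ! box_index T c = c"
  unfolding box_index_def in_set_conv_nth by (rule someI_ex)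

context
  fixes T :: "box list"
  assumes T: "standard_tableau T"
begin

abbreviation (input) inner :: "nat set" where
  "inner \<equiv> {i. i < length T \<and> 0 < fst (T ! i) \<and> 0 < snd (T ! i)}"

definition below :: "nat \<Rightarrow> nat" where "below i = box_index T (fst (T ! i), snd (T ! i) - 1)"
definition left :: "nat \<Rightarrow> nat" where "left i = box_index T (fst (T ! i) - 1, snd (T ! i))"
definition diag :: "nat \<Rightarrow> nat" where "diag i = box_index T (fst (T ! i) - 1, snd (T ! i) - 1)"

lemma index_unique: "i < length T \<Longrightarrow> j < length T \<Longrightarrow> T ! i = T ! j \<longleftrightarrow> i = j"
  using standard_distinct[OF T] by (rule nth_eq_iff_index_eq)

lemma inner_index:
  assumes i: "i \<in> inner"
  shows "below i < length T" "T ! below i = (fst (T ! i), snd (T ! i) - 1)" "below i < i"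
    and "left i < length T" "T ! left i = (fst (T ! i) - 1, snd (T ! i))" "left i < i"
    and "diag i < length T" "T ! diag i = (fst (T ! i) - 1, snd (T ! i) - 1)" "diag i < i" "diag i < below i"
proof -
  have "T ! i \<in> set T" using i by simp
  then have m: "(a, b) \<in> set T" if "a \<le> fst (T ! i)" "b \<le> snd (T ! i)" for a b
    using young_diagram_down[OF standard_young[OF T], of "fst (T ! i)" "snd (T ! i)" a b] that by simp
  show b: "below i < length T" "T ! below i = (fst (T ! i), snd (T ! i) - 1)" unfolding below_def using box_index[OF m] by simp_all
  show l: "left i < length T" "T ! left i = (fst (T ! i) - 1, snd (T ! i))" unfolding left_def using box_index[OF m] by simp_all
  show d: "diag i < length T" "T ! diag i = (fst (T ! i) - 1, snd (T ! i) - 1)" unfolding diag_def using box_index[OF m] by simp_all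
  show "below i < i" by (rule standard_order[OF T b(1)]) (use i b(2) in simp_all)
  then show "diag i < i" using standard_order[OF T d(1) b(1)] i b(2) d(2) by simp
  show "left i < i" by (rule standard_order[OF T l(1)]) (use i l(2) in simp_all)
  show "diag i < below i" by (rule standard_order[OF T d(1) b(1)]) (use i b(2) d(2) in simp_all)
qed

lemma chart_X_upper: "i < length T \<Longrightarrow> j < length T \<Longrightarrow> i < j \<Longrightarrow> chart_X T i j = 0"
  using standard_order[OF T, of j i] by (auto simp: chart_X_def x_free_def box_right_def)

lemma inner_variable:
  assumes i: "i \<in> inner"
  shows "(True, i, below i) \<in> gens (fhilb_chart T)" "gen_wt (fhilb_chart T) (True, i, below i) = 0"
    and "(i, diag i) \<in> rels (fhilb_chart T)" "rel_wt (fhilb_chart T) (i, diag i) = 0"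
    and "point (fhilb_chart T) (True, i, below i) = 1"
proof -
  note ix = inner_index[OF i]
  show "(True, i, below i) \<in> gens (fhilb_chart T)" using i ix(1-3) by (simp add: fhilb_chart_sel y_free_def)
  show "gen_wt (fhilb_chart T) (True, i, below i) = 0"
    using i by (simp add: fhilb_chart_sel ix(2) box_weight_def zero_prod_def of_nat_diff)
  show "(i, diag i) \<in> rels (fhilb_chart T)" using i ix(9) by (simp add: fhilb_chart_sel)
  show "rel_wt (fhilb_chart T) (i, diag i) = 0"
    using i by (simp add: fhilb_chart_sel ix(8) box_weight_def zero_prod_def of_nat_diff)
  show "point (fhilb_chart T) (True, i, below i) = 1"
    using i by (simp add: fhilb_chart_sel ix(2) box_up_def)
qed

text \<open>The commutator entry from the diagonal neighbour of i to i contains the product of the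
  coordinate in question with an entry of X that the slice fixes to be 1. No coordinate to be
  eliminated for box i or a later box occurs elsewhere in it, which is the triangularity needed for
  successive elimination.\<close>

lemma inner_relation:
  assumes i: "i \<in> inner"
  shows "\<exists>s\<in>polys_in (gens (fhilb_chart T) - (\<lambda>j. (True, j, below j)) ` {j\<in>inner. i \<le> j}).
    homogeneous (gen_wt (fhilb_chart T)) 0 s \<and>
    poly_value (point (fhilb_chart T)) s = point (fhilb_chart T) (True, i, below i) \<and>
    rel (fhilb_chart T) (i, diag i) = s - pvar (True, i, below i)"
proof -
  let ?Q = "fhilb_chart T" and ?n = "length T" and ?j = "diag i"
  let ?W = "(\<lambda>j. (True, j, below j)) ` {j\<in>inner. i \<le> j}"
  note ix = inner_index[OF i]
  have n: "i < ?n" using i by simp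
  \<comment> \<open>The commutator contains the coordinate with sign -1, so adding the coordinate
    leaves the rest.\<close>
  define s where "s = rel ?Q (i, ?j) + pvar (True, i, below i)"
  have "y_free T i (below i)" using i ix(1-3) by (simp add: y_free_def)
  then have Y1: "chart_Y T i (below i) = pvar (True, i, below i)" by (simp add: chart_Y_def)
  have r: "T ! below i = box_right (T ! ?j)" using i by (simp add: ix(2,8) box_right_def)
  then have X1: "chart_X T (below i) ?j = 1" by (auto simp: chart_X_def x_free_def)
  have "(\<Sum>k<?n. chart_Y T i k * chart_X T k ?j) =
      chart_Y T i (below i) * chart_X T (below i) ?j + (\<Sum>k\<in>{..<?n} - {below i}. chart_Y T i k * chart_X T k ?j)"
    using ix(1) by (intro sum.remove) auto
  then have s: "s = (\<Sum>k<?n. chart_X T i k * chart_Y T k ?j) - (\<Sum>k\<in>{..<?n} - {below i}. chart_Y T i k * chart_X T k ?j)"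
    by (simp add: s_def fhilb_chart_rel[OF n ix(7)] X1 Y1)
  have XW: "chart_X T k l \<in> polys_in (gens ?Q - ?W)" for k l by (rule chart_X_polys) auto
  have "s \<in> polys_in (gens ?Q - ?W)"
    unfolding s
  proof (intro polys_in_diff polys_in_sum)
    fix k assume k: "k \<in> {..<?n}"
    show "chart_X T i k * chart_Y T k ?j \<in> polys_in (gens ?Q - ?W)"
    proof (cases "i < k")
      case True
      then show ?thesis using chart_X_upper[OF n, of k] k by simp
    next
      case False
      \<comment> \<open>For k < i the row index is too small; for k = i the column is the diagonal
        neighbour, which carries a smaller label than the box below i.\<close>
      then have "(True, k, ?j) \<notin> ?W" using ix(10) by auto
      then show ?thesis by (intro polys_in_mult XW chart_Y_polys)
    qed
  next
    fix k assume "k \<in> {..<?n} - {below i}"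
    then have "(True, i, k) \<notin> ?W" by auto
    then show "chart_Y T i k * chart_X T k ?j \<in> polys_in (gens ?Q - ?W)" by (intro polys_in_mult XW chart_Y_polys)
  qed
  moreover have "homogeneous (gen_wt ?Q) 0 s"
    using homogeneous_add[of "gen_wt ?Q" 0 "rel ?Q (i, ?j)" "pvar (True, i, below i)"]
      rel_homogeneous[OF n ix(7)] homogeneous_pvar[of "gen_wt ?Q" "(True, i, below i)"] inner_variable[OF i]
    by (simp add: s_def)
  moreover have "poly_value (point ?Q) s = point ?Q (True, i, below i)"
  proof -
    \<comment> \<open>At the fixed point the only path from the diagonal neighbour up and then right
      to i runs through the box to the left of i. The path right and then up runs through the box
      below, and the two contributions cancel in the commutator.\<close>
    have "(\<Sum>k<?n. poly_value (point ?Q) (chart_X T i k * chart_Y T k ?j)) = (\<Sum>k<?n. if k = left i then 1 else 0)"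
    proof (rule sum.cong)
      fix k assume "k \<in> {..<?n}"
      then have "T ! k = T ! left i \<longleftrightarrow> k = left i" using index_unique ix(4) by simp
      moreover have "T ! i = box_right (T ! k) \<and> T ! k = box_up (T ! ?j) \<longleftrightarrow> T ! k = T ! left i"
        unfolding ix(5,8) using i by (cases "T ! i"; cases "T ! k") (auto simp: box_right_def box_up_def)
      moreover have "poly_value (point ?Q) (chart_X T i k * chart_Y T k ?j) = 
        (if T ! i = box_right (T ! k) \<and> T ! k = box_up (T ! ?j) then 1 else 0)"
        using chart_X_value[of T i k] chart_Y_value[of T k ?j] by (simp add: poly_value_eq poly_value_simps)
      ultimately show "poly_value (point ?Q) (chart_X T i k * chart_Y T k ?j) = (if k = left i then 1 else 0)" by simp
    qed simp
    then have 1: "(\<Sum>k<?n. poly_value (point ?Q) (chart_X T i k * chart_Y T k ?j)) = 1" using ix(4) by simp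
    have "(\<Sum>k<?n. poly_value (point ?Q) (chart_Y T i k * chart_X T k ?j)) = (\<Sum>k<?n. if k = below i then 1 else 0)"
    proof (rule sum.cong)
      fix k assume "k \<in> {..<?n}"
      then have "T ! k = T ! below i \<longleftrightarrow> k = below i" using index_unique ix(1) by simp
      moreover have "T ! i = box_up (T ! k) \<and> T ! k = box_right (T ! ?j) \<longleftrightarrow> T ! k = T ! below i"
        unfolding ix(2,8) using i by (cases "T ! i"; cases "T ! k") (auto simp: box_right_def box_up_def)
      moreover have "poly_value (point ?Q) (chart_Y T i k * chart_X T k ?j) = 
        (if T ! i = box_up (T ! k) \<and> T ! k = box_right (T ! ?j) then 1 else 0)"
        using chart_Y_value[of T i k] chart_X_value[of T k ?j] by (simp add: poly_value_eq poly_value_simps)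
      ultimately show "poly_value (point ?Q) (chart_Y T i k * chart_X T k ?j) = (if k = below i then 1 else 0)" by simp
    qed simp
    then have 2: "(\<Sum>k<?n. poly_value (point ?Q) (chart_Y T i k * chart_X T k ?j)) = 1" using ix(1) by simp
    have "poly_value (point ?Q) s = poly_value (point ?Q) (rel ?Q (i, ?j)) + point ?Q (True, i, below i)"
      by (simp add: s_def poly_value_eq poly_value_simps)
    also have "poly_value (point ?Q) (rel ?Q (i, ?j)) = 0"
      using 1 2 unfolding fhilb_chart_rel[OF n ix(7)] poly_value_sum[symmetric]
      by (simp add: poly_value_eq poly_value_simps)
    finally show ?thesis by simp
  qed
  ultimately show ?thesis by (intro bexI[of _ s]) (simp_all add: s_def)
qed

text \<open>Weight 0 means that the entry leads from a box to its right or upper neighbour. The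
  slice fixes all such entries of X, and those of Y which start in the first column.\<close>

lemma gen_wt_ne_0:
  assumes "v \<in> gens (fhilb_chart T)" "v \<notin> (\<lambda>i. (True, i, below i)) ` inner"
  shows "gen_wt (fhilb_chart T) v \<noteq> 0"
proof
  assume 0: "gen_wt (fhilb_chart T) v = 0"
  obtain b i j where v: "v = (b, i, j)" by (cases v)
  have f: "if b then y_free T i j else x_free T i j" using assms(1) v by (auto simp: fhilb_chart_sel)
  show False
  proof (cases b)
    case False
    then have "box_weight (T ! i) = box_weight (box_right (T ! j))"
      using 0 unfolding box_weight_right by (simp add: v fhilb_chart_sel algebra_simps)
    then show False using f False unfolding box_weight_inj by (auto simp: x_free_def)
  next
    case True
    then have "box_weight (T ! i) = box_weight (box_up (T ! j))"
      using 0 unfolding box_weight_up by (simp add: v fhilb_chart_sel algebra_simps)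
    then have u: "T ! i = box_up (T ! j)" unfolding box_weight_inj .
    have ij: "j < i" "i < length T" "fst (T ! j) \<noteq> 0" using f True u by (auto simp: y_free_def)
    have i: "i \<in> inner" using ij u by (simp add: box_up_def)
    have "T ! below i = T ! j" using inner_index(2)[OF i] u by (simp add: box_up_def)
    then have "j = below i" using index_unique[of "below i" j] inner_index(1)[OF i] ij by simp
    then have "v \<in> (\<lambda>i. (True, i, below i)) ` inner" using i True v by blast
    then show False using assms(2) by simp
  qed
qed

text \<open>Weight 0 means that the commutator entry leads from a box to its diagonal neighbour,
  which then has both coordinates positive.\<close>

lemma rel_wt_ne_0:
  assumes "c \<in> rels (fhilb_chart T)" "c \<notin> (\<lambda>i. (i, diag i)) ` inner"
  shows "rel_wt (fhilb_chart T) c \<noteq> 0"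
proof
  assume 0: "rel_wt (fhilb_chart T) c = 0"
  obtain i j where c: "c = (i, j)" "j < i" "i < length T" using assms(1) by (auto simp: fhilb_chart_sel)
  have "box_weight (T ! i) = box_weight (T ! j) + (1, 1)"
    using 0 by (simp add: c fhilb_chart_sel algebra_simps)
  also have "\<dots> = box_weight (box_up (box_right (T ! j)))" by (simp add: box_weight_up box_weight_right)
  finally have u: "T ! i = box_up (box_right (T ! j))" unfolding box_weight_inj .
  have i: "i \<in> inner" using c u by (simp add: box_up_def box_right_def)
  have "T ! diag i = T ! j" using inner_index(8)[OF i] u by (simp add: box_up_def box_right_def)
  then have "j = diag i" using index_unique[of "diag i" j] inner_index(7)[OF i] c by simp
  then show False using assms(2) i c(1) by blast
qed

lemma gens_product: "(\<Prod>v\<in>gens (fhilb_chart T). koszul_factor (gen_wt (fhilb_chart T) v)) =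
    (\<Prod>(i, j)\<in>{(i, j). x_free T i j}. koszul_factor (box_weight (T ! j) - box_weight (T ! i) + (1, 0))) *
    (\<Prod>(i, j)\<in>{(i, j). y_free T i j}. koszul_factor (box_weight (T ! j) - box_weight (T ! i) + (0, 1)))"
proof -
  have "(\<Prod>v\<in>gens (fhilb_chart T). koszul_factor (gen_wt (fhilb_chart T) v)) =
      (\<Prod>v\<in>Pair False ` {(i, j). x_free T i j}. koszul_factor (gen_wt (fhilb_chart T) v)) *
      (\<Prod>v\<in>Pair True ` {(i, j). y_free T i j}. koszul_factor (gen_wt (fhilb_chart T) v))"
    unfolding gens_fhilb_chart using finite_free by (intro prod.union_disjoint) auto
  also have "\<dots> = (\<Prod>v\<in>{(i, j). x_free T i j}. koszul_factor (gen_wt (fhilb_chart T) (False, v))) *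
      (\<Prod>v\<in>{(i, j). y_free T i j}. koszul_factor (gen_wt (fhilb_chart T) (True, v)))"
    by (simp add: prod.reindex inj_on_def)
  also have "\<dots> = (\<Prod>(i, j)\<in>{(i, j). x_free T i j}. koszul_factor (box_weight (T ! j) - box_weight (T ! i) + (1, 0))) *
      (\<Prod>(i, j)\<in>{(i, j). y_free T i j}. koszul_factor (box_weight (T ! j) - box_weight (T ! i) + (0, 1)))"
    by (intro arg_cong2[of _ _ _ _ "(*)"] prod.cong) (auto simp: fhilb_chart_sel(2))
  finally show ?thesis .
qed

theorem chart_presentation:
  obtains P :: "(nat, nat) koszul" where "koszul_presentation P (fhilb_chart T)" "poincare_series P = chart_series T"
proof -
  let ?Q = "fhilb_chart T" and ?w = "\<lambda>i. (True, i, below i)" and ?b = "\<lambda>i. (i, diag i)"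
  have "\<exists>R \<phi>. koszul_wf R \<and> koszul_quasi_iso R ?Q \<phi> \<and> gens R = gens ?Q - ?w ` inner \<and>
    rels R = rels ?Q - ?b ` inner \<and> gen_wt R = gen_wt ?Q \<and> rel_wt R = rel_wt ?Q \<and> point R = point ?Q"
  proof (rule koszul_eliminate_all)
    show "koszul_wf ?Q" by (rule koszul_wf_chart)
    show "inner \<subseteq> {..<length T}" by auto
    show "inj_on ?w inner" "inj_on ?b inner" by (auto simp: inj_on_def)
    show "?w i \<in> gens ?Q \<and> gen_wt ?Q (?w i) = 0 \<and> ?b i \<in> rels ?Q \<and> rel_wt ?Q (?b i) = 0" if "i \<in> inner" for i
      using inner_variable[OF that] by blast
  qed (rule inner_relation)
  then obtain R \<phi> where R: "koszul_wf R" "koszul_quasi_iso R ?Q \<phi>" "gens R = gens ?Q - ?w ` inner"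
    "rels R = rels ?Q - ?b ` inner" "gen_wt R = gen_wt ?Q" "rel_wt R = rel_wt ?Q" "point R = point ?Q" by blast
  have nz: "gen_wt R v \<noteq> 0" if "v \<in> gens R" for v using that gen_wt_ne_0[of v] by (simp add: R)
  \<comment> \<open>A coordinate equal to 1 at the fixed point has weight 0, and all of those have
    been eliminated; the presentation is thus localized at the origin.\<close>
  have pt: "point R v = 0" if "v \<in> gens R" for v
  proof (rule ccontr)
    assume "point R v \<noteq> 0"
    moreover obtain b i j where v: "v = (b, i, j)" by (cases v)
    ultimately have "T ! i = (if b then box_up (T ! j) else box_right (T ! j))" by (simp add: R fhilb_chart_sel split: if_splits)
    then have "gen_wt R v = 0" by (simp add: R v fhilb_chart_sel box_weight_up box_weight_right zero_prod_def)
    then show False using nz that by blast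
  qed
  obtain P :: "(nat, nat) koszul" and \<psi> where P: "koszul_wf P" "koszul_quasi_iso P R \<psi>" "point P = (\<lambda>v. 0)"
    "gen_wt P ` gens P = gen_wt R ` gens R" "poincare_series P = poincare_series R"
    by (rule koszul_relabel[OF R(1) pt])
  have "koszul_presentation P ?Q"
    unfolding koszul_presentation_def
  proof (intro conjI ballI)
    show "gen_wt P v \<noteq> 0" if "v \<in> gens P" for v
    proof -
      have "gen_wt P v \<in> gen_wt R ` gens R" using that P(4) by blast
      then show ?thesis using nz by auto
    qed
    show "\<exists>\<phi>. koszul_quasi_iso P ?Q \<phi>" using koszul_quasi_iso_trans[OF P(1,2) R(2)] by blast
  qed (use P(1,3) in \<open>simp_all add: koszul_wf_def\<close>)
  moreover have "poincare_series R = chart_series T"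
  proof -
    have "(\<Prod>b\<in>rels R. 1 - character (rel_wt R b)) = (\<Prod>b\<in>rels R. koszul_factor (rel_wt ?Q b))"
      by (rule prod.cong) (use rel_wt_ne_0 in \<open>auto simp: R koszul_factor_def\<close>)
    also have "\<dots> = (\<Prod>b\<in>rels ?Q. koszul_factor (rel_wt ?Q b))"
      unfolding R(4) by (rule prod.mono_neutral_left) (use finite_rels_chart inner_variable(4) in \<open>auto simp: koszul_factor_def\<close>)
    finally have 1: "(\<Prod>b\<in>rels R. 1 - character (rel_wt R b)) = (\<Prod>b\<in>rels ?Q. koszul_factor (rel_wt ?Q b))" .
    have "(\<Prod>v\<in>gens R. 1 - character (gen_wt R v)) = (\<Prod>v\<in>gens R. koszul_factor (gen_wt ?Q v))"
      by (rule prod.cong) (use gen_wt_ne_0 in \<open>auto simp: R koszul_factor_def\<close>)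
    also have "\<dots> = (\<Prod>v\<in>gens ?Q. koszul_factor (gen_wt ?Q v))"
      unfolding R(3)
      by (rule prod.mono_neutral_left) (use koszul_wf_chart[of T] inner_variable(2) in \<open>auto simp: koszul_wf_def koszul_factor_def\<close>)
    finally have 2: "(\<Prod>v\<in>gens R. 1 - character (gen_wt R v)) = (\<Prod>v\<in>gens ?Q. koszul_factor (gen_wt ?Q v))" .
    show ?thesis
      unfolding poincare_series_def 1 2 gens_product chart_series_def
      by (intro arg_cong2[of _ _ _ _ "(/)"] prod.cong refl) (auto simp: fhilb_chart_sel(4,5))
  qed
  ultimately show thesis using that P(5) by simp
qed

end

theorem theorem1p11:
  fixes \<chi> :: "nat \<Rightarrow> (nat list \<Rightarrow> Kq) set \<Rightarrow> Kqa"
    and p :: "box list \<Rightarrow> (nat list \<Rightarrow> Kq) set"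
    and T T' :: "box list" and n :: nat and lam :: "box set"
  assumes "markov_trace \<chi>"
    and "hecke_idempotents p"
    and "standard_tableau T" and "length T = n" and "set T = lam"
    and "standard_tableau T'" and "set T' = lam"
  shows "euler_characteristic T ((- inverse qhalf_a) ^ n * \<chi> n (p T'))"
proof -
  let ?R = "\<lambda>U. \<Prod>i<length U. rfac qa (qhalf_a - inverse qhalf_a) avar n (set (take i U)) (U ! i)"
  have len: "length T' = n"
    using assms standard_distinct[of T] standard_distinct[of T'] by (metis distinct_card)
  have "\<chi> n (p T') = ?R T'"
    using markov_trace_idempotent[OF assms(1,2,6), of n] len by simp
  \<comment> \<open>The idempotent belongs to \<open>T'\<close> and the chart to \<open>T\<close>;
    both products equal one expression in the common shape.\<close>
  also have "\<dots> = ?R T"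
    using prod_rfac_shape[OF qa_nonroot qa_ne_0 assms(3), of n] prod_rfac_shape[OF qa_nonroot qa_ne_0 assms(6), of n]
      assms len by simp
  finally have \<chi>: "\<chi> n (p T') = ?R T" .
  obtain P :: "(nat, nat) koszul" where P: "koszul_presentation P (fhilb_chart T)" "poincare_series P = chart_series T"
    using chart_presentation[OF assms(3)] by blast
  show ?thesis
    using specializes_chart_series[OF assms(3)] P unfolding euler_characteristic_def \<chi> assms(4)
    by (intro exI[of _ P]) simp
qed

end
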